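(* Let $\mathcal{T}=(A,T,G)$ be a regularity structure with $\bar T\subset T$ (the polynomials), equipped with a product $\star:\bar T\times T\to T$, and let $Z=(\Pi,\Gamma)$ be a model for $\mathcal{T}$ such that for all $X^k\in\bar T$ and $\tau\in T$: (1) $\Gamma(X^k\star\tau)=\Gamma X^k\star\Gamma\tau$ for all $\Gamma\in G$; (2) $\Pi_x(X^k\star\tau)=(\Pi_xX^k)\cdot(\Pi_x\tau)$ for all $x\in\mathbb{R}^d$, where $\cdot$ is the pointwise product. Let $p,q\in[1,\infty]$. If $p,q<\infty$ let $\epsilon=0$, and otherwise let $\epsilon>0$ be sufficiently small. Then the subspace $\mathcal{E}^\gamma_{p,q}$ of elementary modelled distributions is dense in $\mathcal{D}^\gamma_{p,q}$ in the $\mathcal{D}^{\gamma-\epsilon}_{p,q}$-topology.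
   Context: Fix a dimension $d$ and a scaling $\mathfrak{s}\in\mathbb{N}_{\ge1}^d$; $|\mathfrak{s}|=\sum_i\mathfrak{s}_i$, $|k|_{\mathfrak{s}}=\sum_i\mathfrak{s}_ik_i$, and $|x|_{\mathfrak{s}}=\|x\|_{\mathfrak s}$ is the corresponding scaled distance on $\mathbb{R}^d$; $B_1^{\mathfrak{s}}$ is its unit ball. For a function $\varphi$ let $\varphi^\delta_x(y)=\delta^{-|\mathfrak{s}|}\varphi(\delta^{-\mathfrak{s}_1}(y_1-x_1),\dots,\delta^{-\mathfrak{s}_d}(y_d-x_d))$. $\mathfrak{B}^r$ is the set of $\mathcal{C}^r$ functions supported in the unit ball with $\mathcal{C}^r$-norm at most $1$, with $r$ a fixed integer larger than $|\min A|$. A regularity structure $\mathcal{T}=(A,T,G)$ consists of a locally finite, bounded below set $A\subset\mathbb{R}$, a graded space $T=\bigoplus_{\alpha\in A}T_\alpha$ of Banach spaces, and a group $G$ of linear maps on $T$ with $\Gamma\tau-\tau\in\bigoplus_{\beta<\alpha}T_\beta$ for $\tau\in T_\alpha$, $\Gamma\in G$. $|\tau|_\beta$ is the norm of the $T_\beta$-component of $\tau$; $T_{<\gamma}=\bigoplus_{\alpha<\gamma}T_\alpha$. The polynomials $\bar T$ are spanned by monomials $X^k$, $k\in\mathbb{N}^d$, of homogeneity $|k|_{\mathfrak{s}}$, with $G$ acting canonically by translations and with canonical model $(\Pi_xX^k)(y)=(y-x)^k$, $\Gamma_{x,y}X^k=(X+x-y)^k$. The product $\star$ adds homogeneities: $X^k\star\tau\in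 T_{|k|_{\mathfrak{s}}+\alpha}$ for $\tau\in T_\alpha$. A model $Z=(\Pi,\Gamma)$ consists of maps $\Pi:\mathbb{R}^d\to L(T,\mathcal{D}'(\mathbb{R}^d))$ and $\Gamma:\mathbb{R}^d\times\mathbb{R}^d\to G$ with $\Pi_x\Gamma_{x,y}=\Pi_y$, $\Gamma_{x,y}\Gamma_{y,z}=\Gamma_{x,z}$, such that for all $\gamma$, $|\langle\Pi_x\tau,\varphi_x^\delta\rangle|\le C_\gamma|\tau|\delta^\zeta$ and $|\Gamma_{x,y}\tau|_\beta\le C_\gamma|x-y|_{\mathfrak{s}}^{\zeta-\beta}|\tau|$ uniformly over $\varphi\in\mathfrak{B}^r$, $\delta<1$, $x,y\in\mathbb{R}^d$ (with $\|x-y\|_{\mathfrak s}<1$ in the second bound), $\zeta\in A\cap(-\infty,\gamma)$, $\tau\in T_\zeta$, $A\ni\beta<\zeta$. $\mathcal{D}^\gamma_{p,q}$ is the space of measurable maps $f:\mathbb{R}^d\to T_{<\gamma}$ with finite norm $$\|f\|_{\mathcal{D}^\gamma_{p,q}}=\sum_{\zeta\in A\cap(-\infty,\gamma)}\Big(\big\||f(x)|_\zeta\big\|_{L^p(dx)}+\|f\|_{d^{\gamma,\zeta}_{p,q}}\Big),\quad \|f\|^q_{d^{\gamma,\zeta}_{p,q}}=\int_{h\in B^{\mathfrak{s}}_1}\Big\|\frac{|f(x+h)-\Gamma_{x+h,x}f(x)|_\zeta}{\|h\|_{\mathfrak{s}}^{\gamma-\zeta}}\Big\|^q_{L^p(dx)}\frac{dh}{\|h\|_{\mathfrak{s}}^{|\mathfrak{s}|}}$$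 (with the usual supremum modification for $q=\infty$). $\mathcal{E}^\gamma_{p,q}\subset\mathcal{D}^\gamma_{p,q}$ consists of those elements of $\mathcal{D}^\gamma_{p,q}$ that are locally finite linear combinations of localized constants $x\mapsto f_{z,\phi,\tau}(x)=\Phi(x)\star\Gamma_{x,z}\tau$, where $z\in\mathbb{R}^d$, $\tau\in T$, $\phi$ is a smooth compactly supported function and $\Phi(x)=\sum_k\frac{X^k}{k!}D^k\phi(x)$ is its canonical lift; expressions are understood as projected onto $T_{<\gamma}$.
   Formalization: For q<∞ the proved theorem additionally assumes that γ is not a homogeneity, γ∉A; without this the claim fails (e.g. γ=1, A=ℕ/2, rough-path type structure over a bounded nowhere differentiable 1/2-Hölder function). For q=∞ all real γ are covered. *)

theory Defs
  imports "HOL-Analysis.Analysis" "HOL-Probability.Essential_Supremum"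
begin

text \<open>Points of \<open>\<real>\<^sup>d\<close> are elements of \<open>real^'d\<close>; a scaling is \<open>s :: 'd \<Rightarrow> nat\<close> (with all values at
  least 1), a multi-index is \<open>k :: 'd \<Rightarrow> nat\<close>.\<close>

definition sc_total :: "('d::finite \<Rightarrow> nat) \<Rightarrow> nat" where
  "sc_total s = (\<Sum>i\<in>UNIV. s i)"

definition sc_deg :: "('d::finite \<Rightarrow> nat) \<Rightarrow> ('d \<Rightarrow> nat) \<Rightarrow> nat" where
  "sc_deg s k = (\<Sum>i\<in>UNIV. s i * k i)"

text \<open>The scaled distance is taken with the sum over the coordinates; some authors use the (equivalent)
  maximum.\<close>

definition sc_norm :: "('d::finite \<Rightarrow> nat) \<Rightarrow> real^'d \<Rightarrow> real" where
  "sc_norm s x = (\<Sum>i\<in>UNIV. \<bar>x $ i\<bar> powr (1 / real (s i)))"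

definition sc_ball :: "('d::finite \<Rightarrow> nat) \<Rightarrow> (real^'d) set" where
  "sc_ball s = {x. sc_norm s x < 1}"

definition mpow :: "real^'d::finite \<Rightarrow> ('d \<Rightarrow> nat) \<Rightarrow> real" where
  "mpow y k = (\<Prod>i\<in>UNIV. (y $ i) ^ k i)"

definition mfact :: "('d::finite \<Rightarrow> nat) \<Rightarrow> real" where
  "mfact k = (\<Prod>i\<in>UNIV. fact (k i))"

definition partial :: "'d::finite \<Rightarrow> (real^'d \<Rightarrow> real) \<Rightarrow> real^'d \<Rightarrow> real" where
  "partial i f x = frechet_derivative f (at x) (axis i 1)"

text \<open>The index type \<open>'d\<close> carries no order, so \<open>D\<^sup>k f\<close> takes the partial derivatives in some order.
  It is only used for \<open>f\<close> of class \<open>C\<^sup>n\<close> with \<open>n\<close> at least the order of \<open>k\<close>, where the order of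
  differentiation is irrelevant.\<close>

definition mderiv :: "('d::finite \<Rightarrow> nat) \<Rightarrow> (real^'d \<Rightarrow> real) \<Rightarrow> real^'d \<Rightarrow> real" where
  "mderiv k f = foldr partial (SOME ds. \<forall>i. count_list ds i = k i) f"

primrec C_class :: "nat \<Rightarrow> (real^'d::finite \<Rightarrow> real) \<Rightarrow> bool" where
  "C_class 0 f \<longleftrightarrow> continuous_on UNIV f"
| "C_class (Suc n) f \<longleftrightarrow> (\<forall>x. f differentiable (at x)) \<and> (\<forall>i. C_class n (partial i f))"

definition smooth_fun :: "(real^'d::finite \<Rightarrow> real) \<Rightarrow> bool" where
  "smooth_fun f \<longleftrightarrow> (\<forall>n. C_class n f)"

definition fun_supp :: "(real^'d::finite \<Rightarrow> real) \<Rightarrow> (real^'d) set" where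
  "fun_supp f = closure {x. f x \<noteq> 0}"

definition test_fun :: "(real^'d::finite \<Rightarrow> real) \<Rightarrow> bool" where
  "test_fun \<phi> \<longleftrightarrow> smooth_fun \<phi> \<and> compact (fun_supp \<phi>)"

definition distribution :: "((real^'d::finite \<Rightarrow> real) \<Rightarrow> real) \<Rightarrow> bool" where
  "distribution \<xi> \<longleftrightarrow>
    (\<forall>\<phi> \<psi>. test_fun \<phi> \<longrightarrow> test_fun \<psi> \<longrightarrow> \<xi> (\<lambda>y. \<phi> y + \<psi> y) = \<xi> \<phi> + \<xi> \<psi>) \<and>
    (\<forall>c \<phi>. test_fun \<phi> \<longrightarrow> \<xi> (\<lambda>y. c * \<phi> y) = c * \<xi> \<phi>) \<and>
    (\<forall>K. compact K \<longrightarrow> (\<exists>C m. \<forall>\<phi>. test_fun \<phi> \<longrightarrow> fun_supp \<phi> \<subseteq> K \<longrightarrow>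
        (\<forall>B\<ge>0. (\<forall>k y. (\<Sum>i\<in>UNIV. k i) \<le> m \<longrightarrow> \<bar>mderiv k \<phi> y\<bar> \<le> B) \<longrightarrow> \<bar>\<xi> \<phi>\<bar> \<le> C * B)))"

definition fun_times_distr ::
  "(real^'d::finite \<Rightarrow> real) \<Rightarrow> ((real^'d \<Rightarrow> real) \<Rightarrow> real) \<Rightarrow> (real^'d \<Rightarrow> real) \<Rightarrow> real" where
  "fun_times_distr g \<xi> \<phi> = \<xi> (\<lambda>y. g y * \<phi> y)"

text \<open>The elements of \<open>Br s r\<close> are continuous, so vanishing outside the open unit ball is the same as
  having support in the closed one.\<close>

definition Br :: "('d::finite \<Rightarrow> nat) \<Rightarrow> nat \<Rightarrow> (real^'d \<Rightarrow> real) set" where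
  "Br s r = {\<phi>. C_class r \<phi> \<and> {x. \<phi> x \<noteq> 0} \<subseteq> sc_ball s \<and>
                (\<forall>k x. (\<Sum>i\<in>UNIV. k i) \<le> r \<longrightarrow> \<bar>mderiv k \<phi> x\<bar> \<le> 1)}"

definition rescale ::
  "('d::finite \<Rightarrow> nat) \<Rightarrow> real \<Rightarrow> real^'d \<Rightarrow> (real^'d \<Rightarrow> real) \<Rightarrow> real^'d \<Rightarrow> real" where
  "rescale s \<delta> x \<phi> y = \<phi> (\<chi> i. (y $ i - x $ i) / \<delta> ^ s i) / \<delta> ^ sc_total s"

text \<open>The whole vector space \<open>T\<close> is the type \<open>'v\<close>. By convention the sector of homogeneity
  \<open>\<alpha> \<notin> A\<close> is \<open>{0}\<close>. The value of \<open>sec_norm S \<alpha>\<close> is meaningful only on \<open>sector S \<alpha>\<close>.\<close>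

record 'v reg_struct =
  homs :: "real set"
  sector :: "real \<Rightarrow> 'v set"
  sec_norm :: "real \<Rightarrow> 'v \<Rightarrow> real"
  sgroup :: "('v \<Rightarrow> 'v) set"

definition is_decomp :: "('v::real_vector) reg_struct \<Rightarrow> 'v \<Rightarrow> (real \<Rightarrow> 'v) \<Rightarrow> bool" where
  "is_decomp S \<tau> u \<longleftrightarrow> (\<forall>\<alpha>. u \<alpha> \<in> sector S \<alpha>) \<and> finite {\<alpha>. u \<alpha> \<noteq> 0} \<and>
      \<tau> = (\<Sum>\<alpha> | u \<alpha> \<noteq> 0. u \<alpha>)"

definition hom_comp :: "('v::real_vector) reg_struct \<Rightarrow> real \<Rightarrow> 'v \<Rightarrow> 'v" where
  "hom_comp S \<alpha> \<tau> = (THE u. is_decomp S \<tau> u) \<alpha>"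

definition comp_norm :: "('v::real_vector) reg_struct \<Rightarrow> real \<Rightarrow> 'v \<Rightarrow> real" where
  "comp_norm S \<alpha> \<tau> = sec_norm S \<alpha> (hom_comp S \<alpha> \<tau>)"

definition T_below :: "('v::real_vector) reg_struct \<Rightarrow> real \<Rightarrow> 'v set" where
  "T_below S \<gamma> = {\<tau>. \<forall>\<alpha>\<ge>\<gamma>. hom_comp S \<alpha> \<tau> = 0}"

definition proj_below :: "('v::real_vector) reg_struct \<Rightarrow> real \<Rightarrow> 'v \<Rightarrow> 'v" where
  "proj_below S \<gamma> \<tau> = (\<Sum>\<alpha> | \<alpha> < \<gamma> \<and> hom_comp S \<alpha> \<tau> \<noteq> 0. hom_comp S \<alpha> \<tau>)"

definition banach_sector :: "('v::real_vector) set \<Rightarrow> ('v \<Rightarrow> real) \<Rightarrow> bool" where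
  "banach_sector V N \<longleftrightarrow> subspace V \<and>
    (\<forall>v\<in>V. 0 \<le> N v \<and> (N v = 0 \<longleftrightarrow> v = 0)) \<and>
    (\<forall>v\<in>V. \<forall>c. N (c *\<^sub>R v) = \<bar>c\<bar> * N v) \<and>
    (\<forall>v\<in>V. \<forall>w\<in>V. N (v + w) \<le> N v + N w) \<and>
    Metric_space.mcomplete V (\<lambda>v w. N (v - w))"

definition regularity_structure :: "('v::real_vector) reg_struct \<Rightarrow> bool" where
  "regularity_structure S \<longleftrightarrow>
    bdd_below (homs S) \<and> (\<forall>a b. finite (homs S \<inter> {a..b})) \<and>
    (\<forall>\<alpha>. banach_sector (sector S \<alpha>) (sec_norm S \<alpha>)) \<and>
    (\<forall>\<alpha>. \<alpha> \<notin> homs S \<longrightarrow> sector S \<alpha> = {0}) \<and>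
    (\<forall>\<tau>. \<exists>!u. is_decomp S \<tau> u) \<and>
    (\<forall>g\<in>sgroup S. linear g) \<and>
    id \<in> sgroup S \<and>
    (\<forall>g\<in>sgroup S. \<forall>h\<in>sgroup S. g \<circ> h \<in> sgroup S) \<and>
    (\<forall>g\<in>sgroup S. \<exists>h\<in>sgroup S. g \<circ> h = id \<and> h \<circ> g = id) \<and>
    (\<forall>g\<in>sgroup S. \<forall>\<alpha>\<in>homs S. \<forall>\<tau>\<in>sector S \<alpha>. g \<tau> - \<tau> \<in> T_below S \<alpha>)"

text \<open>\<open>X k\<close> is the copy in \<open>T\<close> of the monomial \<open>X\<^sup>k\<close>; \<open>shifted_monomial X a k\<close> is \<open>(X + a)\<^sup>k\<close>, expanded
  by the binomial theorem.\<close>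

definition shifted_monomial ::
  "(('d::finite \<Rightarrow> nat) \<Rightarrow> 'v::real_vector) \<Rightarrow> real^'d \<Rightarrow> ('d \<Rightarrow> nat) \<Rightarrow> 'v" where
  "shifted_monomial X a k =
    (\<Sum>l | l \<le> k. (\<Prod>i\<in>UNIV. real (k i choose l i) * (a $ i) ^ (k i - l i)) *\<^sub>R X l)"

definition contains_polynomials ::
  "('d::finite \<Rightarrow> nat) \<Rightarrow> ('v::real_vector) reg_struct \<Rightarrow> (('d \<Rightarrow> nat) \<Rightarrow> 'v) \<Rightarrow> bool" where
  "contains_polynomials s S X \<longleftrightarrow>
    inj X \<and> independent (range X) \<and>
    (\<forall>k. X k \<in> sector S (real (sc_deg s k))) \<and>
    (\<forall>g\<in>sgroup S. \<exists>a. \<forall>k. g (X k) = shifted_monomial X a k)"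

abbreviation Tbar :: "(('d::finite \<Rightarrow> nat) \<Rightarrow> 'v::real_vector) \<Rightarrow> 'v set" where
  "Tbar X \<equiv> span (range X)"

text \<open>A product is, as usual for regularity structures, bilinear, continuous on each pair of
  homogeneous sectors, additive in the homogeneity, and has the monomial \<open>X\<^sup>0\<close> as unit.
  Continuity in the first argument is automatic, since the sectors of the polynomial structure
  are finite-dimensional. Values outside \<open>Tbar X \<times> UNIV\<close> are irrelevant.\<close>

definition poly_product ::
  "('d::finite \<Rightarrow> nat) \<Rightarrow> ('v::real_vector) reg_struct \<Rightarrow> (('d \<Rightarrow> nat) \<Rightarrow> 'v) \<Rightarrow>
   ('v \<Rightarrow> 'v \<Rightarrow> 'v) \<Rightarrow> bool" where
  "poly_product s S X star \<longleftrightarrow>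
    (\<forall>P\<in>Tbar X. linear (star P)) \<and>
    (\<forall>P\<in>Tbar X. \<forall>Q\<in>Tbar X. \<forall>\<tau>. star (P + Q) \<tau> = star P \<tau> + star Q \<tau>) \<and>
    (\<forall>P\<in>Tbar X. \<forall>c \<tau>. star (c *\<^sub>R P) \<tau> = c *\<^sub>R star P \<tau>) \<and>
    (\<forall>k \<alpha>. \<forall>\<tau>\<in>sector S \<alpha>. star (X k) \<tau> \<in> sector S (real (sc_deg s k) + \<alpha>)) \<and>
    (\<forall>k \<alpha>. \<exists>C. \<forall>\<tau>\<in>sector S \<alpha>.
        sec_norm S (real (sc_deg s k) + \<alpha>) (star (X k) \<tau>) \<le> C * sec_norm S \<alpha> \<tau>) \<and>
    (\<forall>\<tau>. star (X (\<lambda>_. 0)) \<tau> = \<tau>)"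

text \<open>Distributions are functionals on smooth test functions, so the bound on \<open>\<Pi>\<^sub>Z\<close> is required for the
  smooth elements of \<open>Br s r\<close>. Identities between distributions are identities on test functions.
  The clause bounding \<open>\<Pi>\<^sub>Z x \<tau> \<phi>\<close> for fixed \<open>\<phi>\<close> is the continuity of \<open>\<Pi>\<^sub>Z x\<close> as a map into
  distributions.\<close>

definition is_model ::
  "('d::finite \<Rightarrow> nat) \<Rightarrow> nat \<Rightarrow> ('v::real_vector) reg_struct \<Rightarrow>
   (real^'d \<Rightarrow> 'v \<Rightarrow> (real^'d \<Rightarrow> real) \<Rightarrow> real) \<Rightarrow> (real^'d \<Rightarrow> real^'d \<Rightarrow> 'v \<Rightarrow> 'v) \<Rightarrow> bool" where
  "is_model s r S \<Pi>\<^sub>Z \<Gamma> \<longleftrightarrow>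
    (\<forall>x \<tau>. distribution (\<Pi>\<^sub>Z x \<tau>)) \<and>
    (\<forall>x \<phi>. test_fun \<phi> \<longrightarrow> linear (\<lambda>\<tau>. \<Pi>\<^sub>Z x \<tau> \<phi>)) \<and>
    (\<forall>x \<phi> \<alpha>. test_fun \<phi> \<longrightarrow> (\<exists>C. \<forall>\<tau>\<in>sector S \<alpha>. \<bar>\<Pi>\<^sub>Z x \<tau> \<phi>\<bar> \<le> C * sec_norm S \<alpha> \<tau>)) \<and>
    (\<forall>x y. \<Gamma> x y \<in> sgroup S) \<and>
    (\<forall>x y \<tau> \<phi>. test_fun \<phi> \<longrightarrow> \<Pi>\<^sub>Z x (\<Gamma> x y \<tau>) \<phi> = \<Pi>\<^sub>Z y \<tau> \<phi>) \<and>
    (\<forall>x y z. \<Gamma> x y \<circ> \<Gamma> y z = \<Gamma> x z) \<and>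
    (\<forall>\<gamma>. \<exists>C. \<forall>\<zeta>\<in>homs S \<inter> {..<\<gamma>}. \<forall>\<tau>\<in>sector S \<zeta>.
       (\<forall>x. \<forall>\<delta>\<in>{0<..<1}. \<forall>\<phi>\<in>Br s r. smooth_fun \<phi> \<longrightarrow>
          \<bar>\<Pi>\<^sub>Z x \<tau> (rescale s \<delta> x \<phi>)\<bar> \<le> C * sec_norm S \<zeta> \<tau> * \<delta> powr \<zeta>) \<and>
       (\<forall>x y. sc_norm s (x - y) < 1 \<longrightarrow> (\<forall>\<beta>\<in>homs S. \<beta> < \<zeta> \<longrightarrow>
          comp_norm S \<beta> (\<Gamma> x y \<tau>) \<le> C * sc_norm s (x - y) powr (\<zeta> - \<beta>) * sec_norm S \<zeta> \<tau>)))"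

definition canonical_on_polynomials ::
  "(('d::finite \<Rightarrow> nat) \<Rightarrow> 'v::real_vector) \<Rightarrow>
   (real^'d \<Rightarrow> 'v \<Rightarrow> (real^'d \<Rightarrow> real) \<Rightarrow> real) \<Rightarrow> (real^'d \<Rightarrow> real^'d \<Rightarrow> 'v \<Rightarrow> 'v) \<Rightarrow> bool" where
  "canonical_on_polynomials X \<Pi>\<^sub>Z \<Gamma> \<longleftrightarrow>
    (\<forall>x k \<phi>. test_fun \<phi> \<longrightarrow> \<Pi>\<^sub>Z x (X k) \<phi> = (LINT y|lborel. mpow (y - x) k * \<phi> y)) \<and>
    (\<forall>x y k. \<Gamma> x y (X k) = shifted_monomial X (x - y) k)"

definition epowr :: "ennreal \<Rightarrow> real \<Rightarrow> ennreal" where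
  "epowr a t = (if a = \<infinity> then \<infinity> else ennreal (enn2real a powr t))"

definition Lp_norm :: "ennreal \<Rightarrow> ('a::euclidean_space \<Rightarrow> ennreal) \<Rightarrow> ennreal" where
  "Lp_norm p F = (if p = \<infinity> then esssup lborel F
     else epowr (\<integral>\<^sup>+x. epowr (F x) (enn2real p) \<partial>lborel) (1 / enn2real p))"

definition d_quot ::
  "('d::finite \<Rightarrow> nat) \<Rightarrow> ('v::real_vector) reg_struct \<Rightarrow> (real^'d \<Rightarrow> real^'d \<Rightarrow> 'v \<Rightarrow> 'v) \<Rightarrow>
   real \<Rightarrow> real \<Rightarrow> ennreal \<Rightarrow> (real^'d \<Rightarrow> 'v) \<Rightarrow> real^'d \<Rightarrow> ennreal" where
  "d_quot s S \<Gamma> \<gamma> \<zeta> p f h = Lp_norm p (\<lambda>x.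
     ennreal (comp_norm S \<zeta> (f (x + h) - \<Gamma> (x + h) x (f x)) / sc_norm s h powr (\<gamma> - \<zeta>)))"

definition d_seminorm ::
  "('d::finite \<Rightarrow> nat) \<Rightarrow> ('v::real_vector) reg_struct \<Rightarrow> (real^'d \<Rightarrow> real^'d \<Rightarrow> 'v \<Rightarrow> 'v) \<Rightarrow>
   real \<Rightarrow> real \<Rightarrow> ennreal \<Rightarrow> ennreal \<Rightarrow> (real^'d \<Rightarrow> 'v) \<Rightarrow> ennreal" where
  "d_seminorm s S \<Gamma> \<gamma> \<zeta> p q f = (if q = \<infinity> then (SUP h\<in>sc_ball s. d_quot s S \<Gamma> \<gamma> \<zeta> p f h)
     else epowr (\<integral>\<^sup>+h\<in>sc_ball s. epowr (d_quot s S \<Gamma> \<gamma> \<zeta> p f h) (enn2real q)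
                   * ennreal (1 / sc_norm s h ^ sc_total s) \<partial>lborel) (1 / enn2real q))"

definition D_norm ::
  "('d::finite \<Rightarrow> nat) \<Rightarrow> ('v::real_vector) reg_struct \<Rightarrow> (real^'d \<Rightarrow> real^'d \<Rightarrow> 'v \<Rightarrow> 'v) \<Rightarrow>
   real \<Rightarrow> ennreal \<Rightarrow> ennreal \<Rightarrow> (real^'d \<Rightarrow> 'v) \<Rightarrow> ennreal" where
  "D_norm s S \<Gamma> \<gamma> p q f = (\<Sum>\<zeta>\<in>homs S \<inter> {..<\<gamma>}.
     Lp_norm p (\<lambda>x. ennreal (comp_norm S \<zeta> (f x))) + d_seminorm s S \<Gamma> \<gamma> \<zeta> p q f)"

text \<open>Measurability of a map into the Banach space of elements of homogeneity below \<open>\<gamma>\<close> is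
  strong (Bochner) measurability; the Banach spaces need not be separable.\<close>

definition T_measurable ::
  "('v::real_vector) reg_struct \<Rightarrow> real \<Rightarrow> (real^'d::finite \<Rightarrow> 'v) \<Rightarrow> bool" where
  "T_measurable S \<gamma> f \<longleftrightarrow> (\<exists>u :: nat \<Rightarrow> real^'d \<Rightarrow> 'v.
     (\<forall>n. simple_function borel (u n)) \<and>
     (\<forall>x. \<forall>\<alpha>\<in>homs S \<inter> {..<\<gamma>}. (\<lambda>n. comp_norm S \<alpha> (u n x - f x)) \<longlonglongrightarrow> 0))"

definition D_space ::
  "('d::finite \<Rightarrow> nat) \<Rightarrow> ('v::real_vector) reg_struct \<Rightarrow> (real^'d \<Rightarrow> real^'d \<Rightarrow> 'v \<Rightarrow> 'v) \<Rightarrow>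
   real \<Rightarrow> ennreal \<Rightarrow> ennreal \<Rightarrow> (real^'d \<Rightarrow> 'v) set" where
  "D_space s S \<Gamma> \<gamma> p q =
    {f. (\<forall>x. f x \<in> T_below S \<gamma>) \<and> T_measurable S \<gamma> f \<and> D_norm s S \<Gamma> \<gamma> p q f < \<infinity>}"

text \<open>The projection to homogeneities below \<open>\<gamma>\<close> annihilates \<open>X\<^sup>k \<star> \<tau>\<close> unless some \<open>\<alpha> \<in> A\<close> satisfies
  \<open>|k| + \<alpha> < \<gamma>\<close> (scaled degree). So it suffices to sum over the finitely many such \<open>k\<close>, which
  gives a meaning to the formal series \<open>\<Phi>(x)\<close>.\<close>

definition loc_const ::
  "('d::finite \<Rightarrow> nat) \<Rightarrow> ('v::real_vector) reg_struct \<Rightarrow> (('d \<Rightarrow> nat) \<Rightarrow> 'v) \<Rightarrow>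
   ('v \<Rightarrow> 'v \<Rightarrow> 'v) \<Rightarrow> (real^'d \<Rightarrow> real^'d \<Rightarrow> 'v \<Rightarrow> 'v) \<Rightarrow> real \<Rightarrow>
   real^'d \<Rightarrow> (real^'d \<Rightarrow> real) \<Rightarrow> 'v \<Rightarrow> real^'d \<Rightarrow> 'v" where
  "loc_const s S X star \<Gamma> \<gamma> z \<phi> \<tau> x =
    proj_below S \<gamma> (star (\<Sum>k | \<exists>\<alpha>\<in>homs S. real (sc_deg s k) + \<alpha> < \<gamma>.
        (mderiv k \<phi> x / mfact k) *\<^sub>R X k) (\<Gamma> x z \<tau>))"

text \<open>Locally finite families of functions on \<open>\<real>\<^sup>d\<close> have only countably many nonzero members, so
  sequences suffice.\<close>

definition E_space ::
  "('d::finite \<Rightarrow> nat) \<Rightarrow> ('v::real_vector) reg_struct \<Rightarrow> (('d \<Rightarrow> nat) \<Rightarrow> 'v) \<Rightarrow>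
   ('v \<Rightarrow> 'v \<Rightarrow> 'v) \<Rightarrow> (real^'d \<Rightarrow> real^'d \<Rightarrow> 'v \<Rightarrow> 'v) \<Rightarrow>
   real \<Rightarrow> ennreal \<Rightarrow> ennreal \<Rightarrow> (real^'d \<Rightarrow> 'v) set" where
  "E_space s S X star \<Gamma> \<gamma> p q = {f \<in> D_space s S \<Gamma> \<gamma> p q.
     \<exists>(c :: nat \<Rightarrow> real) F.
       (\<forall>j. \<exists>z \<phi> \<tau>. test_fun \<phi> \<and> F j = loc_const s S X star \<Gamma> \<gamma> z \<phi> \<tau>) \<and>
       (\<forall>x. \<exists>U. open U \<and> x \<in> U \<and> finite {j. \<exists>y\<in>U. F j y \<noteq> 0}) \<and>
       (\<forall>x. f x = (\<Sum>j | F j x \<noteq> 0. c j *\<^sub>R F j x))}"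

definition dense_in_D_topology ::
  "('d::finite \<Rightarrow> nat) \<Rightarrow> ('v::real_vector) reg_struct \<Rightarrow> (real^'d \<Rightarrow> real^'d \<Rightarrow> 'v \<Rightarrow> 'v) \<Rightarrow>
   real \<Rightarrow> ennreal \<Rightarrow> ennreal \<Rightarrow> (real^'d \<Rightarrow> 'v) set \<Rightarrow> (real^'d \<Rightarrow> 'v) set \<Rightarrow> bool" where
  "dense_in_D_topology s S \<Gamma> \<gamma> p q E D \<longleftrightarrow> E \<subseteq> D \<and>
     (\<forall>f\<in>D. \<forall>\<eta>>0. \<exists>g\<in>E. D_norm s S \<Gamma> \<gamma> p q (\<lambda>x. f x - g x) < \<eta>)"

end

theory Submission
  imports Defs
begin

text \<open>
  Let \<open>\<phi>\<^sub>z\<close> be a smooth partition of unity on a grid of scaled mesh size \<open>\<delta>\<close>, with canonical lifts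
  \<open>\<Phi>\<^sub>z\<close>. The approximation of \<open>f\<close> is \<open>f\<^sub>\<delta>(x) = \<Sum>\<^sub>z \<Phi>\<^sub>z(x) \<star> \<Gamma> x y f(y)\<close> with one base point \<open>y = y\<^sub>z\<close> in each
  cell. Since \<open>\<Sum>\<^sub>z \<Phi>\<^sub>z\<close> is the lift of the constant function \<open>1\<close>, both \<open>f - f\<^sub>\<delta>\<close> and the increments of
  \<open>f\<^sub>\<delta>\<close> on scales below \<open>\<delta>\<close> are controlled by the local oscillations \<open>f(x) - \<Gamma> x y f(y)\<close>; for the increments one
  uses Taylor expansion of \<open>\<phi>\<^sub>z\<close> and the multiplicativity of \<open>\<Gamma>\<close>.

  Base points are used in place of local averages of \<open>f\<close> so that no vector-valued integral is needed;
  a good choice of \<open>y\<^sub>z\<close> exists because the oscillation is small on average over the cell. The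
  \<open>L\<^sup>p\<close> norm of the oscillation under a shift by \<open>h\<close> is bounded pointwise in \<open>h\<close>, not only in
  \<open>L\<^sup>q\<close>-mean: up to constants it is subadditive in \<open>h\<close>, by the cocycle property of \<open>\<Gamma>\<close>.

  For \<open>q < \<infinity>\<close> the bounds are small by dominated convergence. The part of the lift that is cut off at
  homogeneity \<open>\<gamma>\<close> contributes increments of order \<open>\<alpha> - \<zeta>\<close> with \<open>\<alpha> \<ge> \<gamma>\<close>, and \<open>\<alpha> = \<gamma>\<close> has to be excluded to
  make them integrable against \<open>dh / |h|^|s|\<close>; this is where \<open>\<gamma> \<notin> A\<close> is needed. For \<open>q = \<infinity>\<close> the bounds are only
  of order one in the \<open>\<gamma>\<close>-norm, which gives a factor \<open>\<delta>\<^sup>\<epsilon>\<close> in the norm of order \<open>\<gamma> - \<epsilon>\<close>.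
\<close>

section \<open>A smooth partition of unity on the line\<close>

text \<open>All dependence on the base points enters through one scalar function of x: the sum of
  the weighted oscillations over the cells near x. Let w be its L^p norm, \<theta> the distance from
  \<gamma> down to \<open>homs S\<close> and \<kappa> the gap above \<gamma>. Up to constants the
  error satisfies three bounds: its component at \<beta> has norm
  \<open>\<delta> powr (\<gamma> - \<beta>)\<close> w; its difference quotient at |h| <= \<delta> is
  that of f plus \<open>(|h| / \<delta>) powr \<kappa>\<close> w; at |h| >= \<delta> it is
  \<open>(\<delta> / |h|) powr \<theta>\<close> w, by size alone. Since dh / |h|^|s| is invariant
  under scaling, these two powers integrate to constants independent of \<delta>, so only w and the
  contribution of small h to the seminorm of f must become small. The obstacle to using base points
  is that one point must serve all x near its cell: the mean over the cell is taken of an integral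
  in x, which Fubini bounds by moduli of f under shifts. That the approximation itself lies in the
  space follows from f and the error lying there.\<close>

definition bump_term :: "nat \<Rightarrow> nat \<Rightarrow> real \<Rightarrow> real" where
  "bump_term a b t =
     (if 0 < t \<and> t < 1 then exp (- 1 / t) * exp (- 1 / (1 - t)) / (t ^ a * (1 - t) ^ b) else 0)"

text \<open>From \<open>1 + u \<le> exp u\<close> at \<open>u = 1 / (n * t)\<close>, raised to the
  n-th power: the exponential beats any prescribed power of t at 0.\<close>

lemma exp_minus_inverse_le:
  fixes t :: real
  assumes t: "0 < t" and n: "0 < n"
  shows "exp (- 1 / t) \<le> (real n * t) ^ n"
proof -
  have "1 / (real n * t) \<le> exp (1 / (real n * t))"
    using exp_ge_add_one_self[of "1 / (real n * t)"] by linarith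
  then have "(1 / (real n * t)) ^ n \<le> exp (1 / (real n * t)) ^ n"
    using t by (intro power_mono) auto
  also have "\<dots> = exp (1 / t)"
    using n by (simp add: exp_of_nat_mult[symmetric])
  finally have "1 / (real n * t) ^ n \<le> exp (1 / t)"
    by (simp add: power_divide)
  then show ?thesis
    using t n by (simp add: exp_minus field_simps)
qed

lemma bump_term_nonneg: "0 \<le> bump_term a b t"
  by (simp add: bump_term_def)

lemma bump_term_reflect: "bump_term a b (1 - t) = bump_term b a t"
  by (auto simp: bump_term_def mult.commute)

text \<open>Two powers of t more than the pole order a are extracted from the first exponential,
  which leaves the square; from the second only boundedness is wanted, and the exponent
  \<open>b + 1\<close> appears because \<open>exp_minus_inverse_le\<close> asks for a positive one.
  The square makes the derivative at 0 vanish.\<close>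

lemma bump_term_le: "bump_term a b t \<le> real (a + 2) ^ (a + 2) * real (b + 1) ^ (b + 1) * t\<^sup>2"
proof (cases "0 < t \<and> t < 1")
  case True
  have "exp (- 1 / t) \<le> (real (a + 2) * t) ^ (a + 2)"
    using True by (intro exp_minus_inverse_le) auto
  also have "\<dots> = real (a + 2) ^ (a + 2) * t\<^sup>2 * t ^ a"
    by (simp only: power_mult_distrib) (simp add: power_add power2_eq_square)
  finally have 1: "exp (- 1 / t) / t ^ a \<le> real (a + 2) ^ (a + 2) * t\<^sup>2"
    using True by (simp add: divide_le_eq)
  have "exp (- 1 / (1 - t)) \<le> (real (b + 1) * (1 - t)) ^ (b + 1)"
    using True by (intro exp_minus_inverse_le) auto
  also have "\<dots> \<le> real (b + 1) ^ (b + 1) * (1 - t) ^ b"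
    unfolding power_mult_distrib using True by (intro mult_left_mono) (auto intro: mult_left_le_one_le)
  finally have 2: "exp (- 1 / (1 - t)) / (1 - t) ^ b \<le> real (b + 1) ^ (b + 1)"
    using True by (simp add: divide_le_eq)
  have "bump_term a b t = (exp (- 1 / t) / t ^ a) * (exp (- 1 / (1 - t)) / (1 - t) ^ b)"
    using True by (simp add: bump_term_def)
  also have "\<dots> \<le> (real (a + 2) ^ (a + 2) * t\<^sup>2) * real (b + 1) ^ (b + 1)"
    using True by (intro mult_mono 1 2) auto
  finally show ?thesis
    by (simp add: mult_ac)
qed (auto simp: bump_term_def)

lemma DERIV_zero_if_quadratic:
  fixes f :: "real \<Rightarrow> real"
  assumes "\<And>t. \<bar>f t - f c\<bar> \<le> C * (t - c)\<^sup>2"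
  shows "(f has_real_derivative 0) (at c)"
proof -
  have "((\<lambda>t. C * \<bar>t - c\<bar>) \<longlongrightarrow> C * \<bar>c - c\<bar>) (at c)"
    by (intro tendsto_intros)
  then have lim: "((\<lambda>t. C * \<bar>t - c\<bar>) \<longlongrightarrow> 0) (at c)"
    by simp
  have "norm ((f t - f c) / (t - c)) \<le> C * \<bar>t - c\<bar>" if "t \<noteq> c" for t
    using assms[of t] that by (simp add: abs_divide divide_le_eq power2_eq_square abs_mult[symmetric] mult.assoc)
  then have "((\<lambda>t. (f t - f c) / (t - c)) \<longlongrightarrow> 0) (at c)"
    by (intro Lim_null_comparison[OF _ lim]) (auto simp: eventually_at_filter)
  then show ?thesis
    by (simp add: has_field_derivative_iff)
qed

text \<open>Inside the interval each exponential contributes a pole of order two when differentiated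
  and each denominator one of order one, so the derivative stays in the family. At the endpoints the
  quadratic bound \<open>bump_term_le\<close> gives derivative 0.\<close>

lemma bump_term_has_derivative:
  "(bump_term a b has_real_derivative
     - real a * bump_term (Suc a) b t + real b * bump_term a (Suc b) t
     + bump_term (a + 2) b t - bump_term a (b + 2) t) (at t)"
proof -
  consider "0 < t" "t < 1" | "t < 0 \<or> 1 < t" | "t = 0" | "t = 1" by linarith
  then show ?thesis
  proof cases
    case 1
    let ?g = "\<lambda>t::real. exp (- 1 / t) * exp (- 1 / (1 - t)) * (inverse t ^ a * inverse (1 - t) ^ b)"
    have bt: "bump_term m n t = exp (- 1 / t) * exp (- 1 / (1 - t)) * (inverse t ^ m * inverse (1 - t) ^ n)"
      for m n
      using 1 by (simp add: bump_term_def divide_inverse power_inverse)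
    have dinv: "((\<lambda>t. inverse t ^ n) has_real_derivative - real n * inverse t ^ Suc n) (at t)"
      if "t \<noteq> 0" for n and t :: real
    proof (cases n)
      case (Suc m)
      show ?thesis
        unfolding Suc
        by (rule DERIV_cong[OF DERIV_power_Suc[OF DERIV_inverse[OF that]]]) (simp add: algebra_simps)
    qed simp
    have P: "((\<lambda>t. inverse t ^ a) has_real_derivative - real a * inverse t ^ Suc a) (at t)"
      using 1 by (intro dinv) auto
    have Q: "((\<lambda>t. inverse (1 - t) ^ b) has_real_derivative real b * inverse (1 - t) ^ Suc b) (at t)"
    proof -
      have "((\<lambda>t. 1 - t) has_real_derivative - 1) (at t)"
        by (auto intro!: derivative_eq_intros)
      from DERIV_chain2[where f = "\<lambda>t. inverse t ^ b", OF dinv this] 1 show ?thesis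
        by simp
    qed
    have E: "((\<lambda>t. exp (- 1 / t) * exp (- 1 / (1 - t))) has_real_derivative
        exp (- 1 / t) * exp (- 1 / (1 - t)) * (inverse t ^ 2 - inverse (1 - t) ^ 2)) (at t)"
      using 1 by (auto intro!: derivative_eq_intros simp: power2_eq_square field_simps)
    have "(?g has_real_derivative
      (- real a * bump_term (Suc a) b t + real b * bump_term a (Suc b) t
     + bump_term (a + 2) b t - bump_term a (b + 2) t)) (at t)"
      by (rule DERIV_cong[OF DERIV_mult[OF E DERIV_mult[OF P Q]]])
        (simp add: bt power2_eq_square algebra_simps)
    moreover have "eventually (\<lambda>u. u \<in> {0<..<1}) (nhds t)"
      using 1 by (intro eventually_nhds_in_open) auto
    then have "eventually (\<lambda>u. bump_term a b u = ?g u) (nhds t)"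
      by eventually_elim (auto simp: bump_term_def divide_simps)
    ultimately show ?thesis
      by (subst DERIV_cong_ev[OF refl _ refl])
  next
    case 2
    have "open ({..<0} \<union> {1<..} :: real set)" by auto
    with 2 have "eventually (\<lambda>u. u \<in> {..<0} \<union> {1<..}) (nhds t)"
      by (intro eventually_nhds_in_open) auto
    then have ev: "eventually (\<lambda>u. bump_term a b u = 0) (nhds t)"
      by eventually_elim (auto simp: bump_term_def)
    have "(bump_term a b has_real_derivative 0) (at t)"
      by (subst DERIV_cong_ev[OF refl ev refl]) simp
    then show ?thesis using 2 by (auto simp: bump_term_def)
  next
    case 3
    have "(bump_term a b has_real_derivative 0) (at 0)"
      using bump_term_le[of a b] bump_term_nonneg[of a b]
      by (intro DERIV_zero_if_quadratic[where C = "real (a + 2) ^ (a + 2) * real (b + 1) ^ (b + 1)"])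
        (simp add: bump_term_def[of a b 0])
    then show ?thesis using 3 by (simp add: bump_term_def)
  next
    case 4
    \<comment> \<open>The reflection of t to 1 - t exchanges a and b and carries the endpoint 1 to
      the endpoint 0.\<close>
    have "\<bar>bump_term a b t\<bar> \<le> real (b + 2) ^ (b + 2) * real (a + 1) ^ (a + 1) * (t - 1)\<^sup>2" for t
      using bump_term_le[of b a "1 - t"] bump_term_nonneg[of a b t]
      by (simp add: bump_term_reflect power2_commute)
    then have "(bump_term a b has_real_derivative 0) (at 1)"
      by (intro DERIV_zero_if_quadratic) (simp add: bump_term_def[of a b 1])
    then show ?thesis using 4 by (simp add: bump_term_def)
  qed
qed

text \<open>The linear span of the \<open>bump_term\<close>s. It is closed under differentiation and
  all its members vanish outside the open unit interval, so it supplies every higher derivative of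
  the basic bump at once.\<close>

inductive bump_comb :: "(real \<Rightarrow> real) \<Rightarrow> bool" where
  base: "bump_comb (bump_term a b)"
| add: "bump_comb f \<Longrightarrow> bump_comb g \<Longrightarrow> bump_comb (\<lambda>t. f t + g t)"
| scale: "bump_comb f \<Longrightarrow> bump_comb (\<lambda>t. c * f t)"

lemma bump_comb_derivative:
  assumes "bump_comb f"
  shows "\<exists>g. bump_comb g \<and> (\<forall>t. (f has_real_derivative g t) (at t))"
  using assms
proof induction
  case (base a b)
  have "bump_comb (\<lambda>t. ((- real a * bump_term (Suc a) b t + real b * bump_term a (Suc b) t)
     + bump_term (a + 2) b t) + (- 1) * bump_term a (b + 2) t)"
    by (intro bump_comb.intros)
  with bump_term_has_derivative[of a b] show ?case
    by (intro exI[of _ "\<lambda>t. - real a * bump_term (Suc a) b t + real b * bump_term a (Suc b) t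
     + bump_term (a + 2) b t - bump_term a (b + 2) t"]) simp
next
  case (add f g)
  then obtain f' g' where "bump_comb f'" "bump_comb g'"
    "\<And>t. (f has_real_derivative f' t) (at t)" "\<And>t. (g has_real_derivative g' t) (at t)"
    by blast
  then show ?case
    by (intro exI[of _ "\<lambda>t. f' t + g' t"]) (auto intro!: derivative_intros bump_comb.intros)
next
  case (scale f c)
  then obtain f' where "bump_comb f'" "\<And>t. (f has_real_derivative f' t) (at t)"
    by blast
  then show ?case
    by (intro exI[of _ "\<lambda>t. c * f' t"]) (auto intro!: derivative_eq_intros bump_comb.intros)
qed

lemma bump_comb_vanishes:
  assumes "bump_comb f" "t \<le> 0 \<or> 1 \<le> t"
  shows "f t = 0"
  using assms by induction (auto simp: bump_term_def)

text \<open>Smoothness is recorded as the whole sequence of derivatives: partial derivatives and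
  Taylor remainders then refer to explicit functions.\<close>

definition derivative_chain :: "(nat \<Rightarrow> real \<Rightarrow> real) \<Rightarrow> bool" where
  "derivative_chain D \<longleftrightarrow> (\<forall>n t. (D n has_real_derivative D (Suc n) t) (at t))"

text \<open>Member 0 is the antiderivative F of the bump, shifted and divided by
  \<open>F 1 - F 0\<close>. F is constant where the bump vanishes and strictly increasing in
  between, so this divisor is positive.\<close>

lemma smooth_step_exists:
  "\<exists>D. derivative_chain D \<and> (\<forall>n. \<forall>t\<le>0. D n t = 0) \<and>
     (\<forall>t\<ge>1. D 0 t = 1) \<and> (\<forall>n. \<forall>t\<ge>1. D (Suc n) t = 0)"
proof -
  obtain G where G: "\<And>n. bump_comb (G n)" "G 0 = bump_term 0 0"
    "\<And>n t. (G n has_real_derivative G (Suc n) t) (at t)"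
  proof -
    have "\<exists>G. \<forall>n. (bump_comb (G n) \<and> (n = 0 \<longrightarrow> G n = bump_term 0 0)) \<and>
        (\<forall>t. (G n has_real_derivative G (Suc n) t) (at t))"
      using bump_comb_derivative bump_comb.base by (intro dependent_nat_choice) auto
    then show ?thesis using that by blast
  qed
  have cont: "isCont (bump_term 0 0) t" for t
    using bump_term_has_derivative DERIV_isCont by blast
  then obtain F where F: "\<And>t. (F has_real_derivative bump_term 0 0 t) (at t)"
    using einterval_antiderivative[of "-\<infinity>" "\<infinity>" "bump_term 0 0"]
    by (auto simp: has_real_derivative_iff_has_vector_derivative)
  have contF: "continuous_on A F" for A
    using F by (intro continuous_at_imp_continuous_on) (blast intro: DERIV_isCont)
  have F0: "(F has_real_derivative 0) (at t)" if "t \<le> 0 \<or> 1 \<le> t" for t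
    using F[of t] that by (auto simp: bump_term_def)
  have const_le: "F t = F 0" if "t \<le> 0" for t
    using that F0 contF by (cases "t = 0") (auto intro!: DERIV_isconst_end[of t 0 F, symmetric])
  have const_ge: "F t = F 1" if "1 \<le> t" for t
    using that F0 contF by (cases "t = 1") (auto intro!: DERIV_isconst_end[of 1 t F])
  have pos: "F 0 < F 1"
  proof (rule DERIV_pos_imp_increasing_open[of 0 1 F])
    show "\<exists>y. (F has_real_derivative y) (at x) \<and> 0 < y" if "0 < x" "x < 1" for x :: real
      using F[of x] that by (intro exI[of _ "bump_term 0 0 x"]) (auto simp: bump_term_def)
  qed (use contF in auto)
  define c where "c = F 1 - F 0"
  have c: "0 < c" using pos by (simp add: c_def)
  define D where "D n t = (case n of 0 \<Rightarrow> (F t - F 0) / c | Suc m \<Rightarrow> G m t / c)" for n t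
  have "derivative_chain D"
    unfolding derivative_chain_def
  proof (intro allI)
    fix n t
    show "(D n has_real_derivative D (Suc n) t) (at t)"
      using c G(2) by (cases n) (auto simp: D_def[abs_def] intro!: derivative_eq_intros F G(3))
  qed
  moreover have "D n t = 0" if "t \<le> 0" for n t
    using that const_le[of t] bump_comb_vanishes[OF G(1)] by (cases n) (auto simp: D_def)
  moreover have "D 0 t = 1" "D (Suc n) t = 0" if "1 \<le> t" for n t
    using that const_ge[of t] c bump_comb_vanishes[OF G(1)] by (auto simp: D_def c_def)
  ultimately show ?thesis by blast
qed

definition smooth_step :: "nat \<Rightarrow> real \<Rightarrow> real" where
  "smooth_step = (SOME D. derivative_chain D \<and> (\<forall>n. \<forall>t\<le>0. D n t = 0) \<and>
     (\<forall>t\<ge>1. D 0 t = 1) \<and> (\<forall>n. \<forall>t\<ge>1. D (Suc n) t = 0))"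

lemma smooth_step:
  shows smooth_step_derivative: "(smooth_step n has_real_derivative smooth_step (Suc n) t) (at t)"
    and smooth_step_le_0: "t \<le> 0 \<Longrightarrow> smooth_step n t = 0"
    and smooth_step_ge_1: "1 \<le> t \<Longrightarrow> smooth_step n t = (if n = 0 then 1 else 0)"
proof -
  have *: "derivative_chain smooth_step \<and> (\<forall>n. \<forall>t\<le>0. smooth_step n t = 0) \<and>
     (\<forall>t\<ge>1. smooth_step 0 t = 1) \<and> (\<forall>n. \<forall>t\<ge>1. smooth_step (Suc n) t = 0)"
    unfolding smooth_step_def by (rule someI_ex[OF smooth_step_exists])
  show "(smooth_step n has_real_derivative smooth_step (Suc n) t) (at t)"
    using * by (simp add: derivative_chain_def)
  show "t \<le> 0 \<Longrightarrow> smooth_step n t = 0"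
    using * by simp
  show "1 \<le> t \<Longrightarrow> smooth_step n t = (if n = 0 then 1 else 0)"
    using * by (cases n) auto
qed

text \<open>A difference of two unit shifts of the step, so that integer translates telescope.
  Despite the name it is smooth: member n is the n-th derivative of a bump supported in
  [-1, 1].\<close>

definition tent :: "nat \<Rightarrow> real \<Rightarrow> real" where
  "tent n t = smooth_step n (t + 1) - smooth_step n t"

lemma tent_derivative: "(tent n has_real_derivative tent (Suc n) t) (at t)"
proof -
  have "((\<lambda>t. smooth_step n (t + 1)) has_real_derivative smooth_step (Suc n) (t + 1)) (at t)"
    using DERIV_shift smooth_step_derivative by blast
  then show ?thesis
    unfolding tent_def[abs_def] by (intro derivative_intros smooth_step_derivative)
qed

lemma tent_outside: "1 \<le> \<bar>t\<bar> \<Longrightarrow> tent n t = 0"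
  by (cases "0 \<le> t") (auto simp: tent_def smooth_step_le_0 smooth_step_ge_1)

lemma continuous_tent: "isCont (tent n) t"
  using tent_derivative DERIV_isCont by blast

lemma tent_bounded: "\<exists>B>0. \<forall>t. \<bar>tent n t\<bar> \<le> B"
proof -
  have "compact (tent n ` {-1..1})"
    by (intro compact_continuous_image continuous_at_imp_continuous_on ballI continuous_tent) simp
  then obtain B where B: "\<forall>y\<in>tent n ` {-1..1}. norm y \<le> B"
    using compact_imp_bounded bounded_iff by blast
  have "\<bar>tent n t\<bar> \<le> max B 1" for t
  proof (cases "1 \<le> \<bar>t\<bar>")
    case False
    then have "tent n t \<in> tent n ` {-1..1}" by (intro imageI) auto
    with B have "norm (tent n t) \<le> B" by (rule bspec)
    then show ?thesis by simp
  qed (simp add: tent_outside)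
  then show ?thesis by (intro exI[of _ "max B 1"]) auto
qed

text \<open>The telescoped sum is a value of the step to the right of its transition minus a value
  to the left. For positive n both vanish, which is why the derivatives of the partition of unity
  sum to 0.\<close>

lemma sum_tent:
  fixes t :: real and a b :: int
  assumes "real_of_int a \<le> t - 1" "t + 1 \<le> real_of_int b"
  shows "(\<Sum>m\<in>{a..b}. tent n (t - real_of_int m)) = (if n = 0 then 1 else 0)"
proof -
  have ab: "a \<le> b"
    using assms by linarith
  have "(\<Sum>m\<in>{a..b}. tent n (t - real_of_int m)) =
      smooth_step n (t - real_of_int a + 1) - smooth_step n (t - real_of_int b)"
    using ab
  proof (induction b rule: int_ge_induct)
    case base
    then show ?case by (simp add: tent_def)
  next
    case (step b)
    have "{a..b + 1} = insert (b + 1) {a..b}"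
      using step.hyps by auto
    then show ?case using step by (simp add: tent_def algebra_simps)
  qed
  also have "smooth_step n (t - real_of_int b) = 0"
    using assms by (intro smooth_step_le_0) linarith
  also have "smooth_step n (t - real_of_int a + 1) = (if n = 0 then 1 else 0)"
    using assms by (intro smooth_step_ge_1) linarith
  finally show ?thesis by simp
qed

section \<open>The scaled distance and Taylor expansion of the cut-off functions\<close>

lemma powr_inverse_power:
  fixes c :: real
  assumes "0 \<le> c" "1 \<le> n"
  shows "(c ^ n) powr (1 / real n) = c" and "(c powr (1 / real n)) ^ n = c"
proof -
  show "(c ^ n) powr (1 / real n) = c"
    using assms by (cases "c = 0") (auto simp: powr_powr power_0_left simp flip: powr_realpow)
  show "(c powr (1 / real n)) ^ n = c"
    using assms by (cases "c = 0") (auto simp: powr_powr power_0_left simp flip: powr_realpow)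
qed

lemma sc_norm_nonneg: "0 \<le> sc_norm s x"
  by (simp add: sc_norm_def sum_nonneg)

lemma sc_norm_0 [simp]: "sc_norm s 0 = 0"
  by (simp add: sc_norm_def)

lemma sc_norm_minus [simp]: "sc_norm s (- x) = sc_norm s x"
  by (simp add: sc_norm_def)

lemma sc_norm_minus_commute: "sc_norm s (x - y) = sc_norm s (y - x)"
  by (simp add: sc_norm_def abs_minus_commute)

lemma sc_norm_eq_0_iff: "sc_norm s x = 0 \<longleftrightarrow> x = 0"
  by (auto simp: sc_norm_def sum_nonneg_eq_0_iff vec_eq_iff)

text \<open>For a proportion x in [0, 1] one has \<open>x \<le> x powr c\<close>; this is applied to
  the shares of a and b in \<open>a + b\<close>.\<close>

lemma powr_add_le_add_powr:
  fixes a b c :: real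
  assumes "0 \<le> a" "0 \<le> b" "0 < c" "c \<le> 1"
  shows "(a + b) powr c \<le> a powr c + b powr c"
proof (cases "a + b = 0")
  case False
  then have ab: "0 < a + b" using assms by simp
  have *: "x * (a + b) powr c \<le> (x * (a + b)) powr c" if "0 \<le> x" "x \<le> 1" for x
  proof -
    have "x \<le> x powr c"
      using that assms powr_mono'[of c 1 x] by (cases "x = 0") auto
    then show ?thesis
      using that ab by (simp add: powr_mult mult_right_mono)
  qed
  have "(a + b) powr c = a / (a + b) * (a + b) powr c + b / (a + b) * (a + b) powr c"
    using ab by (simp add: distrib_right[symmetric] add_divide_distrib[symmetric])
  also have "\<dots> \<le> (a / (a + b) * (a + b)) powr c + (b / (a + b) * (a + b)) powr c"
    using assms ab by (intro add_mono *) auto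
  finally show ?thesis using ab by simp
qed (use assms in auto)

text \<open>Scalings of at least 1 make the exponents \<open>1 / s i\<close> at most 1, so every
  summand is subadditive and no constant is lost.\<close>

lemma sc_norm_triangle:
  assumes "\<forall>i. 1 \<le> s i"
  shows "sc_norm s (x + y) \<le> sc_norm s x + sc_norm s y"
proof -
  have "\<bar>(x + y) $ i\<bar> powr (1 / real (s i)) \<le> \<bar>x $ i\<bar> powr (1 / real (s i)) + \<bar>y $ i\<bar> powr (1 / real (s i))" for i
  proof -
    have i: "1 \<le> s i" using assms by blast
    have "\<bar>(x + y) $ i\<bar> powr (1 / real (s i)) \<le> (\<bar>x $ i\<bar> + \<bar>y $ i\<bar>) powr (1 / real (s i))"
      by (intro powr_mono2) auto
    also have "\<dots> \<le> \<bar>x $ i\<bar> powr (1 / real (s i)) + \<bar>y $ i\<bar> powr (1 / real (s i))"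
      using i by (intro powr_add_le_add_powr) auto
    finally show ?thesis .
  qed
  then show ?thesis
    by (simp add: sc_norm_def sum.distrib[symmetric] sum_mono)
qed

lemma component_le_sc_norm:
  assumes "\<forall>i. 1 \<le> s i"
  shows "\<bar>x $ i\<bar> \<le> sc_norm s x ^ s i"
proof -
  have i: "1 \<le> s i" using assms by blast
  have "\<bar>x $ i\<bar> powr (1 / real (s i)) \<le> sc_norm s x"
    unfolding sc_norm_def by (rule member_le_sum) auto
  then have "(\<bar>x $ i\<bar> powr (1 / real (s i))) ^ s i \<le> sc_norm s x ^ s i"
    by (intro power_mono) auto
  also have "(\<bar>x $ i\<bar> powr (1 / real (s i))) ^ s i = \<bar>x $ i\<bar>"
    using i by (simp add: powr_inverse_power)
  finally show ?thesis .
qed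

lemma powr_inverse_le:
  fixes c t :: real
  assumes "0 \<le> c" "\<bar>t\<bar> \<le> c ^ n" "1 \<le> n"
  shows "\<bar>t\<bar> powr (1 / real n) \<le> c"
proof -
  have "\<bar>t\<bar> powr (1 / real n) \<le> (c ^ n) powr (1 / real n)"
    using assms by (intro powr_mono2) auto
  also have "\<dots> = c"
    using assms by (simp add: powr_inverse_power)
  finally show ?thesis .
qed

lemma sc_norm_le:
  fixes x :: "real^'d"
  assumes "\<forall>i. 1 \<le> s i" "0 \<le> c" "\<And>i. \<bar>x $ i\<bar> \<le> c ^ s i"
  shows "sc_norm s x \<le> real CARD('d) * c"
proof -
  have "sc_norm s x \<le> (\<Sum>i\<in>(UNIV :: 'd set). c)"
    unfolding sc_norm_def using assms by (intro sum_mono powr_inverse_le) auto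
  then show ?thesis by simp
qed

lemma sc_norm_dilate:
  assumes "\<forall>i. 1 \<le> s i" "0 \<le> c" "\<And>i. y $ i = c ^ s i * x $ i"
  shows "sc_norm s y = c * sc_norm s x"
proof -
  have "\<bar>c ^ s i * x $ i\<bar> powr (1 / real (s i)) = c * \<bar>x $ i\<bar> powr (1 / real (s i))" for i
  proof -
    have i: "1 \<le> s i" using assms by blast
    have "(c ^ s i) powr (1 / real (s i)) = c"
      using assms i by (simp add: powr_inverse_power)
    then show ?thesis
      using assms by (simp add: abs_mult powr_mult)
  qed
  then show ?thesis
    using assms(3) by (simp add: sc_norm_def sum_distrib_left)
qed

lemma continuous_on_sc_norm:
  assumes "\<forall>i. 1 \<le> s i"
  shows "continuous_on A (sc_norm s)"
proof -
  have "continuous_on A (\<lambda>x. \<bar>x $ i\<bar> powr (1 / real (s i)))" for i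
    using assms by (intro continuous_on_powr' continuous_intros) (auto simp: Suc_le_eq)
  then show ?thesis
    unfolding sc_norm_def[abs_def] by (intro continuous_on_sum)
qed

lemma borel_measurable_sc_norm [measurable]: "sc_norm s \<in> borel_measurable borel"
  unfolding sc_norm_def[abs_def] by measurable

lemma sc_deg_add: "sc_deg s (\<lambda>i. k i + l i) = sc_deg s k + sc_deg s l"
  by (simp add: sc_deg_def algebra_simps sum.distrib)

lemma sc_deg_mono: "(\<And>i. k i \<le> l i) \<Longrightarrow> sc_deg s k \<le> sc_deg s l"
  by (simp add: sc_deg_def sum_mono)

lemma component_le_sc_deg:
  assumes "\<forall>i. 1 \<le> s i"
  shows "k i \<le> sc_deg s k"
proof -
  have "k i \<le> s i * k i" using assms by simp
  also have "\<dots> \<le> sc_deg s k"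
    unfolding sc_deg_def by (rule member_le_sum) auto
  finally show ?thesis .
qed

lemma finite_bounded_multiindex: "finite {k :: 'd::finite \<Rightarrow> nat. \<forall>i. k i < N}"
proof -
  have "{k :: 'd \<Rightarrow> nat. \<forall>i. k i < N} = PiE UNIV (\<lambda>_. {..<N})"
    by (auto simp: PiE_UNIV_domain Pi_iff)
  then show ?thesis by (simp add: finite_PiE)
qed

lemma sc_deg_less_subset:
  assumes "\<forall>i. 1 \<le> s i"
  shows "{k. sc_deg s k < N} \<subseteq> {k. \<forall>i. k i < N}"
  using component_le_sc_deg[OF assms] le_less_trans by blast

lemma finite_sc_deg_less:
  "\<forall>i. 1 \<le> s i \<Longrightarrow> finite {k. sc_deg s k < N}"
  using finite_subset[OF sc_deg_less_subset finite_bounded_multiindex] .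

lemma mpow_le_sc_norm:
  assumes "\<forall>i. 1 \<le> s i"
  shows "\<bar>mpow v l\<bar> \<le> sc_norm s v ^ sc_deg s l"
proof -
  have "\<bar>mpow v l\<bar> = (\<Prod>i\<in>UNIV. \<bar>v $ i\<bar> ^ l i)"
    by (simp add: mpow_def abs_prod power_abs)
  also have "\<dots> \<le> (\<Prod>i\<in>UNIV. (sc_norm s v ^ s i) ^ l i)"
    using component_le_sc_norm[OF assms] by (intro prod_mono) (auto intro: power_mono)
  also have "\<dots> = sc_norm s v ^ sc_deg s l"
    by (simp add: sc_deg_def power_sum power_mult)
  finally show ?thesis .
qed

lemma mfact_pos: "0 < mfact k"
  by (simp add: mfact_def prod_pos)

lemma mfact_ge_1: "1 \<le> mfact k"
  by (simp add: mfact_def prod_ge_1)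

section \<open>Bumps on the scaled grid\<close>

definition tents :: "('d::finite \<Rightarrow> nat) \<Rightarrow> real^'d \<Rightarrow> real" where
  "tents k u = (\<Prod>i\<in>UNIV. tent (k i) (u $ i))"

definition cell_coord :: "('d::finite \<Rightarrow> nat) \<Rightarrow> real \<Rightarrow> int^'d \<Rightarrow> real^'d \<Rightarrow> real^'d" where
  "cell_coord s \<delta> z x = (\<chi> i. x $ i / \<delta> ^ s i - real_of_int (z $ i))"

text \<open>All multi-indices are treated together: member k is the k-th derivative of the bump of
  cell z. The division by \<open>\<delta> ^ sc_deg s k\<close> is the chain rule for the dilation in
  \<open>cell_coord\<close>.\<close>

definition cell_bump :: "('d::finite \<Rightarrow> nat) \<Rightarrow> real \<Rightarrow> int^'d \<Rightarrow> ('d \<Rightarrow> nat) \<Rightarrow> real^'d \<Rightarrow> real" where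
  "cell_bump s \<delta> z k x = tents k (cell_coord s \<delta> z x) / \<delta> ^ sc_deg s k"

lemma tents_outside: "1 \<le> \<bar>u $ i\<bar> \<Longrightarrow> tents k u = 0"
  unfolding tents_def using tent_outside by (intro prod_zero) auto

lemma cell_bump_has_derivative:
  "(cell_bump s \<delta> z k has_derivative
     (\<lambda>y. (\<Sum>i\<in>UNIV. y $ i / \<delta> ^ s i * tent (Suc (k i)) (cell_coord s \<delta> z x $ i) *
        (\<Prod>j\<in>UNIV - {i}. tent (k j) (cell_coord s \<delta> z x $ j))) / \<delta> ^ sc_deg s k)) (at x)"
proof -
  have "((\<lambda>x. tent (k i) (x $ i / \<delta> ^ s i - real_of_int (z $ i))) has_derivative
      (\<lambda>y. y $ i / \<delta> ^ s i * tent (Suc (k i)) (cell_coord s \<delta> z x $ i))) (at x)" for i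
  proof -
    have "((\<lambda>x. x $ i / \<delta> ^ s i - real_of_int (z $ i)) has_derivative (\<lambda>y. y $ i / \<delta> ^ s i)) (at x)"
      by (auto intro!: derivative_eq_intros bounded_linear_imp_has_derivative
          bounded_linear_vec_nth simp: divide_inverse)
    from DERIV_compose_FDERIV[OF tent_derivative this] show ?thesis
      by (simp add: cell_coord_def)
  qed
  then have "((\<lambda>x. \<Prod>i\<in>UNIV. tent (k i) (x $ i / \<delta> ^ s i - real_of_int (z $ i))) has_derivative
      (\<lambda>y. \<Sum>i\<in>UNIV. y $ i / \<delta> ^ s i * tent (Suc (k i)) (cell_coord s \<delta> z x $ i) *
        (\<Prod>j\<in>UNIV - {i}. tent (k j) (x $ j / \<delta> ^ s j - real_of_int (z $ j))))) (at x)"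
    by (rule has_derivative_prod)
  from has_derivative_mult_right[OF this, of "inverse (\<delta> ^ sc_deg s k)"]
  show ?thesis
    by (simp add: cell_bump_def[abs_def] tents_def cell_coord_def divide_inverse mult.commute)
qed

lemma sc_deg_Suc: "sc_deg s (k(i := Suc (k i))) = sc_deg s k + s i"
proof -
  have "sc_deg s (k(i := Suc (k i))) = (\<Sum>j\<in>UNIV. s j * k j + (if j = i then s i else 0))"
    unfolding sc_deg_def by (intro sum.cong) auto
  then show ?thesis
    by (simp add: sum.distrib sc_deg_def)
qed

lemma partial_cell_bump:
  "partial i (cell_bump s \<delta> z k) = cell_bump s \<delta> z (k(i := Suc (k i)))"
proof
  fix x
  let ?u = "cell_coord s \<delta> z x"
  have "partial i (cell_bump s \<delta> z k) x =
      (\<Sum>j\<in>UNIV. axis i 1 $ j / \<delta> ^ s j * tent (Suc (k j)) (?u $ j) *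
        (\<Prod>l\<in>UNIV - {j}. tent (k l) (?u $ l))) / \<delta> ^ sc_deg s k"
    unfolding partial_def frechet_derivative_at[OF cell_bump_has_derivative, symmetric] ..
  also have "(\<Sum>j\<in>UNIV. axis i 1 $ j / \<delta> ^ s j * tent (Suc (k j)) (?u $ j) *
        (\<Prod>l\<in>UNIV - {j}. tent (k l) (?u $ l))) =
      (\<Sum>j\<in>UNIV. if j = i then 1 / \<delta> ^ s i * tent (Suc (k i)) (?u $ i) *
        (\<Prod>l\<in>UNIV - {i}. tent (k l) (?u $ l)) else 0)"
    by (intro sum.cong) (auto simp: axis_def)
  also have "\<dots> = 1 / \<delta> ^ s i * (tent (Suc (k i)) (?u $ i) * (\<Prod>l\<in>UNIV - {i}. tent (k l) (?u $ l)))"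
    by simp
  also have "tent (Suc (k i)) (?u $ i) * (\<Prod>l\<in>UNIV - {i}. tent (k l) (?u $ l)) =
      tents (k(i := Suc (k i))) ?u"
    unfolding tents_def by (subst (2) prod.remove[of _ i]) auto
  finally show "partial i (cell_bump s \<delta> z k) x = cell_bump s \<delta> z (k(i := Suc (k i))) x"
    by (simp add: cell_bump_def[of _ _ _ "k(i := Suc (k i))"] sc_deg_Suc power_add mult.commute)
qed

lemma cell_bump_differentiable: "cell_bump s \<delta> z k differentiable (at x)"
  using cell_bump_has_derivative differentiableI by blast

lemma continuous_cell_bump: "continuous_on A (cell_bump s \<delta> z k)"
  by (intro continuous_at_imp_continuous_on ballI differentiable_imp_continuous_within
      cell_bump_differentiable)

lemma C_class_cell_bump: "C_class n (cell_bump s \<delta> z k)"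
  by (induction n arbitrary: k)
    (auto simp: continuous_cell_bump cell_bump_differentiable partial_cell_bump)

lemma foldr_partial_cell_bump:
  "foldr partial ds (cell_bump s \<delta> z k) = cell_bump s \<delta> z (\<lambda>i. k i + count_list ds i)"
proof (induction ds)
  case (Cons d ds)
  have "(\<lambda>i. k i + count_list ds i)(d := Suc (k d + count_list ds d)) =
      (\<lambda>i. k i + count_list (d # ds) i)"
    by auto
  then show ?case
    by (simp add: Cons partial_cell_bump del: count_list.simps)
qed simp

text \<open>Makes the choice in \<open>mderiv\<close> meaningful. Which list is chosen does not
  matter, as \<open>foldr_partial_cell_bump\<close> sees only its counts.\<close>

lemma exists_list_with_counts:
  fixes k :: "'d::finite \<Rightarrow> nat"
  shows "\<exists>ds. \<forall>i. count_list ds i = k i"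
proof -
  have "\<exists>xs. mset xs = (\<Sum>i\<in>UNIV. replicate_mset (k i) i)"
    by (rule ex_mset)
  then obtain ds where ds: "mset ds = (\<Sum>i\<in>UNIV. replicate_mset (k i) i)" ..
  have "count_list ds i = k i" for i
  proof -
    have "count_list ds i = count (mset ds) i"
      by (simp add: count_mset)
    also have "\<dots> = (\<Sum>j\<in>UNIV. if j = i then k i else 0)"
      unfolding ds count_sum by (intro sum.cong) auto
    finally show ?thesis by simp
  qed
  then show ?thesis by blast
qed

lemma mderiv_cell_bump: "mderiv k (cell_bump s \<delta> z (\<lambda>_. 0)) = cell_bump s \<delta> z k"
  unfolding mderiv_def foldr_partial_cell_bump
  using someI_ex[OF exists_list_with_counts[of k]] by simp

lemma cell_bump_nonzero_imp:
  assumes "cell_bump s \<delta> z k x \<noteq> 0"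
  shows "\<bar>cell_coord s \<delta> z x $ i\<bar> < 1"
  using assms tents_outside[of "cell_coord s \<delta> z x" i k] by (force simp: cell_bump_def)

lemma test_fun_cell_bump:
  assumes "0 < \<delta>"
  shows "test_fun (cell_bump s \<delta> z (\<lambda>_. 0))"
proof -
  let ?a = "\<chi> i. \<delta> ^ s i * (real_of_int (z $ i) - 1)"
  let ?b = "\<chi> i. \<delta> ^ s i * (real_of_int (z $ i) + 1)"
  have "{x. cell_bump s \<delta> z (\<lambda>_. 0) x \<noteq> 0} \<subseteq> cbox ?a ?b"
  proof
    fix x assume "x \<in> {x. cell_bump s \<delta> z (\<lambda>_. 0) x \<noteq> 0}"
    then have "\<bar>x $ i / \<delta> ^ s i - real_of_int (z $ i)\<bar> < 1" for i
      using cell_bump_nonzero_imp[of s \<delta> z _ x i] by (simp add: cell_coord_def)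
    then have "real_of_int (z $ i) - 1 \<le> x $ i / \<delta> ^ s i \<and> x $ i / \<delta> ^ s i \<le> real_of_int (z $ i) + 1" for i
      by (smt (verit))
    then show "x \<in> cbox ?a ?b"
      using assms by (simp add: mem_box_cart le_divide_eq divide_le_eq mult.commute)
  qed
  then have "fun_supp (cell_bump s \<delta> z (\<lambda>_. 0)) \<subseteq> cbox ?a ?b"
    unfolding fun_supp_def by (intro closure_minimal closed_cbox)
  then have "compact (fun_supp (cell_bump s \<delta> z (\<lambda>_. 0)))"
    unfolding fun_supp_def using bounded_subset[OF bounded_cbox] compact_eq_bounded_closed by blast
  then show ?thesis
    by (simp add: test_fun_def smooth_fun_def C_class_cell_bump)
qed

lemma tent_bounded_upto: "\<exists>B\<ge>1. \<forall>n\<le>N. \<forall>t. \<bar>tent n t\<bar> \<le> B"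
proof (induction N)
  case 0
  obtain B where "B > 0" "\<forall>t. \<bar>tent 0 t\<bar> \<le> B" using tent_bounded by blast
  then show ?case by (intro exI[of _ "max B 1"]) (auto simp: le_max_iff_disj)
next
  case (Suc N)
  then obtain B where B: "B \<ge> 1" "\<forall>n\<le>N. \<forall>t. \<bar>tent n t\<bar> \<le> B" by blast
  obtain B' where B': "B' > 0" "\<forall>t. \<bar>tent (Suc N) t\<bar> \<le> B'" using tent_bounded by blast
  show ?case using B B'
    by (intro exI[of _ "max B B'"]) (auto simp: le_max_iff_disj le_Suc_eq)
qed

lemma tents_le:
  fixes k :: "'d::finite \<Rightarrow> nat"
  assumes "\<And>i t. \<bar>tent (k i) t\<bar> \<le> B"
  shows "\<bar>tents k u\<bar> \<le> B ^ CARD('d)"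
proof -
  have "\<bar>tents k u\<bar> = (\<Prod>i\<in>UNIV. \<bar>tent (k i) (u $ i)\<bar>)"
    by (simp add: tents_def abs_prod)
  also have "\<dots> \<le> (\<Prod>i\<in>(UNIV :: 'd set). B)"
    using assms by (intro prod_mono) auto
  finally show ?thesis by simp
qed

text \<open>Distributivity, moved from functions to vectors. It reduces lattice sums of tensor
  products to sums in one coordinate.\<close>

lemma sum_prod_vec:
  fixes A :: "'d::finite \<Rightarrow> 'a set" and f :: "'d \<Rightarrow> 'a \<Rightarrow> 'b::comm_semiring_1"
  assumes "\<And>i. finite (A i)"
  shows "(\<Sum>z | \<forall>i. z $ i \<in> A i. \<Prod>i\<in>UNIV. f i (z $ i)) = (\<Prod>i\<in>UNIV. \<Sum>m\<in>A i. f i m)"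
proof -
  have bij: "bij_betw vec_lambda (PiE UNIV A) {z. \<forall>i. z $ i \<in> A i}"
    by (rule bij_betwI[where g = vec_nth]) (auto simp: PiE_UNIV_domain)
  have "(\<Prod>i\<in>UNIV. \<Sum>m\<in>A i. f i m) = (\<Sum>g\<in>PiE UNIV A. \<Prod>i\<in>UNIV. f i (g i))"
    using assms by (intro prod_sum_PiE) auto
  also have "\<dots> = (\<Sum>z | \<forall>i. z $ i \<in> A i. \<Prod>i\<in>UNIV. f i (z $ i))"
    by (subst sum.reindex_bij_betw[OF bij, symmetric]) simp
  finally show ?thesis ..
qed

lemma finite_vec_box:
  fixes A :: "'d::finite \<Rightarrow> 'a set"
  assumes "\<And>i. finite (A i)"
  shows "finite {z. \<forall>i. z $ i \<in> A i}"
proof -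
  have bij: "bij_betw vec_lambda (PiE UNIV A) {z. \<forall>i. z $ i \<in> A i}"
    by (rule bij_betwI[where g = vec_nth]) (auto simp: PiE_UNIV_domain)
  show ?thesis
    using assms bij_betw_finite[OF bij] by (simp add: finite_PiE)
qed

lemma card_vec_box:
  fixes A :: "'d::finite \<Rightarrow> 'a set"
  assumes "\<And>i. finite (A i)"
  shows "card {z. \<forall>i. z $ i \<in> A i} = (\<Prod>i\<in>UNIV. card (A i))"
  using sum_prod_vec[OF assms, where f = "\<lambda>_ _. 1 :: nat"] by simp

text \<open>The bump of cell z lives where the coordinates are below 1. The bound 2 leaves room for
  a shift by a vector of scaled length at most \<delta>, so that a single index set serves x and x +
  h (\<open>near_cells_shift\<close>).\<close>

definition near_cells :: "('d::finite \<Rightarrow> nat) \<Rightarrow> real \<Rightarrow> real^'d \<Rightarrow> (int^'d) set" where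
  "near_cells s \<delta> x = {z. \<forall>i. \<bar>cell_coord s \<delta> z x $ i\<bar> \<le> 2}"

lemma near_cells_subset:
  "near_cells s \<delta> x \<subseteq> {z. \<forall>i. z $ i \<in> {\<lfloor>x $ i / \<delta> ^ s i\<rfloor> - 2..\<lfloor>x $ i / \<delta> ^ s i\<rfloor> + 2}}"
proof
  fix z assume z: "z \<in> near_cells s \<delta> x"
  have "\<lfloor>x $ i / \<delta> ^ s i\<rfloor> - 2 \<le> z $ i \<and> z $ i \<le> \<lfloor>x $ i / \<delta> ^ s i\<rfloor> + 2" for i
  proof -
    have "\<bar>x $ i / \<delta> ^ s i - real_of_int (z $ i)\<bar> \<le> 2"
      using z by (simp add: near_cells_def cell_coord_def)
    then show ?thesis by linarith
  qed
  then show "z \<in> {z. \<forall>i. z $ i \<in> {\<lfloor>x $ i / \<delta> ^ s i\<rfloor> - 2..\<lfloor>x $ i / \<delta> ^ s i\<rfloor> + 2}}"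
    by simp
qed

lemma finite_near_cells: "finite (near_cells s \<delta> x)"
  by (rule finite_subset[OF near_cells_subset]) (intro finite_vec_box, simp)

lemma card_near_cells:
  fixes x :: "real^'d::finite"
  shows "card (near_cells s \<delta> x) \<le> 5 ^ CARD('d)"
proof -
  have "card (near_cells s \<delta> x) \<le>
      card {z::int^'d. \<forall>i. z $ i \<in> {\<lfloor>x $ i / \<delta> ^ s i\<rfloor> - 2..\<lfloor>x $ i / \<delta> ^ s i\<rfloor> + 2}}"
    by (intro card_mono near_cells_subset finite_vec_box) simp
  \<comment> \<open>Five integers in each coordinate: the floor and two on either side.\<close>
  also have "\<dots> = 5 ^ CARD('d)"
    by (subst card_vec_box) simp_all
  finally show ?thesis .
qed

text \<open>Z is arbitrary as long as it contains the active cells; the sums at two nearby points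
  can then run over the same set.\<close>

lemma sum_tents:
  assumes Z: "finite Z" "\<And>z. (\<forall>i. \<bar>cell_coord s \<delta> z x $ i\<bar> < 1) \<Longrightarrow> z \<in> Z"
  shows "(\<Sum>z\<in>Z. tents k (cell_coord s \<delta> z x)) = (if k = (\<lambda>_. 0) then 1 else 0)"
proof -
  \<comment> \<open>\<open>sum_tent\<close> needs a margin of 1 on both sides of t; with the floor
    in place of t the margins become 1 below and 2 above.\<close>
  define A where "A i = {\<lfloor>x $ i / \<delta> ^ s i\<rfloor> - 1..\<lfloor>x $ i / \<delta> ^ s i\<rfloor> + 2}" for i
  let ?B = "{z. \<forall>i. z $ i \<in> A i}"
  have finB: "finite ?B" by (intro finite_vec_box) (simp add: A_def)
  have inB: "z \<in> ?B" if "\<forall>i. \<bar>cell_coord s \<delta> z x $ i\<bar> < 1" for z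
  proof -
    have "z $ i \<in> A i" for i
    proof -
      have "\<bar>x $ i / \<delta> ^ s i - real_of_int (z $ i)\<bar> < 1"
        using that by (simp add: cell_coord_def)
      then show ?thesis unfolding A_def by simp linarith
    qed
    then show ?thesis by simp
  qed
  have out: "tents k (cell_coord s \<delta> z x) = 0" if "\<not> (\<forall>i. \<bar>cell_coord s \<delta> z x $ i\<bar> < 1)" for z
    using that tents_outside by (auto simp: not_less)
  have "(\<Sum>z\<in>Z. tents k (cell_coord s \<delta> z x)) = (\<Sum>z\<in>Z \<inter> ?B. tents k (cell_coord s \<delta> z x))"
    using Z inB out by (intro sum.mono_neutral_right) auto
  also have "\<dots> = (\<Sum>z\<in>?B. tents k (cell_coord s \<delta> z x))"
    using Z(2) finB out by (intro sum.mono_neutral_left) auto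
  also have "\<dots> = (\<Prod>i\<in>UNIV. \<Sum>m\<in>A i. tent (k i) (x $ i / \<delta> ^ s i - real_of_int m))"
    unfolding tents_def cell_coord_def by (simp add: A_def sum_prod_vec[symmetric])
  also have "\<dots> = (\<Prod>i\<in>UNIV. if k i = 0 then 1 else 0)"
    unfolding A_def by (intro prod.cong sum_tent refl) (simp; linarith)+
  also have "\<dots> = (if k = (\<lambda>_. 0) then 1 else 0)"
    by (auto simp: fun_eq_iff)
  finally show ?thesis .
qed

section \<open>Taylor expansion by scaled degree\<close>

lemma tent_Taylor:
  assumes "\<And>t. \<bar>tent (n + N) t\<bar> \<le> B"
  shows "\<bar>tent n (a + b) - (\<Sum>m<N. tent (n + m) a * b ^ m / fact m)\<bar> \<le> B * \<bar>b\<bar> ^ N"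
proof -
  define D where "D m t = tent (n + m) (a + t)" for m t
  have "\<forall>m t. (D m has_real_derivative D (Suc m) t) (at t)"
  proof (intro allI)
    fix m t
    have "((\<lambda>t. a + t) has_real_derivative 1) (at t)" by (auto intro!: derivative_eq_intros)
    from DERIV_chain2[where f = "tent (n + m)", OF tent_derivative this]
    show "(D m has_real_derivative D (Suc m) t) (at t)"
      by (simp add: D_def[abs_def])
  qed
  then obtain t where "D 0 b = (\<Sum>m<N. D m 0 / fact m * b ^ m) + D N t / fact N * b ^ N"
    using Maclaurin_all_le[of D "D 0" b N] by auto
  then have "tent n (a + b) - (\<Sum>m<N. tent (n + m) a * b ^ m / fact m) = tent (n + N) (a + t) / fact N * b ^ N"
    by (simp add: D_def)
  also have "\<bar>\<dots>\<bar> = \<bar>tent (n + N) (a + t)\<bar> / fact N * \<bar>b\<bar> ^ N"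
    by (simp add: abs_mult power_abs)
  also have "\<dots> \<le> B / 1 * \<bar>b\<bar> ^ N"
  proof (intro mult_right_mono frac_le)
    show "0 \<le> B" using assms[of 0] by (rule order_trans[OF abs_ge_zero])
  qed (use assms fact_ge_1 in auto)
  finally show ?thesis by simp
qed

text \<open>The factors are divided by M because the telescoping bound \<open>norm_prod_diff\<close>
  is for factors of norm at most 1.\<close>

lemma abs_prod_diff_le:
  fixes f g :: "'a \<Rightarrow> real"
  assumes "finite I" "0 < M" "\<And>i. i \<in> I \<Longrightarrow> \<bar>f i\<bar> \<le> M" "\<And>i. i \<in> I \<Longrightarrow> \<bar>g i\<bar> \<le> M"
  shows "\<bar>prod f I - prod g I\<bar> \<le> M ^ card I * (\<Sum>i\<in>I. \<bar>f i - g i\<bar>) / M"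
proof -
  have "norm ((\<Prod>i\<in>I. f i / M) - (\<Prod>i\<in>I. g i / M)) \<le> (\<Sum>i\<in>I. norm (f i / M - g i / M))"
    using assms by (intro norm_prod_diff) (auto simp: divide_le_eq)
  also have "(\<Prod>i\<in>I. f i / M) - (\<Prod>i\<in>I. g i / M) = (prod f I - prod g I) / M ^ card I"
    by (simp add: prod_dividef diff_divide_distrib)
  also have "(\<Sum>i\<in>I. norm (f i / M - g i / M)) = (\<Sum>i\<in>I. \<bar>f i - g i\<bar>) / M"
    using assms(2) by (simp add: sum_divide_distrib diff_divide_distrib[symmetric] abs_divide)
  finally show ?thesis
    using assms(2) by (simp add: abs_divide divide_le_eq mult.commute)
qed

text \<open>In each coordinate N Taylor terms are kept. The product of these polynomials runs over a
  whole box of exponents; the monomials whose scaled degree together with that of k reaches N are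
  moved to the remainder, where \<open>sc_norm s v \<le> 1\<close> lets them be bounded by the
  stated power.\<close>

lemma tents_Taylor:
  fixes s :: "'d::finite \<Rightarrow> nat"
  assumes s: "\<forall>i. 1 \<le> s i"
  shows "\<exists>C\<ge>0. \<forall>k u v. sc_deg s k < N \<longrightarrow> sc_norm s v \<le> 1 \<longrightarrow>
    \<bar>tents k (u + v) - (\<Sum>l | sc_deg s (\<lambda>i. k i + l i) < N. tents (\<lambda>i. k i + l i) u * mpow v l / mfact l)\<bar>
      \<le> C * sc_norm s v ^ (N - sc_deg s k)"
proof -
  \<comment> \<open>Orders \<open>k i + l i\<close> with both summands below N occur, and
    \<open>k i + N\<close> in the remainder.\<close>
  obtain B where B: "B \<ge> 1" "\<And>n t. n \<le> 2 * N \<Longrightarrow> \<bar>tent n t\<bar> \<le> B"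
    using tent_bounded_upto[of "2 * N"] by blast
  \<comment> \<open>M bounds a coordinate factor as well as its Taylor polynomial, a sum of N terms
    of size B; \<open>Suc\<close> keeps M positive and at least B.\<close>
  define M where "M = real (Suc N) * B"
  have M: "0 < M" "B \<le> M" using B(1) by (simp_all add: M_def)
  let ?box = "{l::'d \<Rightarrow> nat. \<forall>i. l i < N}"
  define C where "C = M ^ CARD('d) * (real CARD('d) * B) / M + real (card ?box) * B ^ CARD('d)"
  have C0: "0 \<le> C" using B M by (simp add: C_def)
  show ?thesis
  proof (intro exI[of _ C] conjI allI impI C0)
    fix k :: "'d \<Rightarrow> nat" and u v :: "real^'d"
    assume k: "sc_deg s k < N" and v: "sc_norm s v \<le> 1"
    let ?r = "sc_norm s v ^ (N - sc_deg s k)"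
    let ?K = "{l. sc_deg s (\<lambda>i. k i + l i) < N}"
    have kN: "k i < N" for i
      using k component_le_sc_deg[OF s, of k i] by simp
    have vle: "\<bar>v $ i\<bar> \<le> sc_norm s v" for i
    proof -
      have "\<bar>v $ i\<bar> \<le> sc_norm s v ^ s i" by (rule component_le_sc_norm[OF s])
      also have "\<dots> \<le> sc_norm s v ^ 1"
        using s v by (intro power_decreasing) (auto simp: sc_norm_nonneg)
      finally show ?thesis by simp
    qed
    have v1: "\<bar>v $ i\<bar> \<le> 1" for i using vle[of i] v by simp
    define p where "p i = (\<Sum>m<N. tent (k i + m) (u $ i) * (v $ i) ^ m / fact m)" for i
    have rem: "\<bar>tent (k i) (u $ i + v $ i) - p i\<bar> \<le> B * ?r" for i
    proof -
      have "\<bar>tent (k i) (u $ i + v $ i) - p i\<bar> \<le> B * \<bar>v $ i\<bar> ^ N"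
        unfolding p_def using kN[of i] by (intro tent_Taylor B) simp
      also have "\<dots> \<le> B * sc_norm s v ^ N"
        using B vle[of i] by (intro mult_left_mono power_mono) auto
      also have "\<dots> \<le> B * ?r"
        using B v by (intro mult_left_mono power_decreasing) (auto simp: sc_norm_nonneg)
      finally show ?thesis .
    qed
    have pM: "\<bar>p i\<bar> \<le> M" for i
    proof -
      have "\<bar>p i\<bar> \<le> (\<Sum>m<N. B)"
        unfolding p_def
      proof (rule order_trans[OF sum_abs sum_mono])
        fix m assume "m \<in> {..<N}"
        then have "\<bar>tent (k i + m) (u $ i)\<bar> \<le> B" using kN[of i] by (intro B) simp
        moreover have "\<bar>v $ i\<bar> ^ m / fact m \<le> 1"
          using v1[of i] fact_ge_1[of m, where 'a = real] power_le_one[of "\<bar>v $ i\<bar>" m]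
          by (simp add: divide_le_eq del: fact_ge_1)
        ultimately have "\<bar>tent (k i + m) (u $ i)\<bar> * (\<bar>v $ i\<bar> ^ m / fact m) \<le> B * 1"
          using B(1) by (intro mult_mono) auto
        then show "\<bar>tent (k i + m) (u $ i) * (v $ i) ^ m / fact m\<bar> \<le> B"
          by (simp add: abs_mult power_abs)
      qed
      also have "\<dots> \<le> M" using B(1) by (simp add: M_def)
      finally show ?thesis .
    qed
    have tM: "\<bar>tent (k i) t\<bar> \<le> M" for i t
      using B(2)[of "k i" t] kN[of i] M(2) by simp
    have "\<bar>tents k (u + v) - prod p UNIV\<bar> \<le>
        M ^ CARD('d) * (\<Sum>i\<in>UNIV. \<bar>tent (k i) ((u + v) $ i) - p i\<bar>) / M"
      unfolding tents_def using M pM tM by (intro abs_prod_diff_le) auto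
    also have "\<dots> \<le> M ^ CARD('d) * (\<Sum>i\<in>(UNIV :: 'd set). B * ?r) / M"
      using M rem by (intro divide_right_mono mult_left_mono sum_mono) auto
    finally have 1: "\<bar>tents k (u + v) - prod p UNIV\<bar> \<le> M ^ CARD('d) * (real CARD('d) * B) / M * ?r"
      by simp
    have box: "?box = PiE UNIV (\<lambda>_. {..<N})"
      by (auto simp: PiE_UNIV_domain Pi_iff)
    have "prod p UNIV = (\<Sum>l\<in>?box. \<Prod>i\<in>UNIV. tent (k i + l i) (u $ i) * (v $ i) ^ l i / fact (l i))"
      unfolding p_def box by (intro prod_sum_PiE) auto
    also have "\<dots> = (\<Sum>l\<in>?box. tents (\<lambda>i. k i + l i) u * mpow v l / mfact l)"
      by (simp add: tents_def mpow_def mfact_def prod.distrib prod_dividef)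
    finally have p: "prod p UNIV = (\<Sum>l\<in>?box. tents (\<lambda>i. k i + l i) u * mpow v l / mfact l)" .
    have sub: "?K \<subseteq> ?box"
    proof
      fix l assume "l \<in> ?K"
      then have "l \<in> {l. sc_deg s l < N}"
        using sc_deg_add[of s k l] by simp
      then show "l \<in> ?box" using sc_deg_less_subset[OF s] by blast
    qed
    have diff: "prod p UNIV - (\<Sum>l\<in>?K. tents (\<lambda>i. k i + l i) u * mpow v l / mfact l) =
        (\<Sum>l\<in>?box - ?K. tents (\<lambda>i. k i + l i) u * mpow v l / mfact l)"
      unfolding p by (rule sum_diff[OF finite_bounded_multiindex sub, symmetric])
    have "\<bar>\<Sum>l\<in>?box - ?K. tents (\<lambda>i. k i + l i) u * mpow v l / mfact l\<bar>
        \<le> (\<Sum>l\<in>?box - ?K. B ^ CARD('d) * ?r)"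
    proof (rule order_trans[OF sum_abs sum_mono])
      fix l assume l: "l \<in> ?box - ?K"
      have "\<bar>tents (\<lambda>i. k i + l i) u\<bar> \<le> B ^ CARD('d)"
      proof (rule tents_le)
        fix i t
        have "l i < N" using l by simp
        then show "\<bar>tent (k i + l i) t\<bar> \<le> B" using kN[of i] by (intro B) simp
      qed
      moreover have "\<bar>mpow v l\<bar> \<le> ?r"
      proof -
        have "N \<le> sc_deg s k + sc_deg s l" using l sc_deg_add[of s k l] by (simp add: not_less)
        then have "N - sc_deg s k \<le> sc_deg s l" by simp
        then have "sc_norm s v ^ sc_deg s l \<le> ?r"
          using v by (intro power_decreasing) (auto simp: sc_norm_nonneg)
        with mpow_le_sc_norm[OF s, of v l] show ?thesis by simp
      qed
      ultimately have le: "\<bar>tents (\<lambda>i. k i + l i) u\<bar> * \<bar>mpow v l\<bar> \<le> B ^ CARD('d) * ?r"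
        using B(1) by (intro mult_mono) simp_all
      have "\<bar>tents (\<lambda>i. k i + l i) u * mpow v l / mfact l\<bar> =
          \<bar>tents (\<lambda>i. k i + l i) u\<bar> * \<bar>mpow v l\<bar> / mfact l"
        using mfact_pos[of l] by (simp add: abs_mult abs_divide)
      also have "\<dots> \<le> (\<bar>tents (\<lambda>i. k i + l i) u\<bar> * \<bar>mpow v l\<bar>) / 1"
        by (intro divide_left_mono mfact_ge_1) (use mfact_pos[of l] in auto)
      finally show "\<bar>tents (\<lambda>i. k i + l i) u * mpow v l / mfact l\<bar> \<le> B ^ CARD('d) * ?r"
        using le by simp
    qed
    also have "\<dots> = real (card (?box - ?K)) * (B ^ CARD('d) * ?r)"
      by (rule sum_constant)
    also have "\<dots> \<le> real (card ?box) * (B ^ CARD('d) * ?r)"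
    proof (rule mult_right_mono)
      show "real (card (?box - ?K)) \<le> real (card ?box)"
        by (intro of_nat_mono card_mono finite_bounded_multiindex Diff_subset)
      show "0 \<le> B ^ CARD('d) * ?r" using B(1) by (simp add: sc_norm_nonneg)
    qed
    finally have 2: "\<bar>prod p UNIV - (\<Sum>l\<in>?K. tents (\<lambda>i. k i + l i) u * mpow v l / mfact l)\<bar>
        \<le> real (card ?box) * (B ^ CARD('d) * ?r)"
      unfolding diff .
    show "\<bar>tents k (u + v) - (\<Sum>l\<in>?K. tents (\<lambda>i. k i + l i) u * mpow v l / mfact l)\<bar> \<le> C * ?r"
    proof -
      have "\<bar>a - c\<bar> \<le> C * ?r" if "\<bar>a - b\<bar> \<le> M ^ CARD('d) * (real CARD('d) * B) / M * ?r"
        "\<bar>b - c\<bar> \<le> real (card ?box) * (B ^ CARD('d) * ?r)" for a b c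
      proof -
        have "C * ?r = M ^ CARD('d) * (real CARD('d) * B) / M * ?r + real (card ?box) * (B ^ CARD('d) * ?r)"
          unfolding C_def by (simp only: distrib_right mult.assoc)
        then show ?thesis using abs_triangle_ineq[of "a - b" "b - c"] that by simp
      qed
      from this[OF 1 2] show ?thesis .
    qed
  qed
qed

lemma mpow_dilate:
  assumes "\<And>i. y $ i = c ^ s i * x $ i"
  shows "mpow y l = c ^ sc_deg s l * mpow x l"
  using assms by (simp add: mpow_def sc_deg_def power_sum power_mult power_mult_distrib prod.distrib)

text \<open>\<open>tents_Taylor\<close> in the coordinates of the cell: h measured in units of the
  mesh has scaled norm \<open>sc_norm s h / \<delta>\<close>. The constant depends neither on
  \<delta> nor on z.\<close>

lemma cell_bump_Taylor:
  fixes s :: "'d::finite \<Rightarrow> nat"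
  assumes s: "\<forall>i. 1 \<le> s i"
  shows "\<exists>C\<ge>0. \<forall>\<delta> z k x h. 0 < \<delta> \<longrightarrow> sc_deg s k < N \<longrightarrow> sc_norm s h \<le> \<delta> \<longrightarrow>
    \<bar>cell_bump s \<delta> z k (x + h) - (\<Sum>l | sc_deg s (\<lambda>i. k i + l i) < N.
        cell_bump s \<delta> z (\<lambda>i. k i + l i) x * mpow h l / mfact l)\<bar>
      \<le> C * (sc_norm s h / \<delta>) ^ (N - sc_deg s k) / \<delta> ^ sc_deg s k"
proof -
  obtain C where C: "C \<ge> 0" "\<And>k u v. sc_deg s k < N \<Longrightarrow> sc_norm s v \<le> 1 \<Longrightarrow>
    \<bar>tents k (u + v) - (\<Sum>l | sc_deg s (\<lambda>i. k i + l i) < N. tents (\<lambda>i. k i + l i) u * mpow v l / mfact l)\<bar>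
      \<le> C * sc_norm s v ^ (N - sc_deg s k)"
    using tents_Taylor[OF s, of N] by blast
  show ?thesis
  proof (intro exI[of _ C] conjI allI impI C(1))
    fix \<delta> z k x h
    assume \<delta>: "0 < (\<delta>::real)" and k: "sc_deg s k < N" and h: "sc_norm s h \<le> \<delta>"
    define v :: "real^'d" where "v = (\<chi> i. h $ i / \<delta> ^ s i)"
    let ?u = "cell_coord s \<delta> z x"
    have v: "h $ i = \<delta> ^ s i * v $ i" for i using \<delta> by (simp add: v_def)
    have nv: "sc_norm s v = sc_norm s h / \<delta>"
      using sc_norm_dilate[of s \<delta> h v] s \<delta> v by simp
    have uv: "cell_coord s \<delta> z (x + h) = ?u + v"
      by (simp add: vec_eq_iff cell_coord_def v_def add_divide_distrib)
    have "(\<Sum>l | sc_deg s (\<lambda>i. k i + l i) < N. cell_bump s \<delta> z (\<lambda>i. k i + l i) x * mpow h l / mfact l)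
      = (\<Sum>l | sc_deg s (\<lambda>i. k i + l i) < N. tents (\<lambda>i. k i + l i) ?u * mpow v l / mfact l) / \<delta> ^ sc_deg s k"
      using \<delta> unfolding sum_divide_distrib
      by (intro sum.cong) (simp_all add: cell_bump_def mpow_dilate[OF v] sc_deg_add power_add)
    then have "\<bar>cell_bump s \<delta> z k (x + h) - (\<Sum>l | sc_deg s (\<lambda>i. k i + l i) < N.
        cell_bump s \<delta> z (\<lambda>i. k i + l i) x * mpow h l / mfact l)\<bar> =
        \<bar>tents k (?u + v) - (\<Sum>l | sc_deg s (\<lambda>i. k i + l i) < N.
          tents (\<lambda>i. k i + l i) ?u * mpow v l / mfact l)\<bar> / \<delta> ^ sc_deg s k"
      using \<delta> by (simp add: cell_bump_def uv diff_divide_distrib[symmetric] abs_divide)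
    also have "\<dots> \<le> C * sc_norm s v ^ (N - sc_deg s k) / \<delta> ^ sc_deg s k"
      using h \<delta> nv by (intro divide_right_mono C k) (auto simp: divide_le_eq)
    finally show "\<bar>cell_bump s \<delta> z k (x + h) - (\<Sum>l | sc_deg s (\<lambda>i. k i + l i) < N.
        cell_bump s \<delta> z (\<lambda>i. k i + l i) x * mpow h l / mfact l)\<bar>
      \<le> C * (sc_norm s h / \<delta>) ^ (N - sc_deg s k) / \<delta> ^ sc_deg s k"
      by (simp add: nv)
  qed
qed

section \<open>Powers, Lebesgue norms and scaled integrals\<close>

lemma epowr_ennreal: "0 \<le> a \<Longrightarrow> epowr (ennreal a) t = ennreal (a powr t)"
  by (simp add: epowr_def)

lemma epowr_top [simp]: "epowr top t = top"
  by (simp add: epowr_def)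

lemma epowr_0 [simp]: "epowr 0 t = 0"
  by (simp add: epowr_def)

lemma epowr_mono:
  assumes "a \<le> b" "0 \<le> t"
  shows "epowr a t \<le> epowr b t"
proof (cases b)
  case (real y)
  with assms obtain x where "a = ennreal x" "0 \<le> x" "x \<le> y"
    by (cases a) (auto simp: top_unique)
  with real assms show ?thesis
    by (auto simp: epowr_ennreal intro!: ennreal_leI powr_mono2)
qed (use epowr_top in simp)

lemma epowr_mult:
  assumes "0 < t"
  shows "epowr (a * b) t = epowr a t * epowr b t"
proof -
  have top: "epowr (top * c) t = top * epowr c t" for c
    using assms by (cases c) (auto simp: ennreal_top_mult epowr_def)
  show ?thesis
  proof (cases a; cases b)
    fix x y assume "0 \<le> x" "a = ennreal x" "0 \<le> y" "b = ennreal y"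
    then show ?thesis
      by (simp add: epowr_ennreal powr_mult flip: ennreal_mult')
  qed (use top[of a] top[of b] in \<open>auto simp: mult.commute\<close>)
qed

lemma epowr_inverse:
  assumes "0 < t"
  shows "epowr (epowr a t) (1 / t) = a" and "epowr (epowr a (1 / t)) t = a"
  using assms by (cases a; auto simp: epowr_ennreal powr_powr)+

lemma epowr_less_top_iff: "epowr a t < \<infinity> \<longleftrightarrow> a < \<infinity>"
  by (cases a) (auto simp: epowr_ennreal)

lemma epowr_le_iff:
  assumes "0 < t"
  shows "epowr a t \<le> b \<longleftrightarrow> a \<le> epowr b (1 / t)"
  using assms epowr_mono[of "epowr a t" b "1 / t"] epowr_mono[of a "epowr b (1 / t)" t]
  by (auto simp: epowr_inverse)

lemma epowr_add_le:
  assumes "0 < t"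
  shows "epowr (a + b) t \<le> ennreal (2 powr t) * (epowr a t + epowr b t)"
proof -
  have "a + b \<le> ennreal 2 * max a b"
    by (simp add: mult_2 add_mono)
  then have "epowr (a + b) t \<le> epowr (ennreal 2 * max a b) t"
    using assms by (intro epowr_mono) auto
  also have "\<dots> = ennreal (2 powr t) * epowr (max a b) t"
    using assms by (subst epowr_mult) (simp_all add: epowr_ennreal del: ennreal_numeral)
  also have "\<dots> \<le> ennreal (2 powr t) * (epowr a t + epowr b t)"
    by (intro mult_left_mono) (auto simp: max_def add_increasing add_increasing2)
  finally show ?thesis .
qed

lemma le_suminf_ennreal: "f j \<le> (\<Sum>j. f j)" for f :: "nat \<Rightarrow> ennreal"
  using sum_le_suminf[of f "{j}"] by simp

lemma borel_measurable_epowr [measurable (raw)]: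
  "F \<in> borel_measurable M \<Longrightarrow> (\<lambda>x. epowr (F x) t) \<in> borel_measurable M"
proof -
  assume F [measurable]: "F \<in> borel_measurable M"
  have "{x \<in> space M. F x = \<infinity>} = F -` {\<infinity>} \<inter> space M" by auto
  then have [measurable]: "{x \<in> space M. F x = \<infinity>} \<in> sets M"
    using measurable_sets[OF F, of "{\<infinity>}"] by simp
  show ?thesis
    unfolding epowr_def by (intro measurable_If) simp_all
qed

lemma esssup_le_iff:
  "F \<in> borel_measurable M \<Longrightarrow> esssup M F \<le> c \<longleftrightarrow> (AE x in M. F x \<le> c)"
  using esssup_AE[of F M] by (auto elim: eventually_mono intro: order_trans)

lemma enn2real_ge_1:
  assumes "1 \<le> p" "p < \<infinity>"
  shows "1 \<le> enn2real p"
  using enn2real_mono[of 1 p] assms by simp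

lemma enn2real_pos:
  "1 \<le> p \<Longrightarrow> p < \<infinity> \<Longrightarrow> 0 < enn2real p"
  using enn2real_ge_1 by fastforce

lemma epowr_Lp_norm:
  assumes "1 \<le> p" "p < \<infinity>"
  shows "epowr (Lp_norm p F) (enn2real p) = (\<integral>\<^sup>+x. epowr (F x) (enn2real p) \<partial>lborel)"
  using assms enn2real_pos[OF assms] by (auto simp: Lp_norm_def epowr_inverse)

lemma Lp_norm_le_iff:
  assumes "1 \<le> p" "p < \<infinity>"
  shows "Lp_norm p F \<le> c \<longleftrightarrow> (\<integral>\<^sup>+x. epowr (F x) (enn2real p) \<partial>lborel) \<le> epowr c (enn2real p)"
proof -
  have pos: "0 < enn2real p" using enn2real_pos[OF assms] .
  then have "Lp_norm p F \<le> c \<longleftrightarrow> epowr (Lp_norm p F) (enn2real p) \<le> epowr c (enn2real p)"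
    by (simp add: epowr_le_iff epowr_inverse)
  then show ?thesis
    by (simp add: epowr_Lp_norm[OF assms])
qed

lemma Lp_norm_mono_AE:
  assumes "1 \<le> p" "F \<in> borel_measurable lborel" "AE x in lborel. F x \<le> G x"
  shows "Lp_norm p F \<le> Lp_norm p G"
proof (cases "p = \<infinity>")
  case True
  then show ?thesis using assms by (simp add: Lp_norm_def esssup_AE_mono)
next
  case False
  then have p: "p < \<infinity>" by (simp add: less_top)
  have "(\<integral>\<^sup>+x. epowr (F x) (enn2real p) \<partial>lborel) \<le> (\<integral>\<^sup>+x. epowr (G x) (enn2real p) \<partial>lborel)"
    using assms(3) by (intro nn_integral_mono_AE) (auto elim!: eventually_mono intro: epowr_mono)
  then show ?thesis
    by (simp add: Lp_norm_le_iff[OF assms(1) p] epowr_Lp_norm[OF assms(1) p])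
qed

lemma Lp_norm_mono:
  "1 \<le> p \<Longrightarrow> F \<in> borel_measurable lborel \<Longrightarrow> (\<And>x. F x \<le> G x) \<Longrightarrow> Lp_norm p F \<le> Lp_norm p G"
  by (intro Lp_norm_mono_AE) auto

lemma Lp_norm_0 [simp]: "1 \<le> p \<Longrightarrow> Lp_norm p (\<lambda>x. 0) = 0"
  using esssup_I[of "\<lambda>x. 0 :: ennreal" lborel 0] by (auto simp: Lp_norm_def le_zero_eq)

lemma Lp_norm_cmult:
  assumes p: "1 \<le> p" and F [measurable]: "F \<in> borel_measurable lborel"
  shows "Lp_norm p (\<lambda>x. c * F x) \<le> c * Lp_norm p F"
proof (cases "p = \<infinity>")
  case True
  have "AE x in lborel. c * F x \<le> c * esssup lborel F"
    using esssup_AE[of F lborel] by eventually_elim (intro mult_left_mono, auto)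
  then show ?thesis
    using True by (auto simp: Lp_norm_def intro!: esssup_I)
next
  case False
  then have p': "p < \<infinity>" by (simp add: less_top)
  show ?thesis
    using enn2real_pos[OF p p']
    by (simp add: Lp_norm_le_iff[OF p p'] epowr_mult nn_integral_cmult epowr_Lp_norm[OF p p'])
qed

text \<open>A quasi-triangle inequality with a crude constant takes the place of Minkowski's: a
  power t of a sum costs \<open>2 powr t\<close>, and the factor 2 from the two summands is again at
  most \<open>2 powr t\<close>, because t is at least 1.\<close>

lemma Lp_norm_add:
  assumes p: "1 \<le> p" and [measurable]: "F \<in> borel_measurable lborel" "G \<in> borel_measurable lborel"
  shows "Lp_norm p (\<lambda>x. F x + G x) \<le> 4 * (Lp_norm p F + Lp_norm p G)"
proof (cases "p = \<infinity>")
  case True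
  have "AE x in lborel. F x + G x \<le> esssup lborel F + esssup lborel G"
    using esssup_AE[of F lborel] esssup_AE[of G lborel] by eventually_elim (intro add_mono)
  then have "Lp_norm p (\<lambda>x. F x + G x) \<le> 1 * (Lp_norm p F + Lp_norm p G)"
    using True by (auto simp: Lp_norm_def intro!: esssup_I)
  also have "\<dots> \<le> 4 * (Lp_norm p F + Lp_norm p G)"
    by (intro mult_right_mono) auto
  finally show ?thesis .
next
  case False
  then have p': "p < \<infinity>" by (simp add: less_top)
  define t where "t = enn2real p"
  have t: "1 \<le> t" using enn2real_ge_1[OF p p'] by (simp add: t_def)
  let ?m = "max (Lp_norm p F) (Lp_norm p G)"
  have "(\<integral>\<^sup>+x. epowr (F x + G x) t \<partial>lborel) \<le>
      (\<integral>\<^sup>+x. ennreal (2 powr t) * (epowr (F x) t + epowr (G x) t) \<partial>lborel)"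
    using t by (intro nn_integral_mono epowr_add_le) auto
  also have "\<dots> = ennreal (2 powr t) * (epowr (Lp_norm p F) t + epowr (Lp_norm p G) t)"
    by (simp add: nn_integral_cmult nn_integral_add t_def epowr_Lp_norm[OF p p'])
  also have "\<dots> \<le> ennreal (2 powr t) * (epowr ?m t + epowr ?m t)"
    using t by (intro mult_left_mono add_mono epowr_mono) auto
  also have "\<dots> = ennreal (2 powr t) * (ennreal 2 * epowr ?m t)"
    by (simp add: mult_2)
  also have "\<dots> \<le> ennreal (2 powr t) * (ennreal (2 powr t) * epowr ?m t)"
    using t powr_mono[of 1 t 2] by (intro mult_left_mono mult_right_mono ennreal_leI) auto
  also have "\<dots> = epowr (ennreal 2 * (ennreal 2 * ?m)) t"
    using t by (simp add: epowr_mult epowr_ennreal del: ennreal_numeral)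
  also have "ennreal 2 * (ennreal 2 * ?m) = 4 * ?m"
    by (simp add: mult.assoc[symmetric] flip: ennreal_mult' ennreal_numeral)
  finally have "Lp_norm p (\<lambda>x. F x + G x) \<le> 4 * ?m"
    unfolding t_def by (simp add: Lp_norm_le_iff[OF p p'])
  also have "\<dots> \<le> 4 * (Lp_norm p F + Lp_norm p G)"
    by (intro mult_left_mono) (auto simp: add_increasing add_increasing2)
  finally show ?thesis .
qed

lemma Lp_norm_sum:
  assumes p: "1 \<le> p" and "finite I" "\<And>i. i \<in> I \<Longrightarrow> F i \<in> borel_measurable lborel"
  shows "Lp_norm p (\<lambda>x. \<Sum>i\<in>I. F i x) \<le> 4 ^ card I * (\<Sum>i\<in>I. Lp_norm p (F i))"
  using assms(2,3)
proof (induction I rule: finite_induct)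
  case empty
  then show ?case using p by simp
next
  case (insert i I)
  then have [measurable]: "F i \<in> borel_measurable lborel" "\<And>j. j \<in> I \<Longrightarrow> F j \<in> borel_measurable lborel"
    by auto
  have one: "(1::ennreal) \<le> 4 ^ n" for n
    by (rule one_le_power) simp
  have "Lp_norm p (\<lambda>x. \<Sum>j\<in>insert i I. F j x) = Lp_norm p (\<lambda>x. F i x + (\<Sum>j\<in>I. F j x))"
    using insert by simp
  also have "\<dots> \<le> 4 * (Lp_norm p (F i) + Lp_norm p (\<lambda>x. \<Sum>j\<in>I. F j x))"
    using p by (intro Lp_norm_add) measurable
  also have "\<dots> \<le> 4 * (4 ^ card I * Lp_norm p (F i) + 4 ^ card I * (\<Sum>j\<in>I. Lp_norm p (F j)))"
    using insert one[of "card I"] mult_right_mono[OF one[of "card I"], of "Lp_norm p (F i)"]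
    by (intro mult_left_mono add_mono) auto
  also have "\<dots> = 4 ^ card (insert i I) * (\<Sum>j\<in>insert i I. Lp_norm p (F j))"
    using insert by (simp add: distrib_left mult.assoc)
  finally show ?case .
qed

lemma Lp_norm_translate:
  fixes F :: "'a::euclidean_space \<Rightarrow> ennreal"
  assumes p: "1 \<le> p" and [measurable]: "F \<in> borel_measurable lborel"
  shows "Lp_norm p (\<lambda>x. F (x + h)) = Lp_norm p F"
proof -
  have int: "(\<integral>\<^sup>+x. G (x + h) \<partial>lborel) = (\<integral>\<^sup>+x. G x \<partial>lborel)" if [measurable]: "G \<in> borel_measurable borel"
    for G :: "'a \<Rightarrow> ennreal"
  proof -
    have "(\<integral>\<^sup>+x. G x \<partial>lborel) = (\<integral>\<^sup>+x. G x \<partial>distr lborel borel ((+) h))"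
      by (simp add: lborel_distr_plus)
    also have "\<dots> = (\<integral>\<^sup>+x. G (x + h) \<partial>lborel)"
      by (subst nn_integral_distr) (auto simp: add.commute)
    finally show ?thesis ..
  qed
  have F: "F \<in> borel_measurable borel" using assms(2) by simp
  show ?thesis
  proof (cases "p = \<infinity>")
    case True
    \<comment> \<open>Almost-everywhere statements are turned into integrals of indicators, for
      which translation invariance is available.\<close>
    have "(AE x in lborel. F (x + h) \<le> c) \<longleftrightarrow> (AE x in lborel. F x \<le> c)" for c
    proof -
      have "(\<integral>\<^sup>+x. indicator {x. \<not> F x \<le> c} (x + h) \<partial>lborel) = (\<integral>\<^sup>+x. indicator {x. \<not> F x \<le> c} x \<partial>lborel :: ennreal)"
        by (rule int) measurable
      moreover have "(AE x in lborel. F x \<le> c) \<longleftrightarrow> (\<integral>\<^sup>+x. indicator {x. \<not> F x \<le> c} x \<partial>lborel :: ennreal) = 0"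
        by (subst nn_integral_0_iff_AE) (auto simp: indicator_def intro!: AE_cong)
      moreover have "(AE x in lborel. F (x + h) \<le> c) \<longleftrightarrow>
          (\<integral>\<^sup>+x. indicator {x. \<not> F x \<le> c} (x + h) \<partial>lborel :: ennreal) = 0"
        using F by (subst nn_integral_0_iff_AE) (auto simp: indicator_def intro!: AE_cong)
      ultimately show ?thesis by simp
    qed
    then have "esssup lborel (\<lambda>x. F (x + h)) \<le> c \<longleftrightarrow> esssup lborel F \<le> c" for c
      using F by (simp add: esssup_le_iff)
    then show ?thesis
      using True by (simp add: Lp_norm_def) (meson dual_order.eq_iff)
  next
    case False
    then show ?thesis
      using int[of "\<lambda>x. epowr (F x) (enn2real p)"] F by (simp add: Lp_norm_def)
  qed
qed

text \<open>For finite p this is measurability of a parameter integral. For p = \<infinity> a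
  sublevel set is described by an almost-everywhere statement, which amounts to the vanishing of the
  integral of an indicator.\<close>

lemma borel_measurable_Lp_norm:
  assumes G: "case_prod G \<in> borel_measurable (M \<Otimes>\<^sub>M lborel)"
  shows "(\<lambda>h. Lp_norm p (G h)) \<in> borel_measurable M"
proof (cases "p = \<infinity>")
  case True
  have Gh: "G h \<in> borel_measurable lborel" if "h \<in> space M" for h
    using measurable_Pair2[OF G that] by simp
  note [measurable] = G
  show ?thesis
    unfolding True
  proof (rule borel_measurableI_le)
    fix c
    have "{h \<in> space M. Lp_norm \<infinity> (G h) \<le> c} = {h \<in> space M. AE x in lborel. G h x \<le> c}"
      using Gh by (auto simp: Lp_norm_def esssup_le_iff)
    also have "\<dots> = {h \<in> space M. (\<integral>\<^sup>+x. indicator {c<..} (G h x) \<partial>lborel) = (0::ennreal)}"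
      using Gh by (auto simp: nn_integral_0_iff_AE indicator_def not_less elim!: eventually_mono)
    also have "\<dots> \<in> sets M"
      by measurable
    finally show "{h \<in> space M. Lp_norm \<infinity> (G h) \<le> c} \<in> sets M" .
  qed
next
  case False
  note [measurable] = G
  show ?thesis
    using False by (simp add: Lp_norm_def)
qed

text \<open>If E exceeded c throughout A, then c would be finite and \<open>E - c\<close> would have
  integral 0 over A, hence vanish almost everywhere on A. This is the principle by which base points
  are selected.\<close>

lemma exists_le_average:
  assumes [measurable]: "E \<in> borel_measurable M" "A \<in> sets M"
    and A: "0 < emeasure M A" "emeasure M A < \<infinity>"
    and le: "(\<integral>\<^sup>+y\<in>A. E y \<partial>M) \<le> c * emeasure M A"
  shows "\<exists>y\<in>A. E y \<le> c"
proof (rule ccontr)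
  assume "\<not> (\<exists>y\<in>A. E y \<le> c)"
  then have gt: "c < E y" if "y \<in> A" for y using that by force
  have "A \<noteq> {}" using A by auto
  then have "c < \<infinity>" using gt top.not_eq_extremum by fastforce
  then have fin: "c * emeasure M A < \<infinity>"
    using A by (simp add: ennreal_mult_less_top)
  have "(\<integral>\<^sup>+y\<in>A. E y \<partial>M) = (\<integral>\<^sup>+y. (E y - c) * indicator A y + c * indicator A y \<partial>M)"
    using gt by (intro nn_integral_cong) (auto simp: indicator_def diff_add_cancel_ennreal less_imp_le)
  also have "\<dots> = (\<integral>\<^sup>+y\<in>A. (E y - c) \<partial>M) + c * emeasure M A"
    by (simp add: nn_integral_add nn_integral_cmult)
  finally have "(\<integral>\<^sup>+y\<in>A. (E y - c) \<partial>M) + c * emeasure M A \<le> 0 + c * emeasure M A"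
    using le by simp
  then have "(\<integral>\<^sup>+y\<in>A. (E y - c) \<partial>M) = 0"
    using fin by (metis add.commute ennreal_add_left_cancel_le infinity_ennreal_def le_zero_eq less_irrefl)
  then have "AE y in M. (E y - c) * indicator A y = 0"
    by (subst (asm) nn_integral_0_iff_AE) auto
  then have "AE y in M. y \<notin> A"
    by eventually_elim (auto simp: indicator_def dest: gt simp: diff_eq_0_iff_ennreal not_le[symmetric] split: if_splits)
  then have "emeasure M A = 0"
    using AE_iff_measurable[of A M "\<lambda>y. y \<notin> A"] sets.sets_into_space[OF assms(2)] by (auto simp: Int_absorb1 subset_eq)
  with A show False by simp
qed

section \<open>Volumes and integrals in the scaled geometry\<close>

lemma emeasure_lborel_vec_box:
  fixes a b :: "real^'d::finite"
  assumes "\<And>i. a $ i \<le> b $ i"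
  shows "emeasure lborel (cbox a b) = ennreal (\<Prod>i\<in>UNIV. b $ i - a $ i)"
    and "emeasure lborel (box a b) = ennreal (\<Prod>i\<in>UNIV. b $ i - a $ i)"
proof -
  have le: "a \<bullet> j \<le> b \<bullet> j" if "j \<in> Basis" for j
    using assms that by (auto simp: Basis_vec_def inner_axis)
  have B: "(\<Prod>j\<in>Basis. (b - a) \<bullet> j) = (\<Prod>i\<in>UNIV. b $ i - a $ i)"
  proof -
    have "a \<in> cbox a b" using assms by (simp add: mem_box_cart)
    then have "cbox a b \<noteq> {}" by blast
    then have "measure lborel (cbox a b) = (\<Prod>i\<in>UNIV. b $ i - a $ i)" by (rule content_cbox_cart)
    then show ?thesis using le by (simp add: content_cbox)
  qed
  show "emeasure lborel (cbox a b) = ennreal (\<Prod>i\<in>UNIV. b $ i - a $ i)"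
    using le by (simp add: emeasure_lborel_cbox B)
  show "emeasure lborel (box a b) = ennreal (\<Prod>i\<in>UNIV. b $ i - a $ i)"
    using le by (simp add: emeasure_lborel_box B)
qed

lemma prod_power_sc_total: "(\<Prod>i\<in>UNIV. r ^ s i) = r ^ sc_total s" for r :: real
  by (simp add: sc_total_def power_sum)

lemma emeasure_sc_ball_le:
  fixes s :: "'d::finite \<Rightarrow> nat"
  assumes s: "\<forall>i. 1 \<le> s i" and r: "0 \<le> r"
  shows "emeasure lborel {h. sc_norm s h \<le> r} \<le> ennreal (2 ^ CARD('d) * r ^ sc_total s)"
proof -
  let ?a = "\<chi> i. - (r ^ s i)" and ?b = "\<chi> i. r ^ s i"
  have "{h. sc_norm s h \<le> r} \<subseteq> cbox ?a ?b"
  proof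
    fix h assume "h \<in> {h. sc_norm s h \<le> r}"
    then have "\<bar>h $ i\<bar> \<le> r ^ s i" for i
      using component_le_sc_norm[OF s, of h i] power_mono[of "sc_norm s h" r "s i"]
      by (simp add: sc_norm_nonneg)
    then show "h \<in> cbox ?a ?b"
      by (simp add: mem_box_cart abs_le_iff) (meson minus_le_iff)
  qed
  then have "emeasure lborel {h. sc_norm s h \<le> r} \<le> emeasure lborel (cbox ?a ?b)"
    by (intro emeasure_mono) auto
  also have "\<dots> = ennreal (\<Prod>i\<in>UNIV. 2 * r ^ s i)"
    using r by (subst emeasure_lborel_vec_box) (auto simp: intro: order_trans[of _ 0])
  also have "(\<Prod>i\<in>UNIV. 2 * r ^ s i) = 2 ^ CARD('d) * r ^ sc_total s"
    by (simp add: prod.distrib prod_power_sc_total)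
  finally show ?thesis .
qed

lemma dyadic_interval:
  fixes t :: real
  assumes "0 < t" "t \<le> 1"
  shows "\<exists>j. (1 / 2) ^ Suc j \<le> t \<and> t \<le> (1 / 2) ^ j"
proof -
  \<comment> \<open>The upper bound is the failure of the condition at the predecessor of the least
    j.\<close>
  define j where "j = (LEAST j. (1 / 2) ^ Suc j \<le> t)"
  obtain n where "(1 / 2 :: real) ^ n < t"
    using real_arch_pow_inv[of t "1 / 2"] assms by auto
  moreover have "(1 / 2 :: real) ^ Suc n \<le> (1 / 2) ^ n" by simp
  ultimately have "(1 / 2) ^ Suc n \<le> t" by linarith
  then have 1: "(1 / 2) ^ Suc j \<le> t"
    unfolding j_def by (rule LeastI)
  have 2: "t \<le> (1 / 2) ^ j"
  proof (cases j)
    case (Suc i)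
    then have "i < j" by simp
    then have "i < (LEAST j. (1 / 2) ^ Suc j \<le> t)" unfolding j_def .
    from not_less_Least[OF this] show ?thesis using Suc by simp
  qed (use assms in simp)
  from 1 2 show ?thesis by blast
qed

text \<open>Both dyadic decompositions below produce the geometric series with ratio \<open>2\<close> to the
  power \<open>- c\<close>: the weight of the \<open>j\<close>-th shell cancels its volume up to that factor.\<close>

lemma nn_integral_dyadic_shells:
  fixes s :: "'d::finite \<Rightarrow> nat"
  assumes s: "\<forall>i. 1 \<le> s i" and c: "0 < c" and r: "\<And>j. 0 < r j"
    and g: "\<And>h. g h \<noteq> 0 \<Longrightarrow> \<exists>j. sc_norm s h \<le> r j \<and>
        g h \<le> ennreal ((1 / 2) powr (c * real j) * (2 / r j) ^ sc_total s)"
  shows "(\<integral>\<^sup>+h. g h \<partial>lborel) \<le> ennreal (2 ^ CARD('d) * 2 ^ sc_total s / (1 - (1 / 2) powr c))"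
proof -
  define a where "a j = (1 / 2) powr (c * real j) * (2 / r j) ^ sc_total s" for j :: nat
  have a0: "0 \<le> a j" for j using r[of j] by (simp add: a_def)
  let ?t = "\<lambda>j h. ennreal (a j) * indicator {h. sc_norm s h \<le> r j} h"
  have [measurable]: "{h. sc_norm s h \<le> r j} \<in> sets borel" for j
    by measurable
  have "g h \<le> (\<Sum>j. ?t j h)" for h
  proof (cases "g h = 0")
    case False
    from g[OF this] obtain j where "sc_norm s h \<le> r j" "g h \<le> ennreal (a j)" by (auto simp: a_def)
    then have "g h \<le> ?t j h" by simp
    also have "\<dots> \<le> (\<Sum>j. ?t j h)"
      by (rule le_suminf_ennreal)
    finally show ?thesis .
  qed simp
  then have "(\<integral>\<^sup>+h. g h \<partial>lborel) \<le> (\<integral>\<^sup>+h. (\<Sum>j. ?t j h) \<partial>lborel)"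
    by (intro nn_integral_mono)
  also have "\<dots> = (\<Sum>j. ennreal (a j) * emeasure lborel {h. sc_norm s h \<le> r j})"
    by (subst nn_integral_suminf) (auto simp: nn_integral_cmult_indicator)
  also have "\<dots> \<le> (\<Sum>j. ennreal (2 ^ CARD('d) * 2 ^ sc_total s * ((1 / 2) powr c) ^ j))"
  proof (intro suminf_le allI)
    fix j
    have "ennreal (a j) * emeasure lborel {h. sc_norm s h \<le> r j}
        \<le> ennreal (a j) * ennreal (2 ^ CARD('d) * r j ^ sc_total s)"
      using r[of j] by (intro mult_left_mono emeasure_sc_ball_le s) auto
    also have "\<dots> = ennreal (a j * (2 ^ CARD('d) * r j ^ sc_total s))"
      using a0 by (simp add: ennreal_mult')
    also have "a j * (2 ^ CARD('d) * r j ^ sc_total s) = 2 ^ CARD('d) * 2 ^ sc_total s * ((1 / 2) powr c) ^ j"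
      using r[of j] by (simp add: a_def power_divide powr_powr flip: powr_realpow)
    finally show "ennreal (a j) * emeasure lborel {h. sc_norm s h \<le> r j}
        \<le> ennreal (2 ^ CARD('d) * 2 ^ sc_total s * ((1 / 2) powr c) ^ j)" .
  qed auto
  also have "\<dots> = ennreal (2 ^ CARD('d) * 2 ^ sc_total s / (1 - (1 / 2) powr c))"
  proof (rule suminf_ennreal_eq)
    have "(1 / 2) powr c < (1::real)" using c powr_less_mono2[of c "1 / 2" 1] by simp
    then have "(\<lambda>j. ((1 / 2) powr c) ^ j) sums (1 / (1 - (1 / 2) powr c))"
      by (intro geometric_sums) simp
    from sums_mult[OF this, of "2 ^ CARD('d) * 2 ^ sc_total s"]
    show "(\<lambda>j. 2 ^ CARD('d) * 2 ^ sc_total s * ((1 / 2) powr c) ^ j) sums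
        (2 ^ CARD('d) * 2 ^ sc_total s / (1 - (1 / 2) powr c))" by simp
  qed simp
  finally show ?thesis .
qed

text \<open>The shells have radii \<open>\<delta> / 2 ^ j\<close>. The bound is uniform in \<delta>
  because the weight \<open>1 / sc_norm s h ^ sc_total s\<close> makes the measure invariant under
  scaled dilations. It serves the increments below the mesh size.\<close>

lemma nn_integral_inner:
  fixes s :: "'d::finite \<Rightarrow> nat"
  assumes s: "\<forall>i. 1 \<le> s i" and c: "0 < c" and \<delta>: "0 < \<delta>"
  shows "(\<integral>\<^sup>+h\<in>{h. sc_norm s h < \<delta>}. ennreal ((sc_norm s h / \<delta>) powr c) * ennreal (1 / sc_norm s h ^ sc_total s) \<partial>lborel)
    \<le> ennreal (2 ^ CARD('d) * 2 ^ sc_total s / (1 - (1 / 2) powr c))"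
proof (rule nn_integral_dyadic_shells[OF s c, where r = "\<lambda>j. \<delta> * (1 / 2) ^ j"])
  fix h
  assume ne: "ennreal ((sc_norm s h / \<delta>) powr c) * ennreal (1 / sc_norm s h ^ sc_total s) * indicator {h. sc_norm s h < \<delta>} h \<noteq> 0"
  have "sc_norm s h \<noteq> 0"
    using ne by (rule contrapos_nn) simp
  moreover have "sc_norm s h < \<delta>"
    using ne by (rule contrapos_np) simp
  ultimately have h: "0 < sc_norm s h" "sc_norm s h < \<delta>"
    using sc_norm_nonneg[of s h] by simp_all
  obtain j where j: "(1 / 2) ^ Suc j \<le> sc_norm s h / \<delta>" "sc_norm s h / \<delta> \<le> (1 / 2) ^ j"
    using dyadic_interval[of "sc_norm s h / \<delta>"] h \<delta> by auto
  have 1: "(sc_norm s h / \<delta>) powr c \<le> (1 / 2) powr (c * real j)"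
  proof -
    have "(sc_norm s h / \<delta>) powr c \<le> ((1 / 2) ^ j) powr c"
      using j h \<delta> c by (intro powr_mono2) auto
    then show ?thesis by (simp add: powr_powr mult.commute flip: powr_realpow)
  qed
  have "1 / sc_norm s h \<le> 2 / (\<delta> * (1 / 2) ^ j)"
    using j(1) h \<delta> by (simp add: field_simps)
  then have "(1 / sc_norm s h) ^ sc_total s \<le> (2 / (\<delta> * (1 / 2) ^ j)) ^ sc_total s"
    using h by (intro power_mono) auto
  then have 2: "1 / sc_norm s h ^ sc_total s \<le> (2 / (\<delta> * (1 / 2) ^ j)) ^ sc_total s"
    by (simp add: power_one_over)
  have "(sc_norm s h / \<delta>) powr c * (1 / sc_norm s h ^ sc_total s)
      \<le> (1 / 2) powr (c * real j) * (2 / (\<delta> * (1 / 2) ^ j)) ^ sc_total s"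
    using 1 2 h by (intro mult_mono) auto
  then show "\<exists>j. sc_norm s h \<le> \<delta> * (1 / 2) ^ j \<and>
      ennreal ((sc_norm s h / \<delta>) powr c) * ennreal (1 / sc_norm s h ^ sc_total s) * indicator {h. sc_norm s h < \<delta>} h
      \<le> ennreal ((1 / 2) powr (c * real j) * (2 / (\<delta> * (1 / 2) ^ j)) ^ sc_total s)"
    using h j \<delta> by (intro exI[of _ j]) (auto simp: field_simps indicator_def ennreal_leI simp flip: ennreal_mult')
qed (use \<delta> in simp)

text \<open>The counterpart for shifts beyond the mesh size, where the decay in
  \<open>\<delta> / sc_norm s h\<close> compensates the infinite mass of the weight.\<close>

lemma nn_integral_outer:
  fixes s :: "'d::finite \<Rightarrow> nat"
  assumes s: "\<forall>i. 1 \<le> s i" and c: "0 < c" and \<delta>: "0 < \<delta>"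
  shows "(\<integral>\<^sup>+h\<in>{h. \<delta> \<le> sc_norm s h}. ennreal ((\<delta> / sc_norm s h) powr c) * ennreal (1 / sc_norm s h ^ sc_total s) \<partial>lborel)
    \<le> ennreal (2 ^ CARD('d) * 2 ^ sc_total s / (1 - (1 / 2) powr c))"
\<comment> \<open>A ratio \<open>\<delta> / sc_norm s h\<close> of at least
  \<open>(1 / 2) ^ Suc j\<close> gives only the radius \<open>2 * \<delta> * 2 ^ j\<close>, hence
  the additional 2.\<close>
proof (rule nn_integral_dyadic_shells[OF s c, where r = "\<lambda>j. 2 * \<delta> * 2 ^ j"])
  fix h
  assume "ennreal ((\<delta> / sc_norm s h) powr c) * ennreal (1 / sc_norm s h ^ sc_total s) * indicator {h. \<delta> \<le> sc_norm s h} h \<noteq> 0"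
  then have h: "\<delta> \<le> sc_norm s h" by (auto simp: indicator_def split: if_splits)
  then have h0: "0 < sc_norm s h" using \<delta> by simp
  obtain j where j: "(1 / 2) ^ Suc j \<le> \<delta> / sc_norm s h" "\<delta> / sc_norm s h \<le> (1 / 2) ^ j"
    using dyadic_interval[of "\<delta> / sc_norm s h"] h h0 \<delta> by auto
  have 1: "(\<delta> / sc_norm s h) powr c \<le> (1 / 2) powr (c * real j)"
  proof -
    have "(\<delta> / sc_norm s h) powr c \<le> ((1 / 2) ^ j) powr c"
      using j h h0 \<delta> c by (intro powr_mono2) auto
    then show ?thesis by (simp add: powr_powr mult.commute flip: powr_realpow)
  qed
  have "1 / sc_norm s h \<le> 2 / (2 * \<delta> * 2 ^ j)"
    using j(2) h0 \<delta> by (simp add: power_one_over field_simps)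
  then have "(1 / sc_norm s h) ^ sc_total s \<le> (2 / (2 * \<delta> * 2 ^ j)) ^ sc_total s"
    using h0 by (intro power_mono) auto
  then have 2: "1 / sc_norm s h ^ sc_total s \<le> (2 / (2 * \<delta> * 2 ^ j)) ^ sc_total s"
    by (simp add: power_one_over)
  have "(\<delta> / sc_norm s h) powr c * (1 / sc_norm s h ^ sc_total s)
      \<le> (1 / 2) powr (c * real j) * (2 / (2 * \<delta> * 2 ^ j)) ^ sc_total s"
    using 1 2 h0 by (intro mult_mono) auto
  moreover have "sc_norm s h \<le> 2 * \<delta> * 2 ^ j"
    using j(1) h0 \<delta> by (simp add: power_one_over field_simps)
  ultimately show "\<exists>j. sc_norm s h \<le> 2 * \<delta> * 2 ^ j \<and>
      ennreal ((\<delta> / sc_norm s h) powr c) * ennreal (1 / sc_norm s h ^ sc_total s) * indicator {h. \<delta> \<le> sc_norm s h} h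
      \<le> ennreal ((1 / 2) powr (c * real j) * (2 / (2 * \<delta> * 2 ^ j)) ^ sc_total s)"
    using h by (intro exI[of _ j]) (auto simp: indicator_def ennreal_leI simp flip: ennreal_mult')
qed (use \<delta> in simp)

section \<open>Regularity structures and models\<close>

locale reg_structure =
  fixes S :: "('v::real_vector) reg_struct"
  assumes reg: "regularity_structure S"
begin

abbreviation cn :: "real \<Rightarrow> 'v \<Rightarrow> real" where "cn \<equiv> comp_norm S"
abbreviation hc :: "real \<Rightarrow> 'v \<Rightarrow> 'v" where "hc \<equiv> hom_comp S"

lemma sector_subspace: "subspace (sector S \<alpha>)"
  using reg by (simp add: regularity_structure_def banach_sector_def)

lemma sec_norm_properties:
  assumes "v \<in> sector S \<alpha>"
  shows "0 \<le> sec_norm S \<alpha> v" "sec_norm S \<alpha> v = 0 \<longleftrightarrow> v = 0"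
    "sec_norm S \<alpha> (c *\<^sub>R v) = \<bar>c\<bar> * sec_norm S \<alpha> v"
    "w \<in> sector S \<alpha> \<Longrightarrow> sec_norm S \<alpha> (v + w) \<le> sec_norm S \<alpha> v + sec_norm S \<alpha> w"
  using reg assms by (simp_all add: regularity_structure_def banach_sector_def)

lemma sector_outside: "\<alpha> \<notin> homs S \<Longrightarrow> sector S \<alpha> = {0}"
  using reg by (simp add: regularity_structure_def)

lemma is_decomp_hc: "is_decomp S \<tau> (\<lambda>\<alpha>. hc \<alpha> \<tau>)"
proof -
  have "\<exists>!u. is_decomp S \<tau> u"
    using reg by (simp add: regularity_structure_def)
  from theI'[OF this] show ?thesis
    by (simp add: hom_comp_def)
qed

lemma hc_in_sector: "hc \<alpha> \<tau> \<in> sector S \<alpha>"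
  and finite_hc_support: "finite {\<alpha>. hc \<alpha> \<tau> \<noteq> 0}"
  and hc_sum_support: "\<tau> = (\<Sum>\<alpha> | hc \<alpha> \<tau> \<noteq> 0. hc \<alpha> \<tau>)"
  using is_decomp_hc[of \<tau>] by (auto simp: is_decomp_def)

lemma hc_sum_eq:
  assumes "finite F" "{\<alpha>. hc \<alpha> \<tau> \<noteq> 0} \<subseteq> F"
  shows "(\<Sum>\<alpha>\<in>F. hc \<alpha> \<tau>) = \<tau>"
proof -
  have "(\<Sum>\<alpha> | hc \<alpha> \<tau> \<noteq> 0. hc \<alpha> \<tau>) = (\<Sum>\<alpha>\<in>F. hc \<alpha> \<tau>)"
    using assms by (intro sum.mono_neutral_left) auto
  then show ?thesis using hc_sum_support by simp
qed

text \<open>Uniqueness of the decomposition in usable form: components are computed below by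
  exhibiting a candidate family.\<close>

lemma hc_eqI:
  assumes "\<And>\<alpha>. u \<alpha> \<in> sector S \<alpha>" "finite F" "{\<alpha>. u \<alpha> \<noteq> 0} \<subseteq> F" "\<tau> = (\<Sum>\<alpha>\<in>F. u \<alpha>)"
  shows "hc \<alpha> \<tau> = u \<alpha>"
proof -
  have "(\<Sum>\<alpha> | u \<alpha> \<noteq> 0. u \<alpha>) = (\<Sum>\<alpha>\<in>F. u \<alpha>)"
    using assms by (intro sum.mono_neutral_left) auto
  then have "is_decomp S \<tau> u"
    using assms finite_subset[of _ F] by (simp add: is_decomp_def)
  moreover have "\<exists>!u. is_decomp S \<tau> u"
    using reg by (simp add: regularity_structure_def)
  ultimately show ?thesis
    unfolding hom_comp_def by (metis (no_types, lifting) the1_equality)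
qed

lemma hc_add: "hc \<alpha> (\<sigma> + \<tau>) = hc \<alpha> \<sigma> + hc \<alpha> \<tau>"
proof (rule hc_eqI[where F = "{\<alpha>. hc \<alpha> \<sigma> \<noteq> 0} \<union> {\<alpha>. hc \<alpha> \<tau> \<noteq> 0}"])
  show "hc \<alpha> \<sigma> + hc \<alpha> \<tau> \<in> sector S \<alpha>" for \<alpha>
    by (intro subspace_add[OF sector_subspace] hc_in_sector)
  show "\<sigma> + \<tau> = (\<Sum>\<alpha>\<in>{\<alpha>. hc \<alpha> \<sigma> \<noteq> 0} \<union> {\<alpha>. hc \<alpha> \<tau> \<noteq> 0}. hc \<alpha> \<sigma> + hc \<alpha> \<tau>)"
    by (simp add: sum.distrib hc_sum_eq finite_hc_support)
qed (auto simp: finite_hc_support)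

lemma hc_scale: "hc \<alpha> (c *\<^sub>R \<tau>) = c *\<^sub>R hc \<alpha> \<tau>"
proof (rule hc_eqI[where F = "{\<alpha>. hc \<alpha> \<tau> \<noteq> 0}"])
  show "c *\<^sub>R hc \<alpha> \<tau> \<in> sector S \<alpha>" for \<alpha>
    by (intro subspace_scale[OF sector_subspace] hc_in_sector)
  show "c *\<^sub>R \<tau> = (\<Sum>\<alpha>\<in>{\<alpha>. hc \<alpha> \<tau> \<noteq> 0}. c *\<^sub>R hc \<alpha> \<tau>)"
    by (simp add: scaleR_right.sum[symmetric] hc_sum_eq finite_hc_support)
qed (auto simp: finite_hc_support)

lemma linear_hc: "linear (hc \<alpha>)"
  by (intro linearI hc_add hc_scale)

lemmas hc_0 = linear_0[OF linear_hc]
  and hc_diff = linear_diff[OF linear_hc]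
  and hc_sum = linear_sum[OF linear_hc]

lemma hc_sector:
  assumes "\<tau> \<in> sector S \<alpha>"
  shows "hc \<beta> \<tau> = (if \<beta> = \<alpha> then \<tau> else 0)"
  using assms
  by (intro hc_eqI[where F = "{\<alpha>}"]) (auto intro: subspace_0[OF sector_subspace])

lemma hc_outside: "\<alpha> \<notin> homs S \<Longrightarrow> hc \<alpha> \<tau> = 0"
  using hc_in_sector[of \<alpha> \<tau>] sector_outside by auto

lemma hc_hc: "hc \<beta> (hc \<alpha> \<tau>) = (if \<beta> = \<alpha> then hc \<alpha> \<tau> else 0)"
  by (rule hc_sector) (rule hc_in_sector)

lemma hc_ext:
  assumes "\<And>\<alpha>. hc \<alpha> \<sigma> = hc \<alpha> \<tau>"
  shows "\<sigma> = \<tau>"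
  by (rule trans[OF hc_sum_support[of \<sigma>]], rule trans[OF _ hc_sum_support[of \<tau>, symmetric]])
    (simp add: assms)

lemma cn_nonneg: "0 \<le> cn \<alpha> \<tau>"
  by (simp add: comp_norm_def sec_norm_properties(1) hc_in_sector)

lemma cn_eq_0_iff: "cn \<alpha> \<tau> = 0 \<longleftrightarrow> hc \<alpha> \<tau> = 0"
  by (simp add: comp_norm_def sec_norm_properties(2) hc_in_sector)

lemma cn_scale: "cn \<alpha> (c *\<^sub>R \<tau>) = \<bar>c\<bar> * cn \<alpha> \<tau>"
  by (simp add: comp_norm_def hc_scale sec_norm_properties(3) hc_in_sector)

lemma cn_add: "cn \<alpha> (\<sigma> + \<tau>) \<le> cn \<alpha> \<sigma> + cn \<alpha> \<tau>"
  by (simp add: comp_norm_def hc_add sec_norm_properties(4) hc_in_sector)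

lemma cn_0 [simp]: "cn \<alpha> 0 = 0"
  by (simp add: cn_eq_0_iff hc_0)

lemma cn_minus [simp]: "cn \<alpha> (- \<tau>) = cn \<alpha> \<tau>"
  using cn_scale[of \<alpha> "-1" \<tau>] by simp

lemma cn_diff: "cn \<alpha> (\<sigma> - \<tau>) \<le> cn \<alpha> \<sigma> + cn \<alpha> \<tau>"
  using cn_add[of \<alpha> \<sigma> "- \<tau>"] by simp

lemma cn_minus_commute: "cn \<alpha> (\<sigma> - \<tau>) = cn \<alpha> (\<tau> - \<sigma>)"
  using cn_minus[of \<alpha> "\<sigma> - \<tau>"] by simp

lemma cn_sum: "cn \<alpha> (\<Sum>i\<in>I. f i) \<le> (\<Sum>i\<in>I. cn \<alpha> (f i))"
proof (induction I rule: infinite_finite_induct)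
  case (insert i I)
  then show ?case using cn_add[of \<alpha> "f i" "\<Sum>i\<in>I. f i"] by simp
qed auto

lemma cn_outside: "\<alpha> \<notin> homs S \<Longrightarrow> cn \<alpha> \<tau> = 0"
  by (simp add: cn_eq_0_iff hc_outside)

lemma sec_norm_hc: "sec_norm S \<alpha> (hc \<alpha> \<tau>) = cn \<alpha> \<tau>"
  by (simp add: comp_norm_def)

text \<open>Local finiteness covers bounded windows only; the lower bound of \<open>homs S\<close>
  turns the half-line into such a window.\<close>

lemma finite_homs_below: "finite (homs S \<inter> {..<\<gamma>})"
proof -
  obtain a where "\<And>\<alpha>. \<alpha> \<in> homs S \<Longrightarrow> a \<le> \<alpha>"
    using reg by (auto simp: regularity_structure_def bdd_below_def)
  then have "homs S \<inter> {..<\<gamma>} \<subseteq> homs S \<inter> {a..\<gamma>}" by auto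
  moreover have "finite (homs S \<inter> {a..\<gamma>})"
    using reg by (simp add: regularity_structure_def)
  ultimately show ?thesis by (rule finite_subset)
qed

lemma hc_T_below: "\<tau> \<in> T_below S \<gamma> \<Longrightarrow> \<gamma> \<le> \<alpha> \<Longrightarrow> hc \<alpha> \<tau> = 0"
  by (simp add: T_below_def)

lemma subspace_T_below: "subspace (T_below S \<gamma>)"
  by (auto simp: subspace_def T_below_def hc_0 hc_add hc_scale)

lemma T_below_sum_eq:
  assumes "\<tau> \<in> T_below S \<gamma>"
  shows "(\<Sum>\<alpha>\<in>homs S \<inter> {..<\<gamma>}. hc \<alpha> \<tau>) = \<tau>"
proof (rule hc_sum_eq[OF finite_homs_below])
  show "{\<alpha>. hc \<alpha> \<tau> \<noteq> 0} \<subseteq> homs S \<inter> {..<\<gamma>}"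
    using hc_outside hc_T_below[OF assms] by (force simp: not_less)
qed

lemma T_below_mono: "\<gamma> \<le> \<gamma>' \<Longrightarrow> T_below S \<gamma> \<subseteq> T_below S \<gamma>'"
  by (auto simp: T_below_def)

lemma T_below_exists: "\<exists>\<gamma>. \<tau> \<in> T_below S \<gamma>"
proof -
  obtain b where b: "\<And>\<alpha>. hc \<alpha> \<tau> \<noteq> 0 \<Longrightarrow> \<alpha> \<le> b"
    using finite_hc_support[of \<tau>] bdd_above_finite[of "{\<alpha>. hc \<alpha> \<tau> \<noteq> 0}"] by (auto simp: bdd_above_def)
  have "\<tau> \<in> T_below S (b + 1)"
    unfolding T_below_def using b by force
  then show ?thesis ..
qed

lemma hc_proj: "hc \<alpha> (proj_below S \<gamma> \<tau>) = (if \<alpha> < \<gamma> then hc \<alpha> \<tau> else 0)"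
proof -
  have fin: "finite {\<alpha>. \<alpha> < \<gamma> \<and> hc \<alpha> \<tau> \<noteq> 0}"
    using finite_hc_support by (rule rev_finite_subset) auto
  have "hc \<alpha> (proj_below S \<gamma> \<tau>) = (\<Sum>\<beta> | \<beta> < \<gamma> \<and> hc \<beta> \<tau> \<noteq> 0. if \<alpha> = \<beta> then hc \<alpha> \<tau> else 0)"
    unfolding proj_below_def hc_sum by (intro sum.cong refl) (auto simp: hc_hc)
  then show ?thesis using fin by simp
qed

lemma proj_in_T_below: "proj_below S \<gamma> \<tau> \<in> T_below S \<gamma>"
  by (simp add: T_below_def hc_proj)

lemma proj_T_below: "\<tau> \<in> T_below S \<gamma> \<Longrightarrow> proj_below S \<gamma> \<tau> = \<tau>"
  using hc_T_below[of \<tau> \<gamma>] by - (rule hc_ext, simp add: hc_proj not_less)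

lemma linear_proj: "linear (proj_below S \<gamma>)"
  by (intro linearI; rule hc_ext) (simp_all add: hc_proj hc_add hc_scale)

lemma cn_proj: "cn \<alpha> (proj_below S \<gamma> \<tau>) = (if \<alpha> < \<gamma> then cn \<alpha> \<tau> else 0)"
  using cn_0[of \<alpha>] by (simp add: comp_norm_def hc_proj hc_0)

lemma sgroup_linear: "g \<in> sgroup S \<Longrightarrow> linear g"
  using reg by (simp add: regularity_structure_def)

lemma sgroup_sector:
  assumes g: "g \<in> sgroup S" and \<tau>: "\<tau> \<in> sector S \<alpha>" and \<beta>: "\<alpha> \<le> \<beta>"
  shows "hc \<beta> (g \<tau>) = hc \<beta> \<tau>"
proof (cases "\<alpha> \<in> homs S")
  case True
  then have "g \<tau> - \<tau> \<in> T_below S \<alpha>"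
    using reg g \<tau> by (simp add: regularity_structure_def)
  then have "hc \<beta> (g \<tau> - \<tau>) = 0"
    using \<beta> by (rule hc_T_below)
  then show ?thesis by (simp add: hc_diff)
next
  case False
  then show ?thesis
    using \<tau> sector_outside linear_0[OF sgroup_linear[OF g]] by auto
qed

lemma sgroup_T_below:
  assumes g: "g \<in> sgroup S" and \<tau>: "\<tau> \<in> T_below S \<gamma>"
  shows "g \<tau> \<in> T_below S \<gamma>"
proof -
  have "g \<tau> = (\<Sum>\<alpha>\<in>homs S \<inter> {..<\<gamma>}. g (hc \<alpha> \<tau>))"
    using T_below_sum_eq[OF \<tau>] linear_sum[OF sgroup_linear[OF g]] by metis
  moreover have "hc \<beta> (g (hc \<alpha> \<tau>)) = 0" if "\<alpha> < \<gamma>" "\<gamma> \<le> \<beta>" for \<alpha> \<beta>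
    using sgroup_sector[OF g hc_in_sector[of \<alpha> \<tau>], of \<beta>] that by (simp add: hc_hc)
  ultimately show ?thesis
    by (auto simp: T_below_def hc_sum intro!: sum.neutral)
qed

end

section \<open>Translation operators of the model\<close>

locale modelled_setting = reg_structure S
  for s :: "'d::finite \<Rightarrow> nat" and S :: "('v::real_vector) reg_struct" +
  fixes X :: "('d \<Rightarrow> nat) \<Rightarrow> 'v" and star :: "'v \<Rightarrow> 'v \<Rightarrow> 'v"
    and \<Pi>\<^sub>Z :: "real^'d \<Rightarrow> 'v \<Rightarrow> (real^'d \<Rightarrow> real) \<Rightarrow> real"
    and \<Gamma> :: "real^'d \<Rightarrow> real^'d \<Rightarrow> 'v \<Rightarrow> 'v" and r :: nat
  assumes scaling: "\<forall>i. 1 \<le> s i"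
    and polynomials: "contains_polynomials s S X"
    and product: "poly_product s S X star"
    and model: "is_model s r S \<Pi>\<^sub>Z \<Gamma>"
    and canonical: "canonical_on_polynomials X \<Pi>\<^sub>Z \<Gamma>"
    and multiplicative: "\<forall>k \<tau>. \<forall>g\<in>sgroup S. g (star (X k) \<tau>) = star (g (X k)) (g \<tau>)"
begin

abbreviation sn :: "real^'d \<Rightarrow> real" where "sn \<equiv> sc_norm s"
abbreviation sd :: "('d \<Rightarrow> nat) \<Rightarrow> nat" where "sd \<equiv> sc_deg s"

lemma \<Gamma>_in_sgroup: "\<Gamma> x y \<in> sgroup S"
  and \<Gamma>_compose: "\<Gamma> x y (\<Gamma> y z \<tau>) = \<Gamma> x z \<tau>"
  using model by (auto simp: is_model_def fun_eq_iff)

lemmas linear_\<Gamma> = sgroup_linear[OF \<Gamma>_in_sgroup]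
lemmas \<Gamma>_diff = linear_diff[OF linear_\<Gamma>]
  and \<Gamma>_sum = linear_sum[OF linear_\<Gamma>]
  and \<Gamma>_scale = linear_scale[OF linear_\<Gamma>]
  and \<Gamma>_0 = linear_0[OF linear_\<Gamma>]
lemmas \<Gamma>_T_below = sgroup_T_below[OF \<Gamma>_in_sgroup]

text \<open>By the cocycle property \<open>\<Gamma> x x\<close> is idempotent, and it is invertible
  in the group.\<close>

lemma \<Gamma>_refl [simp]: "\<Gamma> x x \<tau> = \<tau>"
proof -
  have "\<forall>g\<in>sgroup S. \<exists>h\<in>sgroup S. g \<circ> h = id \<and> h \<circ> g = id"
    using reg by (simp add: regularity_structure_def)
  from bspec[OF this \<Gamma>_in_sgroup[of x x]] obtain h where "h \<circ> \<Gamma> x x = id"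
    by blast
  then have h: "h (\<Gamma> x x \<sigma>) = \<sigma>" for \<sigma> by (metis comp_apply id_apply)
  show ?thesis
    using h[of "\<Gamma> x x \<tau>"] h[of \<tau>] by (simp add: \<Gamma>_compose)
qed

text \<open>The bound of the model with a nonnegative constant, and for all real \<alpha> and
  \<beta>: outside \<open>homs S\<close> the sectors are zero.\<close>

lemma \<Gamma>_sector_bound:
  "\<exists>C\<ge>0. \<forall>x y \<tau>. \<forall>\<alpha><\<gamma>. \<forall>\<beta><\<alpha>. \<tau> \<in> sector S \<alpha> \<longrightarrow> sn (x - y) < 1 \<longrightarrow>
     cn \<beta> (\<Gamma> x y \<tau>) \<le> C * sn (x - y) powr (\<alpha> - \<beta>) * sec_norm S \<alpha> \<tau>"
proof -
  obtain C where C: "\<And>\<alpha> \<tau> x y \<beta>. \<alpha> \<in> homs S \<Longrightarrow> \<alpha> < \<gamma> \<Longrightarrow> \<tau> \<in> sector S \<alpha> \<Longrightarrow> sn (x - y) < 1 \<Longrightarrow>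
      \<beta> \<in> homs S \<Longrightarrow> \<beta> < \<alpha> \<Longrightarrow> cn \<beta> (\<Gamma> x y \<tau>) \<le> C * sn (x - y) powr (\<alpha> - \<beta>) * sec_norm S \<alpha> \<tau>"
    using model unfolding is_model_def by fastforce
  show ?thesis
  proof (intro exI[of _ "max C 0"] conjI allI impI)
    fix x y \<tau> \<alpha> \<beta>
    assume *: "\<alpha> < \<gamma>" "\<beta> < \<alpha>" "\<tau> \<in> sector S \<alpha>" "sn (x - y) < 1"
    show "cn \<beta> (\<Gamma> x y \<tau>) \<le> max C 0 * sn (x - y) powr (\<alpha> - \<beta>) * sec_norm S \<alpha> \<tau>"
    proof (cases "\<alpha> \<in> homs S \<and> \<beta> \<in> homs S")
      case True
      then have "cn \<beta> (\<Gamma> x y \<tau>) \<le> C * sn (x - y) powr (\<alpha> - \<beta>) * sec_norm S \<alpha> \<tau>"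
        using * by (intro C) auto
      also have "\<dots> \<le> max C 0 * sn (x - y) powr (\<alpha> - \<beta>) * sec_norm S \<alpha> \<tau>"
        using sec_norm_properties(1)[OF *(3)] by (intro mult_right_mono) auto
      finally show ?thesis .
    next
      case False
      then have "cn \<beta> (\<Gamma> x y \<tau>) = 0"
      proof (cases "\<alpha> \<in> homs S")
        case True
        with False show ?thesis by (simp add: cn_outside)
      next
        case False
        then have "\<tau> = 0" using * sector_outside by auto
        then show ?thesis by (simp add: \<Gamma>_0)
      qed
      then show ?thesis using sec_norm_properties(1)[OF *(3)] by simp
    qed
  qed simp
qed

text \<open>By triangularity only components strictly above \<beta> contribute to the component
  \<beta> of the difference, and each of them is controlled by the bound on its sector.\<close>

lemma \<Gamma>_bound:
  "\<exists>C\<ge>0. \<forall>x y \<sigma> \<beta>. \<sigma> \<in> T_below S \<gamma> \<longrightarrow> sn (x - y) < 1 \<longrightarrow>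
     cn \<beta> (\<Gamma> x y \<sigma> - \<sigma>) \<le> C * (\<Sum>\<alpha>\<in>homs S \<inter> {..<\<gamma>} \<inter> {\<beta><..}. sn (x - y) powr (\<alpha> - \<beta>) * cn \<alpha> \<sigma>)"
proof -
  obtain C where C: "C \<ge> 0" "\<And>x y \<tau> \<alpha> \<beta>. \<alpha> < \<gamma> \<Longrightarrow> \<beta> < \<alpha> \<Longrightarrow> \<tau> \<in> sector S \<alpha> \<Longrightarrow> sn (x - y) < 1 \<Longrightarrow>
     cn \<beta> (\<Gamma> x y \<tau>) \<le> C * sn (x - y) powr (\<alpha> - \<beta>) * sec_norm S \<alpha> \<tau>"
    using \<Gamma>_sector_bound[of \<gamma>] by blast
  show ?thesis
  proof (intro exI[of _ C] conjI allI impI C(1))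
    fix x y \<sigma> \<beta>
    assume \<sigma>: "\<sigma> \<in> T_below S \<gamma>" and xy: "sn (x - y) < 1"
    let ?H = "homs S \<inter> {..<\<gamma>}"
    have eq: "\<Gamma> x y \<sigma> - \<sigma> = (\<Sum>\<alpha>\<in>?H. \<Gamma> x y (hc \<alpha> \<sigma>) - hc \<alpha> \<sigma>)"
      using T_below_sum_eq[OF \<sigma>] by (simp add: sum_subtractf \<Gamma>_sum[symmetric])
    have "cn \<beta> (\<Gamma> x y (hc \<alpha> \<sigma>) - hc \<alpha> \<sigma>) \<le>
        (if \<beta> < \<alpha> then C * sn (x - y) powr (\<alpha> - \<beta>) * cn \<alpha> \<sigma> else 0)" if "\<alpha> \<in> ?H" for \<alpha>
    proof (cases "\<beta> < \<alpha>")
      case True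
      then have "hc \<beta> (hc \<alpha> \<sigma>) = 0" by (simp add: hc_hc)
      then have "cn \<beta> (\<Gamma> x y (hc \<alpha> \<sigma>) - hc \<alpha> \<sigma>) = cn \<beta> (\<Gamma> x y (hc \<alpha> \<sigma>))"
        by (simp add: comp_norm_def hc_diff)
      also have "\<dots> \<le> C * sn (x - y) powr (\<alpha> - \<beta>) * sec_norm S \<alpha> (hc \<alpha> \<sigma>)"
        using True that xy by (intro C(2) hc_in_sector) auto
      finally show ?thesis using True by (simp add: sec_norm_hc)
    next
      case False
      then have "hc \<beta> (\<Gamma> x y (hc \<alpha> \<sigma>) - hc \<alpha> \<sigma>) = 0"
        using sgroup_sector[OF \<Gamma>_in_sgroup hc_in_sector[of \<alpha> \<sigma>], of \<beta>] by (simp add: hc_diff)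
      then show ?thesis using False by (simp add: cn_eq_0_iff[symmetric])
    qed
    then have "cn \<beta> (\<Gamma> x y \<sigma> - \<sigma>) \<le> (\<Sum>\<alpha>\<in>?H. if \<beta> < \<alpha> then C * sn (x - y) powr (\<alpha> - \<beta>) * cn \<alpha> \<sigma> else 0)"
      unfolding eq by (intro order_trans[OF cn_sum] sum_mono) auto
    also have "\<dots> = (\<Sum>\<alpha>\<in>?H \<inter> {\<beta><..}. C * sn (x - y) powr (\<alpha> - \<beta>) * cn \<alpha> \<sigma>)"
      by (subst sum.inter_restrict) (auto simp: finite_homs_below intro!: sum.cong)
    also have "\<dots> = C * (\<Sum>\<alpha>\<in>?H \<inter> {\<beta><..}. sn (x - y) powr (\<alpha> - \<beta>) * cn \<alpha> \<sigma>)"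
      by (simp add: sum_distrib_left mult.assoc)
    finally show "cn \<beta> (\<Gamma> x y \<sigma> - \<sigma>) \<le> C * (\<Sum>\<alpha>\<in>?H \<inter> {\<beta><..}. sn (x - y) powr (\<alpha> - \<beta>) * cn \<alpha> \<sigma>)" .
  qed
qed

section \<open>Multiplication by monomials\<close>

lemma X_in_Tbar: "X k \<in> Tbar X"
  by (simp add: span_base)

lemma linear_star: "linear (star (X k))"
  using product X_in_Tbar by (simp add: poly_product_def)

lemma star_one: "star (X (\<lambda>_. 0)) \<tau> = \<tau>"
  using product by (simp add: poly_product_def)

lemma star_sum_left:
  "star (\<Sum>k\<in>K. c k *\<^sub>R X k) \<tau> = (\<Sum>k\<in>K. c k *\<^sub>R star (X k) \<tau>)"
proof (induction K rule: infinite_finite_induct)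
  case (insert k K)
  have "(\<Sum>k\<in>K. c k *\<^sub>R X k) \<in> Tbar X"
    by (intro span_sum span_scale X_in_Tbar)
  then show ?case
    using insert product X_in_Tbar[of k] by (simp add: poly_product_def span_scale)
qed (use product span_zero[of "range X"] in \<open>simp_all add: poly_product_def, (metis scale_zero_left)+\<close>)

lemma hc_star: "hc \<beta> (star (X k) \<sigma>) = star (X k) (hc (\<beta> - real (sd k)) \<sigma>)"
proof (rule hc_eqI[where F = "(\<lambda>\<alpha>. real (sd k) + \<alpha>) ` {\<alpha>. hc \<alpha> \<sigma> \<noteq> 0}"])
  show "star (X k) (hc (\<alpha> - real (sd k)) \<sigma>) \<in> sector S \<alpha>" for \<alpha>
  proof -
    have "star (X k) (hc (\<alpha> - real (sd k)) \<sigma>) \<in> sector S (real (sd k) + (\<alpha> - real (sd k)))"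
      using product hc_in_sector unfolding poly_product_def by blast
    then show ?thesis by simp
  qed
  show "{\<alpha>. star (X k) (hc (\<alpha> - real (sd k)) \<sigma>) \<noteq> 0} \<subseteq> (\<lambda>\<alpha>. real (sd k) + \<alpha>) ` {\<alpha>. hc \<alpha> \<sigma> \<noteq> 0}"
  proof
    fix \<alpha> assume "\<alpha> \<in> {\<alpha>. star (X k) (hc (\<alpha> - real (sd k)) \<sigma>) \<noteq> 0}"
    then have "hc (\<alpha> - real (sd k)) \<sigma> \<noteq> 0"
      using linear_0[OF linear_star] by force
    then show "\<alpha> \<in> (\<lambda>\<alpha>. real (sd k) + \<alpha>) ` {\<alpha>. hc \<alpha> \<sigma> \<noteq> 0}"
      by (intro image_eqI[of _ _ "\<alpha> - real (sd k)"]) auto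
  qed
  have "star (X k) \<sigma> = star (X k) (\<Sum>\<alpha> | hc \<alpha> \<sigma> \<noteq> 0. hc \<alpha> \<sigma>)"
    using hc_sum_support[of \<sigma>] by simp
  also have "\<dots> = (\<Sum>\<alpha>\<in>(\<lambda>\<alpha>. real (sd k) + \<alpha>) ` {\<alpha>. hc \<alpha> \<sigma> \<noteq> 0}. star (X k) (hc (\<alpha> - real (sd k)) \<sigma>))"
    by (subst sum.reindex) (auto simp: linear_sum[OF linear_star])
  finally show "star (X k) \<sigma> = (\<Sum>\<alpha>\<in>(\<lambda>\<alpha>. real (sd k) + \<alpha>) ` {\<alpha>. hc \<alpha> \<sigma> \<noteq> 0}.
      star (X k) (hc (\<alpha> - real (sd k)) \<sigma>))" .
qed (simp add: finite_hc_support)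

lemma star_bound:
  assumes "finite K" "finite H"
  shows "\<exists>C\<ge>0. \<forall>k\<in>K. \<forall>\<beta>\<in>H. \<forall>\<sigma>. cn \<beta> (star (X k) \<sigma>) \<le> C * cn (\<beta> - real (sd k)) \<sigma>"
proof -
  have "\<exists>C\<ge>0. \<forall>\<sigma>. cn \<beta> (star (X k) \<sigma>) \<le> C * cn (\<beta> - real (sd k)) \<sigma>" for k \<beta>
  proof -
    obtain C where C: "\<And>\<tau>. \<tau> \<in> sector S (\<beta> - real (sd k)) \<Longrightarrow>
        sec_norm S (real (sd k) + (\<beta> - real (sd k))) (star (X k) \<tau>) \<le> C * sec_norm S (\<beta> - real (sd k)) \<tau>"
      using product unfolding poly_product_def by blast
    show ?thesis
    proof (intro exI[of _ "max C 0"] conjI allI)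
      fix \<sigma>
      have "cn \<beta> (star (X k) \<sigma>) \<le> C * cn (\<beta> - real (sd k)) \<sigma>"
        using C[OF hc_in_sector, of \<sigma>] by (simp add: comp_norm_def hc_star)
      also have "\<dots> \<le> max C 0 * cn (\<beta> - real (sd k)) \<sigma>"
        by (intro mult_right_mono cn_nonneg) simp
      finally show "cn \<beta> (star (X k) \<sigma>) \<le> max C 0 * cn (\<beta> - real (sd k)) \<sigma>" .
    qed simp
  qed
  note ex = this
  define C where "C k \<beta> = (SOME C. 0 \<le> C \<and> (\<forall>\<sigma>. cn \<beta> (star (X k) \<sigma>) \<le> C * cn (\<beta> - real (sd k)) \<sigma>))" for k \<beta>
  have C: "0 \<le> C k \<beta>" "cn \<beta> (star (X k) \<sigma>) \<le> C k \<beta> * cn (\<beta> - real (sd k)) \<sigma>" for k \<beta> \<sigma>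
    using someI_ex[OF ex[of \<beta> k]] by (simp_all add: C_def)
  let ?C = "\<Sum>k\<in>K. \<Sum>\<beta>\<in>H. C k \<beta>"
  show ?thesis
  proof (intro exI[of _ ?C] conjI ballI allI)
    fix k \<beta> \<sigma> assume "k \<in> K" "\<beta> \<in> H"
    then have "C k \<beta> \<le> (\<Sum>\<beta>\<in>H. C k \<beta>)" "(\<Sum>\<beta>\<in>H. C k \<beta>) \<le> ?C"
      using assms C(1) by (auto intro!: member_le_sum sum_nonneg)
    then have "C k \<beta> * cn (\<beta> - real (sd k)) \<sigma> \<le> ?C * cn (\<beta> - real (sd k)) \<sigma>"
      by (intro mult_right_mono cn_nonneg) simp
    with C(2)[of \<beta> k \<sigma>] show "cn \<beta> (star (X k) \<sigma>) \<le> ?C * cn (\<beta> - real (sd k)) \<sigma>"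
      by linarith
  qed (simp add: C(1) sum_nonneg)
qed

lemma multinomial_coefficient:
  assumes "l \<le> k"
  shows "(\<Prod>i\<in>UNIV. real (k i choose l i) * (h $ i) ^ (k i - l i)) / mfact k =
    mpow h (\<lambda>i. k i - l i) / (mfact l * mfact (\<lambda>i. k i - l i))"
proof -
  have "real (k i choose l i) / fact (k i) = 1 / (fact (l i) * fact (k i - l i))" for i
    using assms by (simp add: le_fun_def binomial_fact)
  then have "real (k i choose l i) * (h $ i) ^ (k i - l i) / fact (k i) =
      (h $ i) ^ (k i - l i) / (fact (l i) * fact (k i - l i))" for i
    by (metis (no_types, lifting) mult.commute mult.right_neutral times_divide_eq_right)
  then show ?thesis
    by (simp add: mfact_def mpow_def prod_dividef[symmetric] prod.distrib[symmetric])
qed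

text \<open>Division by \<open>mfact k\<close> turns the binomial coefficients into products of
  inverse factorials, the form in which canonical lifts and Taylor polynomials match.\<close>

lemma \<Gamma>_star:
  "(1 / mfact k) *\<^sub>R \<Gamma> x y (star (X k) \<tau>) =
    (\<Sum>l | l \<le> k. (mpow (x - y) (\<lambda>i. k i - l i) / (mfact l * mfact (\<lambda>i. k i - l i))) *\<^sub>R star (X l) (\<Gamma> x y \<tau>))"
proof -
  have "\<Gamma> x y (star (X k) \<tau>) = star (shifted_monomial X (x - y) k) (\<Gamma> x y \<tau>)"
  proof -
    have "\<Gamma> x y (X k) = shifted_monomial X (x - y) k"
      using canonical by (simp add: canonical_on_polynomials_def)
    then show ?thesis
      using multiplicative[rule_format, where g = "\<Gamma> x y" and k = k and \<tau> = \<tau>, OF \<Gamma>_in_sgroup] by simp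
  qed
  then have eq: "\<Gamma> x y (star (X k) \<tau>) = (\<Sum>l | l \<le> k.
      (\<Prod>i\<in>UNIV. real (k i choose l i) * ((x - y) $ i) ^ (k i - l i)) *\<^sub>R star (X l) (\<Gamma> x y \<tau>))"
    by (simp only: shifted_monomial_def star_sum_left)
  show ?thesis
    unfolding eq scaleR_right.sum scaleR_scaleR
    using multinomial_coefficient[of _ k "x - y"] by (intro sum.cong) auto
qed

section \<open>Continuity and measurability\<close>

lemma \<Gamma>_bounded:
  "\<exists>C\<ge>0. \<forall>x y \<sigma> \<beta>. \<sigma> \<in> T_below S \<gamma> \<longrightarrow> sn (x - y) < 1 \<longrightarrow>
     cn \<beta> (\<Gamma> x y \<sigma>) \<le> C * (\<Sum>\<alpha>\<in>homs S \<inter> {..<\<gamma>}. cn \<alpha> \<sigma>)"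
proof -
  obtain C where C: "C \<ge> 0" "\<And>x y \<sigma> \<beta>. \<sigma> \<in> T_below S \<gamma> \<Longrightarrow> sn (x - y) < 1 \<Longrightarrow>
     cn \<beta> (\<Gamma> x y \<sigma> - \<sigma>) \<le> C * (\<Sum>\<alpha>\<in>homs S \<inter> {..<\<gamma>} \<inter> {\<beta><..}. sn (x - y) powr (\<alpha> - \<beta>) * cn \<alpha> \<sigma>)"
    using \<Gamma>_bound[of \<gamma>] by blast
  show ?thesis
  proof (intro exI[of _ "C + 1"] conjI allI impI)
    fix x y \<sigma> \<beta> assume \<sigma>: "\<sigma> \<in> T_below S \<gamma>" and xy: "sn (x - y) < 1"
    let ?H = "homs S \<inter> {..<\<gamma>}"
    have "(\<Sum>\<alpha>\<in>?H \<inter> {\<beta><..}. sn (x - y) powr (\<alpha> - \<beta>) * cn \<alpha> \<sigma>) \<le> (\<Sum>\<alpha>\<in>?H \<inter> {\<beta><..}. 1 * cn \<alpha> \<sigma>)"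
      using xy by (intro sum_mono mult_right_mono cn_nonneg powr_le1) (auto simp: sc_norm_nonneg)
    also have "\<dots> \<le> (\<Sum>\<alpha>\<in>?H. cn \<alpha> \<sigma>)"
      by (simp, intro sum_mono2 finite_homs_below) (auto simp: cn_nonneg)
    finally have 1: "cn \<beta> (\<Gamma> x y \<sigma> - \<sigma>) \<le> C * (\<Sum>\<alpha>\<in>?H. cn \<alpha> \<sigma>)"
      using C(1) order_trans[OF C(2)[OF \<sigma> xy]] mult_left_mono by blast
    have 2: "cn \<beta> \<sigma> \<le> (\<Sum>\<alpha>\<in>?H. cn \<alpha> \<sigma>)"
    proof (cases "\<beta> \<in> ?H")
      case True
      then show ?thesis by (intro member_le_sum finite_homs_below cn_nonneg)
    next
      case False
      then have "cn \<beta> \<sigma> = 0"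
        using cn_outside hc_T_below[OF \<sigma>] by (auto simp: cn_eq_0_iff)
      then show ?thesis by (simp add: sum_nonneg cn_nonneg)
    qed
    have "cn \<beta> (\<Gamma> x y \<sigma>) \<le> cn \<beta> (\<Gamma> x y \<sigma> - \<sigma>) + cn \<beta> \<sigma>"
      using cn_add[of \<beta> "\<Gamma> x y \<sigma> - \<sigma>" \<sigma>] by simp
    with 1 2 show "cn \<beta> (\<Gamma> x y \<sigma>) \<le> (C + 1) * (\<Sum>\<alpha>\<in>?H. cn \<alpha> \<sigma>)"
      by (simp add: distrib_right)
  qed (use C in simp)
qed

lemma sn_tendsto_0: "xs \<longlonglongrightarrow> x \<Longrightarrow> (\<lambda>n. sn (xs n - x)) \<longlonglongrightarrow> 0"
proof -
  assume "xs \<longlonglongrightarrow> x"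
  then have "(\<lambda>n. xs n - x) \<longlonglongrightarrow> 0" by (simp add: LIM_zero)
  moreover have "isCont sn 0"
    using continuous_on_sc_norm[OF scaling, of UNIV] by (simp add: continuous_on_eq_continuous_at)
  ultimately have "(\<lambda>n. sn (xs n - x)) \<longlonglongrightarrow> sn 0"
    by (rule isCont_tendsto_compose[rotated])
  then show ?thesis by simp
qed

lemma \<Gamma>_limit:
  assumes xs: "xs \<longlonglongrightarrow> x"
  shows "(\<lambda>n. cn \<beta> (\<Gamma> (xs n) x \<sigma> - \<sigma>)) \<longlonglongrightarrow> 0" (is ?l)
    and "(\<lambda>n. cn \<beta> (\<Gamma> x (xs n) \<sigma> - \<sigma>)) \<longlonglongrightarrow> 0" (is ?r)
proof -
  obtain \<gamma> where \<sigma>: "\<sigma> \<in> T_below S \<gamma>" using T_below_exists by blast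
  let ?H = "homs S \<inter> {..<\<gamma>} \<inter> {\<beta><..}"
  obtain C where C: "C \<ge> 0" "\<And>x y \<sigma> \<beta>. \<sigma> \<in> T_below S \<gamma> \<Longrightarrow> sn (x - y) < 1 \<Longrightarrow>
     cn \<beta> (\<Gamma> x y \<sigma> - \<sigma>) \<le> C * (\<Sum>\<alpha>\<in>homs S \<inter> {..<\<gamma>} \<inter> {\<beta><..}. sn (x - y) powr (\<alpha> - \<beta>) * cn \<alpha> \<sigma>)"
    using \<Gamma>_bound[of \<gamma>] by blast
  have "(\<lambda>n. sn (xs n - x) powr (\<alpha> - \<beta>)) \<longlonglongrightarrow> 0" if "\<alpha> \<in> ?H" for \<alpha>
    using that tendsto_powr'[OF sn_tendsto_0[OF xs] tendsto_const[of "\<alpha> - \<beta>"]]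
    by (auto simp: sc_norm_nonneg)
  then have "(\<lambda>n. C * (\<Sum>\<alpha>\<in>?H. sn (xs n - x) powr (\<alpha> - \<beta>) * cn \<alpha> \<sigma>)) \<longlonglongrightarrow> C * (\<Sum>\<alpha>\<in>?H. 0 * cn \<alpha> \<sigma>)"
    by (intro tendsto_intros) auto
  then have lim: "(\<lambda>n. C * (\<Sum>\<alpha>\<in>?H. sn (xs n - x) powr (\<alpha> - \<beta>) * cn \<alpha> \<sigma>)) \<longlonglongrightarrow> 0" by simp
  have ev: "eventually (\<lambda>n. sn (xs n - x) < 1) sequentially"
    using order_tendstoD(2)[OF sn_tendsto_0[OF xs]] by simp
  show ?l
    using ev by (intro Lim_null_comparison[OF _ lim]) (auto elim!: eventually_mono simp: cn_nonneg intro: C(2)[OF \<sigma>])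
  have "eventually (\<lambda>n. norm (cn \<beta> (\<Gamma> x (xs n) \<sigma> - \<sigma>)) \<le>
      C * (\<Sum>\<alpha>\<in>?H. sn (xs n - x) powr (\<alpha> - \<beta>) * cn \<alpha> \<sigma>)) sequentially"
    using ev
  proof eventually_elim
    case (elim n)
    then have "sn (x - xs n) < 1" by (simp add: sc_norm_minus_commute)
    from C(2)[OF \<sigma> this, of \<beta>] show ?case
      by (simp add: cn_nonneg sc_norm_minus_commute[of s x])
  qed
  then show ?r by (rule Lim_null_comparison[OF _ lim])
qed

text \<open>\<open>\<Gamma> (xs n) (ys n)\<close> factors through x and y. The outer factors
  converge on each fixed vector only; \<open>\<Gamma>_bounded\<close> carries the error of the
  factor from \<open>ys n\<close> to y through the other two.\<close>

lemma \<Gamma>_limit2: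
  assumes xs: "xs \<longlonglongrightarrow> x" and ys: "ys \<longlonglongrightarrow> y" and xy: "sn (x - y) < 1"
  shows "(\<lambda>n. cn \<beta> (\<Gamma> (xs n) (ys n) \<sigma> - \<Gamma> x y \<sigma>)) \<longlonglongrightarrow> 0"
proof -
  obtain \<gamma> where \<sigma>: "\<sigma> \<in> T_below S \<gamma>" using T_below_exists by blast
  let ?H = "homs S \<inter> {..<\<gamma>}"
  obtain C where C: "C \<ge> 0" "\<And>x y \<sigma> \<beta>. \<sigma> \<in> T_below S \<gamma> \<Longrightarrow> sn (x - y) < 1 \<Longrightarrow>
     cn \<beta> (\<Gamma> x y \<sigma>) \<le> C * (\<Sum>\<alpha>\<in>?H. cn \<alpha> \<sigma>)"
    using \<Gamma>_bounded[of \<gamma>] by blast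
  have split: "\<Gamma> (xs n) (ys n) \<sigma> - \<Gamma> x y \<sigma> =
      (\<Gamma> (xs n) x (\<Gamma> x y \<sigma>) - \<Gamma> x y \<sigma>) + \<Gamma> (xs n) x (\<Gamma> x y (\<Gamma> y (ys n) \<sigma> - \<sigma>))" for n
    by (simp add: \<Gamma>_diff \<Gamma>_compose)
  have lim: "(\<lambda>n. cn \<beta> (\<Gamma> (xs n) x (\<Gamma> x y \<sigma>) - \<Gamma> x y \<sigma>) +
      C * (\<Sum>\<alpha>\<in>?H. C * (\<Sum>\<alpha>'\<in>?H. cn \<alpha>' (\<Gamma> y (ys n) \<sigma> - \<sigma>)))) \<longlonglongrightarrow> 0 + C * (\<Sum>\<alpha>\<in>?H. C * (\<Sum>\<alpha>'\<in>?H. 0))"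
    by (intro tendsto_intros \<Gamma>_limit xs ys)
  have ev: "eventually (\<lambda>n. sn (xs n - x) < 1) sequentially"
    using order_tendstoD(2)[OF sn_tendsto_0[OF xs]] by simp
  show ?thesis
  proof (rule Lim_null_comparison)
    show "eventually (\<lambda>n. norm (cn \<beta> (\<Gamma> (xs n) (ys n) \<sigma> - \<Gamma> x y \<sigma>)) \<le>
      cn \<beta> (\<Gamma> (xs n) x (\<Gamma> x y \<sigma>) - \<Gamma> x y \<sigma>) +
      C * (\<Sum>\<alpha>\<in>?H. C * (\<Sum>\<alpha>'\<in>?H. cn \<alpha>' (\<Gamma> y (ys n) \<sigma> - \<sigma>)))) sequentially"
      using ev
    proof eventually_elim
      case (elim n)
      let ?w = "\<Gamma> y (ys n) \<sigma> - \<sigma>"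
      have w: "?w \<in> T_below S \<gamma>"
        by (intro subspace_diff[OF subspace_T_below] \<Gamma>_T_below \<sigma>)
      have "cn \<beta> (\<Gamma> (xs n) x (\<Gamma> x y ?w)) \<le> C * (\<Sum>\<alpha>\<in>?H. cn \<alpha> (\<Gamma> x y ?w))"
        by (intro C(2) \<Gamma>_T_below w elim)
      also have "\<dots> \<le> C * (\<Sum>\<alpha>\<in>?H. C * (\<Sum>\<alpha>'\<in>?H. cn \<alpha>' ?w))"
        by (intro mult_left_mono sum_mono C w xy)
      finally show ?case
        using cn_add[of \<beta> "\<Gamma> (xs n) x (\<Gamma> x y \<sigma>) - \<Gamma> x y \<sigma>" "\<Gamma> (xs n) x (\<Gamma> x y ?w)"]
        unfolding split by (simp add: cn_nonneg)
    qed
  qed (use lim in simp)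
qed

lemma cn_abs_diff: "\<bar>cn \<beta> \<sigma> - cn \<beta> \<tau>\<bar> \<le> cn \<beta> (\<sigma> - \<tau>)"
  using cn_add[of \<beta> "\<sigma> - \<tau>" \<tau>] cn_add[of \<beta> "\<tau> - \<sigma>" \<sigma>] cn_minus_commute[of \<beta> \<sigma> \<tau>] by simp

lemma continuous_on_cn_\<Gamma>:
  "continuous_on {z. sn (fst z - snd z) < 1} (\<lambda>z. cn \<beta> (v - \<Gamma> (fst z) (snd z) w))"
  unfolding continuous_on_sequentially comp_def
proof (intro allI ballI impI, elim conjE)
  fix zs :: "nat \<Rightarrow> (real^'d) \<times> (real^'d)" and z
  assume z: "z \<in> {z. sn (fst z - snd z) < 1}" and zs: "zs \<longlonglongrightarrow> z"
  let ?e = "\<lambda>n. cn \<beta> (\<Gamma> (fst (zs n)) (snd (zs n)) w - \<Gamma> (fst z) (snd z) w)"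
  have lim: "?e \<longlonglongrightarrow> 0"
    using z by (intro \<Gamma>_limit2 tendsto_fst tendsto_snd zs) auto
  have "norm (cn \<beta> (v - \<Gamma> (fst (zs n)) (snd (zs n)) w) - cn \<beta> (v - \<Gamma> (fst z) (snd z) w)) \<le> ?e n" for n
    using cn_abs_diff[of \<beta> "v - \<Gamma> (fst (zs n)) (snd (zs n)) w" "v - \<Gamma> (fst z) (snd z) w"]
    by (simp add: cn_minus_commute)
  then have "(\<lambda>n. cn \<beta> (v - \<Gamma> (fst (zs n)) (snd (zs n)) w) - cn \<beta> (v - \<Gamma> (fst z) (snd z) w)) \<longlonglongrightarrow> 0"
    by (intro Lim_null_comparison[OF _ lim]) auto
  then show "(\<lambda>n. cn \<beta> (v - \<Gamma> (fst (zs n)) (snd (zs n)) w)) \<longlonglongrightarrow> cn \<beta> (v - \<Gamma> (fst z) (snd z) w)"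
    by (simp add: LIM_zero_iff)
qed

text \<open>The simple functions in \<open>T_measurable\<close> may leave
  \<open>T_below S \<gamma>\<close>, where the bounds on \<Gamma> are stated. Projecting them keeps
  them simple and their limit unchanged.\<close>

lemma T_measurable_simple_in_T_below:
  assumes "T_measurable S \<gamma> f" and f: "\<And>x. f x \<in> T_below S \<gamma>"
  obtains u where "\<And>n. simple_function borel (u n)" "\<And>n x. u n x \<in> T_below S \<gamma>"
    "\<And>x \<alpha>. (\<lambda>n. cn \<alpha> (u n x - f x)) \<longlonglongrightarrow> 0"
proof -
  obtain u where u: "\<And>n. simple_function borel (u n)"
    "\<And>x \<alpha>. \<alpha> \<in> homs S \<inter> {..<\<gamma>} \<Longrightarrow> (\<lambda>n. cn \<alpha> (u n x - f x)) \<longlonglongrightarrow> 0"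
    using assms(1) by (auto simp: T_measurable_def)
  have eq: "proj_below S \<gamma> (u n x) - f x = proj_below S \<gamma> (u n x - f x)" for n x
    by (simp add: linear_diff[OF linear_proj] proj_T_below[OF f])
  show thesis
  proof
    show "simple_function borel (\<lambda>x. proj_below S \<gamma> (u n x))" for n
      using simple_function_compose1[OF u(1)] .
    show "proj_below S \<gamma> (u n x) \<in> T_below S \<gamma>" for n x
      by (rule proj_in_T_below)
    show "(\<lambda>n. cn \<alpha> (proj_below S \<gamma> (u n x) - f x)) \<longlonglongrightarrow> 0" for x \<alpha>
      using u(2)[of \<alpha> x] cn_outside[of \<alpha>] unfolding eq cn_proj by (cases "\<alpha> \<in> homs S"; cases "\<alpha> < \<gamma>") auto
  qed
qed

lemma T_measurable_diff:
  assumes "T_measurable S \<gamma> f" "T_measurable S \<gamma> g"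
  shows "T_measurable S \<gamma> (\<lambda>x. f x - g x)"
proof -
  obtain u where u: "\<And>n. simple_function borel (u n)"
    "\<And>x \<alpha>. \<alpha> \<in> homs S \<inter> {..<\<gamma>} \<Longrightarrow> (\<lambda>n. cn \<alpha> (u n x - f x)) \<longlonglongrightarrow> 0"
    using assms(1) unfolding T_measurable_def by blast
  obtain v where v: "\<And>n. simple_function borel (v n)"
    "\<And>x \<alpha>. \<alpha> \<in> homs S \<inter> {..<\<gamma>} \<Longrightarrow> (\<lambda>n. cn \<alpha> (v n x - g x)) \<longlonglongrightarrow> 0"
    using assms(2) unfolding T_measurable_def by blast
  show ?thesis
    unfolding T_measurable_def
  proof (intro exI[of _ "\<lambda>n x. u n x - v n x"] conjI allI ballI)
    show "simple_function borel (\<lambda>x. u n x - v n x)" for n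
      using simple_function_compose2[OF u(1) v(1)] .
    fix x \<alpha> assume \<alpha>: "\<alpha> \<in> homs S \<inter> {..<\<gamma>}"
    have "(\<lambda>n. cn \<alpha> (u n x - f x) + cn \<alpha> (v n x - g x)) \<longlonglongrightarrow> 0 + 0"
      by (intro tendsto_intros u v \<alpha>)
    then have lim: "(\<lambda>n. cn \<alpha> (u n x - f x) + cn \<alpha> (v n x - g x)) \<longlonglongrightarrow> 0" by simp
    have "norm (cn \<alpha> (u n x - v n x - (f x - g x))) \<le> cn \<alpha> (u n x - f x) + cn \<alpha> (v n x - g x)" for n
    proof -
      have "u n x - v n x - (f x - g x) = (u n x - f x) - (v n x - g x)" by simp
      then show ?thesis
        using cn_diff[of \<alpha> "u n x - f x" "v n x - g x"] by (simp only: real_norm_def abs_of_nonneg[OF cn_nonneg])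
    qed
    then show "(\<lambda>n. cn \<alpha> (u n x - v n x - (f x - g x))) \<longlonglongrightarrow> 0"
      by (intro Lim_null_comparison[OF _ lim] always_eventually allI)
  qed
qed

text \<open>The cut-off makes \<open>gap\<close> measurable on the whole space: a model controls \<open>\<Gamma> x y\<close> only at distances
  below \<open>1\<close>.\<close>

definition gap :: "(real^'d \<Rightarrow> 'v) \<Rightarrow> real \<Rightarrow> real^'d \<Rightarrow> real^'d \<Rightarrow> real" where
  "gap f \<beta> x y = (if sn (x - y) < 1 then cn \<beta> (f x - \<Gamma> x y (f y)) else 0)"

lemma gap_nonneg: "0 \<le> gap f \<beta> x y"
  by (simp add: gap_def cn_nonneg)

text \<open>For simple functions the gap is a finite sum, over pairs of values, of indicators times
  a function continuous on the pairs of points at distance below 1. The general case is a pointwise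
  limit, since there \<Gamma> is bounded on \<open>T_below S \<gamma>\<close>.\<close>

lemma borel_measurable_gap:
  assumes "T_measurable S \<gamma> f" "\<And>x. f x \<in> T_below S \<gamma>"
  shows "(\<lambda>z. gap f \<beta> (fst z) (snd z)) \<in> borel_measurable (borel \<Otimes>\<^sub>M borel)"
proof -
  obtain u where u: "\<And>n. simple_function borel (u n)" "\<And>n x. u n x \<in> T_below S \<gamma>"
    "\<And>x \<alpha>. (\<lambda>n. cn \<alpha> (u n x - f x)) \<longlonglongrightarrow> 0"
    using T_measurable_simple_in_T_below[OF assms] by blast
  obtain C where C: "C \<ge> 0" "\<And>x y \<sigma> \<beta>. \<sigma> \<in> T_below S \<gamma> \<Longrightarrow> sn (x - y) < 1 \<Longrightarrow>
     cn \<beta> (\<Gamma> x y \<sigma>) \<le> C * (\<Sum>\<alpha>\<in>homs S \<inter> {..<\<gamma>}. cn \<alpha> \<sigma>)"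
    using \<Gamma>_bounded[of \<gamma>] by blast
  let ?D = "{z :: (real^'d) \<times> (real^'d). sn (fst z - snd z) < 1}"
  have D: "?D \<in> sets borel"
  proof -
    have "continuous_on UNIV (\<lambda>z::(real^'d) \<times> (real^'d). sn (fst z - snd z))"
      by (rule continuous_on_compose2[OF continuous_on_sc_norm[OF scaling, of UNIV]]) (auto intro!: continuous_intros)
    then have "open ?D" by (intro open_Collect_less continuous_intros)
    then show ?thesis by simp
  qed
  have meas: "(\<lambda>z. gap (u n) \<beta> (fst z) (snd z)) \<in> borel_measurable (borel \<Otimes>\<^sub>M borel)" for n
  proof -
    have fin: "finite (range (u n))"
      using u(1)[of n] by (simp add: simple_function_def)
    have pre: "u n -` {v} \<in> sets borel" for v
    proof (cases "v \<in> range (u n)")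
      case True
      with u(1)[of n] show ?thesis by (auto simp: simple_function_def)
    next
      case False
      then have "u n -` {v} = {}" by auto
      then show ?thesis by simp
    qed
    have "(\<lambda>z. indicator ?D z *\<^sub>R cn \<beta> (v - \<Gamma> (fst z) (snd z) w)) \<in> borel_measurable borel" for v w
      by (rule borel_measurable_continuous_on_indicator[OF D continuous_on_cn_\<Gamma>])
    then have [measurable]: "(\<lambda>z. indicator ?D z *\<^sub>R cn \<beta> (v - \<Gamma> (fst z) (snd z) w)) \<in> borel_measurable (borel \<Otimes>\<^sub>M borel)" for v w
      by (simp only: borel_prod)
    note [measurable] = pre
    have "gap (u n) \<beta> (fst z) (snd z) = (\<Sum>v\<in>range (u n). \<Sum>w\<in>range (u n).
        indicator (u n -` {v}) (fst z) * (indicator (u n -` {w}) (snd z) *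
          (indicator ?D z *\<^sub>R cn \<beta> (v - \<Gamma> (fst z) (snd z) w))))" for z
    proof -
      define G where "G v w = indicator ?D z *\<^sub>R cn \<beta> (v - \<Gamma> (fst z) (snd z) w)" for v w
      have "(\<Sum>v\<in>range (u n). \<Sum>w\<in>range (u n).
        indicator (u n -` {v}) (fst z) * (indicator (u n -` {w}) (snd z) * G v w)) =
        (\<Sum>v\<in>range (u n). if v = u n (fst z) then \<Sum>w\<in>range (u n). if w = u n (snd z) then G v w else 0 else 0)"
        by (intro sum.cong refl) (auto simp: indicator_def intro!: sum.cong)
      also have "\<dots> = indicator ?D z *\<^sub>R cn \<beta> (u n (fst z) - \<Gamma> (fst z) (snd z) (u n (snd z)))"
        using fin by (simp add: G_def)
      finally show ?thesis unfolding G_def by (simp add: gap_def indicator_def)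
    qed
    then show ?thesis by (simp only:) measurable
  qed
  show ?thesis
  proof (rule borel_measurable_LIMSEQ_real[OF _ meas])
    fix z :: "(real^'d) \<times> (real^'d)"
    obtain x y where z: "z = (x, y)" by (cases z)
    show "(\<lambda>n. gap (u n) \<beta> (fst z) (snd z)) \<longlonglongrightarrow> gap f \<beta> (fst z) (snd z)"
    proof (cases "sn (x - y) < 1")
      case True
      have lim: "(\<lambda>n. cn \<beta> (u n x - f x) + C * (\<Sum>\<alpha>\<in>homs S \<inter> {..<\<gamma>}. cn \<alpha> (u n y - f y))) \<longlonglongrightarrow>
          0 + C * (\<Sum>\<alpha>\<in>homs S \<inter> {..<\<gamma>}. 0)"
        by (intro tendsto_intros u(3))
      have le: "norm (gap (u n) \<beta> x y - gap f \<beta> x y) \<le>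
          cn \<beta> (u n x - f x) + C * (\<Sum>\<alpha>\<in>homs S \<inter> {..<\<gamma>}. cn \<alpha> (u n y - f y))" for n
      proof -
        have "u n y - f y \<in> T_below S \<gamma>"
          by (intro subspace_diff[OF subspace_T_below] u assms)
        from C(2)[OF this True, of \<beta>]
        have "cn \<beta> (\<Gamma> x y (u n y - f y)) \<le> C * (\<Sum>\<alpha>\<in>homs S \<inter> {..<\<gamma>}. cn \<alpha> (u n y - f y))" .
        moreover have eq: "(u n x - \<Gamma> x y (u n y)) - (f x - \<Gamma> x y (f y)) = (u n x - f x) - \<Gamma> x y (u n y - f y)"
          by (simp add: \<Gamma>_diff)
        moreover have "\<bar>cn \<beta> (u n x - \<Gamma> x y (u n y)) - cn \<beta> (f x - \<Gamma> x y (f y))\<bar>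
            \<le> cn \<beta> ((u n x - f x) - \<Gamma> x y (u n y - f y))"
          unfolding eq[symmetric] by (rule cn_abs_diff)
        ultimately show ?thesis
          using True cn_diff[of \<beta> "u n x - f x" "\<Gamma> x y (u n y - f y)"] by (simp add: gap_def)
      qed
      have "(\<lambda>n. gap (u n) \<beta> x y - gap f \<beta> x y) \<longlonglongrightarrow> 0"
        using lim by (intro Lim_null_comparison[OF always_eventually[OF allI[OF le]]]) simp
      then show ?thesis by (simp add: z LIM_zero_iff)
    qed (simp add: z gap_def)
  qed
qed

lemma borel_measurable_cn:
  assumes "T_measurable S \<gamma> f" "\<And>x. f x \<in> T_below S \<gamma>"
  shows "(\<lambda>x. cn \<beta> (f x)) \<in> borel_measurable borel"
proof -
  obtain u where u: "\<And>n. simple_function borel (u n)" "\<And>n x. u n x \<in> T_below S \<gamma>"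
    "\<And>x \<alpha>. (\<lambda>n. cn \<alpha> (u n x - f x)) \<longlonglongrightarrow> 0"
    using T_measurable_simple_in_T_below[OF assms] by blast
  show ?thesis
  proof (rule borel_measurable_LIMSEQ_real)
    show "(\<lambda>x. cn \<beta> (u n x)) \<in> borel_measurable borel" for n
      using simple_function_compose1[OF u(1)] by (rule borel_measurable_simple_function)
    fix x
    have "(\<lambda>n. cn \<beta> (u n x) - cn \<beta> (f x)) \<longlonglongrightarrow> 0"
      by (rule Lim_null_comparison[OF _ u(3)[of \<beta> x]]) (simp add: cn_abs_diff)
    then show "(\<lambda>n. cn \<beta> (u n x)) \<longlonglongrightarrow> cn \<beta> (f x)"
      by (simp add: LIM_zero_iff)
  qed
qed

text \<open>f is evaluated at grid points of mesh \<open>1 / Suc n\<close>; clamping the grid to the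
  cube of half-width n leaves finitely many values.\<close>

lemma T_measurable_if_continuous:
  fixes f :: "real^'d \<Rightarrow> 'v"
  assumes cont: "\<And>xs x \<alpha>. xs \<longlonglongrightarrow> x \<Longrightarrow> (\<lambda>n. cn \<alpha> (f (xs n) - f x)) \<longlonglongrightarrow> 0"
  shows "T_measurable S \<gamma> f"
proof -
  define grid :: "nat \<Rightarrow> real^'d \<Rightarrow> int^'d" where
    "grid n x = (\<chi> i. max (- int (n * Suc n)) (min (int (n * Suc n)) \<lfloor>real (Suc n) * x $ i\<rfloor>))" for n x
  define pt :: "nat \<Rightarrow> real^'d \<Rightarrow> real^'d" where
    "pt n x = (\<chi> i. real_of_int (grid n x $ i) / real (Suc n))" for n x
  have simple: "simple_function borel (grid n)" for n
    unfolding simple_function_def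
  proof (intro conjI ballI)
    have "range (grid n) \<subseteq> {z. \<forall>i. z $ i \<in> {- int (n * Suc n)..int (n * Suc n)}}"
      by (auto simp: grid_def)
    from finite_subset[OF this finite_vec_box] show "finite (grid n ` space borel)"
      by simp
    fix z
    have "grid n -` {z} \<inter> space borel = {x \<in> space borel. \<forall>i\<in>UNIV.
        max (- int (n * Suc n)) (min (int (n * Suc n)) \<lfloor>real (Suc n) * x $ i\<rfloor>) = z $ i}"
      by (auto simp: grid_def vec_eq_iff)
    also have "\<dots> \<in> sets borel"
      by measurable
    finally show "grid n -` {z} \<inter> space borel \<in> sets borel" .
  qed
  have pt_lim: "(\<lambda>n. pt n x) \<longlonglongrightarrow> x" for x
  proof (rule vec_tendstoI)
    fix i
    obtain m where m: "\<bar>x $ i\<bar> + 1 \<le> real m" using real_arch_simple by blast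
    have "norm (pt n x $ i - x $ i) \<le> 1 / real (Suc n)" if "m \<le> n" for n
    proof -
      let ?t = "real (Suc n) * x $ i"
      have "\<bar>?t\<bar> + 1 \<le> real (Suc n) * (\<bar>x $ i\<bar> + 1)"
        by (simp add: abs_mult distrib_left)
      also have "\<dots> \<le> real (Suc n) * real n"
        using m that by (intro mult_left_mono) auto
      finally have t: "\<bar>?t\<bar> + 1 \<le> real (n * Suc n)" by (simp only: of_nat_mult mult.commute)
      have le: "real_of_int \<lfloor>?t\<rfloor> \<le> ?t" "?t \<le> real_of_int \<lfloor>?t\<rfloor> + 1"
        by linarith+
      with t have "real_of_int \<lfloor>?t\<rfloor> \<le> real_of_int (int (n * Suc n))"
        "real_of_int (- int (n * Suc n)) \<le> real_of_int \<lfloor>?t\<rfloor>"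
        unfolding of_int_minus of_int_of_nat_eq by linarith+
      then have "grid n x $ i = \<lfloor>?t\<rfloor>"
        unfolding of_int_le_iff by (simp add: grid_def)
      then have "pt n x $ i - x $ i = (real_of_int \<lfloor>?t\<rfloor> - ?t) / real (Suc n)"
        by (simp add: pt_def diff_divide_distrib)
      moreover have "\<bar>real_of_int \<lfloor>?t\<rfloor> - ?t\<bar> \<le> 1" using le by linarith
      ultimately show ?thesis
        by (simp add: abs_divide divide_right_mono)
    qed
    then have "eventually (\<lambda>n. norm (pt n x $ i - x $ i) \<le> 1 / real (Suc n)) sequentially"
      using eventually_sequentially by blast
    then have "(\<lambda>n. pt n x $ i - x $ i) \<longlonglongrightarrow> 0"
      by (rule Lim_null_comparison[OF _ LIMSEQ_inverse_real_of_nat[unfolded inverse_eq_divide]])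
    then show "(\<lambda>n. pt n x $ i) \<longlonglongrightarrow> x $ i" by (simp add: LIM_zero_iff)
  qed
  show ?thesis
    unfolding T_measurable_def
  proof (intro exI[of _ "\<lambda>n x. f (pt n x)"] conjI allI ballI)
    show "simple_function borel (\<lambda>x. f (pt n x))" for n
      using simple_function_compose1[OF simple[of n], of "\<lambda>z. f (\<chi> i. real_of_int (z $ i) / real (Suc n))"]
      by (simp add: pt_def[abs_def])
    show "(\<lambda>n. cn \<alpha> (f (pt n x) - f x)) \<longlonglongrightarrow> 0" for x \<alpha>
      using cont[OF pt_lim] .
  qed
qed

end

section \<open>The approximating modelled distributions\<close>

lemma abs_divide_mfact_le: "\<bar>a / mfact k\<bar> \<le> \<bar>a\<bar>"
proof -
  have "\<bar>a\<bar> / mfact k \<le> \<bar>a\<bar> / 1"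
    by (intro divide_left_mono mfact_ge_1) (use mfact_pos[of k] in auto)
  then show ?thesis
    using mfact_pos[of k] by (simp add: abs_divide)
qed

context modelled_setting
begin

text \<open>The sum of lifts before projection, truncated only at scaled degree N. It is kept apart
  because \<Gamma> respects the product but does not commute with the projection below
  \<gamma>.\<close>

definition lift_sum :: "nat \<Rightarrow> real \<Rightarrow> (int^'d \<Rightarrow> real^'d) \<Rightarrow> (real^'d \<Rightarrow> 'v) \<Rightarrow> real^'d \<Rightarrow> 'v" where
  "lift_sum N \<delta> y f x = (\<Sum>z\<in>near_cells s \<delta> x. \<Sum>k | sd k < N.
     (cell_bump s \<delta> z k x / mfact k) *\<^sub>R star (X k) (\<Gamma> x (y z) (f (y z))))"

definition approximant :: "real \<Rightarrow> nat \<Rightarrow> real \<Rightarrow> (int^'d \<Rightarrow> real^'d) \<Rightarrow> (real^'d \<Rightarrow> 'v) \<Rightarrow> real^'d \<Rightarrow> 'v" where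
  "approximant \<gamma> N \<delta> y f x = proj_below S \<gamma> (lift_sum N \<delta> y f x)"

text \<open>This weighted norm is invariant under rescaling to length scale \<open>\<delta>\<close>, which makes the estimates
  below uniform in \<open>\<delta>\<close>.\<close>

definition scaled_norm :: "real \<Rightarrow> real \<Rightarrow> 'v \<Rightarrow> real" where
  "scaled_norm \<gamma> \<delta> \<sigma> = (\<Sum>\<beta>\<in>homs S \<inter> {..<\<gamma>}. \<delta> powr (\<beta> - \<gamma>) * cn \<beta> \<sigma>)"

lemma scaled_norm_nonneg: "0 \<le> scaled_norm \<gamma> \<delta> \<sigma>"
  by (simp add: scaled_norm_def sum_nonneg cn_nonneg)

lemma cn_le_scaled_norm:
  assumes \<sigma>: "\<sigma> \<in> T_below S \<gamma>" and \<delta>: "0 < \<delta>"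
  shows "cn \<beta> \<sigma> \<le> \<delta> powr (\<gamma> - \<beta>) * scaled_norm \<gamma> \<delta> \<sigma>"
proof (cases "\<beta> \<in> homs S \<inter> {..<\<gamma>}")
  case True
  have "\<delta> powr (\<beta> - \<gamma>) * cn \<beta> \<sigma> \<le> scaled_norm \<gamma> \<delta> \<sigma>"
    unfolding scaled_norm_def
    by (rule member_le_sum[OF True]) (simp_all add: cn_nonneg finite_homs_below)
  then have "\<delta> powr (\<gamma> - \<beta>) * (\<delta> powr (\<beta> - \<gamma>) * cn \<beta> \<sigma>) \<le> \<delta> powr (\<gamma> - \<beta>) * scaled_norm \<gamma> \<delta> \<sigma>"
    by (intro mult_left_mono) auto
  moreover have "\<delta> powr (\<gamma> - \<beta>) * \<delta> powr (\<beta> - \<gamma>) = 1"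
    using \<delta> by (simp add: powr_add[symmetric])
  ultimately show ?thesis by (simp add: mult.assoc[symmetric])
next
  case False
  then have "cn \<beta> \<sigma> = 0"
    using cn_outside hc_T_below[OF \<sigma>] by (auto simp: cn_eq_0_iff)
  then show ?thesis by (simp add: scaled_norm_nonneg)
qed

lemma near_cells_if:
  assumes "\<And>i. \<bar>cell_coord s \<delta> z x $ i\<bar> < 1"
  shows "z \<in> near_cells s \<delta> x"
proof -
  have "\<bar>cell_coord s \<delta> z x $ i\<bar> \<le> 2" for i
    using assms[of i] by linarith
  then show ?thesis by (simp add: near_cells_def)
qed

lemma near_cells_shift:
  assumes \<delta>: "0 < \<delta>" and h: "sn h \<le> \<delta>" and z: "\<And>i. \<bar>cell_coord s \<delta> z x $ i\<bar> < 1"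
  shows "z \<in> near_cells s \<delta> (x + h)"
proof -
  have "\<bar>cell_coord s \<delta> z (x + h) $ i\<bar> \<le> 2" for i
  proof -
    have "\<bar>h $ i\<bar> \<le> sn h ^ s i" by (rule component_le_sc_norm[OF scaling])
    also have "\<dots> \<le> \<delta> ^ s i" using h by (intro power_mono) (auto simp: sc_norm_nonneg)
    finally have "\<bar>h $ i / \<delta> ^ s i\<bar> \<le> 1" using \<delta> by (simp add: abs_divide divide_le_eq)
    moreover have "cell_coord s \<delta> z (x + h) $ i = cell_coord s \<delta> z x $ i + h $ i / \<delta> ^ s i"
      by (simp add: cell_coord_def add_divide_distrib)
    ultimately show ?thesis using z[of i] by linarith
  qed
  then show ?thesis by (simp add: near_cells_def)
qed

lemma sum_cell_bump:
  assumes "finite Z" "\<And>z. (\<forall>i. \<bar>cell_coord s \<delta> z x $ i\<bar> < 1) \<Longrightarrow> z \<in> Z"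
  shows "(\<Sum>z\<in>Z. cell_bump s \<delta> z k x) = (if k = (\<lambda>_. 0) then 1 else 0)"
proof -
  have "(\<Sum>z\<in>Z. cell_bump s \<delta> z k x) = (\<Sum>z\<in>Z. tents k (cell_coord s \<delta> z x)) / \<delta> ^ sd k"
    by (simp add: cell_bump_def sum_divide_distrib)
  also have "\<dots> = (if k = (\<lambda>_. 0) then 1 else 0)"
    using sum_tents[OF assms] by (simp add: sc_deg_def)
  finally show ?thesis .
qed

text \<open>Inactive cells contribute 0, so the sum at x may be taken over the cells near another
  point.\<close>

lemma lift_sum_eq:
  assumes Z: "finite Z" "\<And>z. (\<forall>i. \<bar>cell_coord s \<delta> z x $ i\<bar> < 1) \<Longrightarrow> z \<in> Z"
  shows "lift_sum N \<delta> y f x = (\<Sum>z\<in>Z. \<Sum>k | sd k < N.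
     (cell_bump s \<delta> z k x / mfact k) *\<^sub>R star (X k) (\<Gamma> x (y z) (f (y z))))"
    (is "_ = sum ?g Z")
proof -
  have 0: "?g z = 0" if "\<not> (\<forall>i. \<bar>cell_coord s \<delta> z x $ i\<bar> < 1)" for z
    using that cell_bump_nonzero_imp[of s \<delta> z _ x] by (intro sum.neutral) auto
  have "lift_sum N \<delta> y f x = sum ?g (near_cells s \<delta> x \<inter> Z)"
    unfolding lift_sum_def using 0 Z near_cells_if
    by (intro sum.mono_neutral_right finite_near_cells) blast+
  also have "\<dots> = sum ?g Z"
    using 0 near_cells_if by (intro sum.mono_neutral_left Z) blast+
  finally show ?thesis .
qed

text \<open>The bumps sum to 1 and their derivatives to 0, so the lifts add up to
  \<open>X (\<lambda>_. 0)\<close>, the unit of the product; \<open>0 < N\<close> keeps this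
  multi-index in the range.\<close>

lemma sum_star_unit:
  assumes Z: "finite Z" "\<And>z. (\<forall>i. \<bar>cell_coord s \<delta> z x $ i\<bar> < 1) \<Longrightarrow> z \<in> Z" and N: "0 < N"
  shows "(\<Sum>z\<in>Z. \<Sum>k | sd k < N. (cell_bump s \<delta> z k x / mfact k) *\<^sub>R star (X k) \<sigma>) = \<sigma>"
proof -
  have "(\<Sum>z\<in>Z. \<Sum>k | sd k < N. (cell_bump s \<delta> z k x / mfact k) *\<^sub>R star (X k) \<sigma>) =
      (\<Sum>k | sd k < N. ((\<Sum>z\<in>Z. cell_bump s \<delta> z k x) / mfact k) *\<^sub>R star (X k) \<sigma>)"
    by (subst sum.swap) (simp only: scaleR_sum_left sum_divide_distrib)
  also have "\<dots> = (\<Sum>k | sd k < N. if k = (\<lambda>_. 0) then \<sigma> else 0)"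
  proof (intro sum.cong refl)
    fix k
    have "(\<Sum>z\<in>Z. cell_bump s \<delta> z k x) = (if k = (\<lambda>_. 0) then 1 else 0)"
      by (rule sum_cell_bump[OF Z])
    then show "((\<Sum>z\<in>Z. cell_bump s \<delta> z k x) / mfact k) *\<^sub>R star (X k) \<sigma> = (if k = (\<lambda>_. 0) then \<sigma> else 0)"
      by (cases "k = (\<lambda>_. 0)") (simp_all add: star_one mfact_def)
  qed
  also have "\<dots> = \<sigma>"
    using N finite_sc_deg_less[OF scaling, of N] by (simp add: sc_deg_def)
  finally show ?thesis .
qed

text \<open>The product with \<open>X k\<close> reads the component of \<sigma> that lies lower by
  \<open>sd k\<close>, for which the bound by the weighted norm carries an additional
  \<open>\<delta> ^ sd k\<close>. This factor cancels the \<open>1 / \<delta> ^ sd k\<close> in the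
  derivative of the bump.\<close>

lemma cn_star_le_scaled_norm:
  assumes "finite H"
  shows "\<exists>C\<ge>0. \<forall>\<delta> \<sigma> k \<alpha>. 0 < \<delta> \<longrightarrow> \<sigma> \<in> T_below S \<gamma> \<longrightarrow> sd k < N \<longrightarrow> \<alpha> \<in> H \<longrightarrow>
    cn \<alpha> (star (X k) \<sigma>) \<le> C * \<delta> powr (\<gamma> - \<alpha>) * \<delta> ^ sd k * scaled_norm \<gamma> \<delta> \<sigma>"
proof -
  obtain C where C: "C \<ge> 0" "\<And>k \<alpha> \<sigma>. sd k < N \<Longrightarrow> \<alpha> \<in> H \<Longrightarrow>
      cn \<alpha> (star (X k) \<sigma>) \<le> C * cn (\<alpha> - real (sd k)) \<sigma>"
    using star_bound[OF finite_sc_deg_less[OF scaling, of N] assms] by blast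
  show ?thesis
  proof (intro exI[of _ C] conjI allI impI C(1))
    fix \<delta> \<sigma> k \<alpha>
    assume *: "(0::real) < \<delta>" "\<sigma> \<in> T_below S \<gamma>" "sd k < N" "\<alpha> \<in> H"
    have "cn \<alpha> (star (X k) \<sigma>) \<le> C * cn (\<alpha> - real (sd k)) \<sigma>"
      using * by (intro C) auto
    also have "\<dots> \<le> C * (\<delta> powr (\<gamma> - (\<alpha> - real (sd k))) * scaled_norm \<gamma> \<delta> \<sigma>)"
      using * C by (intro mult_left_mono cn_le_scaled_norm) auto
    also have "\<delta> powr (\<gamma> - (\<alpha> - real (sd k))) = \<delta> powr (\<gamma> - \<alpha>) * \<delta> ^ sd k"
    proof -
      have "\<gamma> - (\<alpha> - real (sd k)) = (\<gamma> - \<alpha>) + real (sd k)" by simp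
      then show ?thesis using * by (simp only: powr_add powr_realpow)
    qed
    finally show "cn \<alpha> (star (X k) \<sigma>) \<le> C * \<delta> powr (\<gamma> - \<alpha>) * \<delta> ^ sd k * scaled_norm \<gamma> \<delta> \<sigma>"
      by (simp add: mult.assoc)
  qed
qed

text \<open>After subtracting \<open>f x\<close> by means of \<open>sum_star_unit\<close> only the
  oscillations remain, and the powers of \<delta> from bump and product cancel. H is left open,
  since the part cut off by the projection, at homogeneities from \<gamma> on, needs the bound
  too.\<close>

lemma lift_sum_error:
  assumes H: "finite H" and N: "0 < N"
  shows "\<exists>C\<ge>0. \<forall>\<delta> y f W x \<alpha>. 0 < \<delta> \<longrightarrow> (\<forall>x. f x \<in> T_below S \<gamma>) \<longrightarrow>
     (\<forall>x. \<forall>z\<in>near_cells s \<delta> x. scaled_norm \<gamma> \<delta> (\<Gamma> x (y z) (f (y z)) - f x) \<le> W x) \<longrightarrow> 0 \<le> W x \<longrightarrow> \<alpha> \<in> H \<longrightarrow>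
     cn \<alpha> (lift_sum N \<delta> y f x - f x) \<le> C * \<delta> powr (\<gamma> - \<alpha>) * W x"
proof -
  obtain C1 where C1: "C1 \<ge> 0" "\<And>\<delta> \<sigma> k \<alpha>. 0 < \<delta> \<Longrightarrow> \<sigma> \<in> T_below S \<gamma> \<Longrightarrow> sd k < N \<Longrightarrow> \<alpha> \<in> H \<Longrightarrow>
    cn \<alpha> (star (X k) \<sigma>) \<le> C1 * \<delta> powr (\<gamma> - \<alpha>) * \<delta> ^ sd k * scaled_norm \<gamma> \<delta> \<sigma>"
    using cn_star_le_scaled_norm[OF H] by blast
  obtain B where B: "B \<ge> 1" "\<And>n t. n \<le> N \<Longrightarrow> \<bar>tent n t\<bar> \<le> B"
    using tent_bounded_upto[of N] by blast
  define K where "K = {k. sd k < N}"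
  define M where "M = 5 ^ CARD('d) * (real (card K) * (B ^ CARD('d) * C1))"
  show ?thesis
  proof (intro exI[of _ M] conjI allI impI)
    show "0 \<le> M" using B C1 by (simp add: M_def)
    fix \<delta> y f W x \<alpha>
    assume \<delta>: "(0::real) < \<delta>" and f: "\<forall>x. f x \<in> T_below S \<gamma>"
      and W: "\<forall>x. \<forall>z\<in>near_cells s \<delta> x. scaled_norm \<gamma> \<delta> (\<Gamma> x (y z) (f (y z)) - f x) \<le> W x"
      and W0: "0 \<le> W x" and \<alpha>: "\<alpha> \<in> H"
    let ?Z = "near_cells s \<delta> x"
    define \<sigma> where "\<sigma> z = \<Gamma> x (y z) (f (y z)) - f x" for z
    have "lift_sum N \<delta> y f x - f x = (\<Sum>z\<in>?Z. \<Sum>k\<in>K. (cell_bump s \<delta> z k x / mfact k) *\<^sub>R star (X k) (\<Gamma> x (y z) (f (y z))))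
        - (\<Sum>z\<in>?Z. \<Sum>k\<in>K. (cell_bump s \<delta> z k x / mfact k) *\<^sub>R star (X k) (f x))"
      unfolding lift_sum_def K_def using near_cells_if N
      by (subst sum_star_unit) (auto simp: finite_near_cells)
    then have eq: "lift_sum N \<delta> y f x - f x = (\<Sum>z\<in>?Z. \<Sum>k\<in>K. (cell_bump s \<delta> z k x / mfact k) *\<^sub>R star (X k) (\<sigma> z))"
      by (simp add: sum_subtractf[symmetric] scaleR_diff_right[symmetric] \<sigma>_def linear_diff[OF linear_star])
    have each: "cn \<alpha> ((cell_bump s \<delta> z k x / mfact k) *\<^sub>R star (X k) (\<sigma> z)) \<le> B ^ CARD('d) * C1 * (\<delta> powr (\<gamma> - \<alpha>) * W x)"
      if z: "z \<in> ?Z" and k: "k \<in> K" for z k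
    proof -
      have "\<bar>tents k (cell_coord s \<delta> z x)\<bar> \<le> B ^ CARD('d)"
      proof (rule tents_le)
        fix i t
        have "k i \<le> N" using component_le_sc_deg[OF scaling, of k i] k by (simp add: K_def)
        then show "\<bar>tent (k i) t\<bar> \<le> B" by (rule B(2))
      qed
      then have "\<bar>cell_bump s \<delta> z k x\<bar> \<le> B ^ CARD('d) / \<delta> ^ sd k"
        using \<delta> by (simp add: cell_bump_def abs_divide divide_right_mono)
      moreover have "\<bar>cell_bump s \<delta> z k x / mfact k\<bar> \<le> \<bar>cell_bump s \<delta> z k x\<bar>"
        by (rule abs_divide_mfact_le)
      ultimately have 1: "\<bar>cell_bump s \<delta> z k x / mfact k\<bar> \<le> B ^ CARD('d) / \<delta> ^ sd k" by linarith
      have "\<sigma> z \<in> T_below S \<gamma>"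
        unfolding \<sigma>_def using f by (intro subspace_diff[OF subspace_T_below] \<Gamma>_T_below) auto
      then have "cn \<alpha> (star (X k) (\<sigma> z)) \<le> C1 * \<delta> powr (\<gamma> - \<alpha>) * \<delta> ^ sd k * scaled_norm \<gamma> \<delta> (\<sigma> z)"
        using \<delta> k \<alpha> by (intro C1) (auto simp: K_def)
      also have "\<dots> \<le> C1 * \<delta> powr (\<gamma> - \<alpha>) * \<delta> ^ sd k * W x"
        using C1(1) \<delta> W z unfolding \<sigma>_def by (intro mult_left_mono) auto
      finally have 2: "cn \<alpha> (star (X k) (\<sigma> z)) \<le> C1 * \<delta> powr (\<gamma> - \<alpha>) * \<delta> ^ sd k * W x" .
      have "cn \<alpha> ((cell_bump s \<delta> z k x / mfact k) *\<^sub>R star (X k) (\<sigma> z)) \<le>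
          (B ^ CARD('d) / \<delta> ^ sd k) * (C1 * \<delta> powr (\<gamma> - \<alpha>) * \<delta> ^ sd k * W x)"
        unfolding cn_scale by (intro mult_mono 1 2) (use B \<delta> in \<open>auto simp: cn_nonneg\<close>)
      also have "\<dots> = B ^ CARD('d) * C1 * (\<delta> powr (\<gamma> - \<alpha>) * W x)"
        using \<delta> by simp
      finally show ?thesis .
    qed
    have "cn \<alpha> (lift_sum N \<delta> y f x - f x) \<le> (\<Sum>z\<in>?Z. \<Sum>k\<in>K. cn \<alpha> ((cell_bump s \<delta> z k x / mfact k) *\<^sub>R star (X k) (\<sigma> z)))"
      unfolding eq by (intro order_trans[OF cn_sum] sum_mono cn_sum)
    also have "\<dots> \<le> (\<Sum>z\<in>?Z. \<Sum>k\<in>K. B ^ CARD('d) * C1 * (\<delta> powr (\<gamma> - \<alpha>) * W x))"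
      by (intro sum_mono each)
    also have "\<dots> = real (card ?Z) * (real (card K) * (B ^ CARD('d) * C1 * (\<delta> powr (\<gamma> - \<alpha>) * W x)))"
      by (simp only: sum_constant)
    also have "\<dots> \<le> 5 ^ CARD('d) * (real (card K) * (B ^ CARD('d) * C1 * (\<delta> powr (\<gamma> - \<alpha>) * W x)))"
    proof (rule mult_right_mono)
      show "real (card ?Z) \<le> 5 ^ CARD('d)"
        using of_nat_mono[OF card_near_cells[of s \<delta> x], where 'a = real] by simp
    qed (use B C1 W0 in simp)
    also have "\<dots> = M * \<delta> powr (\<gamma> - \<alpha>) * W x"
      by (simp add: M_def mult_ac)
    finally show "cn \<alpha> (lift_sum N \<delta> y f x - f x) \<le> M * \<delta> powr (\<gamma> - \<alpha>) * W x" .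
  qed
qed

text \<open>The substitution m = k - l, where subtraction of naturals is exact because of
  \<open>l \<le> k\<close>.\<close>

lemma sum_multiindex_shift:
  fixes g :: "('d \<Rightarrow> nat) \<Rightarrow> ('d \<Rightarrow> nat) \<Rightarrow> 'b::comm_monoid_add"
  shows "(\<Sum>k | sd k < N. \<Sum>l | l \<le> k. g k l) =
    (\<Sum>l | sd l < N. \<Sum>m | sd (\<lambda>i. l i + m i) < N. g (\<lambda>i. l i + m i) l)"
proof -
  have fin: "finite {l :: 'd \<Rightarrow> nat. l \<le> k}" for k
  proof (rule finite_subset[OF _ finite_sc_deg_less[OF scaling, of "Suc (sd k)"]])
    show "{l. l \<le> k} \<subseteq> {l. sd l < Suc (sd k)}"
      using sc_deg_mono by (auto simp: le_fun_def less_Suc_eq_le)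
  qed
  have fin2: "finite {m. sd (\<lambda>i. l i + m i) < N}" for l
    by (rule finite_subset[OF _ finite_sc_deg_less[OF scaling, of N]]) (auto simp: sc_deg_add)
  have "(\<Sum>k | sd k < N. \<Sum>l | l \<le> k. g k l) = (\<Sum>(k, l)\<in>Sigma {k. sd k < N} (\<lambda>k. {l. l \<le> k}). g k l)"
    by (rule sum.Sigma) (use fin finite_sc_deg_less[OF scaling, of N] in auto)
  also have "\<dots> = (\<Sum>(l, m)\<in>Sigma {l. sd l < N} (\<lambda>l. {m. sd (\<lambda>i. l i + m i) < N}). g (\<lambda>i. l i + m i) l)"
    by (rule sum.reindex_bij_witness[where i = "\<lambda>(l, m). ((\<lambda>i. l i + m i), l)" and j = "\<lambda>(k, l). (l, \<lambda>i. k i - l i)"])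
      (auto simp: le_fun_def intro: le_less_trans[OF sc_deg_mono])
  also have "\<dots> = (\<Sum>l | sd l < N. \<Sum>m | sd (\<lambda>i. l i + m i) < N. g (\<lambda>i. l i + m i) l)"
    by (rule sum.Sigma[symmetric]) (use fin2 finite_sc_deg_less[OF scaling, of N] in auto)
  finally show ?thesis .
qed

text \<open>Moving the lift to x + h replaces the coefficients c by their Taylor polynomials in h.
  Increments of lifts are therefore governed by Taylor remainders.\<close>

lemma \<Gamma>_lift:
  "\<Gamma> (x + h) x (\<Sum>k | sd k < N. (c k / mfact k) *\<^sub>R star (X k) (\<Gamma> x z \<tau>)) =
    (\<Sum>l | sd l < N. ((\<Sum>m | sd (\<lambda>i. l i + m i) < N. c (\<lambda>i. l i + m i) * mpow h m / mfact m) / mfact l)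
      *\<^sub>R star (X l) (\<Gamma> (x + h) z \<tau>))"
proof -
  have "\<Gamma> (x + h) x (\<Sum>k | sd k < N. (c k / mfact k) *\<^sub>R star (X k) (\<Gamma> x z \<tau>)) =
      (\<Sum>k | sd k < N. c k *\<^sub>R ((1 / mfact k) *\<^sub>R \<Gamma> (x + h) x (star (X k) (\<Gamma> x z \<tau>))))"
    unfolding \<Gamma>_sum by (intro sum.cong refl) (simp add: \<Gamma>_scale)
  also have "\<dots> = (\<Sum>k | sd k < N. \<Sum>l | l \<le> k.
      (c k * (mpow h (\<lambda>i. k i - l i) / (mfact l * mfact (\<lambda>i. k i - l i)))) *\<^sub>R star (X l) (\<Gamma> (x + h) z \<tau>))"
    unfolding \<Gamma>_star scaleR_right.sum by (simp add: \<Gamma>_compose)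
  also have "\<dots> = (\<Sum>l | sd l < N. \<Sum>m | sd (\<lambda>i. l i + m i) < N.
      (c (\<lambda>i. l i + m i) * (mpow h m / (mfact l * mfact m))) *\<^sub>R star (X l) (\<Gamma> (x + h) z \<tau>))"
    unfolding sum_multiindex_shift by simp
  also have "\<dots> = (\<Sum>l | sd l < N. ((\<Sum>m | sd (\<lambda>i. l i + m i) < N. c (\<lambda>i. l i + m i) * mpow h m / mfact m) / mfact l)
      *\<^sub>R star (X l) (\<Gamma> (x + h) z \<tau>))"
    unfolding scaleR_sum_left sum_divide_distrib by (intro sum.cong refl) (simp add: mult.commute)
  finally show ?thesis .
qed

text \<open>The case \<open>\<kappa> > 0\<close> needs the gap of \<open>homs S\<close> to the right of \<open>\<gamma>\<close>; it is available if
  \<open>\<gamma> \<notin> homs S\<close>.\<close>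

lemma lift_sum_increment:
  assumes N: "0 < N" and N_ge: "\<And>\<alpha>. \<alpha> \<in> homs S \<Longrightarrow> \<gamma> - \<alpha> + \<kappa> \<le> real N"
  shows "\<exists>C\<ge>0. \<forall>\<delta> y f W x h \<alpha>. 0 < \<delta> \<longrightarrow> sn h \<le> \<delta> \<longrightarrow> (\<forall>x. f x \<in> T_below S \<gamma>) \<longrightarrow>
     (\<forall>x. \<forall>z\<in>near_cells s \<delta> x. scaled_norm \<gamma> \<delta> (\<Gamma> x (y z) (f (y z)) - f x) \<le> W x) \<longrightarrow>
     0 \<le> W (x + h) \<longrightarrow> \<alpha> \<in> homs S \<inter> {..<\<gamma>} \<longrightarrow>
     cn \<alpha> (lift_sum N \<delta> y f (x + h) - \<Gamma> (x + h) x (lift_sum N \<delta> y f x))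
       \<le> C * \<delta> powr (\<gamma> - \<alpha>) * (sn h / \<delta>) powr (\<gamma> - \<alpha> + \<kappa>) * W (x + h)"
proof -
  let ?H = "homs S \<inter> {..<\<gamma>}"
  obtain C1 where C1: "C1 \<ge> 0" "\<And>\<delta> \<sigma> k \<alpha>. 0 < \<delta> \<Longrightarrow> \<sigma> \<in> T_below S \<gamma> \<Longrightarrow> sd k < N \<Longrightarrow> \<alpha> \<in> ?H \<Longrightarrow>
    cn \<alpha> (star (X k) \<sigma>) \<le> C1 * \<delta> powr (\<gamma> - \<alpha>) * \<delta> ^ sd k * scaled_norm \<gamma> \<delta> \<sigma>"
    using cn_star_le_scaled_norm[OF finite_homs_below[of \<gamma>]] by blast
  obtain C2 where C2: "C2 \<ge> 0" "\<And>\<delta> z k x h. 0 < \<delta> \<Longrightarrow> sd k < N \<Longrightarrow> sn h \<le> \<delta> \<Longrightarrow>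
    \<bar>cell_bump s \<delta> z k (x + h) - (\<Sum>l | sd (\<lambda>i. k i + l i) < N.
        cell_bump s \<delta> z (\<lambda>i. k i + l i) x * mpow h l / mfact l)\<bar>
      \<le> C2 * (sn h / \<delta>) ^ (N - sd k) / \<delta> ^ sd k"
    using cell_bump_Taylor[OF scaling, of N] by blast
  define K where "K = {k. sd k < N}"
  define M where "M = 5 ^ CARD('d) * (real (card K) * (C2 * C1))"
  show ?thesis
  proof (intro exI[of _ M] conjI allI impI)
    show "0 \<le> M" using C1 C2 by (simp add: M_def)
    fix \<delta> y f W x h \<alpha>
    assume \<delta>: "(0::real) < \<delta>" and h: "sn h \<le> \<delta>" and f: "\<forall>x. f x \<in> T_below S \<gamma>"
      and W: "\<forall>x. \<forall>z\<in>near_cells s \<delta> x. scaled_norm \<gamma> \<delta> (\<Gamma> x (y z) (f (y z)) - f x) \<le> W x"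
      and W0: "0 \<le> W (x + h)" and \<alpha>: "\<alpha> \<in> ?H"
    let ?Z = "near_cells s \<delta> (x + h)" and ?t = "sn h / \<delta>"
    \<comment> \<open>The cells near x + h contain all cells active at x, so both lifts are summed
      over them.\<close>
    have Z: "finite ?Z" "\<And>z. (\<forall>i. \<bar>cell_coord s \<delta> z x $ i\<bar> < 1) \<Longrightarrow> z \<in> ?Z"
      using near_cells_shift[OF \<delta> h] by (auto simp: finite_near_cells)
    have Z': "\<And>z. (\<forall>i. \<bar>cell_coord s \<delta> z (x + h) $ i\<bar> < 1) \<Longrightarrow> z \<in> ?Z"
      using near_cells_if by blast
    define P where "P z l = (\<Sum>m | sd (\<lambda>i. l i + m i) < N. cell_bump s \<delta> z (\<lambda>i. l i + m i) x * mpow h m / mfact m)" for z l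
    define rem where "rem z l = cell_bump s \<delta> z l (x + h) - P z l" for z l
    define \<sigma> where "\<sigma> z = \<Gamma> (x + h) (y z) (f (y z)) - f (x + h)" for z
    have 1: "lift_sum N \<delta> y f (x + h) - \<Gamma> (x + h) x (lift_sum N \<delta> y f x) =
        (\<Sum>z\<in>?Z. \<Sum>l\<in>K. (rem z l / mfact l) *\<^sub>R star (X l) (\<Gamma> (x + h) (y z) (f (y z))))"
    proof -
      have "\<Gamma> (x + h) x (lift_sum N \<delta> y f x) = (\<Sum>z\<in>?Z. \<Sum>l\<in>K. (P z l / mfact l) *\<^sub>R star (X l) (\<Gamma> (x + h) (y z) (f (y z))))"
      proof -
        have "\<Gamma> (x + h) x (lift_sum N \<delta> y f x) = (\<Sum>z\<in>?Z. \<Gamma> (x + h) x (\<Sum>k | sd k < N.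
            (cell_bump s \<delta> z k x / mfact k) *\<^sub>R star (X k) (\<Gamma> x (y z) (f (y z)))))"
          by (subst lift_sum_eq[OF Z], assumption, rule \<Gamma>_sum)
        then show ?thesis by (simp only: \<Gamma>_lift P_def K_def)
      qed
      moreover have "lift_sum N \<delta> y f (x + h) = (\<Sum>z\<in>?Z. \<Sum>l\<in>K.
          (cell_bump s \<delta> z l (x + h) / mfact l) *\<^sub>R star (X l) (\<Gamma> (x + h) (y z) (f (y z))))"
        unfolding lift_sum_def K_def ..
      ultimately show ?thesis
        by (simp add: rem_def sum_subtractf diff_divide_distrib scaleR_diff_left)
    qed
    \<comment> \<open>The sum of the bumps is constant and so agrees with its Taylor polynomial: the
      remainders sum to 0 over the cells, and \<open>f (x + h)\<close> may be subtracted.\<close>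
    have 2: "(\<Sum>z\<in>?Z. \<Sum>l\<in>K. (rem z l / mfact l) *\<^sub>R star (X l) (f (x + h))) = 0"
    proof -
      have "(\<Sum>z\<in>?Z. rem z l) = 0" for l
      proof -
        have "(\<Sum>z\<in>?Z. P z l) = (\<Sum>m | sd (\<lambda>i. l i + m i) < N. (\<Sum>z\<in>?Z. cell_bump s \<delta> z (\<lambda>i. l i + m i) x) * mpow h m / mfact m)"
          unfolding P_def by (subst sum.swap) (simp add: sum_distrib_right sum_divide_distrib)
        also have "\<dots> = (\<Sum>m | sd (\<lambda>i. l i + m i) < N. if m = (\<lambda>_. 0) then (if l = (\<lambda>_. 0) then 1 else 0) else 0)"
        proof (intro sum.cong refl)
          fix m
          have eq: "(\<Sum>z\<in>?Z. cell_bump s \<delta> z (\<lambda>i. l i + m i) x) =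
              (if (\<lambda>i. l i + m i) = (\<lambda>_. 0) then 1 else 0)"
            by (rule sum_cell_bump[OF Z])
          have "((\<lambda>i. l i + m i) = (\<lambda>_. 0)) \<longleftrightarrow> m = (\<lambda>_. 0) \<and> l = (\<lambda>_. 0)"
            by (auto simp: fun_eq_iff)
          then show "(\<Sum>z\<in>?Z. cell_bump s \<delta> z (\<lambda>i. l i + m i) x) * mpow h m / mfact m =
              (if m = (\<lambda>_. 0) then (if l = (\<lambda>_. 0) then 1 else 0) else 0)"
            unfolding eq by (simp add: mpow_def mfact_def)
        qed
        also have "\<dots> = (if l = (\<lambda>_. 0) then 1 else 0)"
        proof -
          have "finite {m. sd (\<lambda>i. l i + m i) < N}"
            by (rule finite_subset[OF _ finite_sc_deg_less[OF scaling, of N]]) (auto simp: sc_deg_add)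
          then show ?thesis using N by (simp add: sc_deg_def)
        qed
        finally show ?thesis
          using sum_cell_bump[OF Z(1) Z', where k = l] by (simp add: rem_def sum_subtractf)
      qed
      then show ?thesis
        by (subst sum.swap) (simp add: scaleR_sum_left[symmetric] sum_divide_distrib[symmetric])
    qed
    have eq: "lift_sum N \<delta> y f (x + h) - \<Gamma> (x + h) x (lift_sum N \<delta> y f x) =
        (\<Sum>z\<in>?Z. \<Sum>l\<in>K. (rem z l / mfact l) *\<^sub>R star (X l) (\<sigma> z))"
      using 1 2 by (simp add: \<sigma>_def linear_diff[OF linear_star] scaleR_diff_right sum_subtractf)
    let ?b = "\<delta> powr (\<gamma> - \<alpha>) * ?t powr (\<gamma> - \<alpha> + \<kappa>) * W (x + h)"
    have each: "cn \<alpha> ((rem z l / mfact l) *\<^sub>R star (X l) (\<sigma> z)) \<le> C2 * C1 * ?b"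
      if z: "z \<in> ?Z" and l: "l \<in> K" for z l
    proof (cases "\<alpha> - real (sd l) \<in> homs S")
      case True
      have t: "0 \<le> ?t" "?t \<le> 1" using h \<delta> by (auto simp: sc_norm_nonneg)
      have "?t ^ (N - sd l) \<le> ?t powr (\<gamma> - \<alpha> + \<kappa>)"
      proof (cases "?t = 0")
        case True
        \<comment> \<open>At h = 0 the power is 0 because \<open>sd l < N\<close>.\<close>
        show ?thesis unfolding True using l by (simp add: K_def power_0_left)
      next
        case False
        \<comment> \<open>\<open>N_ge\<close> is applied to the homogeneity
          \<open>\<alpha> - real (sd l)\<close>.\<close>
        have "\<gamma> - \<alpha> + \<kappa> \<le> real (N - sd l)"
          using N_ge[OF True] l by (simp add: K_def)
        then have "?t powr real (N - sd l) \<le> ?t powr (\<gamma> - \<alpha> + \<kappa>)"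
          using t by (intro powr_mono') auto
        then show ?thesis using False t by (simp add: powr_realpow)
      qed
      then have "C2 * ?t ^ (N - sd l) / \<delta> ^ sd l \<le> C2 * ?t powr (\<gamma> - \<alpha> + \<kappa>) / \<delta> ^ sd l"
        using C2(1) \<delta> by (intro divide_right_mono mult_left_mono) auto
      moreover have "\<bar>rem z l\<bar> \<le> C2 * ?t ^ (N - sd l) / \<delta> ^ sd l"
        unfolding rem_def P_def using l by (intro C2(2) \<delta> h) (simp add: K_def)
      ultimately have "\<bar>rem z l\<bar> \<le> C2 * ?t powr (\<gamma> - \<alpha> + \<kappa>) / \<delta> ^ sd l"
        by linarith
      moreover have "\<bar>rem z l / mfact l\<bar> \<le> \<bar>rem z l\<bar>"
        by (rule abs_divide_mfact_le)
      ultimately have 1: "\<bar>rem z l / mfact l\<bar> \<le> C2 * ?t powr (\<gamma> - \<alpha> + \<kappa>) / \<delta> ^ sd l" by linarith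
      have "\<sigma> z \<in> T_below S \<gamma>"
        unfolding \<sigma>_def using f by (intro subspace_diff[OF subspace_T_below] \<Gamma>_T_below) auto
      then have "cn \<alpha> (star (X l) (\<sigma> z)) \<le> C1 * \<delta> powr (\<gamma> - \<alpha>) * \<delta> ^ sd l * scaled_norm \<gamma> \<delta> (\<sigma> z)"
        using \<delta> l \<alpha> by (intro C1) (auto simp: K_def)
      also have "\<dots> \<le> C1 * \<delta> powr (\<gamma> - \<alpha>) * \<delta> ^ sd l * W (x + h)"
        using C1(1) \<delta> W z unfolding \<sigma>_def by (intro mult_left_mono) auto
      finally have 2: "cn \<alpha> (star (X l) (\<sigma> z)) \<le> C1 * \<delta> powr (\<gamma> - \<alpha>) * \<delta> ^ sd l * W (x + h)" .
      have "cn \<alpha> ((rem z l / mfact l) *\<^sub>R star (X l) (\<sigma> z)) \<le>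
          (C2 * ?t powr (\<gamma> - \<alpha> + \<kappa>) / \<delta> ^ sd l) * (C1 * \<delta> powr (\<gamma> - \<alpha>) * \<delta> ^ sd l * W (x + h))"
        unfolding cn_scale by (intro mult_mono 1 2) (use C2 \<delta> in \<open>auto simp: cn_nonneg\<close>)
      also have "\<dots> = C2 * C1 * ?b"
        using \<delta> by simp
      finally show ?thesis .
    next
      case False
      \<comment> \<open>The product with \<open>X l\<close> reads the component at
        \<open>\<alpha> - real (sd l)\<close>, whose sector is zero.\<close>
      then have "cn \<alpha> (star (X l) (\<sigma> z)) = 0"
        by (simp add: cn_eq_0_iff hc_star hc_outside linear_0[OF linear_star])
      then show ?thesis
        using C1 C2 W0 by (simp add: cn_scale)
    qed
    have "cn \<alpha> (lift_sum N \<delta> y f (x + h) - \<Gamma> (x + h) x (lift_sum N \<delta> y f x))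
        \<le> (\<Sum>z\<in>?Z. \<Sum>l\<in>K. cn \<alpha> ((rem z l / mfact l) *\<^sub>R star (X l) (\<sigma> z)))"
      unfolding eq by (intro order_trans[OF cn_sum] sum_mono cn_sum)
    also have "\<dots> \<le> (\<Sum>z\<in>?Z. \<Sum>l\<in>K. C2 * C1 * ?b)"
      by (intro sum_mono each)
    also have "\<dots> = real (card ?Z) * (real (card K) * (C2 * C1 * ?b))"
      by (simp only: sum_constant)
    also have "\<dots> \<le> 5 ^ CARD('d) * (real (card K) * (C2 * C1 * ?b))"
    proof (rule mult_right_mono)
      show "real (card ?Z) \<le> 5 ^ CARD('d)"
        using of_nat_mono[OF card_near_cells[of s \<delta> "x + h"], where 'a = real] by simp
    qed (use C1 C2 W0 in simp)
    also have "\<dots> = M * \<delta> powr (\<gamma> - \<alpha>) * ?t powr (\<gamma> - \<alpha> + \<kappa>) * W (x + h)"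
      by (simp add: M_def mult_ac)
    finally show "cn \<alpha> (lift_sum N \<delta> y f (x + h) - \<Gamma> (x + h) x (lift_sum N \<delta> y f x))
       \<le> M * \<delta> powr (\<gamma> - \<alpha>) * ?t powr (\<gamma> - \<alpha> + \<kappa>) * W (x + h)" .
  qed
qed

lemma lift_sum_T_below:
  assumes f: "\<And>x. f x \<in> T_below S \<gamma>"
  shows "lift_sum N \<delta> y f x \<in> T_below S (\<gamma> + real N)"
proof -
  have "star (X k) \<sigma> \<in> T_below S (\<gamma> + real N)" if "sd k < N" "\<sigma> \<in> T_below S \<gamma>" for k \<sigma>
    using that by (auto simp: T_below_def hc_star linear_0[OF linear_star])
  then have "star (X k) (\<Gamma> x (y z) (f (y z))) \<in> T_below S (\<gamma> + real N)" if "sd k < N" for k z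
    using that \<Gamma>_T_below[OF f] by blast
  then show ?thesis
    unfolding lift_sum_def
    by (intro subspace_sum[OF subspace_T_below] subspace_scale[OF subspace_T_below]) auto
qed

lemma approximant_error:
  assumes N: "0 < N"
  shows "\<exists>C\<ge>0. \<forall>\<delta> y f W x \<alpha>. 0 < \<delta> \<longrightarrow> (\<forall>x. f x \<in> T_below S \<gamma>) \<longrightarrow>
     (\<forall>x. \<forall>z\<in>near_cells s \<delta> x. scaled_norm \<gamma> \<delta> (\<Gamma> x (y z) (f (y z)) - f x) \<le> W x) \<longrightarrow> 0 \<le> W x \<longrightarrow>
     \<alpha> \<in> homs S \<inter> {..<\<gamma>} \<longrightarrow>
     cn \<alpha> (f x - approximant \<gamma> N \<delta> y f x) \<le> C * \<delta> powr (\<gamma> - \<alpha>) * W x"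
proof -
  have "cn \<alpha> (f x - approximant \<gamma> N \<delta> y f x) = cn \<alpha> (lift_sum N \<delta> y f x - f x)" if "\<alpha> < \<gamma>" for \<alpha> \<delta> y f x
    using that cn_minus_commute[of \<alpha> "f x" "approximant \<gamma> N \<delta> y f x"]
    by (simp add: approximant_def comp_norm_def hc_diff hc_proj)
  then show ?thesis
    using lift_sum_error[OF finite_homs_below[of \<gamma>] N, of \<gamma>] by simp
qed

text \<open>The discarded part q re-enters below \<gamma> through the off-diagonal part of \<Gamma>.
  A component of q at \<alpha> has size \<open>\<delta> powr (\<gamma> - \<alpha>)\<close> times the
  dominating function and reaches level \<zeta> with the factor
  \<open>sn h powr (\<alpha> - \<zeta>)\<close>. As \<alpha> is at least
  \<open>\<gamma> + \<kappa>\<close>, the result has the same form as the increment of the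
  lift.\<close>

lemma approximant_increment:
  assumes N: "0 < N" and N_ge: "\<And>\<alpha>. \<alpha> \<in> homs S \<Longrightarrow> \<gamma> - \<alpha> + \<kappa> \<le> real N"
    and \<kappa>: "\<And>\<alpha>. \<alpha> \<in> homs S \<Longrightarrow> \<gamma> \<le> \<alpha> \<Longrightarrow> \<gamma> + \<kappa> \<le> \<alpha>"
  shows "\<exists>C\<ge>0. \<forall>\<delta> y f W x h \<alpha>. 0 < \<delta> \<longrightarrow> \<delta> < 1 \<longrightarrow> sn h \<le> \<delta> \<longrightarrow> (\<forall>x. f x \<in> T_below S \<gamma>) \<longrightarrow>
     (\<forall>x. \<forall>z\<in>near_cells s \<delta> x. scaled_norm \<gamma> \<delta> (\<Gamma> x (y z) (f (y z)) - f x) \<le> W x) \<longrightarrow>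
     (\<forall>x. 0 \<le> W x) \<longrightarrow> \<alpha> \<in> homs S \<inter> {..<\<gamma>} \<longrightarrow>
     cn \<alpha> (approximant \<gamma> N \<delta> y f (x + h) - \<Gamma> (x + h) x (approximant \<gamma> N \<delta> y f x))
       \<le> C * \<delta> powr (\<gamma> - \<alpha>) * (sn h / \<delta>) powr (\<gamma> - \<alpha> + \<kappa>) * (W (x + h) + W x)"
proof -
  let ?H = "homs S \<inter> {..<\<gamma>}" and ?H' = "homs S \<inter> {..<\<gamma> + real N}"
  obtain C1 where C1: "C1 \<ge> 0" "\<And>\<delta> y f W x h \<alpha>. 0 < \<delta> \<Longrightarrow> sn h \<le> \<delta> \<Longrightarrow> (\<forall>x. f x \<in> T_below S \<gamma>) \<Longrightarrow>
     (\<forall>x. \<forall>z\<in>near_cells s \<delta> x. scaled_norm \<gamma> \<delta> (\<Gamma> x (y z) (f (y z)) - f x) \<le> W x) \<Longrightarrow>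
     0 \<le> W (x + h) \<Longrightarrow> \<alpha> \<in> ?H \<Longrightarrow>
     cn \<alpha> (lift_sum N \<delta> y f (x + h) - \<Gamma> (x + h) x (lift_sum N \<delta> y f x))
       \<le> C1 * \<delta> powr (\<gamma> - \<alpha>) * (sn h / \<delta>) powr (\<gamma> - \<alpha> + \<kappa>) * W (x + h)"
    using lift_sum_increment[OF N N_ge] by blast
  obtain C2 where C2: "C2 \<ge> 0" "\<And>\<delta> y f W x \<alpha>. 0 < \<delta> \<Longrightarrow> (\<forall>x. f x \<in> T_below S \<gamma>) \<Longrightarrow>
     (\<forall>x. \<forall>z\<in>near_cells s \<delta> x. scaled_norm \<gamma> \<delta> (\<Gamma> x (y z) (f (y z)) - f x) \<le> W x) \<Longrightarrow> 0 \<le> W x \<Longrightarrow> \<alpha> \<in> ?H' \<Longrightarrow>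
     cn \<alpha> (lift_sum N \<delta> y f x - f x) \<le> C2 * \<delta> powr (\<gamma> - \<alpha>) * W x"
    using lift_sum_error[OF finite_homs_below[of "\<gamma> + real N"] N, of \<gamma>] by blast
  obtain C3 where C3: "C3 \<ge> 0" "\<And>x y \<sigma> \<beta>. \<sigma> \<in> T_below S (\<gamma> + real N) \<Longrightarrow> sn (x - y) < 1 \<Longrightarrow>
     cn \<beta> (\<Gamma> x y \<sigma> - \<sigma>) \<le> C3 * (\<Sum>\<alpha>\<in>?H' \<inter> {\<beta><..}. sn (x - y) powr (\<alpha> - \<beta>) * cn \<alpha> \<sigma>)"
    using \<Gamma>_bound[of "\<gamma> + real N"] by blast
  define M where "M = C1 + C3 * (real (card ?H') * C2)"
  show ?thesis
  proof (intro exI[of _ M] conjI allI impI)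
    show "0 \<le> M" using C1 C2 C3 by (simp add: M_def)
    fix \<delta> y f W x h \<zeta>
    assume \<delta>: "(0::real) < \<delta>" "\<delta> < 1" and h: "sn h \<le> \<delta>" and f: "\<forall>x. f x \<in> T_below S \<gamma>"
      and W: "\<forall>x. \<forall>z\<in>near_cells s \<delta> x. scaled_norm \<gamma> \<delta> (\<Gamma> x (y z) (f (y z)) - f x) \<le> W x"
      and W0: "\<forall>x. 0 \<le> W x" and \<zeta>: "\<zeta> \<in> ?H"
    let ?F = "lift_sum N \<delta> y f" and ?t = "sn h / \<delta>"
    let ?b = "\<delta> powr (\<gamma> - \<zeta>) * ?t powr (\<gamma> - \<zeta> + \<kappa>)"
    have t: "0 \<le> ?t" "?t \<le> 1" using h \<delta> by (auto simp: sc_norm_nonneg)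
    define q where "q = ?F x - proj_below S \<gamma> (?F x)"
    have q: "q \<in> T_below S (\<gamma> + real N)"
      unfolding q_def using f
      by (intro subspace_diff[OF subspace_T_below] lift_sum_T_below)
        (auto intro: subsetD[OF T_below_mono proj_in_T_below])
    have hcq: "hc \<alpha> q = (if \<alpha> < \<gamma> then 0 else hc \<alpha> (?F x))" for \<alpha>
      by (simp add: q_def hc_diff hc_proj)
    have cnq: "cn \<alpha> q \<le> (if \<alpha> < \<gamma> then 0 else C2 * \<delta> powr (\<gamma> - \<alpha>) * W x)" if "\<alpha> \<in> ?H'" for \<alpha>
    proof (cases "\<alpha> < \<gamma>")
      case True
      then show ?thesis using hcq[of \<alpha>] by (simp add: cn_eq_0_iff[symmetric])
    next
      case False
      \<comment> \<open>f has no components from \<gamma> on, so there q is the error of the lift,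
        which \<open>lift_sum_error\<close> controls.\<close>
      then have "cn \<alpha> q = cn \<alpha> (?F x - f x)"
        using hcq[of \<alpha>] f hc_T_below[of "f x" \<gamma> \<alpha>] by (simp add: comp_norm_def hc_diff)
      then show ?thesis
        using C2(2)[OF \<delta>(1) f W _ that, of x] W0 False by simp
    qed
    have xh: "sn (x + h - x) < 1" using h \<delta> by simp
    have each: "sn h powr (\<alpha> - \<zeta>) * cn \<alpha> q \<le> C2 * (?b * W x)" if \<alpha>: "\<alpha> \<in> ?H' \<inter> {\<zeta><..}" for \<alpha>
    proof (cases "\<alpha> < \<gamma>")
      case True
      then have "cn \<alpha> q \<le> 0" using cnq[of \<alpha>] \<alpha> by simp
      then have "cn \<alpha> q = 0" using cn_nonneg[of \<alpha> q] by simp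
      then show ?thesis using C2(1) W0 by simp
    next
      case False
      then have "\<gamma> + \<kappa> \<le> \<alpha>" using \<alpha> \<kappa>[of \<alpha>] by simp
      then have "?t powr (\<alpha> - \<zeta>) \<le> ?t powr (\<gamma> - \<zeta> + \<kappa>)"
        using t by (intro powr_mono') auto
      moreover have "sn h powr (\<alpha> - \<zeta>) * \<delta> powr (\<gamma> - \<alpha>) = ?t powr (\<alpha> - \<zeta>) * \<delta> powr (\<gamma> - \<zeta>)"
      proof -
        have "sn h powr (\<alpha> - \<zeta>) = ?t powr (\<alpha> - \<zeta>) * \<delta> powr (\<alpha> - \<zeta>)"
          using \<delta> t by (subst powr_mult[symmetric]) auto
        then show ?thesis using \<delta> by (simp add: mult.assoc powr_add[symmetric])
      qed
      ultimately have "sn h powr (\<alpha> - \<zeta>) * \<delta> powr (\<gamma> - \<alpha>) \<le> ?b"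
        using mult_right_mono[of "?t powr (\<alpha> - \<zeta>)" "?t powr (\<gamma> - \<zeta> + \<kappa>)" "\<delta> powr (\<gamma> - \<zeta>)"]
        by (simp only: powr_ge_zero mult.commute[of "\<delta> powr (\<gamma> - \<zeta>)"])
      then have "C2 * ((sn h powr (\<alpha> - \<zeta>) * \<delta> powr (\<gamma> - \<alpha>)) * W x) \<le> C2 * (?b * W x)"
        using C2(1) W0 by (intro mult_left_mono mult_right_mono) auto
      moreover have "sn h powr (\<alpha> - \<zeta>) * cn \<alpha> q \<le> sn h powr (\<alpha> - \<zeta>) * (C2 * \<delta> powr (\<gamma> - \<alpha>) * W x)"
        using cnq[of \<alpha>] \<alpha> False by (intro mult_left_mono) auto
      ultimately show ?thesis by (simp add: mult_ac)
    qed
    \<comment> \<open>q has no component at \<zeta>, so only the off-diagonal part of \<Gamma>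
      acts.\<close>
    have "cn \<zeta> (\<Gamma> (x + h) x q) = cn \<zeta> (\<Gamma> (x + h) x q - q)"
      using hcq[of \<zeta>] \<zeta> by (simp add: comp_norm_def hc_diff)
    also have "\<dots> \<le> C3 * (\<Sum>\<alpha>\<in>?H' \<inter> {\<zeta><..}. sn (x + h - x) powr (\<alpha> - \<zeta>) * cn \<alpha> q)"
      by (rule C3(2)[OF q xh])
    also have "\<dots> \<le> C3 * (\<Sum>\<alpha>\<in>?H' \<inter> {\<zeta><..}. C2 * (?b * W x))"
      using each by (intro mult_left_mono sum_mono C3) simp
    also have "\<dots> \<le> C3 * (\<Sum>\<alpha>\<in>?H'. C2 * (?b * W x))"
      using C2(1) W0 by (intro mult_left_mono sum_mono2 C3 finite_homs_below) auto
    finally have 2: "cn \<zeta> (\<Gamma> (x + h) x q) \<le> C3 * (real (card ?H') * C2) * (?b * W x)"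
      by (simp add: mult.assoc)
    have 1: "cn \<zeta> (?F (x + h) - \<Gamma> (x + h) x (?F x)) \<le> C1 * (?b * W (x + h))"
      using C1(2)[OF \<delta>(1) h f W _ \<zeta>] W0 by (simp add: mult.assoc)
    have eq: "\<Gamma> (x + h) x (approximant \<gamma> N \<delta> y f x) = \<Gamma> (x + h) x (?F x) - \<Gamma> (x + h) x q"
      by (simp add: q_def approximant_def \<Gamma>_diff)
    have "hc \<zeta> (approximant \<gamma> N \<delta> y f (x + h) - \<Gamma> (x + h) x (approximant \<gamma> N \<delta> y f x)) =
        hc \<zeta> ((?F (x + h) - \<Gamma> (x + h) x (?F x)) + \<Gamma> (x + h) x q)"
      unfolding eq hc_diff hc_add using \<zeta> by (simp add: approximant_def hc_proj)
    then have "cn \<zeta> (approximant \<gamma> N \<delta> y f (x + h) - \<Gamma> (x + h) x (approximant \<gamma> N \<delta> y f x)) =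
        cn \<zeta> ((?F (x + h) - \<Gamma> (x + h) x (?F x)) + \<Gamma> (x + h) x q)"
      by (simp only: comp_norm_def)
    also have "\<dots> \<le> C1 * (?b * W (x + h)) + C3 * (real (card ?H') * C2) * (?b * W x)"
      by (rule order_trans[OF cn_add add_mono[OF 1 2]])
    also have "\<dots> \<le> M * (?b * W (x + h)) + M * (?b * W x)"
      using C1(1) C2(1) C3(1) W0 by (intro add_mono mult_right_mono) (auto simp: M_def)
    also have "\<dots> = M * \<delta> powr (\<gamma> - \<zeta>) * ?t powr (\<gamma> - \<zeta> + \<kappa>) * (W (x + h) + W x)"
      by (simp add: algebra_simps)
    finally show "cn \<zeta> (approximant \<gamma> N \<delta> y f (x + h) - \<Gamma> (x + h) x (approximant \<gamma> N \<delta> y f x))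
       \<le> M * \<delta> powr (\<gamma> - \<zeta>) * ?t powr (\<gamma> - \<zeta> + \<kappa>) * (W (x + h) + W x)" .
  qed
qed

section \<open>Approximants as sums of localized constants\<close>

lemma approximant_T_below: "approximant \<gamma> N \<delta> y f x \<in> T_below S \<gamma>"
  by (simp add: approximant_def proj_in_T_below)

text \<open>\<open>loc_const\<close> sums over the k that can survive the projection,
  \<open>lift_sum\<close> over all k of scaled degree below N; the additional terms are annihilated
  by the projection.\<close>

lemma loc_const_cell_bump:
  assumes N: "\<And>\<alpha>. \<alpha> \<in> homs S \<Longrightarrow> \<gamma> - \<alpha> \<le> real N"
  shows "loc_const s S X star \<Gamma> \<gamma> p (cell_bump s \<delta> z (\<lambda>_. 0)) \<tau> x =
    proj_below S \<gamma> (\<Sum>k | sd k < N. (cell_bump s \<delta> z k x / mfact k) *\<^sub>R star (X k) (\<Gamma> x p \<tau>))"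
proof -
  let ?K = "{k. \<exists>\<alpha>\<in>homs S. real (sd k) + \<alpha> < \<gamma>}"
  have 0: "proj_below S \<gamma> (star (X k) \<sigma>) = 0" if "k \<notin> ?K" for k \<sigma>
  proof (rule hc_ext)
    fix \<alpha>
    have "star (X k) (hc (\<alpha> - real (sd k)) \<sigma>) = 0" if "\<alpha> < \<gamma>"
    proof -
      have "\<alpha> - real (sd k) \<notin> homs S" using that \<open>k \<notin> ?K\<close> by force
      then show ?thesis by (simp add: hc_outside linear_0[OF linear_star])
    qed
    then show "hc \<alpha> (proj_below S \<gamma> (star (X k) \<sigma>)) = hc \<alpha> 0"
      by (simp add: hc_proj hc_star hc_0)
  qed
  have sub: "?K \<subseteq> {k. sd k < N}"
  proof
    fix k assume "k \<in> ?K"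
    then obtain \<alpha> where "\<alpha> \<in> homs S" "real (sd k) + \<alpha> < \<gamma>" by blast
    with N[of \<alpha>] have "real (sd k) < real N" by linarith
    then show "k \<in> {k. sd k < N}" by simp
  qed
  have "loc_const s S X star \<Gamma> \<gamma> p (cell_bump s \<delta> z (\<lambda>_. 0)) \<tau> x =
      (\<Sum>k\<in>?K. (cell_bump s \<delta> z k x / mfact k) *\<^sub>R proj_below S \<gamma> (star (X k) (\<Gamma> x p \<tau>)))"
    unfolding loc_const_def mderiv_cell_bump star_sum_left linear_sum[OF linear_proj]
    by (simp add: linear_scale[OF linear_proj])
  also have "\<dots> = (\<Sum>k | sd k < N. (cell_bump s \<delta> z k x / mfact k) *\<^sub>R proj_below S \<gamma> (star (X k) (\<Gamma> x p \<tau>)))"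
    using 0 by (intro sum.mono_neutral_left finite_sc_deg_less scaling sub) auto
  finally show ?thesis
    by (simp add: linear_sum[OF linear_proj] linear_scale[OF linear_proj])
qed

lemma approximant_eq_sum_loc_const:
  assumes N: "\<And>\<alpha>. \<alpha> \<in> homs S \<Longrightarrow> \<gamma> - \<alpha> \<le> real N"
  shows "approximant \<gamma> N \<delta> y f x =
    (\<Sum>z\<in>near_cells s \<delta> x. loc_const s S X star \<Gamma> \<gamma> (y z) (cell_bump s \<delta> z (\<lambda>_. 0)) (f (y z)) x)"
  by (simp add: approximant_def lift_sum_def loc_const_cell_bump[OF N] linear_sum[OF linear_proj])

lemma loc_const_cell_bump_nonzero:
  assumes N: "\<And>\<alpha>. \<alpha> \<in> homs S \<Longrightarrow> \<gamma> - \<alpha> \<le> real N"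
    and "loc_const s S X star \<Gamma> \<gamma> p (cell_bump s \<delta> z (\<lambda>_. 0)) \<tau> x \<noteq> 0"
  shows "\<bar>cell_coord s \<delta> z x $ i\<bar> < 1"
proof (rule ccontr)
  assume "\<not> \<bar>cell_coord s \<delta> z x $ i\<bar> < 1"
  then have "cell_bump s \<delta> z k x = 0" for k
    using cell_bump_nonzero_imp by blast
  then show False
    using assms(2) by (simp add: loc_const_cell_bump[OF N] linear_0[OF linear_proj])
qed

text \<open>Each of the finitely many terms is a continuous coefficient times a product that is
  continuous by \<open>\<Gamma>_limit\<close>, and close to x the active cells stay among those near
  x. Measurability is the purpose.\<close>

lemma approximant_continuous:
  assumes \<delta>: "0 < \<delta>" and xs: "xs \<longlonglongrightarrow> x"
  shows "(\<lambda>n. cn \<alpha> (approximant \<gamma> N \<delta> y f (xs n) - approximant \<gamma> N \<delta> y f x)) \<longlonglongrightarrow> 0"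
proof -
  let ?Z = "near_cells s \<delta> x" and ?c = "\<lambda>z k x. cell_bump s \<delta> z k x / mfact k"
  define \<sigma> where "\<sigma> z x' = \<Gamma> x' (y z) (f (y z))" for z x'
  have "(\<lambda>n. cn \<alpha> (?c z k (xs n) *\<^sub>R star (X k) (\<sigma> z (xs n)) - ?c z k x *\<^sub>R star (X k) (\<sigma> z x))) \<longlonglongrightarrow> 0" for z k
  proof -
    obtain C where C: "\<And>\<sigma>. cn \<alpha> (star (X k) \<sigma>) \<le> C * cn (\<alpha> - real (sd k)) \<sigma>"
      using star_bound[of "{k}" "{\<alpha>}"] by auto
    have c: "(\<lambda>n. ?c z k (xs n)) \<longlonglongrightarrow> ?c z k x"
    proof -
      have "isCont (cell_bump s \<delta> z k) x"
        by (rule differentiable_imp_continuous_within[OF cell_bump_differentiable])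
      then show ?thesis
        by (intro tendsto_divide isCont_tendsto_compose[OF _ xs] tendsto_const) (use mfact_pos[of k] in auto)
    qed
    have \<sigma>: "(\<lambda>n. cn \<beta> (\<sigma> z (xs n) - \<sigma> z x)) \<longlonglongrightarrow> 0" for \<beta>
      using \<Gamma>_limit(1)[OF xs, of \<beta> "\<Gamma> x (y z) (f (y z))"] by (simp add: \<sigma>_def \<Gamma>_compose)
    have "(\<lambda>n. \<bar>?c z k (xs n)\<bar> * (C * cn (\<alpha> - real (sd k)) (\<sigma> z (xs n) - \<sigma> z x)) +
        \<bar>?c z k (xs n) - ?c z k x\<bar> * cn \<alpha> (star (X k) (\<sigma> z x))) \<longlonglongrightarrow>
        \<bar>?c z k x\<bar> * (C * 0) + \<bar>?c z k x - ?c z k x\<bar> * cn \<alpha> (star (X k) (\<sigma> z x))"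
      by (intro tendsto_intros c \<sigma>)
    then have lim: "(\<lambda>n. \<bar>?c z k (xs n)\<bar> * (C * cn (\<alpha> - real (sd k)) (\<sigma> z (xs n) - \<sigma> z x)) +
        \<bar>?c z k (xs n) - ?c z k x\<bar> * cn \<alpha> (star (X k) (\<sigma> z x))) \<longlonglongrightarrow> 0" by simp
    have "cn \<alpha> (a *\<^sub>R star (X k) \<sigma>1 - b *\<^sub>R star (X k) \<sigma>2) \<le>
        \<bar>a\<bar> * (C * cn (\<alpha> - real (sd k)) (\<sigma>1 - \<sigma>2)) + \<bar>a - b\<bar> * cn \<alpha> (star (X k) \<sigma>2)" for a b \<sigma>1 \<sigma>2
    proof -
      have "a *\<^sub>R star (X k) \<sigma>1 - b *\<^sub>R star (X k) \<sigma>2 = a *\<^sub>R star (X k) (\<sigma>1 - \<sigma>2) + (a - b) *\<^sub>R star (X k) \<sigma>2"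
        by (simp add: linear_diff[OF linear_star] algebra_simps)
      then have "cn \<alpha> (a *\<^sub>R star (X k) \<sigma>1 - b *\<^sub>R star (X k) \<sigma>2) \<le>
          \<bar>a\<bar> * cn \<alpha> (star (X k) (\<sigma>1 - \<sigma>2)) + \<bar>a - b\<bar> * cn \<alpha> (star (X k) \<sigma>2)"
        using cn_add by (metis cn_scale)
      moreover have "\<bar>a\<bar> * cn \<alpha> (star (X k) (\<sigma>1 - \<sigma>2)) \<le> \<bar>a\<bar> * (C * cn (\<alpha> - real (sd k)) (\<sigma>1 - \<sigma>2))"
        by (intro mult_left_mono C) simp
      ultimately show ?thesis by linarith
    qed
    note le = this
    show ?thesis
      by (rule Lim_null_comparison[OF always_eventually lim])
        (unfold real_norm_def abs_of_nonneg[OF cn_nonneg], rule allI, rule le)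
  qed
  then have lim: "(\<lambda>n. \<Sum>z\<in>?Z. \<Sum>k | sd k < N.
      cn \<alpha> (?c z k (xs n) *\<^sub>R star (X k) (\<sigma> z (xs n)) - ?c z k x *\<^sub>R star (X k) (\<sigma> z x))) \<longlonglongrightarrow> 0"
    by (intro tendsto_null_sum)
  have "eventually (\<lambda>n. sn (xs n - x) < \<delta>) sequentially"
    using order_tendstoD(2)[OF sn_tendsto_0[OF xs] \<delta>] .
  then have "eventually (\<lambda>n. norm (cn \<alpha> (approximant \<gamma> N \<delta> y f (xs n) - approximant \<gamma> N \<delta> y f x)) \<le>
      (\<Sum>z\<in>?Z. \<Sum>k | sd k < N.
        cn \<alpha> (?c z k (xs n) *\<^sub>R star (X k) (\<sigma> z (xs n)) - ?c z k x *\<^sub>R star (X k) (\<sigma> z x)))) sequentially"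
  proof eventually_elim
    case (elim n)
    have "z \<in> ?Z" if "\<forall>i. \<bar>cell_coord s \<delta> z (xs n) $ i\<bar> < 1" for z
      using near_cells_shift[OF \<delta>, of "x - xs n" z "xs n"] that elim
      by (simp add: sc_norm_minus_commute[of s x])
    then have "lift_sum N \<delta> y f (xs n) - lift_sum N \<delta> y f x = (\<Sum>z\<in>?Z. \<Sum>k | sd k < N.
        ?c z k (xs n) *\<^sub>R star (X k) (\<sigma> z (xs n)) - ?c z k x *\<^sub>R star (X k) (\<sigma> z x))"
      by (subst lift_sum_eq[OF finite_near_cells]) (auto simp: lift_sum_def \<sigma>_def sum_subtractf)
    then have "cn \<alpha> (lift_sum N \<delta> y f (xs n) - lift_sum N \<delta> y f x) \<le> (\<Sum>z\<in>?Z. \<Sum>k | sd k < N.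
        cn \<alpha> (?c z k (xs n) *\<^sub>R star (X k) (\<sigma> z (xs n)) - ?c z k x *\<^sub>R star (X k) (\<sigma> z x)))"
      by (simp only:) (intro order_trans[OF cn_sum] sum_mono cn_sum)
    moreover have "cn \<alpha> (approximant \<gamma> N \<delta> y f (xs n) - approximant \<gamma> N \<delta> y f x) \<le>
        cn \<alpha> (lift_sum N \<delta> y f (xs n) - lift_sum N \<delta> y f x)"
      unfolding approximant_def linear_diff[OF linear_proj, symmetric] cn_proj by (simp add: cn_nonneg)
    ultimately show ?case
      by (simp add: cn_nonneg)
  qed
  then show ?thesis by (rule Lim_null_comparison[OF _ lim])
qed

lemma T_measurable_approximant: "0 < \<delta> \<Longrightarrow> T_measurable S \<gamma> (approximant \<gamma> N \<delta> y f)"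
  by (intro T_measurable_if_continuous approximant_continuous)

end

section \<open>Selecting base points\<close>

lemma epowr_sum_le:
  assumes t: "0 < t" and I: "finite I"
  shows "epowr (\<Sum>i\<in>I. a i) t \<le> ennreal (real (card I) powr t) * (\<Sum>i\<in>I. epowr (a i) t)"
proof (cases "I = {}")
  case False
  define m where "m = Max (a ` I)"
  have m: "m \<in> a ` I" "\<And>i. i \<in> I \<Longrightarrow> a i \<le> m"
    using I False by (auto simp: m_def)
  have "(\<Sum>i\<in>I. a i) \<le> (\<Sum>i\<in>I. m)"
    using m by (intro sum_mono)
  also have "\<dots> = ennreal (real (card I)) * m"
    by (simp add: ennreal_of_nat_eq_real_of_nat)
  finally have "epowr (\<Sum>i\<in>I. a i) t \<le> epowr (ennreal (real (card I)) * m) t"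
    using t by (intro epowr_mono) auto
  also have "\<dots> = ennreal (real (card I) powr t) * epowr m t"
    using t by (subst epowr_mult) (simp_all only: epowr_ennreal of_nat_0_le_iff)
  also have "epowr m t \<le> (\<Sum>i\<in>I. epowr (a i) t)"
    using m(1) I by (auto intro: member_le_sum)
  finally show ?thesis by (simp add: mult_left_mono)
qed simp

lemma nn_integral_lborel_translate:
  fixes G :: "'a::euclidean_space \<Rightarrow> ennreal"
  assumes [measurable]: "G \<in> borel_measurable borel"
  shows "(\<integral>\<^sup>+x. G (a + x) \<partial>lborel) = (\<integral>\<^sup>+x. G x \<partial>lborel)"
proof -
  have "(\<integral>\<^sup>+x. G x \<partial>lborel) = (\<integral>\<^sup>+x. G x \<partial>distr lborel borel ((+) a))"
    by (simp add: lborel_distr_plus)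
  also have "\<dots> = (\<integral>\<^sup>+x. G (a + x) \<partial>lborel)"
    by (subst nn_integral_distr) auto
  finally show ?thesis ..
qed

text \<open>Half-open, so that the cells partition the space and integrals over the cells add up to
  a single integral.\<close>

definition cell :: "('d::finite \<Rightarrow> nat) \<Rightarrow> real \<Rightarrow> int^'d \<Rightarrow> (real^'d) set" where
  "cell s \<delta> z = {y. \<forall>i. \<lfloor>y $ i / \<delta> ^ s i\<rfloor> = z $ i}"

lemma sets_cell [measurable]: "cell s \<delta> z \<in> sets borel"
proof -
  have "cell s \<delta> z = {y \<in> space borel. \<forall>i\<in>UNIV. \<lfloor>y $ i / \<delta> ^ s i\<rfloor> = z $ i}"
    by (auto simp: cell_def)
  also have "\<dots> \<in> sets borel" by measurable
  finally show ?thesis .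
qed

lemma emeasure_cell:
  fixes z :: "int^'d::finite"
  assumes \<delta>: "0 < \<delta>"
  shows "emeasure lborel (cell s \<delta> z) = ennreal (\<delta> ^ sc_total s)"
proof -
  define a :: "real^'d" where "a = (\<chi> i. \<delta> ^ s i * real_of_int (z $ i))"
  define b where "b = (\<chi> i. \<delta> ^ s i * (real_of_int (z $ i) + 1))"
  have ab: "a $ i \<le> b $ i" for i
    using \<delta> by (simp add: a_def b_def)
  have floor_iff: "\<lfloor>t / c\<rfloor> = m \<longleftrightarrow> c * real_of_int m \<le> t \<and> t < c * (real_of_int m + 1)" if "0 < c" for t c :: real and m
    using that by (simp add: floor_eq_iff le_divide_eq divide_less_eq mult.commute)
  have cell: "y \<in> cell s \<delta> z \<longleftrightarrow> (\<forall>i. a $ i \<le> y $ i \<and> y $ i < b $ i)" for y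
    using \<delta> by (simp add: cell_def a_def b_def floor_iff)
  have vol: "(\<Prod>i\<in>UNIV. b $ i - a $ i) = \<delta> ^ sc_total s"
    by (simp add: a_def b_def algebra_simps prod_power_sc_total)
  have "emeasure lborel (cell s \<delta> z) \<le> emeasure lborel (cbox a b)"
    by (intro emeasure_mono) (auto simp: cell mem_box_cart less_imp_le)
  moreover have "emeasure lborel (box a b) \<le> emeasure lborel (cell s \<delta> z)"
    by (intro emeasure_mono) (auto simp: cell mem_box_cart less_imp_le)
  ultimately show ?thesis
    by (simp add: emeasure_lborel_vec_box[OF ab] vol)
qed

text \<open>The 3 is 2 for a point near the cell plus 1 for the size of the cell.\<close>

lemma near_cell_difference:
  assumes "0 < \<delta>" "y \<in> cell s \<delta> z" "z \<in> near_cells s \<delta> x"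
  shows "\<bar>(x - y) $ i\<bar> \<le> 3 * \<delta> ^ s i"
proof -
  have "\<bar>x $ i / \<delta> ^ s i - real_of_int (z $ i)\<bar> \<le> 2"
    using assms by (simp add: near_cells_def cell_coord_def)
  moreover have "\<bar>y $ i / \<delta> ^ s i - real_of_int (z $ i)\<bar> \<le> 1"
  proof -
    have "\<lfloor>y $ i / \<delta> ^ s i\<rfloor> = z $ i" using assms by (simp add: cell_def)
    then show ?thesis by linarith
  qed
  ultimately have "\<bar>x $ i / \<delta> ^ s i - y $ i / \<delta> ^ s i\<bar> \<le> 3" by linarith
  then have "\<bar>(x - y) $ i\<bar> / \<delta> ^ s i \<le> 3"
    using assms(1) by (simp add: diff_divide_distrib[symmetric] abs_divide)
  then show ?thesis using assms(1) by (simp add: divide_le_eq)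
qed

text \<open>Sums over cells become series over the naturals, for which sum and integral can be
  exchanged; \<open>E_space\<close> also asks for families indexed by naturals.\<close>

lemma exists_enumeration_cells:
  obtains e :: "nat \<Rightarrow> int^'d::finite" where "bij e"
proof -
  have "infinite (UNIV :: (int^'d) set)"
  proof
    assume "finite (UNIV :: (int^'d) set)"
    then have "finite (range (\<lambda>m::int. (\<chi> i. m) :: int^'d))"
      by (rule finite_subset[OF subset_UNIV])
    moreover have "inj (\<lambda>m::int. (\<chi> i. m) :: int^'d)"
      by (auto simp: inj_def vec_eq_iff)
    ultimately show False
      using finite_imageD infinite_UNIV_int by blast
  qed
  then have "bij_betw (from_nat_into (UNIV :: (int^'d) set)) UNIV UNIV"
    by (intro bij_betw_from_nat_into) auto
  then show ?thesis using that by blast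
qed

lemma sets_near_cells [measurable]: "{x. z \<in> near_cells s \<delta> x} \<in> sets borel"
proof -
  have "{x. z \<in> near_cells s \<delta> x} = {x \<in> space borel. \<forall>i\<in>UNIV. \<bar>x $ i / \<delta> ^ s i - real_of_int (z $ i)\<bar> \<le> 2}"
    by (auto simp: near_cells_def cell_coord_def)
  also have "\<dots> \<in> sets borel" by measurable
  finally show ?thesis .
qed

lemma sum_near_cells_eq_suminf:
  fixes g :: "int^'d::finite \<Rightarrow> ennreal"
  assumes e: "bij e"
  shows "(\<Sum>z\<in>near_cells s \<delta> x. g z) = (\<Sum>j. indicator {x. e j \<in> near_cells s \<delta> x} x * g (e j))"
proof -
  let ?J = "{j. e j \<in> near_cells s \<delta> x}"
  have J: "bij_betw e ?J (near_cells s \<delta> x)"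
    using e by (auto simp: bij_betw_def inj_on_def inj_def surj_def)
  then have fin: "finite ?J" using finite_near_cells bij_betw_finite by blast
  have "(\<Sum>j. indicator {x. e j \<in> near_cells s \<delta> x} x * g (e j)) =
      (\<Sum>j\<in>?J. indicator {x. e j \<in> near_cells s \<delta> x} x * g (e j))"
    by (intro suminf_finite fin) auto
  also have "\<dots> = (\<Sum>j\<in>?J. g (e j))"
    by (intro sum.cong) auto
  also have "\<dots> = (\<Sum>z\<in>near_cells s \<delta> x. g z)"
    by (rule sum.reindex_bij_betw[OF J])
  finally show ?thesis ..
qed

text \<open>In each cell a point is taken at which the integral of V over the nearby x is at most
  its mean over the cell. The cells being disjoint, the means add up to a double integral over pairs
  (x, u) with x - u in the box Q; exchanging the integrals bounds it by B times the volume of Q.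
  That volume is \<open>6 ^ CARD('d)\<close> times the cell volume \<mu> by which the means are
  divided.\<close>

lemma select_cell_points:
  fixes V :: "real^'d::finite \<Rightarrow> real^'d \<Rightarrow> ennreal"
  assumes \<delta>: "0 < \<delta>"
    and V: "(\<lambda>w. V (fst w) (snd w)) \<in> borel_measurable (borel \<Otimes>\<^sub>M borel)"
    and B: "\<And>h. (\<And>i. \<bar>h $ i\<bar> \<le> 3 * \<delta> ^ s i) \<Longrightarrow> (\<integral>\<^sup>+y. V (y + h) y \<partial>lborel) \<le> B"
  shows "\<exists>y. (\<forall>z. y z \<in> cell s \<delta> z) \<and>
    (\<integral>\<^sup>+x. (\<Sum>z\<in>near_cells s \<delta> x. V x (y z)) \<partial>lborel) \<le> 6 ^ CARD('d) * B"
proof -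
  define \<mu> where "\<mu> = ennreal (\<delta> ^ sc_total s)"
  have \<mu>: "0 < \<mu>" "\<mu> < \<infinity>" using \<delta> by (simp_all add: \<mu>_def)
  have [measurable (raw)]: "(\<lambda>w. V (f w) (g w)) \<in> borel_measurable M"
    if "f \<in> measurable M borel" "g \<in> measurable M borel" for f g and M :: "((real^'d) \<times> (real^'d)) measure"
    using measurable_compose[OF measurable_Pair[OF that] V] by simp
  have [measurable (raw)]: "(\<lambda>w. V (f w) (g w)) \<in> borel_measurable M"
    if "f \<in> measurable M borel" "g \<in> measurable M borel" for f g and M :: "(real^'d) measure"
    using measurable_compose[OF measurable_Pair[OF that] V] by simp
  define E where "E z y = (\<integral>\<^sup>+x. indicator {x. z \<in> near_cells s \<delta> x} x * V x y \<partial>lborel)" for z y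
  have E [measurable]: "E z \<in> borel_measurable borel" for z
  proof -
    have "(\<lambda>w. indicator {x. z \<in> near_cells s \<delta> x} (snd w) * V (snd w) (fst w)) \<in> borel_measurable (borel \<Otimes>\<^sub>M lborel)"
      by measurable
    from lborel.borel_measurable_nn_integral_fst[OF this] show ?thesis
      by (simp add: E_def[abs_def])
  qed
  have "\<exists>y\<in>cell s \<delta> z. E z y \<le> (\<integral>\<^sup>+y\<in>cell s \<delta> z. E z y \<partial>lborel) / \<mu>" for z
  proof (rule exists_le_average)
    show "(\<integral>\<^sup>+y\<in>cell s \<delta> z. E z y \<partial>lborel) \<le> (\<integral>\<^sup>+y\<in>cell s \<delta> z. E z y \<partial>lborel) / \<mu> * emeasure lborel (cell s \<delta> z)"
      using \<mu> by (simp add: emeasure_cell[OF \<delta>] \<mu>_def[symmetric] ennreal_divide_times ennreal_divide_self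
          flip: ennreal_times_divide)
  qed (use \<mu> in \<open>simp_all add: emeasure_cell[OF \<delta>] \<mu>_def[symmetric]\<close>)
  then obtain y where y: "\<And>z. y z \<in> cell s \<delta> z"
    "\<And>z. E z (y z) \<le> (\<integral>\<^sup>+y\<in>cell s \<delta> z. E z y \<partial>lborel) / \<mu>"
    by metis
  obtain e :: "nat \<Rightarrow> int^'d" where e: "bij e" using exists_enumeration_cells .
  define Q where "Q = {h::real^'d. \<forall>i. \<bar>h $ i\<bar> \<le> 3 * \<delta> ^ s i}"
  have Q: "Q = cbox (\<chi> i. - (3 * \<delta> ^ s i)) (\<chi> i. 3 * \<delta> ^ s i)"
    by (auto simp: Q_def mem_box_cart abs_le_iff minus_le_iff)
  then have [measurable]: "Q \<in> sets borel" by simp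
  have Qvol: "emeasure lborel Q = 6 ^ CARD('d) * \<mu>"
  proof -
    have "emeasure lborel Q = ennreal (\<Prod>i\<in>UNIV. 6 * \<delta> ^ s i)"
      unfolding Q using \<delta> by (subst emeasure_lborel_vec_box) (auto intro: order_trans[of _ 0])
    also have "(\<Prod>i\<in>UNIV. 6 * \<delta> ^ s i) = 6 ^ CARD('d) * \<delta> ^ sc_total s"
      by (simp add: prod.distrib prod_power_sc_total)
    also have "ennreal \<dots> = 6 ^ CARD('d) * \<mu>"
      using \<delta> by (simp add: \<mu>_def ennreal_mult' ennreal_power[symmetric])
    finally show ?thesis .
  qed
  have pointwise: "(\<Sum>j. indicator (cell s \<delta> (e j)) u * E (e j) u) \<le> (\<integral>\<^sup>+h. indicator Q h * V (u + h) u \<partial>lborel)" for u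
  proof -
    \<comment> \<open>Only the cell that contains u contributes to the sum.\<close>
    define z where "z = (\<chi> i. \<lfloor>u $ i / \<delta> ^ s i\<rfloor>)"
    have z: "u \<in> cell s \<delta> z'  \<longleftrightarrow> z' = z" for z'
      by (auto simp: cell_def z_def vec_eq_iff)
    obtain j0 where j0: "e j0 = z" using e by (metis bij_pointE)
    have "j = j0" if "e j = z" for j using e j0 that by (auto simp: bij_def inj_def)
    then have "(\<Sum>j. indicator (cell s \<delta> (e j)) u * E (e j) u) = (\<Sum>j\<in>{j0}. indicator (cell s \<delta> (e j)) u * E (e j) u)"
      by (intro suminf_finite) (auto simp: indicator_def z)
    also have "\<dots> = E z u" by (simp add: j0 z)
    also have "\<dots> \<le> (\<integral>\<^sup>+x. indicator Q (- u + x) * V x u \<partial>lborel)"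
      unfolding E_def
    proof (intro nn_integral_mono mult_right_mono)
      fix x
      show "indicator {x. z \<in> near_cells s \<delta> x} x \<le> (indicator Q (- u + x) :: ennreal)"
        using near_cell_difference[OF \<delta>, of u s z x] z by (auto simp: indicator_def Q_def)
    qed simp
    also have "\<dots> = (\<integral>\<^sup>+x. indicator Q (- u + (u + x)) * V (u + x) u \<partial>lborel)"
      by (rule nn_integral_lborel_translate[symmetric]) measurable
    finally show ?thesis by simp
  qed
  have "(\<Sum>j. E (e j) (y (e j))) \<le> (\<Sum>j. (\<integral>\<^sup>+u\<in>cell s \<delta> (e j). E (e j) u \<partial>lborel) * inverse \<mu>)"
    using y(2) by (intro suminf_le) (auto simp: divide_ennreal_def)
  also have "\<dots> = (\<Sum>j. \<integral>\<^sup>+u\<in>cell s \<delta> (e j). E (e j) u \<partial>lborel) * inverse \<mu>"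
    by (rule ennreal_suminf_multc)
  also have "(\<Sum>j. \<integral>\<^sup>+u\<in>cell s \<delta> (e j). E (e j) u \<partial>lborel) = (\<integral>\<^sup>+u. (\<Sum>j. indicator (cell s \<delta> (e j)) u * E (e j) u) \<partial>lborel)"
    by (subst nn_integral_suminf) (auto simp: mult.commute)
  also have "\<dots> \<le> (\<integral>\<^sup>+u. (\<integral>\<^sup>+h. indicator Q h * V (u + h) u \<partial>lborel) \<partial>lborel)"
    by (intro nn_integral_mono pointwise)
  also have "\<dots> = (\<integral>\<^sup>+h. (\<integral>\<^sup>+u. indicator Q h * V (u + h) u \<partial>lborel) \<partial>lborel)"
  proof (rule lborel_pair.Fubini')
    show "(\<lambda>(h, u). indicator Q h * V (u + h) u) \<in> borel_measurable (lborel \<Otimes>\<^sub>M lborel)"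
      unfolding case_prod_beta by measurable
  qed
  also have "\<dots> \<le> (\<integral>\<^sup>+h. B * indicator Q h \<partial>lborel)"
  proof (rule nn_integral_mono)
    fix h :: "real^'d"
    show "(\<integral>\<^sup>+u. indicator Q h * V (u + h) u \<partial>lborel) \<le> B * indicator Q h"
      using B[of h] by (cases "h \<in> Q") (auto simp: Q_def)
  qed
  also have "\<dots> = B * (6 ^ CARD('d) * \<mu>)"
    by (simp add: nn_integral_cmult_indicator Qvol)
  also have "B * (6 ^ CARD('d) * \<mu>) * inverse \<mu> = 6 ^ CARD('d) * B"
  proof -
    have "\<mu> * inverse \<mu> = 1" using \<mu> by (simp add: ennreal_divide_self flip: divide_ennreal_def)
    then have "B * 6 ^ CARD('d) * (\<mu> * inverse \<mu>) = B * 6 ^ CARD('d)" by simp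
    then show ?thesis by (simp only: mult_ac)
  qed
  finally have sumE: "(\<Sum>j. E (e j) (y (e j))) \<le> 6 ^ CARD('d) * B"
    by (simp add: mult_right_mono)
  have "(\<integral>\<^sup>+x. (\<Sum>z\<in>near_cells s \<delta> x. V x (y z)) \<partial>lborel) =
      (\<integral>\<^sup>+x. (\<Sum>j. indicator {x. e j \<in> near_cells s \<delta> x} x * V x (y (e j))) \<partial>lborel)"
    by (intro nn_integral_cong sum_near_cells_eq_suminf e)
  also have "\<dots> = (\<Sum>j. E (e j) (y (e j)))"
    unfolding E_def by (intro nn_integral_suminf) measurable
  finally show ?thesis
    using sumE y(1) by (intro exI[of _ y]) simp
qed

section \<open>The modulus of continuity of a modelled distribution\<close>

context modelled_setting
begin

definition scaled_gap :: "real \<Rightarrow> real \<Rightarrow> (real^'d \<Rightarrow> 'v) \<Rightarrow> real^'d \<Rightarrow> real^'d \<Rightarrow> real" where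
  "scaled_gap \<gamma> \<delta> f x y = (\<Sum>\<beta>\<in>homs S \<inter> {..<\<gamma>}. \<delta> powr (\<beta> - \<gamma>) * gap f \<beta> x y)"

lemma scaled_gap_nonneg: "0 \<le> scaled_gap \<gamma> \<delta> f x y"
  by (simp add: scaled_gap_def sum_nonneg gap_nonneg)

lemma scaled_gap_eq:
  "sn (x - y) < 1 \<Longrightarrow> scaled_gap \<gamma> \<delta> f x y = scaled_norm \<gamma> \<delta> (f x - \<Gamma> x y (f y))"
  by (simp add: scaled_gap_def scaled_norm_def gap_def)

text \<open>The weighted oscillation under the shift h at mesh size \<delta>: the quantity that is
  controlled at every single h, which selection of base points requires.\<close>

definition modulus :: "real \<Rightarrow> real \<Rightarrow> ennreal \<Rightarrow> (real^'d \<Rightarrow> 'v) \<Rightarrow> real^'d \<Rightarrow> ennreal" where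
  "modulus \<gamma> \<delta> p f h = Lp_norm p (\<lambda>x. ennreal (scaled_gap \<gamma> \<delta> f (x + h) x))"

lemma scaled_norm_add: "0 < \<delta> \<Longrightarrow> scaled_norm \<gamma> \<delta> (\<sigma> + \<tau>) \<le> scaled_norm \<gamma> \<delta> \<sigma> + scaled_norm \<gamma> \<delta> \<tau>"
  unfolding scaled_norm_def sum.distrib[symmetric] distrib_left[symmetric]
  by (intro sum_mono mult_left_mono cn_add) simp

lemma scaled_norm_minus [simp]: "scaled_norm \<gamma> \<delta> (- \<sigma>) = scaled_norm \<gamma> \<delta> \<sigma>"
  by (simp add: scaled_norm_def)

text \<open>The weights of \<open>scaled_norm\<close> turn the bound
  \<open>(c * \<delta>) powr (\<alpha> - \<beta>)\<close> for the off-diagonal part of \<Gamma> into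
  \<open>c powr (\<alpha> - \<beta>)\<close>, which is free of \<delta>.\<close>

lemma scaled_norm_\<Gamma>:
  assumes c: "0 < c"
  shows "\<exists>C\<ge>0. \<forall>\<delta> x y \<sigma>. 0 < \<delta> \<longrightarrow> sn (x - y) < 1 \<longrightarrow> sn (x - y) \<le> c * \<delta> \<longrightarrow> \<sigma> \<in> T_below S \<gamma> \<longrightarrow>
    scaled_norm \<gamma> \<delta> (\<Gamma> x y \<sigma>) \<le> C * scaled_norm \<gamma> \<delta> \<sigma>"
proof -
  let ?H = "homs S \<inter> {..<\<gamma>}"
  obtain C where C: "C \<ge> 0" "\<And>x y \<sigma> \<beta>. \<sigma> \<in> T_below S \<gamma> \<Longrightarrow> sn (x - y) < 1 \<Longrightarrow>
     cn \<beta> (\<Gamma> x y \<sigma> - \<sigma>) \<le> C * (\<Sum>\<alpha>\<in>?H \<inter> {\<beta><..}. sn (x - y) powr (\<alpha> - \<beta>) * cn \<alpha> \<sigma>)"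
    using \<Gamma>_bound[of \<gamma>] by blast
  define M where "M = 1 + (\<Sum>\<beta>\<in>?H. C * (\<Sum>\<alpha>\<in>?H. c powr (\<alpha> - \<beta>)))"
  show ?thesis
  proof (intro exI[of _ M] conjI allI impI)
    show "0 \<le> M" using C by (simp add: M_def sum_nonneg)
    fix \<delta> x y \<sigma>
    assume \<delta>: "(0::real) < \<delta>" and xy: "sn (x - y) < 1" "sn (x - y) \<le> c * \<delta>" and \<sigma>: "\<sigma> \<in> T_below S \<gamma>"
    let ?N = "scaled_norm \<gamma> \<delta> \<sigma>"
    have "\<delta> powr (\<beta> - \<gamma>) * cn \<beta> (\<Gamma> x y \<sigma> - \<sigma>) \<le> C * (\<Sum>\<alpha>\<in>?H. c powr (\<alpha> - \<beta>)) * ?N" if "\<beta> \<in> ?H" for \<beta>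
    proof -
      have each: "sn (x - y) powr (\<alpha> - \<beta>) * cn \<alpha> \<sigma> \<le> \<delta> powr (\<gamma> - \<beta>) * (c powr (\<alpha> - \<beta>) * ?N)"
        if "\<alpha> \<in> ?H \<inter> {\<beta><..}" for \<alpha>
      proof -
        have "sn (x - y) powr (\<alpha> - \<beta>) \<le> (c * \<delta>) powr (\<alpha> - \<beta>)"
          using that xy by (intro powr_mono2) (auto simp: sc_norm_nonneg)
        then have "sn (x - y) powr (\<alpha> - \<beta>) * cn \<alpha> \<sigma> \<le> (c * \<delta>) powr (\<alpha> - \<beta>) * (\<delta> powr (\<gamma> - \<alpha>) * ?N)"
          by (intro mult_mono cn_le_scaled_norm \<sigma> \<delta>) (auto simp: cn_nonneg)
        also have "\<dots> = (\<delta> powr (\<alpha> - \<beta>) * \<delta> powr (\<gamma> - \<alpha>)) * (c powr (\<alpha> - \<beta>) * ?N)"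
          using c \<delta> by (simp add: powr_mult mult_ac)
        also have "\<delta> powr (\<alpha> - \<beta>) * \<delta> powr (\<gamma> - \<alpha>) = \<delta> powr (\<gamma> - \<beta>)"
          by (simp add: powr_add[symmetric])
        finally show ?thesis .
      qed
      have "cn \<beta> (\<Gamma> x y \<sigma> - \<sigma>) \<le> C * (\<Sum>\<alpha>\<in>?H \<inter> {\<beta><..}. sn (x - y) powr (\<alpha> - \<beta>) * cn \<alpha> \<sigma>)"
        by (rule C(2)[OF \<sigma> xy(1)])
      also have "\<dots> \<le> C * (\<Sum>\<alpha>\<in>?H \<inter> {\<beta><..}. \<delta> powr (\<gamma> - \<beta>) * (c powr (\<alpha> - \<beta>) * ?N))"
        by (intro mult_left_mono sum_mono each C(1))
      also have "\<dots> \<le> C * (\<Sum>\<alpha>\<in>?H. \<delta> powr (\<gamma> - \<beta>) * (c powr (\<alpha> - \<beta>) * ?N))"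
        by (intro mult_left_mono sum_mono2 finite_homs_below C(1)) (auto simp: scaled_norm_nonneg)
      also have "\<dots> = \<delta> powr (\<gamma> - \<beta>) * (C * (\<Sum>\<alpha>\<in>?H. c powr (\<alpha> - \<beta>)) * ?N)"
        by (simp add: sum_distrib_left sum_distrib_right mult_ac)
      finally have "\<delta> powr (\<beta> - \<gamma>) * cn \<beta> (\<Gamma> x y \<sigma> - \<sigma>) \<le>
          \<delta> powr (\<beta> - \<gamma>) * (\<delta> powr (\<gamma> - \<beta>) * (C * (\<Sum>\<alpha>\<in>?H. c powr (\<alpha> - \<beta>)) * ?N))"
        by (intro mult_left_mono) auto
      moreover have "\<delta> powr (\<beta> - \<gamma>) * \<delta> powr (\<gamma> - \<beta>) = 1"
        using \<delta> by (simp add: powr_add[symmetric])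
      ultimately show ?thesis by (simp only: mult.assoc[symmetric] mult_1_left)
    qed
    then have "scaled_norm \<gamma> \<delta> (\<Gamma> x y \<sigma> - \<sigma>) \<le> (\<Sum>\<beta>\<in>?H. C * (\<Sum>\<alpha>\<in>?H. c powr (\<alpha> - \<beta>)) * ?N)"
      unfolding scaled_norm_def[of _ _ "\<Gamma> x y \<sigma> - \<sigma>"] by (intro sum_mono)
    also have "\<dots> = (M - 1) * ?N"
      by (simp add: M_def sum_distrib_right)
    finally have 1: "scaled_norm \<gamma> \<delta> (\<Gamma> x y \<sigma> - \<sigma>) \<le> (M - 1) * ?N" .
    show "scaled_norm \<gamma> \<delta> (\<Gamma> x y \<sigma>) \<le> M * ?N"
      using 1 scaled_norm_add[OF \<delta>, of \<gamma> "\<Gamma> x y \<sigma> - \<sigma>" \<sigma>] by (simp add: algebra_simps)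
  qed
qed

context
  fixes f :: "real^'d \<Rightarrow> 'v" and \<gamma> :: real
  assumes f_meas: "T_measurable S \<gamma> f" and f_below: "\<And>x. f x \<in> T_below S \<gamma>"
begin

lemma borel_measurable_scaled_gap:
  "(\<lambda>w. scaled_gap \<gamma> \<delta> f (fst w) (snd w)) \<in> borel_measurable (borel \<Otimes>\<^sub>M borel)"
  unfolding scaled_gap_def
  by (intro borel_measurable_sum borel_measurable_times borel_measurable_const
      borel_measurable_gap[OF f_meas f_below])

lemma borel_measurable_shifted:
  fixes G :: "real^'d \<Rightarrow> real^'d \<Rightarrow> real" and h :: "real^'d"
  assumes G: "(\<lambda>w. G (fst w) (snd w)) \<in> borel_measurable (borel \<Otimes>\<^sub>M borel)"
  shows "(\<lambda>(h, x). G (x + h) x) \<in> borel_measurable (borel \<Otimes>\<^sub>M lborel)"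
    and "(\<lambda>x. G (x + h) x) \<in> borel_measurable borel"
proof -
  have "(\<lambda>w :: (real^'d) \<times> (real^'d). (snd w + fst w, snd w)) \<in> measurable (borel \<Otimes>\<^sub>M lborel) (borel \<Otimes>\<^sub>M borel)"
    by measurable
  from measurable_compose[OF this G] show "(\<lambda>(h, x). G (x + h) x) \<in> borel_measurable (borel \<Otimes>\<^sub>M lborel)"
    by (simp add: case_prod_beta)
  have "(\<lambda>x :: real^'d. (x + h, x)) \<in> measurable borel (borel \<Otimes>\<^sub>M borel)"
    by measurable
  from measurable_compose[OF this G] show "(\<lambda>x. G (x + h) x) \<in> borel_measurable borel"
    by simp
qed

lemmas gap_shift_measurable = borel_measurable_shifted[OF borel_measurable_gap[OF f_meas f_below]]
  and scaled_gap_shift_measurable = borel_measurable_shifted[OF borel_measurable_scaled_gap]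

lemma borel_measurable_modulus: "modulus \<gamma> \<delta> p f \<in> borel_measurable borel"
  unfolding modulus_def[abs_def]
  by (rule borel_measurable_Lp_norm)
    (use scaled_gap_shift_measurable(1)[of \<delta>] in \<open>simp add: case_prod_beta\<close>)

text \<open>\<open>d_quot\<close> with the cut-off of \<open>gap\<close>, so that it is measurable
  in h on the whole space; the two agree on the unit ball (\<open>gap_quot_eq\<close>).\<close>

definition gap_quot :: "real \<Rightarrow> ennreal \<Rightarrow> real^'d \<Rightarrow> ennreal" where
  "gap_quot \<beta> p h = Lp_norm p (\<lambda>x. ennreal (gap f \<beta> (x + h) x / sn h powr (\<gamma> - \<beta>)))"

lemma borel_measurable_gap_quot: "gap_quot \<beta> p \<in> borel_measurable borel"
  unfolding gap_quot_def[abs_def]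
proof (rule borel_measurable_Lp_norm)
  note [measurable] = gap_shift_measurable(1)[of \<beta>, unfolded case_prod_beta]
  show "(\<lambda>(h, x). ennreal (gap f \<beta> (x + h) x / sn h powr (\<gamma> - \<beta>))) \<in> borel_measurable (borel \<Otimes>\<^sub>M lborel)"
    unfolding case_prod_beta by measurable
qed

lemma gap_quot_eq: "sn h < 1 \<Longrightarrow> gap_quot \<beta> p h = d_quot s S \<Gamma> \<gamma> \<beta> p f h"
  by (simp add: gap_quot_def d_quot_def gap_def)

lemma Lp_norm_gap_le:
  assumes p: "1 \<le> p"
  shows "Lp_norm p (\<lambda>x. ennreal (gap f \<beta> (x + h) x)) \<le> ennreal (sn h powr (\<gamma> - \<beta>)) * gap_quot \<beta> p h"
proof (cases "h = 0")
  case True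
  then show ?thesis using p by (simp add: gap_def)
next
  case False
  then have "0 < sn h"
    using sc_norm_nonneg[of s h] sc_norm_eq_0_iff[of s h] by simp
  then have "ennreal (gap f \<beta> (x + h) x) =
      ennreal (sn h powr (\<gamma> - \<beta>)) * ennreal (gap f \<beta> (x + h) x / sn h powr (\<gamma> - \<beta>))" for x
    by (simp add: ennreal_mult'[symmetric] gap_nonneg)
  then show ?thesis
    unfolding gap_quot_def using gap_shift_measurable(2)[of \<beta> h] p
    by (simp only:) (intro Lp_norm_cmult, auto)
qed

text \<open>As \<gamma> - \<beta> is positive, \<open>sn h \<le> c * \<delta>\<close> bounds the
  weight \<open>\<delta> powr (\<beta> - \<gamma>)\<close>, up to a constant, by the
  \<open>sn h powr (\<beta> - \<gamma>)\<close> of the difference quotient.\<close>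

lemma modulus_le_gap_quot:
  assumes p: "1 \<le> p" and c: "0 < c"
  shows "\<exists>C\<ge>0. \<forall>\<delta>>0. \<forall>h. sn h \<le> c * \<delta> \<longrightarrow>
    modulus \<gamma> \<delta> p f h \<le> ennreal C * (\<Sum>\<beta>\<in>homs S \<inter> {..<\<gamma>}. gap_quot \<beta> p h)"
proof -
  let ?H = "homs S \<inter> {..<\<gamma>}"
  define M where "M = (\<Sum>\<beta>\<in>?H. c powr (\<gamma> - \<beta>))"
  show ?thesis
  proof (intro exI[of _ "4 ^ card ?H * M"] conjI allI impI)
    show "0 \<le> 4 ^ card ?H * M" by (simp add: M_def sum_nonneg)
    fix \<delta> h assume \<delta>: "(0::real) < \<delta>" and h: "sn h \<le> c * \<delta>"
    have each: "Lp_norm p (\<lambda>x. ennreal (\<delta> powr (\<beta> - \<gamma>) * gap f \<beta> (x + h) x)) \<le> ennreal M * gap_quot \<beta> p h"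
      if "\<beta> \<in> ?H" for \<beta>
    proof -
      have "Lp_norm p (\<lambda>x. ennreal (\<delta> powr (\<beta> - \<gamma>) * gap f \<beta> (x + h) x)) =
          Lp_norm p (\<lambda>x. ennreal (\<delta> powr (\<beta> - \<gamma>)) * ennreal (gap f \<beta> (x + h) x))"
        by (simp add: ennreal_mult')
      also have "\<dots> \<le> ennreal (\<delta> powr (\<beta> - \<gamma>)) * Lp_norm p (\<lambda>x. ennreal (gap f \<beta> (x + h) x))"
        using gap_shift_measurable(2)[of \<beta> h] by (intro Lp_norm_cmult p) simp
      also have "\<dots> \<le> ennreal (\<delta> powr (\<beta> - \<gamma>)) * (ennreal (sn h powr (\<gamma> - \<beta>)) * gap_quot \<beta> p h)"
        by (intro mult_left_mono Lp_norm_gap_le p) simp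
      also have "\<dots> = ennreal (\<delta> powr (\<beta> - \<gamma>) * sn h powr (\<gamma> - \<beta>)) * gap_quot \<beta> p h"
        by (simp add: ennreal_mult' mult.assoc)
      also have "\<dots> \<le> ennreal M * gap_quot \<beta> p h"
      proof (intro mult_right_mono ennreal_leI)
        have "sn h powr (\<gamma> - \<beta>) \<le> (c * \<delta>) powr (\<gamma> - \<beta>)"
          using h that by (intro powr_mono2) (auto simp: sc_norm_nonneg)
        then have "\<delta> powr (\<beta> - \<gamma>) * sn h powr (\<gamma> - \<beta>) \<le> \<delta> powr (\<beta> - \<gamma>) * (c * \<delta>) powr (\<gamma> - \<beta>)"
          by (intro mult_left_mono) auto
        also have "\<dots> = c powr (\<gamma> - \<beta>)"
          using c \<delta> by (simp add: powr_mult powr_add[symmetric] mult.left_commute)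
        also have "\<dots> \<le> M"
          unfolding M_def using that by (intro member_le_sum finite_homs_below) auto
        finally show "\<delta> powr (\<beta> - \<gamma>) * sn h powr (\<gamma> - \<beta>) \<le> M" .
      qed simp
      finally show ?thesis .
    qed
    have "modulus \<gamma> \<delta> p f h = Lp_norm p (\<lambda>x. \<Sum>\<beta>\<in>?H. ennreal (\<delta> powr (\<beta> - \<gamma>) * gap f \<beta> (x + h) x))"
      by (simp add: modulus_def scaled_gap_def sum_ennreal gap_nonneg)
    also have "\<dots> \<le> 4 ^ card ?H * (\<Sum>\<beta>\<in>?H. Lp_norm p (\<lambda>x. ennreal (\<delta> powr (\<beta> - \<gamma>) * gap f \<beta> (x + h) x)))"
      using gap_shift_measurable(2)[of _ h] by (intro Lp_norm_sum p finite_homs_below) simp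
    also have "\<dots> \<le> 4 ^ card ?H * (\<Sum>\<beta>\<in>?H. ennreal M * gap_quot \<beta> p h)"
      by (intro mult_left_mono sum_mono each) auto
    also have "\<dots> = ennreal (4 ^ card ?H * M) * (\<Sum>\<beta>\<in>?H. gap_quot \<beta> p h)"
    proof -
      have "ennreal (4 ^ card ?H * M) = 4 ^ card ?H * ennreal M"
        by (simp add: ennreal_mult' M_def sum_nonneg ennreal_power[symmetric])
      then show ?thesis by (simp add: sum_distrib_left mult.assoc)
    qed
    finally show "modulus \<gamma> \<delta> p f h \<le> ennreal (4 ^ card ?H * M) * (\<Sum>\<beta>\<in>?H. gap_quot \<beta> p h)" .
  qed
qed

text \<open>The chain passes through \<open>u = x + h + k\<close>, so that only translations of the variables occur.\<close>

lemma modulus_chain: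
  assumes p: "1 \<le> p" and c: "0 < c"
  shows "\<exists>C\<ge>0. \<forall>\<delta> h k. 0 < \<delta> \<longrightarrow> sn h < 1 \<longrightarrow> sn (h + k) < 1 \<longrightarrow> sn k < 1 \<longrightarrow> sn k \<le> c * \<delta> \<longrightarrow>
    modulus \<gamma> \<delta> p f h \<le> ennreal C * (modulus \<gamma> \<delta> p f k + modulus \<gamma> \<delta> p f (h + k))"
proof -
  obtain C where C: "C \<ge> 0" "\<And>\<delta> x y \<sigma>. 0 < \<delta> \<Longrightarrow> sn (x - y) < 1 \<Longrightarrow> sn (x - y) \<le> c * \<delta> \<Longrightarrow> \<sigma> \<in> T_below S \<gamma> \<Longrightarrow>
    scaled_norm \<gamma> \<delta> (\<Gamma> x y \<sigma>) \<le> C * scaled_norm \<gamma> \<delta> \<sigma>"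
    using scaled_norm_\<Gamma>[OF c, of \<gamma>] by blast
  show ?thesis
  proof (intro exI[of _ "C * 4"] conjI allI impI)
    show "0 \<le> C * 4" using C by simp
    fix \<delta> h k
    assume \<delta>: "(0::real) < \<delta>" and h: "sn h < 1" and hk: "sn (h + k) < 1" and k: "sn k < 1" "sn k \<le> c * \<delta>"
    note m = scaled_gap_shift_measurable(2)[of \<delta>]
    have pointwise: "scaled_gap \<gamma> \<delta> f (x + h) x \<le>
        C * (scaled_gap \<gamma> \<delta> f ((x + h) + k) (x + h) + scaled_gap \<gamma> \<delta> f (x + (h + k)) x)" for x
    proof -
      define u where "u = x + h + k"
      define a where "a = f u - \<Gamma> u (x + h) (f (x + h))"
      define b where "b = f u - \<Gamma> u x (f x)"
      have "f (x + h) - \<Gamma> (x + h) x (f x) = - \<Gamma> (x + h) u a + \<Gamma> (x + h) u b"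
        by (simp add: a_def b_def \<Gamma>_diff \<Gamma>_compose)
      then have "scaled_norm \<gamma> \<delta> (f (x + h) - \<Gamma> (x + h) x (f x)) \<le>
          scaled_norm \<gamma> \<delta> (\<Gamma> (x + h) u a) + scaled_norm \<gamma> \<delta> (\<Gamma> (x + h) u b)"
        using scaled_norm_add[OF \<delta>, of \<gamma> "- \<Gamma> (x + h) u a" "\<Gamma> (x + h) u b"] by simp
      also have "\<dots> \<le> C * scaled_norm \<gamma> \<delta> a + C * scaled_norm \<gamma> \<delta> b"
      proof (intro add_mono C(2) \<delta>)
        have "x + h - u = - k" by (simp add: u_def)
        then show "sn (x + h - u) < 1" "sn (x + h - u) < 1" "sn (x + h - u) \<le> c * \<delta>" "sn (x + h - u) \<le> c * \<delta>"
          using k by simp_all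
        show "a \<in> T_below S \<gamma>" "b \<in> T_below S \<gamma>"
          unfolding a_def b_def by (intro subspace_diff[OF subspace_T_below] \<Gamma>_T_below f_below)+
      qed
      finally show ?thesis
        using h hk k by (simp add: scaled_gap_eq a_def b_def u_def add.assoc distrib_left)
    qed
    have "modulus \<gamma> \<delta> p f h \<le> Lp_norm p (\<lambda>x. ennreal C *
        (ennreal (scaled_gap \<gamma> \<delta> f ((x + h) + k) (x + h)) + ennreal (scaled_gap \<gamma> \<delta> f (x + (h + k)) x)))"
      unfolding modulus_def
    proof (rule Lp_norm_mono[OF p])
      show "ennreal (scaled_gap \<gamma> \<delta> f (x + h) x) \<le> ennreal C *
        (ennreal (scaled_gap \<gamma> \<delta> f ((x + h) + k) (x + h)) + ennreal (scaled_gap \<gamma> \<delta> f (x + (h + k)) x))" for x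
        using ennreal_leI[OF pointwise[of x]] C(1)
        by (simp add: ennreal_mult' ennreal_plus[symmetric] scaled_gap_nonneg del: ennreal_plus)
    qed (use m in simp)
    also have "\<dots> \<le> ennreal C * Lp_norm p (\<lambda>x. ennreal (scaled_gap \<gamma> \<delta> f ((x + h) + k) (x + h)) +
        ennreal (scaled_gap \<gamma> \<delta> f (x + (h + k)) x))"
    proof (rule Lp_norm_cmult[OF p])
      have "(\<lambda>x. scaled_gap \<gamma> \<delta> f ((x + h) + k) (x + h)) \<in> borel_measurable borel"
        using measurable_compose[OF _ m[of k], of "\<lambda>x. x + h" borel] by simp
      then show "(\<lambda>x. ennreal (scaled_gap \<gamma> \<delta> f ((x + h) + k) (x + h)) +
        ennreal (scaled_gap \<gamma> \<delta> f (x + (h + k)) x)) \<in> borel_measurable lborel"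
        using m[of "h + k"] by simp
    qed
    also have "\<dots> \<le> ennreal C * (4 * (Lp_norm p (\<lambda>x. ennreal (scaled_gap \<gamma> \<delta> f ((x + h) + k) (x + h))) +
        Lp_norm p (\<lambda>x. ennreal (scaled_gap \<gamma> \<delta> f (x + (h + k)) x))))"
    proof (intro mult_left_mono Lp_norm_add p)
      have "(\<lambda>x. scaled_gap \<gamma> \<delta> f ((x + h) + k) (x + h)) \<in> borel_measurable borel"
        using measurable_compose[OF _ m[of k], of "\<lambda>x. x + h" borel] by simp
      then show "(\<lambda>x. ennreal (scaled_gap \<gamma> \<delta> f ((x + h) + k) (x + h))) \<in> borel_measurable lborel"
        by simp
    qed (use m[of "h + k"] in simp_all)
    also have "Lp_norm p (\<lambda>x. ennreal (scaled_gap \<gamma> \<delta> f ((x + h) + k) (x + h))) = modulus \<gamma> \<delta> p f k"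
      unfolding modulus_def using m[of k]
      by (intro Lp_norm_translate[where F = "\<lambda>x. ennreal (scaled_gap \<gamma> \<delta> f (x + k) x)"] p) simp
    finally show "modulus \<gamma> \<delta> p f h \<le> ennreal (C * 4) * (modulus \<gamma> \<delta> p f k + modulus \<gamma> \<delta> p f (h + k))"
      using C(1) by (simp add: modulus_def ennreal_mult' mult.assoc)
  qed
qed

text \<open>Up to the q-th root, the part of the seminorms of f that is carried by shifts shorter
  than \<rho>.\<close>

definition tail :: "ennreal \<Rightarrow> ennreal \<Rightarrow> real \<Rightarrow> ennreal" where
  "tail p q \<rho> = (\<integral>\<^sup>+h\<in>{h. sn h < \<rho>}. (\<Sum>\<beta>\<in>homs S \<inter> {..<\<gamma>}. epowr (gap_quot \<beta> p h) (enn2real q)) *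
      ennreal (1 / sn h ^ sc_total s) \<partial>lborel)"

lemma sets_sn_less [measurable]: "{h. sn h < \<rho>} \<in> sets borel" "{h. sn h \<le> \<rho>} \<in> sets borel"
  by measurable

text \<open>Passage from a mean over h to every single h. By \<open>modulus_chain\<close> the
  modulus at h is bounded by those at k and at h + k, for any small k. Averaging their q-th powers
  over the k in the ball of radius \<open>c * \<delta>\<close> finds one k for which both are small,
  since k and h + k stay in the ball of radius \<open>2 * c * \<delta>\<close>, where the tail
  controls the integral.\<close>

lemma modulus_le_tail:
  assumes p: "1 \<le> p" and q: "1 \<le> q" "q < \<infinity>" and c: "0 < c"
  shows "\<exists>C\<ge>0. \<forall>\<delta> h. 0 < \<delta> \<longrightarrow> 2 * c * \<delta> \<le> 1 \<longrightarrow> sn h < c * \<delta> \<longrightarrow>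
    epowr (modulus \<gamma> \<delta> p f h) (enn2real q) \<le> ennreal C * tail p q (2 * c * \<delta>)"
proof -
  let ?H = "homs S \<inter> {..<\<gamma>}"
  define t where "t = enn2real q"
  have t: "0 < t" using enn2real_pos[OF q] by (simp add: t_def)
  define n where "n = sc_total s"
  have n: "0 < n"
  proof -
    obtain i :: 'd where True by blast
    have "1 \<le> s i" using scaling by blast
    also have "s i \<le> n" unfolding n_def sc_total_def by (rule member_le_sum) auto
    finally show ?thesis by simp
  qed
  obtain C1 where C1: "C1 \<ge> 0" "\<And>\<delta> h. 0 < \<delta> \<Longrightarrow> sn h \<le> (2 * c) * \<delta> \<Longrightarrow>
      modulus \<gamma> \<delta> p f h \<le> ennreal C1 * (\<Sum>\<beta>\<in>?H. gap_quot \<beta> p h)"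
    using modulus_le_gap_quot[OF p, of "2 * c"] c by auto
  obtain C2 where C2: "C2 \<ge> 0" "\<And>\<delta> h k. 0 < \<delta> \<Longrightarrow> sn h < 1 \<Longrightarrow> sn (h + k) < 1 \<Longrightarrow> sn k < 1 \<Longrightarrow> sn k \<le> c * \<delta> \<Longrightarrow>
    modulus \<gamma> \<delta> p f h \<le> ennreal C2 * (modulus \<gamma> \<delta> p f k + modulus \<gamma> \<delta> p f (h + k))"
    using modulus_chain[OF p c] by blast
  \<comment> \<open>\<open>A1\<close> collects the constants that bound the q-th power of the
    modulus by the density of the tail; \<open>a0 * \<delta> ^ n\<close> is a lower bound for the
    volume of the ball over which k is averaged.\<close>
  define A1 where "A1 = (C1 powr t * real (card ?H) powr t) * (2 * c) ^ n"
  define a0 where "a0 = 2 ^ CARD('d) * (c / (2 * real CARD('d))) ^ n"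
  have a0: "0 < a0" using c by (simp add: a0_def)
  define M where "M = C2 powr t * 2 powr t * (2 * A1 / a0)"
  show ?thesis
  proof (intro exI[of _ M] conjI allI impI)
    show "0 \<le> M" using a0 c by (simp add: M_def A1_def)
    fix \<delta> h assume \<delta>: "(0::real) < \<delta>" and c\<delta>: "2 * c * \<delta> \<le> 1" and h: "sn h < c * \<delta>"
    define G where "G k = epowr (modulus \<gamma> \<delta> p f k) t" for k
    note [measurable] = borel_measurable_modulus[of \<delta> p] borel_measurable_gap_quot[of _ p]
    have [measurable]: "G \<in> borel_measurable borel"
      unfolding G_def[abs_def] by measurable
    let ?B = "{k. sn k < 2 * c * \<delta>}" and ?A = "{k. sn k < c * \<delta>}"
    have G_int: "(\<integral>\<^sup>+k\<in>?B. G k \<partial>lborel) \<le> ennreal (A1 * \<delta> ^ n) * tail p q (2 * c * \<delta>)"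
    proof -
      have "G k * indicator ?B k \<le> ennreal (A1 * \<delta> ^ n) * ((\<Sum>\<beta>\<in>?H. epowr (gap_quot \<beta> p k) t) *
          ennreal (1 / sn k ^ n) * indicator ?B k)" for k
      proof (cases "k \<in> ?B \<and> k \<noteq> 0")
        case True
        then have k: "0 < sn k" "sn k < 2 * c * \<delta>"
          using sc_norm_nonneg[of s k] sc_norm_eq_0_iff[of s k] by auto
        \<comment> \<open>Inserts the weight of the tail: in the ball of radius
          \<open>2 * c * \<delta>\<close> it is at least
          \<open>1 / (2 * c * \<delta>) ^ n\<close>.\<close>
        have one: "1 \<le> ennreal ((2 * c * \<delta>) ^ n) * ennreal (1 / sn k ^ n)"
        proof -
          have "sn k ^ n \<le> (2 * c * \<delta>) ^ n" using k by (intro power_mono) auto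
          then have "1 \<le> (2 * c * \<delta>) ^ n * (1 / sn k ^ n)" using k by simp
          then show ?thesis using c \<delta> by (simp add: ennreal_mult'[symmetric] del: ennreal_1 flip: ennreal_1)
        qed
        have "G k \<le> epowr (ennreal C1 * (\<Sum>\<beta>\<in>?H. gap_quot \<beta> p k)) t"
          unfolding G_def using k \<delta> t by (intro epowr_mono C1) auto
        also have "\<dots> = ennreal (C1 powr t) * epowr (\<Sum>\<beta>\<in>?H. gap_quot \<beta> p k) t"
          using t C1(1) by (simp add: epowr_mult epowr_ennreal)
        also have "\<dots> \<le> ennreal (C1 powr t) * (ennreal (real (card ?H) powr t) * (\<Sum>\<beta>\<in>?H. epowr (gap_quot \<beta> p k) t))"
          by (intro mult_left_mono epowr_sum_le t finite_homs_below) simp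
        also have "\<dots> \<le> \<dots> * (ennreal ((2 * c * \<delta>) ^ n) * ennreal (1 / sn k ^ n))"
          using mult_left_mono[OF one] by simp
        also have "\<dots> = ennreal (A1 * \<delta> ^ n) * ((\<Sum>\<beta>\<in>?H. epowr (gap_quot \<beta> p k) t) * ennreal (1 / sn k ^ n))"
          using c \<delta> by (simp add: A1_def power_mult_distrib ennreal_mult' mult_ac)
        finally show ?thesis using k by simp
      next
        case False
        \<comment> \<open>At k = 0 the weight on the right is 0 by the convention for division, so
          \<open>G 0\<close> has to vanish as well.\<close>
        have "G 0 = 0"
        proof -
          have "modulus \<gamma> \<delta> p f 0 = 0"
            using p by (simp add: modulus_def scaled_gap_def gap_def)
          then show ?thesis by (simp add: G_def)
        qed
        with False show ?thesis by (auto simp: indicator_def)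
      qed
      then have "(\<integral>\<^sup>+k\<in>?B. G k \<partial>lborel) \<le> (\<integral>\<^sup>+k. ennreal (A1 * \<delta> ^ n) * ((\<Sum>\<beta>\<in>?H. epowr (gap_quot \<beta> p k) t) *
          ennreal (1 / sn k ^ n) * indicator ?B k) \<partial>lborel)"
        by (intro nn_integral_mono)
      also have "\<dots> = ennreal (A1 * \<delta> ^ n) * tail p q (2 * c * \<delta>)"
        unfolding tail_def t_def[symmetric] n_def[symmetric] by (rule nn_integral_cmult) measurable
      finally show ?thesis .
    qed
    have A_lower: "ennreal (a0 * \<delta> ^ n) \<le> emeasure lborel ?A"
    proof -
      \<comment> \<open>Half of the radius that \<open>sc_norm_le\<close> would permit, because the
        ball is given by a strict inequality.\<close>
      define \<rho> where "\<rho> = c * \<delta> / (2 * real CARD('d))"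
      have \<rho>: "0 < \<rho>" using c \<delta> by (simp add: \<rho>_def)
      let ?l = "\<chi> i. - (\<rho> ^ s i)" and ?u = "\<chi> i. \<rho> ^ s i"
      have "box ?l ?u \<subseteq> ?A"
      proof
        fix k assume "k \<in> box ?l ?u"
        then have "\<bar>k $ i\<bar> \<le> \<rho> ^ s i" for i
          by (simp add: mem_box_cart abs_le_iff) (meson less_imp_le minus_less_iff)
        then have "sn k \<le> real CARD('d) * \<rho>"
          using \<rho> by (intro sc_norm_le scaling) auto
        also have "\<dots> < c * \<delta>" using c \<delta> by (simp add: \<rho>_def)
        finally show "k \<in> ?A" by simp
      qed
      then have "emeasure lborel (box ?l ?u) \<le> emeasure lborel ?A"
        by (intro emeasure_mono) auto
      moreover have "emeasure lborel (box ?l ?u) = ennreal (\<Prod>i\<in>UNIV. 2 * \<rho> ^ s i)"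
        using \<rho> by (subst emeasure_lborel_vec_box) (auto intro: order_trans[of _ 0])
      moreover have "(\<Prod>i\<in>UNIV. 2 * \<rho> ^ s i) = a0 * \<delta> ^ n"
      proof -
        have "(\<Prod>i\<in>UNIV. 2 * \<rho> ^ s i) = 2 ^ CARD('d) * \<rho> ^ n"
          by (simp add: prod.distrib prod_power_sc_total n_def)
        also have "\<dots> = a0 * \<delta> ^ n"
          by (simp add: a0_def \<rho>_def power_mult_distrib power_divide)
        finally show ?thesis .
      qed
      ultimately show ?thesis by simp
    qed
    have "\<exists>k\<in>?A. G k + G (h + k) \<le> ennreal (2 * A1 / a0) * tail p q (2 * c * \<delta>)"
    proof (rule exists_le_average)
      show "0 < emeasure lborel ?A"
        using A_lower a0 \<delta> by (intro less_le_trans[OF _ A_lower]) simp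
      have "emeasure lborel ?A \<le> emeasure lborel {k. sn k \<le> c * \<delta>}"
        by (intro emeasure_mono) auto
      also have "\<dots> \<le> ennreal (2 ^ CARD('d) * (c * \<delta>) ^ sc_total s)"
        using c \<delta> by (intro emeasure_sc_ball_le scaling) auto
      finally show "emeasure lborel ?A < \<infinity>" by (simp add: le_less_trans)
      have "(\<integral>\<^sup>+k\<in>?A. (G k + G (h + k)) \<partial>lborel) = (\<integral>\<^sup>+k. G k * indicator ?A k + G (h + k) * indicator ?A k \<partial>lborel)"
        by (simp add: distrib_right)
      also have "\<dots> \<le> (\<integral>\<^sup>+k. G k * indicator ?B k + G (h + k) * indicator ?B (h + k) \<partial>lborel)"
      proof (intro nn_integral_mono add_mono mult_left_mono)
        fix k
        have "sn (h + k) < 2 * c * \<delta>" if "sn k < c * \<delta>"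
          using sc_norm_triangle[OF scaling, of h k] that h by simp
        then show "indicator ?A k \<le> (indicator ?B (h + k) :: ennreal)"
          by (auto simp: indicator_def)
        have "sn k < 2 * c * \<delta>" if "sn k < c * \<delta>"
          using that mult_pos_pos[OF c \<delta>] by simp
        then show "indicator ?A k \<le> (indicator ?B k :: ennreal)"
          by (auto simp: indicator_def)
      qed auto
      also have "\<dots> = (\<integral>\<^sup>+k. G k * indicator ?B k \<partial>lborel) + (\<integral>\<^sup>+k. G (h + k) * indicator ?B (h + k) \<partial>lborel)"
        by (rule nn_integral_add) measurable
      also have "(\<integral>\<^sup>+k. G (h + k) * indicator ?B (h + k) \<partial>lborel) = (\<integral>\<^sup>+k. G k * indicator ?B k \<partial>lborel)"
        by (rule nn_integral_lborel_translate) measurable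
      also have "(\<integral>\<^sup>+k\<in>?B. G k \<partial>lborel) + (\<integral>\<^sup>+k\<in>?B. G k \<partial>lborel) \<le>
          ennreal (A1 * \<delta> ^ n) * tail p q (2 * c * \<delta>) + ennreal (A1 * \<delta> ^ n) * tail p q (2 * c * \<delta>)"
        by (intro add_mono G_int)
      also have "\<dots> = ennreal (2 * A1 / a0) * tail p q (2 * c * \<delta>) * ennreal (a0 * \<delta> ^ n)"
      proof -
        have A1: "0 \<le> A1" using c by (simp add: A1_def)
        have "2 * A1 / a0 * (a0 * \<delta> ^ n) = A1 * \<delta> ^ n + A1 * \<delta> ^ n" using a0 by simp
        then have eq: "ennreal (2 * A1 / a0) * ennreal (a0 * \<delta> ^ n) = ennreal (A1 * \<delta> ^ n) + ennreal (A1 * \<delta> ^ n)"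
          using A1 a0 \<delta> by (simp add: ennreal_mult'[symmetric] ennreal_plus[symmetric] del: ennreal_plus)
        show ?thesis
          unfolding distrib_right[symmetric] eq[symmetric] by (simp only: mult_ac)
      qed
      also have "\<dots> \<le> ennreal (2 * A1 / a0) * tail p q (2 * c * \<delta>) * emeasure lborel ?A"
        by (intro mult_left_mono A_lower) simp
      finally show "(\<integral>\<^sup>+k\<in>?A. (G k + G (h + k)) \<partial>lborel) \<le>
          ennreal (2 * A1 / a0) * tail p q (2 * c * \<delta>) * emeasure lborel ?A" .
    qed measurable
    then obtain k where k: "sn k < c * \<delta>" "G k + G (h + k) \<le> ennreal (2 * A1 / a0) * tail p q (2 * c * \<delta>)"
      by auto
    have "sn (h + k) < 1"
      using sc_norm_triangle[OF scaling, of h k] k(1) h c\<delta> by simp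
    then have "modulus \<gamma> \<delta> p f h \<le> ennreal C2 * (modulus \<gamma> \<delta> p f k + modulus \<gamma> \<delta> p f (h + k))"
      using k(1) h c\<delta> c \<delta> by (intro C2) auto
    then have "epowr (modulus \<gamma> \<delta> p f h) t \<le> epowr (ennreal C2 * (modulus \<gamma> \<delta> p f k + modulus \<gamma> \<delta> p f (h + k))) t"
      using t by (intro epowr_mono) auto
    also have "\<dots> = ennreal (C2 powr t) * epowr (modulus \<gamma> \<delta> p f k + modulus \<gamma> \<delta> p f (h + k)) t"
      using t C2(1) by (simp add: epowr_mult epowr_ennreal)
    also have "\<dots> \<le> ennreal (C2 powr t) * (ennreal (2 powr t) * (G k + G (h + k)))"
      unfolding G_def by (intro mult_left_mono epowr_add_le t) simp
    also have "\<dots> \<le> ennreal (C2 powr t) * (ennreal (2 powr t) * (ennreal (2 * A1 / a0) * tail p q (2 * c * \<delta>)))"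
      by (intro mult_left_mono k(2)) auto
    also have "\<dots> = ennreal M * tail p q (2 * c * \<delta>)"
      by (simp add: M_def ennreal_mult' mult.assoc del: times_divide_eq_right)
    finally show "epowr (modulus \<gamma> \<delta> p f h) (enn2real q) \<le> ennreal M * tail p q (2 * c * \<delta>)"
      by (simp add: t_def)
  qed
qed

text \<open>Dominated convergence, with the integrand on the unit ball as majorant: every h other
  than 0 leaves the shrinking balls.\<close>

lemma tail_tendsto_0:
  assumes fin: "tail p q 1 < \<infinity>" and \<rho>: "\<rho> \<longlonglongrightarrow> 0" "\<And>n. \<rho> n \<le> 1"
  shows "(\<lambda>n. tail p q (\<rho> n)) \<longlonglongrightarrow> 0"
proof -
  note [measurable] = borel_measurable_gap_quot[of _ p]
  let ?g = "\<lambda>h. (\<Sum>\<beta>\<in>homs S \<inter> {..<\<gamma>}. epowr (gap_quot \<beta> p h) (enn2real q)) * ennreal (1 / sn h ^ sc_total s)"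
  have "(\<lambda>n. \<integral>\<^sup>+h. ?g h * indicator {h. sn h < \<rho> n} h \<partial>lborel) \<longlonglongrightarrow> integral\<^sup>N lborel (\<lambda>h::real^'d. 0)"
  proof (rule nn_integral_dominated_convergence[where w = "\<lambda>h. ?g h * indicator {h. sn h < 1} h"])
    show "AE h in lborel. (\<lambda>n. ?g h * indicator {h. sn h < \<rho> n} h) \<longlonglongrightarrow> 0"
    proof (rule AE_I2)
      fix h :: "real^'d"
      show "(\<lambda>n. ?g h * indicator {h. sn h < \<rho> n} h) \<longlonglongrightarrow> 0"
      proof (cases "h = 0")
        case True
        \<comment> \<open>The exponent is positive, so the weight at h = 0 is \<open>1 / 0\<close>,
          that is 0.\<close>
        have "sc_total s \<noteq> 0"
          using scaling by (auto simp: sc_total_def Suc_le_eq)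
        with True have "?g h = 0" by simp
        then show ?thesis by (simp only: mult_zero_left tendsto_const)
      next
        case False
        then have "0 < sn h"
          using sc_norm_nonneg[of s h] sc_norm_eq_0_iff[of s h] by simp
        then have "eventually (\<lambda>n. \<rho> n < sn h) sequentially"
          using order_tendstoD(2)[OF \<rho>(1)] by simp
        then have "eventually (\<lambda>n. ?g h * indicator {h. sn h < \<rho> n} h = 0) sequentially"
          by eventually_elim simp
        then show ?thesis by (rule tendsto_eventually)
      qed
    qed
    show "(\<integral>\<^sup>+h. ?g h * indicator {h. sn h < 1} h \<partial>lborel) < \<infinity>"
      using fin by (simp add: tail_def)
    show "AE h in lborel. ?g h * indicator {h. sn h < \<rho> n} h \<le> ?g h * indicator {h. sn h < 1} h" for n
    proof (intro AE_I2 mult_left_mono)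
      fix h
      show "indicator {h. sn h < \<rho> n} h \<le> (indicator {h. sn h < 1} h :: ennreal)"
        using \<rho>(2)[of n] by (auto simp: indicator_def)
    qed simp
  qed measurable
  then show ?thesis by (simp add: tail_def)
qed

lemma tail_finite:
  assumes q: "1 \<le> q" "q < \<infinity>" and fin: "D_norm s S \<Gamma> \<gamma> p q f < \<infinity>"
  shows "tail p q 1 < \<infinity>"
proof -
  note [measurable] = borel_measurable_gap_quot[of _ p]
  have each: "(\<integral>\<^sup>+h\<in>{h. sn h < 1}. epowr (gap_quot \<beta> p h) (enn2real q) * ennreal (1 / sn h ^ sc_total s) \<partial>lborel) < \<infinity>"
    if "\<beta> \<in> homs S \<inter> {..<\<gamma>}" for \<beta>
  proof -
    have "d_seminorm s S \<Gamma> \<gamma> \<beta> p q f \<le> D_norm s S \<Gamma> \<gamma> p q f"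
      unfolding D_norm_def
      by (rule order_trans[OF _ member_le_sum[OF that]]) (simp_all add: finite_homs_below)
    then have "d_seminorm s S \<Gamma> \<gamma> \<beta> p q f < \<infinity>" using fin by (rule le_less_trans)
    moreover have "d_seminorm s S \<Gamma> \<gamma> \<beta> p q f = epowr (\<integral>\<^sup>+h\<in>sc_ball s.
        epowr (d_quot s S \<Gamma> \<gamma> \<beta> p f h) (enn2real q) * ennreal (1 / sn h ^ sc_total s) \<partial>lborel) (1 / enn2real q)"
      using q by (auto simp: d_seminorm_def)
    ultimately have "(\<integral>\<^sup>+h\<in>sc_ball s. epowr (d_quot s S \<Gamma> \<gamma> \<beta> p f h) (enn2real q) * ennreal (1 / sn h ^ sc_total s) \<partial>lborel) < \<infinity>"
      by (simp only: epowr_less_top_iff)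
    also have "(\<integral>\<^sup>+h\<in>sc_ball s. epowr (d_quot s S \<Gamma> \<gamma> \<beta> p f h) (enn2real q) * ennreal (1 / sn h ^ sc_total s) \<partial>lborel) =
        (\<integral>\<^sup>+h\<in>{h. sn h < 1}. epowr (gap_quot \<beta> p h) (enn2real q) * ennreal (1 / sn h ^ sc_total s) \<partial>lborel)"
      by (intro nn_integral_cong) (auto simp: sc_ball_def indicator_def gap_quot_eq)
    finally show ?thesis .
  qed
  have "tail p q 1 = (\<Sum>\<beta>\<in>homs S \<inter> {..<\<gamma>}.
      \<integral>\<^sup>+h\<in>{h. sn h < 1}. epowr (gap_quot \<beta> p h) (enn2real q) * ennreal (1 / sn h ^ sc_total s) \<partial>lborel)"
    unfolding tail_def sum_distrib_right by (rule nn_integral_sum) measurable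
  then show ?thesis
    using each by (simp add: finite_homs_below less_top[symmetric])
qed

end

end

section \<open>The dominating function\<close>

lemma epowr_Lp_norm_top_le:
  assumes F: "F \<in> borel_measurable lborel" and "AE x in lborel. F x \<le> b"
  shows "Lp_norm \<infinity> F \<le> b"
  using assms by (simp add: Lp_norm_def esssup_le_iff)

context modelled_setting
begin

text \<open>As all scalings are at least 1,
  \<open>3 * \<delta> ^ s i \<le> (3 * \<delta>) ^ s i\<close>, which gives
  \<open>3 * CARD('d) * \<delta>\<close>. The 4 makes the inequality strict, as
  \<open>modulus_le_tail\<close> requires.\<close>

lemma sn_near_cell:
  assumes \<delta>: "0 < \<delta>" and h: "\<And>i. \<bar>h $ i\<bar> \<le> 3 * \<delta> ^ s i"
  shows "sn h < 4 * real CARD('d) * \<delta>"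
proof -
  have "\<bar>h $ i\<bar> \<le> (3 * \<delta>) ^ s i" for i
  proof -
    have "(3::real) ^ 1 \<le> 3 ^ s i" using scaling by (intro power_increasing) auto
    then have "3 * \<delta> ^ s i \<le> 3 ^ s i * \<delta> ^ s i" using \<delta> by (intro mult_right_mono) auto
    with h[of i] show ?thesis by (simp add: power_mult_distrib)
  qed
  then have "sn h \<le> real CARD('d) * (3 * \<delta>)"
    using \<delta> by (intro sc_norm_le scaling) auto
  also have "\<dots> < 4 * real CARD('d) * \<delta>" using \<delta> by simp
  finally show ?thesis .
qed

text \<open>The common pointwise bound W of the approximation lemmas. It is a sum instead of a
  maximum over the nearby cells, so that powers of the oscillation can be integrated cell by
  cell.\<close>

definition dominator :: "real \<Rightarrow> real \<Rightarrow> (int^'d \<Rightarrow> real^'d) \<Rightarrow> (real^'d \<Rightarrow> 'v) \<Rightarrow> real^'d \<Rightarrow> real" where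
  "dominator \<gamma> \<delta> y f x = (\<Sum>z\<in>near_cells s \<delta> x. scaled_gap \<gamma> \<delta> f x (y z))"

lemma dominator_nonneg: "0 \<le> dominator \<gamma> \<delta> y f x"
  by (simp add: dominator_def sum_nonneg scaled_gap_nonneg)

lemma scaled_norm_le_dominator:
  assumes \<delta>: "0 < \<delta>" "8 * real CARD('d) * \<delta> \<le> 1" and y: "\<And>z. y z \<in> cell s \<delta> z"
    and z: "z \<in> near_cells s \<delta> x"
  shows "scaled_norm \<gamma> \<delta> (\<Gamma> x (y z) (f (y z)) - f x) \<le> dominator \<gamma> \<delta> y f x"
proof -
  have "sn (x - y z) < 4 * real CARD('d) * \<delta>"
    using near_cell_difference[OF \<delta>(1) y z] by (intro sn_near_cell \<delta>) auto
  \<comment> \<open>The distance stays below 1/2, so the cut-off in \<open>gap\<close> has no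
    effect.\<close>
  then have "sn (x - y z) < 1" using \<delta> by simp
  then have "scaled_gap \<gamma> \<delta> f x (y z) = scaled_norm \<gamma> \<delta> (- (\<Gamma> x (y z) (f (y z)) - f x))"
    by (simp add: scaled_gap_eq)
  then have "scaled_norm \<gamma> \<delta> (\<Gamma> x (y z) (f (y z)) - f x) = scaled_gap \<gamma> \<delta> f x (y z)"
    by (simp only: scaled_norm_minus)
  also have "\<dots> \<le> dominator \<gamma> \<delta> y f x"
    unfolding dominator_def
    by (rule member_le_sum[OF z]) (simp_all add: scaled_gap_nonneg finite_near_cells)
  finally show ?thesis .
qed

context
  fixes f :: "real^'d \<Rightarrow> 'v" and \<gamma> :: real
  assumes f_meas: "T_measurable S \<gamma> f" and f_below: "\<And>x. f x \<in> T_below S \<gamma>"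
begin

lemma borel_measurable_dominator: "(\<lambda>x. ennreal (dominator \<gamma> \<delta> y f x)) \<in> borel_measurable borel"
proof -
  obtain e :: "nat \<Rightarrow> int^'d" where e: "bij e" using exists_enumeration_cells .
  have [measurable]: "(\<lambda>x. scaled_gap \<gamma> \<delta> f x w) \<in> borel_measurable borel" for w
    using measurable_compose[OF _ borel_measurable_scaled_gap[OF f_meas f_below], of "\<lambda>x. (x, w)" borel] by simp
  have "ennreal (dominator \<gamma> \<delta> y f x) =
      (\<Sum>j. indicator {x. e j \<in> near_cells s \<delta> x} x * ennreal (scaled_gap \<gamma> \<delta> f x (y (e j))))" for x
    unfolding sum_near_cells_eq_suminf[OF e, symmetric, where g = "\<lambda>z. ennreal (scaled_gap \<gamma> \<delta> f x (y z))"]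
    by (simp add: dominator_def sum_ennreal scaled_gap_nonneg)
  then show ?thesis by (simp only:) measurable
qed

text \<open>For finite p the points are selected for the p-th power of the oscillation. For p =
  \<infinity> they are selected for the indicator of the event that the oscillation exceeds b, whose
  integral is 0 under each admissible shift. The 30 is 5 for the nearby cells times 6 for the
  selection, per coordinate.\<close>

lemma exists_dominator:
  assumes p: "1 \<le> p" and \<delta>: "0 < \<delta>" "8 * real CARD('d) * \<delta> \<le> 1"
    and b: "\<And>h. sn h < 4 * real CARD('d) * \<delta> \<Longrightarrow> modulus \<gamma> \<delta> p f h \<le> b"
  shows "\<exists>y. (\<forall>z. y z \<in> cell s \<delta> z) \<and>
    Lp_norm p (\<lambda>x. ennreal (dominator \<gamma> \<delta> y f x)) \<le> ennreal (30 ^ CARD('d)) * b"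
proof (cases "p = \<infinity>")
  case False
  then have p': "p < \<infinity>" by (simp add: less_top)
  define t where "t = enn2real p"
  have t: "1 \<le> t" "0 < t" using enn2real_ge_1[OF p p'] by (simp_all add: t_def)
  have V: "(\<lambda>w. epowr (ennreal (scaled_gap \<gamma> \<delta> f (fst w) (snd w))) t) \<in> borel_measurable (borel \<Otimes>\<^sub>M borel)"
    using borel_measurable_scaled_gap[OF f_meas f_below] by measurable
  have "(\<integral>\<^sup>+y. epowr (ennreal (scaled_gap \<gamma> \<delta> f (y + h) y)) t \<partial>lborel) \<le> epowr b t"
    if "\<And>i. \<bar>h $ i\<bar> \<le> 3 * \<delta> ^ s i" for h
  proof -
    have "(\<integral>\<^sup>+y. epowr (ennreal (scaled_gap \<gamma> \<delta> f (y + h) y)) t \<partial>lborel) = epowr (modulus \<gamma> \<delta> p f h) t"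
      by (simp add: modulus_def t_def epowr_Lp_norm[OF p p'])
    also have "\<dots> \<le> epowr b t"
      using t sn_near_cell[OF \<delta>(1) that] by (intro epowr_mono b) auto
    finally show ?thesis .
  qed
  from select_cell_points[OF \<delta>(1) V this] obtain y where y: "\<And>z. y z \<in> cell s \<delta> z"
    "(\<integral>\<^sup>+x. (\<Sum>z\<in>near_cells s \<delta> x. epowr (ennreal (scaled_gap \<gamma> \<delta> f x (y z))) t) \<partial>lborel) \<le> 6 ^ CARD('d) * epowr b t"
    by auto
  have "Lp_norm p (\<lambda>x. ennreal (dominator \<gamma> \<delta> y f x)) \<le> ennreal (30 ^ CARD('d)) * b"
    unfolding Lp_norm_le_iff[OF p p'] t_def[symmetric]
  proof -
    have "epowr (ennreal (dominator \<gamma> \<delta> y f x)) t \<le> ennreal ((5 ^ CARD('d)) powr t) *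
        (\<Sum>z\<in>near_cells s \<delta> x. epowr (ennreal (scaled_gap \<gamma> \<delta> f x (y z))) t)" for x
    proof -
      have "epowr (ennreal (dominator \<gamma> \<delta> y f x)) t =
          epowr (\<Sum>z\<in>near_cells s \<delta> x. ennreal (scaled_gap \<gamma> \<delta> f x (y z))) t"
        by (simp add: dominator_def sum_ennreal scaled_gap_nonneg)
      also have "\<dots> \<le> ennreal (real (card (near_cells s \<delta> x)) powr t) *
          (\<Sum>z\<in>near_cells s \<delta> x. epowr (ennreal (scaled_gap \<gamma> \<delta> f x (y z))) t)"
        by (intro epowr_sum_le t finite_near_cells)
      also have "\<dots> \<le> ennreal ((5 ^ CARD('d)) powr t) *
          (\<Sum>z\<in>near_cells s \<delta> x. epowr (ennreal (scaled_gap \<gamma> \<delta> f x (y z))) t)"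
        using of_nat_mono[OF card_near_cells[of s \<delta> x], where 'a = real] t
        by (intro mult_right_mono ennreal_leI powr_mono2) auto
      finally show ?thesis .
    qed
    then have "(\<integral>\<^sup>+x. epowr (ennreal (dominator \<gamma> \<delta> y f x)) t \<partial>lborel) \<le>
        (\<integral>\<^sup>+x. ennreal ((5 ^ CARD('d)) powr t) *
          (\<Sum>z\<in>near_cells s \<delta> x. epowr (ennreal (scaled_gap \<gamma> \<delta> f x (y z))) t) \<partial>lborel)"
      by (intro nn_integral_mono)
    also have "\<dots> = ennreal ((5 ^ CARD('d)) powr t) *
        (\<integral>\<^sup>+x. (\<Sum>z\<in>near_cells s \<delta> x. epowr (ennreal (scaled_gap \<gamma> \<delta> f x (y z))) t) \<partial>lborel)"
    proof (rule nn_integral_cmult)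
      obtain e :: "nat \<Rightarrow> int^'d" where e: "bij e" using exists_enumeration_cells .
      have [measurable]: "(\<lambda>x. scaled_gap \<gamma> \<delta> f x w) \<in> borel_measurable borel" for w
        using measurable_compose[OF _ borel_measurable_scaled_gap[OF f_meas f_below], of "\<lambda>x. (x, w)" borel] by simp
      show "(\<lambda>x. \<Sum>z\<in>near_cells s \<delta> x. epowr (ennreal (scaled_gap \<gamma> \<delta> f x (y z))) t) \<in> borel_measurable lborel"
        unfolding sum_near_cells_eq_suminf[OF e] by measurable
    qed
    also have "\<dots> \<le> ennreal ((5 ^ CARD('d)) powr t) * (6 ^ CARD('d) * epowr b t)"
      by (intro mult_left_mono y) simp
    also have "\<dots> \<le> ennreal ((5 ^ CARD('d)) powr t) * (ennreal ((6 ^ CARD('d)) powr t) * epowr b t)"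
    proof (intro mult_left_mono mult_right_mono)
      \<comment> \<open>The constant of the selection is at least 1, hence at most its own t-th
        power, and in that form it can be drawn into \<open>epowr\<close>.\<close>
      have "(6 ^ CARD('d) :: real) powr 1 \<le> (6 ^ CARD('d)) powr t"
        using t by (intro powr_mono) auto
      then have "ennreal (6 ^ CARD('d)) \<le> ennreal ((6 ^ CARD('d)) powr t)"
        by (intro ennreal_leI) simp
      then show "6 ^ CARD('d) \<le> ennreal ((6 ^ CARD('d)) powr t)"
        by (simp add: ennreal_power[symmetric])
    qed auto
    also have "\<dots> = ennreal ((5 ^ CARD('d) * 6 ^ CARD('d)) powr t) * epowr b t"
      by (simp only: powr_mult ennreal_mult' powr_ge_zero mult.assoc)
    also have "(5::real) ^ CARD('d) * 6 ^ CARD('d) = 30 ^ CARD('d)"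
      by (simp add: power_mult_distrib[symmetric])
    also have "ennreal ((30 ^ CARD('d)) powr t) * epowr b t = epowr (ennreal (30 ^ CARD('d)) * b) t"
      using t by (subst epowr_mult) (simp_all only: epowr_ennreal zero_le_power zero_le_numeral)
    finally show "(\<integral>\<^sup>+x. epowr (ennreal (dominator \<gamma> \<delta> y f x)) t \<partial>lborel) \<le> epowr (ennreal (30 ^ CARD('d)) * b) t" .
  qed
  with y(1) show ?thesis by blast
next
  case True
  have V: "(\<lambda>w. indicator {b<..} (ennreal (scaled_gap \<gamma> \<delta> f (fst w) (snd w))) :: ennreal) \<in> borel_measurable (borel \<Otimes>\<^sub>M borel)"
    using borel_measurable_scaled_gap[OF f_meas f_below] by measurable
  have "(\<integral>\<^sup>+y. indicator {b<..} (ennreal (scaled_gap \<gamma> \<delta> f (y + h) y)) \<partial>lborel) \<le> (0::ennreal)"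
    if "\<And>i. \<bar>h $ i\<bar> \<le> 3 * \<delta> ^ s i" for h
  proof -
    have m: "(\<lambda>x. ennreal (scaled_gap \<gamma> \<delta> f (x + h) x)) \<in> borel_measurable lborel"
      using scaled_gap_shift_measurable(2)[OF f_meas f_below] by simp
    have "modulus \<gamma> \<delta> p f h \<le> b" by (intro b sn_near_cell \<delta> that)
    then have ae: "AE x in lborel. ennreal (scaled_gap \<gamma> \<delta> f (x + h) x) \<le> b"
      using esssup_le_iff[OF m] by (simp add: modulus_def True Lp_norm_def)
    have "(\<integral>\<^sup>+y. indicator {b<..} (ennreal (scaled_gap \<gamma> \<delta> f (y + h) y)) \<partial>lborel) = (\<integral>\<^sup>+y. (0::ennreal) \<partial>(lborel :: (real^'d) measure))"
      using ae by (intro nn_integral_cong_AE) (auto elim!: eventually_mono simp: indicator_def not_less)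
    then show ?thesis by simp
  qed
  from select_cell_points[OF \<delta>(1) V this] obtain y where y: "\<And>z. y z \<in> cell s \<delta> z"
    and int: "(\<integral>\<^sup>+x. (\<Sum>z\<in>near_cells s \<delta> x. indicator {b<..} (ennreal (scaled_gap \<gamma> \<delta> f x (y z)))) \<partial>lborel) = (0::ennreal)"
    by auto
  obtain e :: "nat \<Rightarrow> int^'d" where e: "bij e" using exists_enumeration_cells .
  have [measurable]: "(\<lambda>x. scaled_gap \<gamma> \<delta> f x w) \<in> borel_measurable borel" for w
    using measurable_compose[OF _ borel_measurable_scaled_gap[OF f_meas f_below], of "\<lambda>x. (x, w)" borel] by simp
  have meas: "(\<lambda>x. \<Sum>z\<in>near_cells s \<delta> x. indicator {b<..} (ennreal (scaled_gap \<gamma> \<delta> f x (y z))) :: ennreal) \<in> borel_measurable lborel"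
    unfolding sum_near_cells_eq_suminf[OF e] by measurable
  have "AE x in lborel. (\<Sum>z\<in>near_cells s \<delta> x. indicator {b<..} (ennreal (scaled_gap \<gamma> \<delta> f x (y z)))) = (0::ennreal)"
    using int by (simp add: nn_integral_0_iff_AE[OF meas])
  then have "AE x in lborel. ennreal (dominator \<gamma> \<delta> y f x) \<le> ennreal (30 ^ CARD('d)) * b"
  proof eventually_elim
    case (elim x)
    have le: "ennreal (scaled_gap \<gamma> \<delta> f x (y z)) \<le> b" if "z \<in> near_cells s \<delta> x" for z
      using elim that finite_near_cells[of s \<delta> x] by (auto simp: indicator_def not_less split: if_splits)
    have "ennreal (dominator \<gamma> \<delta> y f x) = (\<Sum>z\<in>near_cells s \<delta> x. ennreal (scaled_gap \<gamma> \<delta> f x (y z)))"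
      by (simp add: dominator_def sum_ennreal scaled_gap_nonneg)
    also have "\<dots> \<le> (\<Sum>z\<in>near_cells s \<delta> x. b)"
      by (intro sum_mono le)
    also have "\<dots> = ennreal (real (card (near_cells s \<delta> x))) * b"
      by (simp add: ennreal_of_nat_eq_real_of_nat)
    also have "\<dots> \<le> ennreal (30 ^ CARD('d)) * b"
    proof (intro mult_right_mono ennreal_leI)
      have "real (card (near_cells s \<delta> x)) \<le> 5 ^ CARD('d)"
        using of_nat_mono[OF card_near_cells[of s \<delta> x], where 'a = real] by simp
      also have "\<dots> \<le> 30 ^ CARD('d)" by (intro power_mono) auto
      finally show "real (card (near_cells s \<delta> x)) \<le> 30 ^ CARD('d)" .
    qed simp
    finally show ?case .
  qed
  then have "Lp_norm p (\<lambda>x. ennreal (dominator \<gamma> \<delta> y f x)) \<le> ennreal (30 ^ CARD('d)) * b"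
    unfolding True using borel_measurable_dominator by (intro epowr_Lp_norm_top_le) auto
  with y show ?thesis by blast
qed

end

lemma T_measurable_error:
  "T_measurable S \<gamma> f \<Longrightarrow> 0 < \<delta> \<Longrightarrow> T_measurable S \<gamma> (\<lambda>x. f x - approximant \<gamma> N \<delta> y f x)"
  by (intro T_measurable_diff T_measurable_approximant)

lemma error_T_below:
  "(\<And>x. f x \<in> T_below S \<gamma>) \<Longrightarrow> f x - approximant \<gamma> N \<delta> y f x \<in> T_below S \<gamma>"
  by (intro subspace_diff[OF subspace_T_below] approximant_T_below)

text \<open>The 8 is the constant 4 of \<open>Lp_norm_add\<close> times 2, because the shifted and
  the unshifted dominating function have the same norm.\<close>

lemma Lp_norm_le_dominator:
  assumes p: "1 \<le> p" and f: "T_measurable S \<gamma> f" "\<And>x. f x \<in> T_below S \<gamma>"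
    and F: "F \<in> borel_measurable borel"
    and le: "\<And>x. F x \<le> M * (dominator \<gamma> \<delta> y f (x + h) + dominator \<gamma> \<delta> y f x)" and M: "0 \<le> M"
  shows "Lp_norm p (\<lambda>x. ennreal (F x)) \<le> ennreal (8 * M) * Lp_norm p (\<lambda>x. ennreal (dominator \<gamma> \<delta> y f x))"
proof -
  let ?W = "\<lambda>x. ennreal (dominator \<gamma> \<delta> y f x)"
  have W: "?W \<in> borel_measurable borel" by (rule borel_measurable_dominator[OF f])
  have Wh: "(\<lambda>x. ?W (x + h)) \<in> borel_measurable borel"
    using measurable_compose[OF _ W, of "\<lambda>x. x + h" borel] by simp
  have "Lp_norm p (\<lambda>x. ennreal (F x)) \<le> Lp_norm p (\<lambda>x. ennreal M * (?W (x + h) + ?W x))"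
  proof (rule Lp_norm_mono[OF p])
    show "ennreal (F x) \<le> ennreal M * (?W (x + h) + ?W x)" for x
      using ennreal_leI[OF le[of x]] M
      by (simp add: ennreal_mult' dominator_nonneg)
  qed (use F in simp)
  also have "\<dots> \<le> ennreal M * Lp_norm p (\<lambda>x. ?W (x + h) + ?W x)"
    using W Wh by (intro Lp_norm_cmult p) simp
  also have "\<dots> \<le> ennreal M * (4 * (Lp_norm p (\<lambda>x. ?W (x + h)) + Lp_norm p ?W))"
    using W Wh by (intro mult_left_mono Lp_norm_add p) simp_all
  also have "Lp_norm p (\<lambda>x. ?W (x + h)) = Lp_norm p ?W"
    using W by (intro Lp_norm_translate p) simp
  also have "ennreal M * (4 * (Lp_norm p ?W + Lp_norm p ?W)) = ennreal (8 * M) * Lp_norm p ?W"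
  proof -
    have "ennreal (8 * M) = ennreal M * 8"
      using M by (simp add: ennreal_mult' mult.commute)
    moreover have "4 * (Lp_norm p ?W + Lp_norm p ?W) = 8 * Lp_norm p ?W"
      by (simp add: mult_2[symmetric] mult.assoc[symmetric])
    ultimately show ?thesis by (simp add: mult.assoc)
  qed
  finally show ?thesis .
qed

section \<open>Estimates for the approximation error\<close>

text \<open>For shifts up to \<delta> the increments of f and of the approximation are bounded
  separately, the latter by \<open>approximant_increment\<close>. For longer shifts cancellation in
  the increment is given up: it is bounded by the components of the error, which are small by
  \<open>\<delta> powr (\<gamma> - \<alpha>)\<close>, and \<theta> is a lower bound for these
  exponents.\<close>

lemma error_estimates:
  assumes p: "1 \<le> p" and N: "0 < N" and N_ge: "\<And>\<alpha>. \<alpha> \<in> homs S \<Longrightarrow> \<gamma> - \<alpha> + \<kappa> \<le> real N"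
    and \<kappa>: "\<And>\<alpha>. \<alpha> \<in> homs S \<Longrightarrow> \<gamma> \<le> \<alpha> \<Longrightarrow> \<gamma> + \<kappa> \<le> \<alpha>"
    and \<theta>: "\<And>\<alpha>. \<alpha> \<in> homs S \<Longrightarrow> \<alpha> < \<gamma> \<Longrightarrow> \<theta> \<le> \<gamma> - \<alpha>"
  shows "\<exists>C\<ge>0. \<forall>f \<delta> y \<beta>. T_measurable S \<gamma> f \<longrightarrow> (\<forall>x. f x \<in> T_below S \<gamma>) \<longrightarrow> 0 < \<delta> \<longrightarrow>
      8 * real CARD('d) * \<delta> \<le> 1 \<longrightarrow> (\<forall>z. y z \<in> cell s \<delta> z) \<longrightarrow> \<beta> \<in> homs S \<inter> {..<\<gamma>} \<longrightarrow>
    (let e = (\<lambda>x. f x - approximant \<gamma> N \<delta> y f x);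
         w = Lp_norm p (\<lambda>x. ennreal (dominator \<gamma> \<delta> y f x)) in
      Lp_norm p (\<lambda>x. ennreal (cn \<beta> (e x))) \<le> ennreal (C * \<delta> powr (\<gamma> - \<beta>)) * w \<and>
      (\<forall>h. sn h \<le> \<delta> \<longrightarrow> gap_quot e \<gamma> \<beta> p h \<le> 4 * gap_quot f \<gamma> \<beta> p h + ennreal (C * (sn h / \<delta>) powr \<kappa>) * w) \<and>
      (\<forall>h. \<delta> \<le> sn h \<longrightarrow> sn h < 1 \<longrightarrow> gap_quot e \<gamma> \<beta> p h \<le> ennreal (C * (\<delta> / sn h) powr \<theta>) * w))"
proof -
  let ?H = "homs S \<inter> {..<\<gamma>}"
  obtain C1 where C1: "C1 \<ge> 0" "\<And>\<delta> y f W x \<alpha>. 0 < \<delta> \<Longrightarrow> (\<forall>x. f x \<in> T_below S \<gamma>) \<Longrightarrow>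
     (\<forall>x. \<forall>z\<in>near_cells s \<delta> x. scaled_norm \<gamma> \<delta> (\<Gamma> x (y z) (f (y z)) - f x) \<le> W x) \<Longrightarrow> 0 \<le> W x \<Longrightarrow>
     \<alpha> \<in> ?H \<Longrightarrow> cn \<alpha> (f x - approximant \<gamma> N \<delta> y f x) \<le> C1 * \<delta> powr (\<gamma> - \<alpha>) * W x"
    using approximant_error[OF N, of \<gamma>] by blast
  obtain C2 where C2: "C2 \<ge> 0" "\<And>\<delta> y f W x h \<alpha>. 0 < \<delta> \<Longrightarrow> \<delta> < 1 \<Longrightarrow> sn h \<le> \<delta> \<Longrightarrow> (\<forall>x. f x \<in> T_below S \<gamma>) \<Longrightarrow>
     (\<forall>x. \<forall>z\<in>near_cells s \<delta> x. scaled_norm \<gamma> \<delta> (\<Gamma> x (y z) (f (y z)) - f x) \<le> W x) \<Longrightarrow>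
     (\<forall>x. 0 \<le> W x) \<Longrightarrow> \<alpha> \<in> ?H \<Longrightarrow>
     cn \<alpha> (approximant \<gamma> N \<delta> y f (x + h) - \<Gamma> (x + h) x (approximant \<gamma> N \<delta> y f x))
       \<le> C2 * \<delta> powr (\<gamma> - \<alpha>) * (sn h / \<delta>) powr (\<gamma> - \<alpha> + \<kappa>) * (W (x + h) + W x)"
    using approximant_increment[OF N N_ge \<kappa>] by blast
  obtain C3 where C3: "C3 \<ge> 0" "\<And>x y \<sigma> \<beta>. \<sigma> \<in> T_below S \<gamma> \<Longrightarrow> sn (x - y) < 1 \<Longrightarrow>
     cn \<beta> (\<Gamma> x y \<sigma> - \<sigma>) \<le> C3 * (\<Sum>\<alpha>\<in>?H \<inter> {\<beta><..}. sn (x - y) powr (\<alpha> - \<beta>) * cn \<alpha> \<sigma>)"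
    using \<Gamma>_bound[of \<gamma>] by blast
  \<comment> \<open>The constant for long shifts: \<open>C1\<close> for the size of the error at an
    endpoint, the rest for the off-diagonal part of \<Gamma>.\<close>
  define C4 where "C4 = C1 + C3 * (real (card ?H) * C1)"
  \<comment> \<open>One constant for the three bounds: 8 from \<open>Lp_norm_le_dominator\<close>,
    and for short shifts a further 4 from \<open>Lp_norm_add\<close>.\<close>
  define C where "C = 8 * C1 + 32 * C2 + 8 * C4"
  have C4: "C1 \<le> C4" "0 \<le> C4" using C1 C3 by (simp_all add: C4_def)
  show ?thesis
  proof (intro exI[of _ C] conjI allI impI)
    show C0: "0 \<le> C" using C1 C2 C4 by (simp add: C_def)
    fix f :: "real^'d \<Rightarrow> 'v" and \<delta> y \<beta>
    assume f: "T_measurable S \<gamma> f" and fb: "\<forall>x. f x \<in> T_below S \<gamma>" and \<delta>: "(0::real) < \<delta>"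
      and \<delta>8: "8 * real CARD('d) * \<delta> \<le> 1" and y: "\<forall>z. y z \<in> cell s \<delta> z" and \<beta>: "\<beta> \<in> ?H"
    define g where "g = approximant \<gamma> N \<delta> y f"
    define e where "e = (\<lambda>x. f x - g x)"
    define W where "W = dominator \<gamma> \<delta> y f"
    define w where "w = Lp_norm p (\<lambda>x. ennreal (W x))"
    have d1: "1 \<le> real CARD('d)" by (simp add: Suc_le_eq)
    have "8 * 1 * \<delta> \<le> 8 * real CARD('d) * \<delta>" using d1 \<delta> by (intro mult_right_mono mult_left_mono) auto
    with \<delta>8 have \<delta>1: "\<delta> < 1" using \<delta> by linarith
    have fb': "f x \<in> T_below S \<gamma>" for x using fb by blast
    have W: "\<forall>x. \<forall>z\<in>near_cells s \<delta> x. scaled_norm \<gamma> \<delta> (\<Gamma> x (y z) (f (y z)) - f x) \<le> W x"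
      unfolding W_def using scaled_norm_le_dominator[OF \<delta> \<delta>8, of y] y by blast
    have W0: "\<forall>x. 0 \<le> W x" by (simp add: W_def dominator_nonneg)
    have em: "T_measurable S \<gamma> e" and eb: "\<And>x. e x \<in> T_below S \<gamma>"
      unfolding e_def g_def using T_measurable_error[OF f \<delta>] error_T_below[of f \<gamma>, OF fb'] by blast+
    have gm: "T_measurable S \<gamma> g" and gb: "\<And>x. g x \<in> T_below S \<gamma>"
      unfolding g_def using T_measurable_approximant[OF \<delta>] approximant_T_below by blast+
    have err: "cn \<alpha> (e x) \<le> C1 * \<delta> powr (\<gamma> - \<alpha>) * W x" if "\<alpha> \<in> ?H" for \<alpha> x
      unfolding e_def g_def using C1(2)[OF \<delta> fb W _ that, of x] W0 by blast
    have a: "Lp_norm p (\<lambda>x. ennreal (cn \<beta> (e x))) \<le> ennreal (C * \<delta> powr (\<gamma> - \<beta>)) * w"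
    proof -
      have "Lp_norm p (\<lambda>x. ennreal (cn \<beta> (e x))) \<le> ennreal (8 * (C1 * \<delta> powr (\<gamma> - \<beta>))) * w"
        unfolding w_def W_def
      proof (rule Lp_norm_le_dominator[OF p f fb', where h = 0])
        show "(\<lambda>x. cn \<beta> (e x)) \<in> borel_measurable borel"
          by (rule borel_measurable_cn[OF em eb])
        show "cn \<beta> (e x) \<le> C1 * \<delta> powr (\<gamma> - \<beta>) * (dominator \<gamma> \<delta> y f (x + 0) + dominator \<gamma> \<delta> y f x)" for x
        proof -
          have "C1 * \<delta> powr (\<gamma> - \<beta>) * W x \<le> C1 * \<delta> powr (\<gamma> - \<beta>) * (W (x + 0) + W x)"
            using C1(1) W0 by (intro mult_left_mono) auto
          with err[OF \<beta>, of x] show ?thesis by (simp add: W_def)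
        qed
      qed (use C1 in simp)
      also have "\<dots> \<le> ennreal (C * \<delta> powr (\<gamma> - \<beta>)) * w"
        unfolding mult.assoc[symmetric] using C2(1) C4
        by (intro mult_right_mono ennreal_leI) (auto simp: C_def)
      finally show ?thesis .
    qed
    have quot_le: "Lp_norm p (\<lambda>x. ennreal (gap k \<beta> (x + h) x / sn h powr (\<gamma> - \<beta>))) \<le> ennreal (8 * M) * w"
      if k: "T_measurable S \<gamma> k" "\<And>x. k x \<in> T_below S \<gamma>" and M: "0 \<le> M"
        and le: "\<And>x. gap k \<beta> (x + h) x \<le> sn h powr (\<gamma> - \<beta>) * (M * (W (x + h) + W x))" for k h M
      unfolding w_def W_def
    proof (rule Lp_norm_le_dominator[OF p f fb' _ _ M])
      show "(\<lambda>x. gap k \<beta> (x + h) x / sn h powr (\<gamma> - \<beta>)) \<in> borel_measurable borel"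
        using gap_shift_measurable(2)[OF k] by (intro borel_measurable_divide) auto
      show "gap k \<beta> (x + h) x / sn h powr (\<gamma> - \<beta>) \<le> M * (dominator \<gamma> \<delta> y f (x + h) + dominator \<gamma> \<delta> y f x)" for x
      proof (cases "sn h = 0")
        case True
        then show ?thesis using M by (simp add: dominator_nonneg)
      next
        case False
        then have "0 < sn h powr (\<gamma> - \<beta>)" by simp
        then show ?thesis
          using le[of x] by (simp add: W_def divide_le_eq mult.commute)
      qed
    qed
    have b: "gap_quot e \<gamma> \<beta> p h \<le> 4 * gap_quot f \<gamma> \<beta> p h + ennreal (C * (sn h / \<delta>) powr \<kappa>) * w"
      if h: "sn h \<le> \<delta>" for h
    proof (cases "h = 0")
      case True
      then show ?thesis using p by (simp add: gap_quot_def[OF f fb'] gap_quot_def[OF em eb])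
    next
      case False
      then have h0: "0 < sn h" using sc_norm_nonneg[of s h] sc_norm_eq_0_iff[of s h] by simp
      let ?t = "sn h / \<delta>" and ?a = "sn h powr (\<gamma> - \<beta>)"
      have t0: "0 < ?t" using h0 \<delta> by simp
      have hx: "sn (x + h - x) < 1" for x using h \<delta>1 by simp
      have split: "gap e \<beta> (x + h) x \<le> gap f \<beta> (x + h) x + gap g \<beta> (x + h) x" for x
      proof -
        have "e (x + h) - \<Gamma> (x + h) x (e x) = (f (x + h) - \<Gamma> (x + h) x (f x)) - (g (x + h) - \<Gamma> (x + h) x (g x))"
          by (simp add: e_def \<Gamma>_diff)
        then show ?thesis
          using cn_diff hx[of x] by (simp add: gap_def)
      qed
      have gap_g: "gap g \<beta> (x + h) x \<le> ?a * (C2 * ?t powr \<kappa> * (W (x + h) + W x))" for x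
      proof -
        have "\<delta> powr (\<gamma> - \<beta>) * ?t powr (\<gamma> - \<beta> + \<kappa>) = ?a * ?t powr \<kappa>"
        proof -
          have "\<delta> powr (\<gamma> - \<beta>) * ?t powr (\<gamma> - \<beta>) = ?a"
            using \<delta> t0 by (subst powr_mult[symmetric]) auto
          then show ?thesis by (simp only: powr_add mult.assoc[symmetric])
        qed
        then have eq: "C2 * \<delta> powr (\<gamma> - \<beta>) * ?t powr (\<gamma> - \<beta> + \<kappa>) = ?a * (C2 * ?t powr \<kappa>)"
          by (simp only: mult_ac)
        have "gap g \<beta> (x + h) x = cn \<beta> (g (x + h) - \<Gamma> (x + h) x (g x))"
          using hx[of x] by (simp add: gap_def)
        also have "\<dots> \<le> C2 * \<delta> powr (\<gamma> - \<beta>) * ?t powr (\<gamma> - \<beta> + \<kappa>) * (W (x + h) + W x)"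
          unfolding g_def by (rule C2(2)[OF \<delta> \<delta>1 h fb W W0 \<beta>])
        finally show ?thesis unfolding eq by (simp only: mult.assoc)
      qed
      have m: "(\<lambda>x. gap k \<beta> (x + h) x / ?a) \<in> borel_measurable borel"
        if "T_measurable S \<gamma> k" "\<And>x. k x \<in> T_below S \<gamma>" for k
        using gap_shift_measurable(2)[OF that] by (intro borel_measurable_divide) auto
      note me = m[OF em eb] and mf = m[OF f fb'] and mg = m[OF gm gb]
      have "gap_quot e \<gamma> \<beta> p h \<le> Lp_norm p (\<lambda>x. ennreal (gap f \<beta> (x + h) x / ?a) + ennreal (gap g \<beta> (x + h) x / ?a))"
        unfolding gap_quot_def[OF em eb]
      proof (rule Lp_norm_mono[OF p])
        show "ennreal (gap e \<beta> (x + h) x / ?a) \<le> ennreal (gap f \<beta> (x + h) x / ?a) + ennreal (gap g \<beta> (x + h) x / ?a)" for x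
          using divide_right_mono[OF split[of x], of ?a]
          by (simp add: ennreal_plus[symmetric] gap_nonneg add_divide_distrib ennreal_leI del: ennreal_plus)
      qed (use me in simp)
      also have "\<dots> \<le> 4 * (Lp_norm p (\<lambda>x. ennreal (gap f \<beta> (x + h) x / ?a)) + Lp_norm p (\<lambda>x. ennreal (gap g \<beta> (x + h) x / ?a)))"
        using mf mg by (intro Lp_norm_add p) simp_all
      also have "Lp_norm p (\<lambda>x. ennreal (gap f \<beta> (x + h) x / ?a)) = gap_quot f \<gamma> \<beta> p h"
        by (simp add: gap_quot_def[OF f fb'])
      also have "4 * (gap_quot f \<gamma> \<beta> p h + Lp_norm p (\<lambda>x. ennreal (gap g \<beta> (x + h) x / ?a))) \<le>
          4 * (gap_quot f \<gamma> \<beta> p h + ennreal (8 * (C2 * ?t powr \<kappa>)) * w)"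
        using C2(1) by (intro mult_left_mono add_left_mono quot_le gm gb gap_g) auto
      also have "\<dots> = 4 * gap_quot f \<gamma> \<beta> p h + ennreal (4 * (8 * (C2 * ?t powr \<kappa>))) * w"
        using C2(1) by (subst ennreal_mult'[of 4]) (simp_all add: distrib_left mult.assoc)
      also have "\<dots> \<le> 4 * gap_quot f \<gamma> \<beta> p h + ennreal (C * ?t powr \<kappa>) * w"
      proof -
        have "32 * C2 * ?t powr \<kappa> \<le> C * ?t powr \<kappa>"
          using C1(1) C4 by (intro mult_right_mono) (auto simp: C_def)
        then show ?thesis by (intro add_left_mono mult_right_mono ennreal_leI) (simp_all add: mult.assoc)
      qed
      finally show ?thesis .
    qed
    have c: "gap_quot e \<gamma> \<beta> p h \<le> ennreal (C * (\<delta> / sn h) powr \<theta>) * w"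
      if h: "\<delta> \<le> sn h" "sn h < 1" for h
    proof -
      let ?t = "\<delta> / sn h" and ?a = "sn h powr (\<gamma> - \<beta>)"
      have h0: "0 < sn h" using h \<delta> by simp
      have t: "0 < ?t" "?t \<le> 1" using h h0 \<delta> by simp_all
      have hx: "sn (x + h - x) < 1" for x using h by simp
      have scale: "sn h powr (\<alpha> - \<beta>) * \<delta> powr (\<gamma> - \<alpha>) \<le> ?a * ?t powr \<theta>" if "\<alpha> \<in> ?H" for \<alpha>
      proof -
        have "\<delta> powr (\<gamma> - \<alpha>) = sn h powr (\<gamma> - \<alpha>) * ?t powr (\<gamma> - \<alpha>)"
          using h0 t by (subst powr_mult[symmetric]) auto
        then have "sn h powr (\<alpha> - \<beta>) * \<delta> powr (\<gamma> - \<alpha>) = ?a * ?t powr (\<gamma> - \<alpha>)"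
          by (simp add: mult.assoc[symmetric] powr_add[symmetric])
        also have "\<dots> \<le> ?a * ?t powr \<theta>"
          using t \<theta>[of \<alpha>] that by (intro mult_left_mono powr_mono') auto
        finally show ?thesis .
      qed
      have "gap e \<beta> (x + h) x \<le> ?a * (C4 * ?t powr \<theta> * (W (x + h) + W x))" for x
      proof -
        have comp: "sn h powr (\<alpha> - \<beta>) * cn \<alpha> (e u) \<le> C1 * (?a * ?t powr \<theta>) * W u" if "\<alpha> \<in> ?H" for \<alpha> u
        proof -
          have "sn h powr (\<alpha> - \<beta>) * cn \<alpha> (e u) \<le> sn h powr (\<alpha> - \<beta>) * (C1 * \<delta> powr (\<gamma> - \<alpha>) * W u)"
            by (intro mult_left_mono err that) simp
          also have "\<dots> = C1 * (sn h powr (\<alpha> - \<beta>) * \<delta> powr (\<gamma> - \<alpha>)) * W u"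
            by (simp only: mult_ac)
          also have "\<dots> \<le> C1 * (?a * ?t powr \<theta>) * W u"
            using C1(1) W0 by (intro mult_right_mono mult_left_mono scale that) auto
          finally show ?thesis .
        qed
        have comp\<beta>: "cn \<beta> (e u) \<le> C1 * (?a * ?t powr \<theta>) * W u" for u
          using comp[OF \<beta>, of u] h0 by simp
        have "cn \<beta> (\<Gamma> (x + h) x (e x) - e x) \<le> C3 * (\<Sum>\<alpha>\<in>?H \<inter> {\<beta><..}. sn (x + h - x) powr (\<alpha> - \<beta>) * cn \<alpha> (e x))"
          by (rule C3(2)[OF eb hx])
        also have "\<dots> \<le> C3 * (\<Sum>\<alpha>\<in>?H \<inter> {\<beta><..}. C1 * (?a * ?t powr \<theta>) * W x)"
          using comp by (intro mult_left_mono sum_mono C3(1)) simp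
        also have "\<dots> \<le> C3 * (\<Sum>\<alpha>\<in>?H. C1 * (?a * ?t powr \<theta>) * W x)"
          using C1(1) W0 by (intro mult_left_mono sum_mono2 finite_homs_below C3(1)) auto
        also have "\<dots> = C3 * (real (card ?H) * C1) * ((?a * ?t powr \<theta>) * W x)"
          by (simp only: sum_constant mult_ac)
        finally have 1: "cn \<beta> (\<Gamma> (x + h) x (e x) - e x) \<le> C3 * (real (card ?H) * C1) * ((?a * ?t powr \<theta>) * W x)" .
        \<comment> \<open>Three contributions: the error at x + h, the error at x, and the
          off-diagonal part of \<Gamma> acting on the latter.\<close>
        have "gap e \<beta> (x + h) x = cn \<beta> (e (x + h) - (\<Gamma> (x + h) x (e x) - e x) - e x)"
          using hx[of x] by (simp add: gap_def)
        also have "\<dots> \<le> cn \<beta> (e (x + h)) + cn \<beta> (\<Gamma> (x + h) x (e x) - e x) + cn \<beta> (e x)"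
          using cn_diff[of \<beta> "e (x + h) - (\<Gamma> (x + h) x (e x) - e x)" "e x"]
            cn_diff[of \<beta> "e (x + h)" "\<Gamma> (x + h) x (e x) - e x"] by linarith
        also have "\<dots> \<le> C1 * ((?a * ?t powr \<theta>) * W (x + h)) + C4 * ((?a * ?t powr \<theta>) * W x)"
          using comp\<beta>[of "x + h"] comp\<beta>[of x] 1 unfolding C4_def distrib_right by (simp only: mult.assoc)
        also have "\<dots> \<le> C4 * ((?a * ?t powr \<theta>) * W (x + h)) + C4 * ((?a * ?t powr \<theta>) * W x)"
          using C4 W0 by (intro add_right_mono mult_right_mono) auto
        also have "\<dots> = ?a * (C4 * ?t powr \<theta> * (W (x + h) + W x))"
          by (simp only: distrib_left distrib_right mult_ac)
        finally show ?thesis .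
      qed
      then have "gap_quot e \<gamma> \<beta> p h \<le> ennreal (8 * (C4 * ?t powr \<theta>)) * w"
        unfolding gap_quot_def[OF em eb] using C4 by (intro quot_le em eb) auto
      also have "\<dots> \<le> ennreal (C * ?t powr \<theta>) * w"
        unfolding mult.assoc[symmetric] using C1(1) C2(1)
        by (intro mult_right_mono ennreal_leI) (auto simp: C_def)
      finally show ?thesis .
    qed
    show "let e = \<lambda>x. f x - approximant \<gamma> N \<delta> y f x;
         w = Lp_norm p (\<lambda>x. ennreal (dominator \<gamma> \<delta> y f x)) in
      Lp_norm p (\<lambda>x. ennreal (cn \<beta> (e x))) \<le> ennreal (C * \<delta> powr (\<gamma> - \<beta>)) * w \<and>
      (\<forall>h. sn h \<le> \<delta> \<longrightarrow> gap_quot e \<gamma> \<beta> p h \<le> 4 * gap_quot f \<gamma> \<beta> p h + ennreal (C * (sn h / \<delta>) powr \<kappa>) * w) \<and>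
      (\<forall>h. \<delta> \<le> sn h \<longrightarrow> sn h < 1 \<longrightarrow> gap_quot e \<gamma> \<beta> p h \<le> ennreal (C * (\<delta> / sn h) powr \<theta>) * w)"
      using a b c unfolding Let_def e_def[unfolded g_def, symmetric] W_def[symmetric] w_def[symmetric] by blast
  qed
qed

text \<open>Lowering the order of the quotient gains the corresponding power of \<open>sn h\<close>;
  this is the source of smallness for q = \<infinity>.\<close>

lemma d_quot_lower_order:
  assumes p: "1 \<le> p" and f: "T_measurable S \<gamma> f" "\<And>x. f x \<in> T_below S \<gamma>" and h: "sn h < 1"
  shows "d_quot s S \<Gamma> \<gamma>' \<beta> p f h \<le> ennreal (sn h powr (\<gamma> - \<gamma>')) * gap_quot f \<gamma> \<beta> p h"
proof (cases "h = 0")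
  case True
  then show ?thesis using p by (simp add: d_quot_def)
next
  case False
  then have h0: "0 < sn h" using sc_norm_nonneg[of s h] sc_norm_eq_0_iff[of s h] by simp
  have eq: "ennreal (cn \<beta> (f (x + h) - \<Gamma> (x + h) x (f x)) / sn h powr (\<gamma>' - \<beta>)) =
      ennreal (sn h powr (\<gamma> - \<gamma>')) * ennreal (gap f \<beta> (x + h) x / sn h powr (\<gamma> - \<beta>))" for x
  proof -
    have "sn h powr (\<gamma> - \<gamma>') * sn h powr (\<gamma>' - \<beta>) = sn h powr (\<gamma> - \<beta>)"
      by (simp add: powr_add[symmetric])
    then have "cn \<beta> (f (x + h) - \<Gamma> (x + h) x (f x)) / sn h powr (\<gamma>' - \<beta>) =
      sn h powr (\<gamma> - \<gamma>') * (gap f \<beta> (x + h) x / sn h powr (\<gamma> - \<beta>))"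
      using h0 h by (simp add: gap_def field_simps)
    then show ?thesis by (simp only: ennreal_mult' powr_ge_zero)
  qed
  have "(\<lambda>x. gap f \<beta> (x + h) x / sn h powr (\<gamma> - \<beta>)) \<in> borel_measurable borel"
    using gap_shift_measurable(2)[OF f] by (intro borel_measurable_divide) auto
  then show ?thesis
    unfolding d_quot_def eq gap_quot_def[OF f] by (intro Lp_norm_cmult p) simp
qed

end

section \<open>Norms of the error and membership in the space of elementary elements\<close>

lemma ennreal_mult_add:
  "0 \<le> c \<Longrightarrow> 0 \<le> a \<Longrightarrow> 0 \<le> b \<Longrightarrow> ennreal (c * (a + b)) = ennreal c * (ennreal a + ennreal b)"
  by (simp add: ennreal_mult')

context modelled_setting
begin

lemma d_seminorm_infinity:
  "d_seminorm s S \<Gamma> \<gamma> \<beta> p \<infinity> f = (SUP h\<in>sc_ball s. d_quot s S \<Gamma> \<gamma> \<beta> p f h)"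
  by (simp add: d_seminorm_def)

lemma epowr_d_seminorm:
  assumes q: "1 \<le> q" "q < \<infinity>"
  shows "epowr (d_seminorm s S \<Gamma> \<gamma> \<beta> p q f) (enn2real q) =
    (\<integral>\<^sup>+h\<in>sc_ball s. epowr (d_quot s S \<Gamma> \<gamma> \<beta> p f h) (enn2real q) * ennreal (1 / sn h ^ sc_total s) \<partial>lborel)"
  using q enn2real_pos[OF q] by (auto simp: d_seminorm_def epowr_inverse)

lemma D_norm_component_le:
  assumes "\<beta> \<in> homs S \<inter> {..<\<gamma>}"
  shows "Lp_norm p (\<lambda>x. ennreal (cn \<beta> (f x))) + d_seminorm s S \<Gamma> \<gamma> \<beta> p q f \<le> D_norm s S \<Gamma> \<gamma> p q f"
  unfolding D_norm_def by (rule member_le_sum[OF assms]) (simp_all add: finite_homs_below)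

lemma d_seminorm_le_D_norm:
  "\<beta> \<in> homs S \<inter> {..<\<gamma>} \<Longrightarrow> d_seminorm s S \<Gamma> \<gamma> \<beta> p q f \<le> D_norm s S \<Gamma> \<gamma> p q f"
  by (rule order_trans[OF _ D_norm_component_le]) auto

lemma Lp_norm_le_D_norm:
  "\<beta> \<in> homs S \<inter> {..<\<gamma>} \<Longrightarrow> Lp_norm p (\<lambda>x. ennreal (cn \<beta> (f x))) \<le> D_norm s S \<Gamma> \<gamma> p q f"
  by (rule order_trans[OF _ D_norm_component_le]) auto

lemma D_norm_lower_order:
  assumes p: "1 \<le> p" and f: "T_measurable S \<gamma> f" "\<And>x. f x \<in> T_below S \<gamma>" and \<gamma>': "\<gamma>' \<le> \<gamma>"
  shows "D_norm s S \<Gamma> \<gamma>' p q f \<le> D_norm s S \<Gamma> \<gamma> p q f"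
proof -
  have quot: "d_quot s S \<Gamma> \<gamma>' \<beta> p f h \<le> d_quot s S \<Gamma> \<gamma> \<beta> p f h" if "sn h < 1" for \<beta> h
  proof -
    have "sn h powr (\<gamma> - \<gamma>') \<le> 1"
      using that \<gamma>' by (intro powr_le1) (auto simp: sc_norm_nonneg)
    then have "ennreal (sn h powr (\<gamma> - \<gamma>')) * gap_quot f \<gamma> \<beta> p h \<le> 1 * gap_quot f \<gamma> \<beta> p h"
      by (intro mult_right_mono) (auto simp: ennreal_le_1)
    then show ?thesis
      using d_quot_lower_order[OF p f that, of \<gamma>' \<beta>] gap_quot_eq[OF f that, of \<beta> p] by simp
  qed
  have semi: "d_seminorm s S \<Gamma> \<gamma>' \<beta> p q f \<le> d_seminorm s S \<Gamma> \<gamma> \<beta> p q f" for \<beta>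
  proof (cases "q = \<infinity>")
    case True
    show ?thesis
      unfolding True d_seminorm_infinity
    proof (rule SUP_mono)
      fix h assume "h \<in> sc_ball s"
      then show "\<exists>h'\<in>sc_ball s. d_quot s S \<Gamma> \<gamma>' \<beta> p f h \<le> d_quot s S \<Gamma> \<gamma> \<beta> p f h'"
        using quot[of h \<beta>] by (intro bexI[of _ h]) (auto simp: sc_ball_def)
    qed
  next
    case False
    have "epowr (d_quot s S \<Gamma> \<gamma>' \<beta> p f h) (enn2real q) * ennreal (1 / sn h ^ sc_total s) * indicator (sc_ball s) h \<le>
        epowr (d_quot s S \<Gamma> \<gamma> \<beta> p f h) (enn2real q) * ennreal (1 / sn h ^ sc_total s) * indicator (sc_ball s) h" for h
      using quot[of h \<beta>] by (cases "h \<in> sc_ball s") (auto simp: sc_ball_def intro!: mult_right_mono epowr_mono)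
    then show ?thesis
      using False by (auto simp: d_seminorm_def intro!: epowr_mono nn_integral_mono)
  qed
  show ?thesis
    unfolding D_norm_def using \<gamma>'
    by (intro order_trans[OF sum_mono[OF add_left_mono[OF semi]] sum_mono2] finite_homs_below) auto
qed

text \<open>For short shifts the gained \<open>sn h powr \<epsilon>\<close> is at most
  \<open>\<delta> powr \<epsilon>\<close>; for long ones
  \<open>sn h powr \<epsilon> * (\<delta> / sn h) powr \<theta>\<close> is, because \<epsilon> is at
  most \<theta>. A supremum over h asks for no decay at short shifts, hence \<kappa> = 0. The points
  y are chosen before \<epsilon>, since the same approximation is used at
  \<open>\<epsilon> = 0\<close>, to see that it lies in the space, and at the positive \<epsilon> of
  the theorem.\<close>

lemma error_D_norm_sup:
  assumes p: "1 \<le> p" and N: "0 < N" and N_ge: "\<And>\<alpha>. \<alpha> \<in> homs S \<Longrightarrow> \<gamma> - \<alpha> \<le> real N"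
    and \<theta>: "\<And>\<alpha>. \<alpha> \<in> homs S \<Longrightarrow> \<alpha> < \<gamma> \<Longrightarrow> \<theta> \<le> \<gamma> - \<alpha>"
    and f: "T_measurable S \<gamma> f" "\<And>x. f x \<in> T_below S \<gamma>"
  shows "\<exists>M\<ge>0. \<forall>\<delta>. 0 < \<delta> \<longrightarrow> 8 * real CARD('d) * \<delta> \<le> 1 \<longrightarrow> (\<exists>y. \<forall>\<epsilon>. 0 \<le> \<epsilon> \<longrightarrow> \<epsilon> \<le> \<theta> \<longrightarrow>
    D_norm s S \<Gamma> (\<gamma> - \<epsilon>) p \<infinity> (\<lambda>x. f x - approximant \<gamma> N \<delta> y f x) \<le>
      ennreal (\<delta> powr \<epsilon>) * (ennreal M * D_norm s S \<Gamma> \<gamma> p \<infinity> f))"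
proof -
  let ?H = "homs S \<inter> {..<\<gamma>}"
  define D where "D = D_norm s S \<Gamma> \<gamma> p \<infinity> f"
  obtain C where C: "C \<ge> 0" "\<And>\<delta> y \<beta>. 0 < \<delta> \<Longrightarrow>
      8 * real CARD('d) * \<delta> \<le> 1 \<Longrightarrow> (\<forall>z. y z \<in> cell s \<delta> z) \<Longrightarrow> \<beta> \<in> ?H \<Longrightarrow>
    (let e = (\<lambda>x. f x - approximant \<gamma> N \<delta> y f x);
         w = Lp_norm p (\<lambda>x. ennreal (dominator \<gamma> \<delta> y f x)) in
      Lp_norm p (\<lambda>x. ennreal (cn \<beta> (e x))) \<le> ennreal (C * \<delta> powr (\<gamma> - \<beta>)) * w \<and>
      (\<forall>h. sn h \<le> \<delta> \<longrightarrow> gap_quot e \<gamma> \<beta> p h \<le> 4 * gap_quot f \<gamma> \<beta> p h + ennreal (C * (sn h / \<delta>) powr 0) * w) \<and>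
      (\<forall>h. \<delta> \<le> sn h \<longrightarrow> sn h < 1 \<longrightarrow> gap_quot e \<gamma> \<beta> p h \<le> ennreal (C * (\<delta> / sn h) powr \<theta>) * w))"
    using error_estimates[OF p N, of \<gamma> 0 \<theta>] N_ge \<theta> f by auto
  obtain C' where C': "C' \<ge> 0" "\<And>\<delta> h. 0 < \<delta> \<Longrightarrow> sn h \<le> 4 * real CARD('d) * \<delta> \<Longrightarrow>
    modulus \<gamma> \<delta> p f h \<le> ennreal C' * (\<Sum>\<beta>\<in>?H. gap_quot f \<gamma> \<beta> p h)"
    using modulus_le_gap_quot[OF f p, of "4 * real CARD('d)"] by auto
  have gq: "gap_quot f \<gamma> \<beta> p h \<le> D" if "\<beta> \<in> ?H" "sn h < 1" for \<beta> h
  proof -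
    have "gap_quot f \<gamma> \<beta> p h = d_quot s S \<Gamma> \<gamma> \<beta> p f h" by (rule gap_quot_eq[OF f that(2)])
    also have "\<dots> \<le> d_seminorm s S \<Gamma> \<gamma> \<beta> p \<infinity> f"
      using that(2) unfolding d_seminorm_infinity by (intro SUP_upper) (simp add: sc_ball_def)
    also have "\<dots> \<le> D" unfolding D_def by (rule d_seminorm_le_D_norm[OF that(1)])
    finally show ?thesis .
  qed
  define K where "K = 30 ^ CARD('d) * (C' * real (card ?H))"
  have K: "0 \<le> K" using C' by (simp add: K_def)
  define M where "M = real (card ?H) * (C * K + (4 + C * K))"
  show ?thesis
  proof (intro exI[of _ M] conjI allI impI)
    show "0 \<le> M" using C K by (simp add: M_def)
    fix \<delta> assume \<delta>: "(0::real) < \<delta>" and \<delta>8: "8 * real CARD('d) * \<delta> \<le> 1"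
    have d1: "1 \<le> real CARD('d)" by (simp add: Suc_le_eq)
    have "8 * 1 * \<delta> \<le> 8 * real CARD('d) * \<delta>" using d1 \<delta> by (intro mult_right_mono mult_left_mono) auto
    with \<delta>8 have \<delta>1: "\<delta> < 1" using \<delta> by linarith
    have "modulus \<gamma> \<delta> p f h \<le> ennreal (C' * real (card ?H)) * D" if "sn h < 4 * real CARD('d) * \<delta>" for h
    proof -
      have "modulus \<gamma> \<delta> p f h \<le> ennreal C' * (\<Sum>\<beta>\<in>?H. gap_quot f \<gamma> \<beta> p h)"
        using that by (intro C' \<delta>) auto
      also have "\<dots> \<le> ennreal C' * (\<Sum>\<beta>\<in>?H. D)"
        using that \<delta>8 by (intro mult_left_mono sum_mono gq) auto
      also have "\<dots> = ennreal (C' * real (card ?H)) * D"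
        using C' by (simp add: ennreal_mult' ennreal_of_nat_eq_real_of_nat mult.assoc)
      finally show ?thesis .
    qed
    from exists_dominator[OF f p \<delta> \<delta>8 this] obtain y where y: "\<forall>z. y z \<in> cell s \<delta> z"
      and w: "Lp_norm p (\<lambda>x. ennreal (dominator \<gamma> \<delta> y f x)) \<le> ennreal (30 ^ CARD('d)) * (ennreal (C' * real (card ?H)) * D)"
      by auto
    define e where "e = (\<lambda>x. f x - approximant \<gamma> N \<delta> y f x)"
    define w where "w = Lp_norm p (\<lambda>x. ennreal (dominator \<gamma> \<delta> y f x))"
    have wD: "w \<le> ennreal K * D"
      using w C' by (simp add: w_def K_def ennreal_mult' mult.assoc)
    have em: "T_measurable S \<gamma> e" and eb: "\<And>x. e x \<in> T_below S \<gamma>"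
      unfolding e_def using T_measurable_error[OF f(1) \<delta>] error_T_below[of f \<gamma>, OF f(2)] by blast+
    have est: "Lp_norm p (\<lambda>x. ennreal (cn \<beta> (e x))) \<le> ennreal (C * \<delta> powr (\<gamma> - \<beta>)) * w"
      "\<And>h. sn h \<le> \<delta> \<Longrightarrow> gap_quot e \<gamma> \<beta> p h \<le> 4 * gap_quot f \<gamma> \<beta> p h + ennreal (C * (sn h / \<delta>) powr 0) * w"
      "\<And>h. \<delta> \<le> sn h \<Longrightarrow> sn h < 1 \<Longrightarrow> gap_quot e \<gamma> \<beta> p h \<le> ennreal (C * (\<delta> / sn h) powr \<theta>) * w"
      if "\<beta> \<in> ?H" for \<beta>
      using C(2)[OF \<delta> \<delta>8 y that] unfolding Let_def e_def[symmetric] w_def[symmetric] by blast+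
    show "\<exists>y. \<forall>\<epsilon>. 0 \<le> \<epsilon> \<longrightarrow> \<epsilon> \<le> \<theta> \<longrightarrow>
      D_norm s S \<Gamma> (\<gamma> - \<epsilon>) p \<infinity> (\<lambda>x. f x - approximant \<gamma> N \<delta> y f x) \<le>
        ennreal (\<delta> powr \<epsilon>) * (ennreal M * D_norm s S \<Gamma> \<gamma> p \<infinity> f)"
    proof (intro exI[of _ y] allI impI)
      fix \<epsilon> :: real assume \<epsilon>: "0 \<le> \<epsilon>" "\<epsilon> \<le> \<theta>"
      have one: "Lp_norm p (\<lambda>x. ennreal (cn \<beta> (e x))) \<le> ennreal (\<delta> powr \<epsilon>) * (ennreal (C * K) * D)" if \<beta>: "\<beta> \<in> ?H" for \<beta>
      proof -
        have "\<delta> powr (\<gamma> - \<beta>) \<le> \<delta> powr \<epsilon>"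
          using \<theta>[of \<beta>] \<beta> \<epsilon> \<delta> \<delta>1 by (intro powr_mono') auto
        then have "Lp_norm p (\<lambda>x. ennreal (cn \<beta> (e x))) \<le> ennreal (C * \<delta> powr \<epsilon>) * (ennreal K * D)"
          using C(1) by (intro order_trans[OF est(1)[OF \<beta>]] mult_mono ennreal_leI wD mult_left_mono) auto
        also have "\<dots> = ennreal (\<delta> powr \<epsilon>) * (ennreal (C * K) * D)"
          using C(1) K by (simp add: ennreal_mult' mult_ac)
        finally show ?thesis .
      qed
      have two: "d_seminorm s S \<Gamma> (\<gamma> - \<epsilon>) \<beta> p \<infinity> e \<le> ennreal (\<delta> powr \<epsilon>) * (ennreal (4 + C * K) * D)" if \<beta>: "\<beta> \<in> ?H" for \<beta>
        unfolding d_seminorm_infinity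
      proof (rule SUP_least)
        fix h assume "h \<in> sc_ball s"
        then have h: "sn h < 1" by (simp add: sc_ball_def)
        have "d_quot s S \<Gamma> (\<gamma> - \<epsilon>) \<beta> p e h \<le> ennreal (sn h powr (\<gamma> - (\<gamma> - \<epsilon>))) * gap_quot e \<gamma> \<beta> p h"
          by (rule d_quot_lower_order[OF p em eb h])
        also have "\<dots> = ennreal (sn h powr \<epsilon>) * gap_quot e \<gamma> \<beta> p h" by simp
        also have "\<dots> \<le> ennreal (\<delta> powr \<epsilon>) * (ennreal (4 + C * K) * D)"
        proof (cases "sn h \<le> \<delta>")
          case True
          have "gap_quot e \<gamma> \<beta> p h \<le> 4 * gap_quot f \<gamma> \<beta> p h + ennreal (C * (sn h / \<delta>) powr 0) * w"
            by (rule est(2)[OF \<beta> True])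
          also have "\<dots> \<le> 4 * D + ennreal C * (ennreal K * D)"
            using C(1) by (intro add_mono mult_mono mult_left_mono gq \<beta> h wD ennreal_leI) auto
          also have "\<dots> = ennreal (4 + C * K) * D"
            using C(1) K by (simp add: ennreal_mult' distrib_right mult.assoc)
          finally show ?thesis
            using True \<epsilon> by (intro mult_mono ennreal_leI powr_mono2) (auto simp: sc_norm_nonneg)
        next
          case False
          then have h\<delta>: "\<delta> \<le> sn h" "0 < sn h" using \<delta> by auto
          have "sn h powr \<epsilon> * (\<delta> / sn h) powr \<theta> \<le> sn h powr \<epsilon> * (\<delta> / sn h) powr \<epsilon>"
            using h\<delta> \<delta> \<epsilon> by (intro mult_left_mono powr_mono') auto
          also have "\<dots> = \<delta> powr \<epsilon>"
            using h\<delta> \<delta> by (subst powr_mult[symmetric]) auto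
          finally have "sn h powr \<epsilon> * (\<delta> / sn h) powr \<theta> \<le> \<delta> powr \<epsilon>" .
          from mult_left_mono[OF this C(1)] have le: "sn h powr \<epsilon> * (C * (\<delta> / sn h) powr \<theta>) \<le> \<delta> powr \<epsilon> * C"
            by (simp only: mult_ac)
          have "ennreal (sn h powr \<epsilon>) * gap_quot e \<gamma> \<beta> p h \<le>
              ennreal (sn h powr \<epsilon>) * (ennreal (C * (\<delta> / sn h) powr \<theta>) * w)"
            by (intro mult_left_mono est(3)[OF \<beta> h\<delta>(1) h]) simp
          also have "\<dots> = ennreal (sn h powr \<epsilon> * (C * (\<delta> / sn h) powr \<theta>)) * w"
            by (subst ennreal_mult') (simp_all add: mult.assoc)
          also have "\<dots> \<le> ennreal (\<delta> powr \<epsilon> * C) * (ennreal K * D)"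
            by (intro mult_mono ennreal_leI le wD) auto
          also have "\<dots> = ennreal (\<delta> powr \<epsilon>) * (ennreal (C * K) * D)"
            using C(1) K by (simp add: ennreal_mult' mult.assoc)
          also have "\<dots> \<le> ennreal (\<delta> powr \<epsilon>) * (ennreal (4 + C * K) * D)"
            by (intro mult_left_mono mult_right_mono ennreal_leI) auto
          finally show ?thesis .
        qed
        finally show "d_quot s S \<Gamma> (\<gamma> - \<epsilon>) \<beta> p e h \<le> ennreal (\<delta> powr \<epsilon>) * (ennreal (4 + C * K) * D)" .
      qed
      have "D_norm s S \<Gamma> (\<gamma> - \<epsilon>) p \<infinity> e \<le>
          (\<Sum>\<beta>\<in>homs S \<inter> {..<\<gamma> - \<epsilon>}. ennreal (\<delta> powr \<epsilon>) * (ennreal (C * K) * D) + ennreal (\<delta> powr \<epsilon>) * (ennreal (4 + C * K) * D))"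
        unfolding D_norm_def using \<epsilon> by (intro sum_mono add_mono one two) auto
      also have "\<dots> \<le> (\<Sum>\<beta>\<in>?H. ennreal (\<delta> powr \<epsilon>) * (ennreal (C * K) * D) + ennreal (\<delta> powr \<epsilon>) * (ennreal (4 + C * K) * D))"
        using \<epsilon> by (intro sum_mono2 finite_homs_below) auto
      also have "\<dots> = ennreal (\<delta> powr \<epsilon>) * (ennreal M * D)"
      proof -
        have "ennreal M = ennreal (real (card ?H)) * (ennreal (C * K) + ennreal (4 + C * K))"
          unfolding M_def using C(1) K by (intro ennreal_mult_add) simp_all
        then show ?thesis
          by (simp only: sum_constant ennreal_of_nat_eq_real_of_nat distrib_left distrib_right mult_ac)
      qed
      finally show "D_norm s S \<Gamma> (\<gamma> - \<epsilon>) p \<infinity> (\<lambda>x. f x - approximant \<gamma> N \<delta> y f x) \<le>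
        ennreal (\<delta> powr \<epsilon>) * (ennreal M * D_norm s S \<Gamma> \<gamma> p \<infinity> f)"
        by (simp add: e_def D_def)
    qed
  qed
qed

text \<open>The integral over h is split at \<delta>. Below it, the quotient of f itself contributes
  at most the tail, and the remaining terms on both sides are w times a power that
  \<open>nn_integral_inner\<close> and \<open>nn_integral_outer\<close> integrate to a constant. By
  \<open>modulus_le_tail\<close> the q-th power of w is bounded by the same tail, so the whole norm
  is.\<close>

lemma error_D_norm_integral:
  assumes p: "1 \<le> p" and q: "1 \<le> q" "q < \<infinity>"
    and N: "0 < N" and N_ge: "\<And>\<alpha>. \<alpha> \<in> homs S \<Longrightarrow> \<gamma> - \<alpha> + \<kappa> \<le> real N"
    and \<kappa>: "0 < \<kappa>" "\<And>\<alpha>. \<alpha> \<in> homs S \<Longrightarrow> \<gamma> \<le> \<alpha> \<Longrightarrow> \<gamma> + \<kappa> \<le> \<alpha>"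
    and \<theta>: "0 < \<theta>" "\<And>\<alpha>. \<alpha> \<in> homs S \<Longrightarrow> \<alpha> < \<gamma> \<Longrightarrow> \<theta> \<le> \<gamma> - \<alpha>"
    and f: "T_measurable S \<gamma> f" "\<And>x. f x \<in> T_below S \<gamma>"
  shows "\<exists>M\<ge>0. \<forall>\<delta>. 0 < \<delta> \<longrightarrow> 8 * real CARD('d) * \<delta> \<le> 1 \<longrightarrow> (\<exists>y.
    D_norm s S \<Gamma> \<gamma> p q (\<lambda>x. f x - approximant \<gamma> N \<delta> y f x) \<le>
      ennreal M * epowr (tail f \<gamma> p q (8 * real CARD('d) * \<delta>)) (1 / enn2real q))"
proof -
  let ?H = "homs S \<inter> {..<\<gamma>}"
  define t where "t = enn2real q"
  have t: "0 < t" using enn2real_pos[OF q] by (simp add: t_def)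
  define wt where "wt h = ennreal (1 / sn h ^ sc_total s)" for h :: "real^'d"
  obtain C where C: "C \<ge> 0" "\<And>\<delta> y \<beta>. 0 < \<delta> \<Longrightarrow>
      8 * real CARD('d) * \<delta> \<le> 1 \<Longrightarrow> (\<forall>z. y z \<in> cell s \<delta> z) \<Longrightarrow> \<beta> \<in> ?H \<Longrightarrow>
    (let e = (\<lambda>x. f x - approximant \<gamma> N \<delta> y f x);
         w = Lp_norm p (\<lambda>x. ennreal (dominator \<gamma> \<delta> y f x)) in
      Lp_norm p (\<lambda>x. ennreal (cn \<beta> (e x))) \<le> ennreal (C * \<delta> powr (\<gamma> - \<beta>)) * w \<and>
      (\<forall>h. sn h \<le> \<delta> \<longrightarrow> gap_quot e \<gamma> \<beta> p h \<le> 4 * gap_quot f \<gamma> \<beta> p h + ennreal (C * (sn h / \<delta>) powr \<kappa>) * w) \<and>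
      (\<forall>h. \<delta> \<le> sn h \<longrightarrow> sn h < 1 \<longrightarrow> gap_quot e \<gamma> \<beta> p h \<le> ennreal (C * (\<delta> / sn h) powr \<theta>) * w))"
    using error_estimates[OF p N N_ge \<kappa>(2) \<theta>(2)] f by blast
  obtain C' where C': "C' \<ge> 0" "\<And>\<delta> h. 0 < \<delta> \<Longrightarrow> 2 * (4 * real CARD('d)) * \<delta> \<le> 1 \<Longrightarrow> sn h < 4 * real CARD('d) * \<delta> \<Longrightarrow>
    epowr (modulus \<gamma> \<delta> p f h) t \<le> ennreal C' * tail f \<gamma> p q (2 * (4 * real CARD('d)) * \<delta>)"
    using modulus_le_tail[OF f p q, of "4 * real CARD('d)"] unfolding t_def by auto
  define I1 where "I1 = 2 ^ CARD('d) * 2 ^ sc_total s / (1 - (1 / 2) powr (\<kappa> * t))"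
  define I2 where "I2 = 2 ^ CARD('d) * 2 ^ sc_total s / (1 - (1 / 2) powr (\<theta> * t))"
  have half: "(1 / 2 :: real) powr a < 1" if "0 < a" for a
    using that powr_less_mono2[of a "1 / 2" 1] by simp
  have I: "0 \<le> I1" "0 \<le> I2"
    using half[of "\<kappa> * t"] half[of "\<theta> * t"] \<kappa> \<theta> t by (simp_all add: I1_def I2_def)
  define K where "K = (30 ^ CARD('d)) powr t * C'"
  have K: "0 \<le> K" using C' by (simp add: K_def)
  \<comment> \<open>\<open>2 powr t * 4 powr t\<close> belongs to the quotient of f;
    \<open>I1\<close> and \<open>I2\<close> are the inner and the outer integral, and K converts the
    power of w into the tail.\<close>
  define A where "A = 2 powr t * 4 powr t + (2 powr t * C powr t * I1 + C powr t * I2) * K"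
  have A: "0 \<le> A" using C K I by (simp add: A_def)
  define M where "M = real (card ?H) * (C * K powr (1 / t) + A powr (1 / t))"
  show ?thesis
  proof (intro exI[of _ M] conjI allI impI)
    show "0 \<le> M" using C K A by (simp add: M_def)
    fix \<delta> assume \<delta>: "(0::real) < \<delta>" and \<delta>8: "8 * real CARD('d) * \<delta> \<le> 1"
    have d1: "1 \<le> real CARD('d)" by (simp add: Suc_le_eq)
    have \<delta>le: "\<delta> \<le> 8 * real CARD('d) * \<delta>"
    proof -
      have "1 \<le> 8 * real CARD('d)" using d1 by linarith
      then have "1 * \<delta> \<le> 8 * real CARD('d) * \<delta>" using \<delta> by (intro mult_right_mono) simp_all
      then show ?thesis by simp
    qed
    have "8 * 1 * \<delta> \<le> 8 * real CARD('d) * \<delta>" using d1 \<delta> by (intro mult_right_mono mult_left_mono) auto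
    with \<delta>8 have \<delta>1: "\<delta> < 1" using \<delta> by linarith
    define Tl where "Tl = tail f \<gamma> p q (8 * real CARD('d) * \<delta>)"
    have "modulus \<gamma> \<delta> p f h \<le> epowr (ennreal C' * Tl) (1 / t)" if "sn h < 4 * real CARD('d) * \<delta>" for h
      using C'(2)[OF \<delta> _ that] \<delta>8 t by (simp add: epowr_le_iff Tl_def)
    from exists_dominator[OF f p \<delta> \<delta>8 this] obtain y where y: "\<forall>z. y z \<in> cell s \<delta> z"
      and w: "Lp_norm p (\<lambda>x. ennreal (dominator \<gamma> \<delta> y f x)) \<le> ennreal (30 ^ CARD('d)) * epowr (ennreal C' * Tl) (1 / t)"
      by auto
    define e where "e = (\<lambda>x. f x - approximant \<gamma> N \<delta> y f x)"
    define w where "w = Lp_norm p (\<lambda>x. ennreal (dominator \<gamma> \<delta> y f x))"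
    have wT: "epowr w t \<le> ennreal K * Tl"
    proof -
      have "epowr w t \<le> epowr (ennreal (30 ^ CARD('d)) * epowr (ennreal C' * Tl) (1 / t)) t"
        using w t unfolding w_def by (intro epowr_mono) auto
      also have "\<dots> = epowr (ennreal (30 ^ CARD('d))) t * (ennreal C' * Tl)"
        using t by (simp add: epowr_mult epowr_inverse)
      also have "epowr (ennreal (30 ^ CARD('d))) t = ennreal ((30 ^ CARD('d)) powr t)"
        by (rule epowr_ennreal) simp
      finally show ?thesis by (simp add: K_def ennreal_mult' mult.assoc)
    qed
    have em: "T_measurable S \<gamma> e" and eb: "\<And>x. e x \<in> T_below S \<gamma>"
      unfolding e_def using T_measurable_error[OF f(1) \<delta>] error_T_below[of f \<gamma>, OF f(2)] by blast+
    have est: "Lp_norm p (\<lambda>x. ennreal (cn \<beta> (e x))) \<le> ennreal (C * \<delta> powr (\<gamma> - \<beta>)) * w"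
      "\<And>h. sn h \<le> \<delta> \<Longrightarrow> gap_quot e \<gamma> \<beta> p h \<le> 4 * gap_quot f \<gamma> \<beta> p h + ennreal (C * (sn h / \<delta>) powr \<kappa>) * w"
      "\<And>h. \<delta> \<le> sn h \<Longrightarrow> sn h < 1 \<Longrightarrow> gap_quot e \<gamma> \<beta> p h \<le> ennreal (C * (\<delta> / sn h) powr \<theta>) * w"
      if "\<beta> \<in> ?H" for \<beta>
      using C(2)[OF \<delta> \<delta>8 y that] unfolding Let_def e_def[symmetric] w_def[symmetric] by blast+
    have one: "Lp_norm p (\<lambda>x. ennreal (cn \<beta> (e x))) \<le> ennreal (C * K powr (1 / t)) * epowr Tl (1 / t)" if \<beta>: "\<beta> \<in> ?H" for \<beta>
    proof -
      have "\<delta> powr (\<gamma> - \<beta>) \<le> 1"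
        using \<beta> \<delta> \<delta>1 by (intro powr_le1) auto
      then have "C * \<delta> powr (\<gamma> - \<beta>) \<le> C"
        using C(1) mult_left_mono[of "\<delta> powr (\<gamma> - \<beta>)" 1 C] by simp
      moreover have "w \<le> epowr (ennreal K * Tl) (1 / t)"
        using wT t by (simp add: epowr_le_iff)
      ultimately have "ennreal (C * \<delta> powr (\<gamma> - \<beta>)) * w \<le> ennreal C * epowr (ennreal K * Tl) (1 / t)"
        by (intro mult_mono ennreal_leI) auto
      also have "epowr (ennreal K * Tl) (1 / t) = ennreal (K powr (1 / t)) * epowr Tl (1 / t)"
        using t K by (simp add: epowr_mult epowr_ennreal)
      finally show ?thesis
        using est(1)[OF \<beta>] C(1) by (simp add: ennreal_mult' mult.assoc)
    qed
    have two: "d_seminorm s S \<Gamma> \<gamma> \<beta> p q e \<le> ennreal (A powr (1 / t)) * epowr Tl (1 / t)" if \<beta>: "\<beta> \<in> ?H" for \<beta>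
    proof -
      note [measurable] = borel_measurable_gap_quot[OF f, of \<beta> p]
      have [measurable]: "wt \<in> borel_measurable borel"
        unfolding wt_def[abs_def] by measurable
      let ?in = "{h. sn h < \<delta>}" and ?out = "{h. \<delta> \<le> sn h}"
      have [measurable]: "?in \<in> sets borel" "?out \<in> sets borel" by measurable
      let ?f1 = "\<lambda>h. epowr (gap_quot f \<gamma> \<beta> p h) t * wt h * indicator ?in h"
      let ?f2 = "\<lambda>h. ennreal ((sn h / \<delta>) powr (\<kappa> * t)) * wt h * indicator ?in h"
      let ?f3 = "\<lambda>h. ennreal ((\<delta> / sn h) powr (\<theta> * t)) * wt h * indicator ?out h"
      let ?c1 = "ennreal (2 powr t * 4 powr t)" and ?c2 = "ennreal (2 powr t * C powr t) * epowr w t"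
        and ?c3 = "ennreal (C powr t) * epowr w t"
      have pointwise: "epowr (d_quot s S \<Gamma> \<gamma> \<beta> p e h) t * wt h * indicator (sc_ball s) h \<le>
          ?c1 * ?f1 h + (?c2 * ?f2 h + ?c3 * ?f3 h)" for h
      proof (cases "sn h < 1")
        case True
        note h = True
        have eq: "d_quot s S \<Gamma> \<gamma> \<beta> p e h = gap_quot e \<gamma> \<beta> p h"
          using gap_quot_eq[OF em eb h, of \<beta> p] by simp
        show ?thesis
        proof (cases "sn h < \<delta>")
          case True
          have "epowr (gap_quot e \<gamma> \<beta> p h) t \<le>
              epowr (4 * gap_quot f \<gamma> \<beta> p h + ennreal (C * (sn h / \<delta>) powr \<kappa>) * w) t"
            using t True by (intro epowr_mono est(2)[OF \<beta>]) auto
          also have "\<dots> \<le> ennreal (2 powr t) * (epowr (4 * gap_quot f \<gamma> \<beta> p h) t + epowr (ennreal (C * (sn h / \<delta>) powr \<kappa>) * w) t)"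
            by (rule epowr_add_le[OF t])
          also have "epowr (4 * gap_quot f \<gamma> \<beta> p h) t = ennreal (4 powr t) * epowr (gap_quot f \<gamma> \<beta> p h) t"
            using t epowr_ennreal[of 4 t] by (simp add: epowr_mult)
          also have "epowr (ennreal (C * (sn h / \<delta>) powr \<kappa>) * w) t =
              ennreal (C powr t) * ennreal ((sn h / \<delta>) powr (\<kappa> * t)) * epowr w t"
            using t C(1) by (simp add: epowr_mult epowr_ennreal powr_mult powr_powr ennreal_mult')
          finally have "epowr (gap_quot e \<gamma> \<beta> p h) t \<le>
              ?c1 * epowr (gap_quot f \<gamma> \<beta> p h) t + ?c2 * ennreal ((sn h / \<delta>) powr (\<kappa> * t))"
            by (simp add: distrib_left ennreal_mult' mult_ac)
          from mult_right_mono[OF this, of "wt h"] show ?thesis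
            using True h unfolding eq by (simp add: sc_ball_def distrib_right mult.assoc)
        next
          case False
          have "epowr (gap_quot e \<gamma> \<beta> p h) t \<le> epowr (ennreal (C * (\<delta> / sn h) powr \<theta>) * w) t"
            using t False h by (intro epowr_mono est(3)[OF \<beta>]) auto
          also have "\<dots> = ?c3 * ennreal ((\<delta> / sn h) powr (\<theta> * t))"
            using t C(1) by (simp add: epowr_mult epowr_ennreal powr_mult powr_powr ennreal_mult' mult_ac)
          finally have "epowr (gap_quot e \<gamma> \<beta> p h) t \<le> ?c3 * ennreal ((\<delta> / sn h) powr (\<theta> * t))" .
          from mult_right_mono[OF this, of "wt h"] show ?thesis
            using False h unfolding eq by (simp add: sc_ball_def mult.assoc)
        qed
      qed (simp add: sc_ball_def)
      have f1: "(\<integral>\<^sup>+h. ?f1 h \<partial>lborel) \<le> Tl"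
        unfolding Tl_def tail_def[OF f] t_def[symmetric] wt_def[symmetric]
      proof (intro nn_integral_mono mult_mono)
        fix h
        show "epowr (gap_quot f \<gamma> \<beta> p h) t \<le> (\<Sum>\<beta>\<in>?H. epowr (gap_quot f \<gamma> \<beta> p h) t)"
          by (rule member_le_sum[OF \<beta>]) (simp_all add: finite_homs_below)
        show "indicator ?in h \<le> (indicator {h. sn h < 8 * real CARD('d) * \<delta>} h :: ennreal)"
          using \<delta>le by (auto simp: indicator_def)
      qed auto
      have f2: "(\<integral>\<^sup>+h. ?f2 h \<partial>lborel) \<le> ennreal I1"
        unfolding wt_def I1_def using \<kappa> t \<delta> by (intro nn_integral_inner scaling) auto
      have f3: "(\<integral>\<^sup>+h. ?f3 h \<partial>lborel) \<le> ennreal I2"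
        unfolding wt_def I2_def using \<theta> t \<delta> by (intro nn_integral_outer scaling) auto
      have "epowr (d_seminorm s S \<Gamma> \<gamma> \<beta> p q e) t \<le> (\<integral>\<^sup>+h. ?c1 * ?f1 h + (?c2 * ?f2 h + ?c3 * ?f3 h) \<partial>lborel)"
        unfolding t_def epowr_d_seminorm[OF q] unfolding t_def[symmetric] wt_def[symmetric]
        by (intro nn_integral_mono pointwise)
      also have "\<dots> = ?c1 * (\<integral>\<^sup>+h. ?f1 h \<partial>lborel) + (?c2 * (\<integral>\<^sup>+h. ?f2 h \<partial>lborel) + ?c3 * (\<integral>\<^sup>+h. ?f3 h \<partial>lborel))"
        by (simp add: nn_integral_add nn_integral_cmult)
      also have "\<dots> \<le> ?c1 * Tl + (ennreal (2 powr t * C powr t) * (ennreal K * Tl) * ennreal I1 +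
          ennreal (C powr t) * (ennreal K * Tl) * ennreal I2)"
        by (intro add_mono mult_mono f1 f2 f3 wT mult_left_mono) auto
      also have "\<dots> = ennreal A * Tl"
      proof -
        have "ennreal A = ?c1 + (ennreal (2 powr t * C powr t) * ennreal K * ennreal I1 +
          ennreal (C powr t) * ennreal K * ennreal I2)"
          using K I by (simp add: A_def ennreal_mult'[symmetric] ennreal_plus[symmetric] algebra_simps del: ennreal_plus)
        then show ?thesis by (simp only: distrib_left distrib_right mult_ac)
      qed
      finally have "d_seminorm s S \<Gamma> \<gamma> \<beta> p q e \<le> epowr (ennreal A * Tl) (1 / t)"
        using t by (simp add: epowr_le_iff)
      then show ?thesis
        using t A by (simp add: epowr_mult epowr_ennreal)
    qed
    have "D_norm s S \<Gamma> \<gamma> p q e \<le> (\<Sum>\<beta>\<in>?H. ennreal (C * K powr (1 / t)) * epowr Tl (1 / t) + ennreal (A powr (1 / t)) * epowr Tl (1 / t))"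
      unfolding D_norm_def by (intro sum_mono add_mono one two)
    also have "\<dots> = ennreal M * epowr Tl (1 / t)"
    proof -
      have "ennreal M = ennreal (real (card ?H)) * (ennreal (C * K powr (1 / t)) + ennreal (A powr (1 / t)))"
        unfolding M_def using C(1) by (intro ennreal_mult_add) simp_all
      then show ?thesis
        by (simp only: sum_constant ennreal_of_nat_eq_real_of_nat distrib_left distrib_right mult_ac)
    qed
    finally show "\<exists>y. D_norm s S \<Gamma> \<gamma> p q (\<lambda>x. f x - approximant \<gamma> N \<delta> y f x) \<le>
      ennreal M * epowr (tail f \<gamma> p q (8 * real CARD('d) * \<delta>)) (1 / enn2real q)"
      unfolding e_def Tl_def t_def by blast
  qed
qed

text \<open>The quasi-triangle inequality in every component. It is applied to f and the error,
  which places the approximation itself in the space.\<close>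

lemma D_norm_diff_finite:
  assumes p: "1 \<le> p" and q: "1 \<le> q"
    and f: "T_measurable S \<gamma> f" "\<And>x. f x \<in> T_below S \<gamma>" and g: "T_measurable S \<gamma> g" "\<And>x. g x \<in> T_below S \<gamma>"
    and fin: "D_norm s S \<Gamma> \<gamma> p q f < \<infinity>" "D_norm s S \<Gamma> \<gamma> p q g < \<infinity>"
  shows "D_norm s S \<Gamma> \<gamma> p q (\<lambda>x. f x - g x) < \<infinity>"
proof -
  let ?H = "homs S \<inter> {..<\<gamma>}"
  define e where "e = (\<lambda>x. f x - g x)"
  have e: "T_measurable S \<gamma> e" "\<And>x. e x \<in> T_below S \<gamma>"
    unfolding e_def using f g by (auto intro: T_measurable_diff subspace_diff[OF subspace_T_below])
  have L: "Lp_norm p (\<lambda>x. ennreal (cn \<beta> (e x))) < \<infinity>" if \<beta>: "\<beta> \<in> ?H" for \<beta>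
  proof -
    have "Lp_norm p (\<lambda>x. ennreal (cn \<beta> (e x))) \<le> Lp_norm p (\<lambda>x. ennreal (cn \<beta> (f x)) + ennreal (cn \<beta> (g x)))"
      using borel_measurable_cn[OF e]
      by (intro Lp_norm_mono p) (auto simp: e_def cn_nonneg cn_diff ennreal_plus[symmetric] intro!: ennreal_leI simp del: ennreal_plus)
    also have "\<dots> \<le> 4 * (Lp_norm p (\<lambda>x. ennreal (cn \<beta> (f x))) + Lp_norm p (\<lambda>x. ennreal (cn \<beta> (g x))))"
      using borel_measurable_cn[OF f] borel_measurable_cn[OF g] by (intro Lp_norm_add p) auto
    also have "\<dots> < \<infinity>"
      using le_less_trans[OF Lp_norm_le_D_norm[OF \<beta>] fin(1)] le_less_trans[OF Lp_norm_le_D_norm[OF \<beta>] fin(2)]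
      by (simp add: ennreal_mult_less_top)
    finally show ?thesis .
  qed
  have quot: "gap_quot e \<gamma> \<beta> p h \<le> 4 * (gap_quot f \<gamma> \<beta> p h + gap_quot g \<gamma> \<beta> p h)" for \<beta> h
  proof -
    have m: "(\<lambda>x. gap k \<beta> (x + h) x / sn h powr (\<gamma> - \<beta>)) \<in> borel_measurable borel"
      if "T_measurable S \<gamma> k" "\<And>x. k x \<in> T_below S \<gamma>" for k
      using gap_shift_measurable(2)[OF that] by (intro borel_measurable_divide) auto
    have "gap e \<beta> (x + h) x \<le> gap f \<beta> (x + h) x + gap g \<beta> (x + h) x" for x
    proof -
      have "e (x + h) - \<Gamma> (x + h) x (e x) = (f (x + h) - \<Gamma> (x + h) x (f x)) - (g (x + h) - \<Gamma> (x + h) x (g x))"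
        by (simp add: e_def \<Gamma>_diff)
      then show ?thesis using cn_diff by (simp add: gap_def)
    qed
    then have le: "gap e \<beta> (x + h) x / sn h powr (\<gamma> - \<beta>) \<le>
        gap f \<beta> (x + h) x / sn h powr (\<gamma> - \<beta>) + gap g \<beta> (x + h) x / sn h powr (\<gamma> - \<beta>)" for x
      unfolding add_divide_distrib[symmetric] by (intro divide_right_mono) auto
    have "gap_quot e \<gamma> \<beta> p h \<le> Lp_norm p (\<lambda>x. ennreal (gap f \<beta> (x + h) x / sn h powr (\<gamma> - \<beta>)) +
        ennreal (gap g \<beta> (x + h) x / sn h powr (\<gamma> - \<beta>)))"
      unfolding gap_quot_def[OF e] using m[OF e] ennreal_leI[OF le]
      by (intro Lp_norm_mono p) (simp_all add: gap_nonneg)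
    also have "\<dots> \<le> 4 * (gap_quot f \<gamma> \<beta> p h + gap_quot g \<gamma> \<beta> p h)"
      unfolding gap_quot_def[OF f] gap_quot_def[OF g] using m[OF f] m[OF g] by (intro Lp_norm_add p) simp_all
    finally show ?thesis .
  qed
  have semi: "d_seminorm s S \<Gamma> \<gamma> \<beta> p q e < \<infinity>" if \<beta>: "\<beta> \<in> ?H" for \<beta>
  proof -
    have fin': "d_seminorm s S \<Gamma> \<gamma> \<beta> p q f < \<infinity>" "d_seminorm s S \<Gamma> \<gamma> \<beta> p q g < \<infinity>"
      using le_less_trans[OF d_seminorm_le_D_norm[OF \<beta>] fin(1)] le_less_trans[OF d_seminorm_le_D_norm[OF \<beta>] fin(2)] by auto
    show ?thesis
    proof (cases "q = \<infinity>")
      case True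
      have "d_seminorm s S \<Gamma> \<gamma> \<beta> p \<infinity> e \<le> 4 * (d_seminorm s S \<Gamma> \<gamma> \<beta> p \<infinity> f + d_seminorm s S \<Gamma> \<gamma> \<beta> p \<infinity> g)"
        unfolding d_seminorm_infinity
      proof (rule SUP_least)
        fix h assume hb: "h \<in> sc_ball s"
        then have h: "sn h < 1" by (simp add: sc_ball_def)
        have "d_quot s S \<Gamma> \<gamma> \<beta> p e h \<le> 4 * (d_quot s S \<Gamma> \<gamma> \<beta> p f h + d_quot s S \<Gamma> \<gamma> \<beta> p g h)"
          using quot[of \<beta> h] by (simp add: gap_quot_eq[OF _ _ h] e f g)
        also have "\<dots> \<le> 4 * ((SUP h\<in>sc_ball s. d_quot s S \<Gamma> \<gamma> \<beta> p f h) + (SUP h\<in>sc_ball s. d_quot s S \<Gamma> \<gamma> \<beta> p g h))"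
          using hb by (intro mult_left_mono add_mono SUP_upper) auto
        finally show "d_quot s S \<Gamma> \<gamma> \<beta> p e h \<le>
          4 * ((SUP h\<in>sc_ball s. d_quot s S \<Gamma> \<gamma> \<beta> p f h) + (SUP h\<in>sc_ball s. d_quot s S \<Gamma> \<gamma> \<beta> p g h))" .
      qed
      also have "\<dots> < \<infinity>"
        using fin' True by (simp add: ennreal_mult_less_top)
      finally show ?thesis using True by simp
    next
      case False
      then have q': "q < \<infinity>" by (simp add: less_top)
      define t where "t = enn2real q"
      have t: "0 < t" using enn2real_pos[OF q q'] by (simp add: t_def)
      define wt where "wt h = ennreal (1 / sn h ^ sc_total s)" for h :: "real^'d"
      note [measurable] = borel_measurable_gap_quot[OF f, of \<beta> p] borel_measurable_gap_quot[OF g, of \<beta> p]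
      have [measurable]: "wt \<in> borel_measurable borel"
        unfolding wt_def[abs_def] by measurable
      have [measurable]: "sc_ball s \<in> sets borel"
        unfolding sc_ball_def by measurable
      let ?c = "ennreal (4 powr t) * ennreal (2 powr t)"
      let ?G = "\<lambda>k h. epowr (gap_quot k \<gamma> \<beta> p h) t * wt h * indicator (sc_ball s) h"
      have G: "(\<integral>\<^sup>+h. ?G k h \<partial>lborel) < \<infinity>"
        if "T_measurable S \<gamma> k" "\<And>x. k x \<in> T_below S \<gamma>" "d_seminorm s S \<Gamma> \<gamma> \<beta> p q k < \<infinity>" for k
      proof -
        have "(\<integral>\<^sup>+h. ?G k h \<partial>lborel) = epowr (d_seminorm s S \<Gamma> \<gamma> \<beta> p q k) t"
          unfolding t_def epowr_d_seminorm[OF q q'] wt_def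
          by (intro nn_integral_cong) (auto simp: indicator_def sc_ball_def gap_quot_eq[OF that(1,2)])
        then show ?thesis using that(3) by (simp only: epowr_less_top_iff)
      qed
      have "epowr (d_quot s S \<Gamma> \<gamma> \<beta> p e h) t * wt h * indicator (sc_ball s) h \<le> ?c * (?G f h + ?G g h)" for h
      proof (cases "h \<in> sc_ball s")
        case True
        then have h: "sn h < 1" by (simp add: sc_ball_def)
        have "epowr (d_quot s S \<Gamma> \<gamma> \<beta> p e h) t \<le> epowr (4 * (gap_quot f \<gamma> \<beta> p h + gap_quot g \<gamma> \<beta> p h)) t"
          unfolding gap_quot_eq[OF e h, symmetric] using t by (intro epowr_mono quot) auto
        also have "\<dots> = ennreal (4 powr t) * epowr (gap_quot f \<gamma> \<beta> p h + gap_quot g \<gamma> \<beta> p h) t"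
          using t epowr_ennreal[of 4 t] by (subst epowr_mult) simp_all
        also have "\<dots> \<le> ennreal (4 powr t) * (ennreal (2 powr t) * (epowr (gap_quot f \<gamma> \<beta> p h) t + epowr (gap_quot g \<gamma> \<beta> p h) t))"
          by (intro mult_left_mono epowr_add_le t) simp
        finally have "epowr (d_quot s S \<Gamma> \<gamma> \<beta> p e h) t * wt h \<le>
            ennreal (4 powr t) * (ennreal (2 powr t) * (epowr (gap_quot f \<gamma> \<beta> p h) t + epowr (gap_quot g \<gamma> \<beta> p h) t)) * wt h"
          by (rule mult_right_mono) simp
        then show ?thesis
          using True by (simp add: distrib_right distrib_left mult.assoc)
      qed simp
      then have "epowr (d_seminorm s S \<Gamma> \<gamma> \<beta> p q e) t \<le> (\<integral>\<^sup>+h. ?c * (?G f h + ?G g h) \<partial>lborel)"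
        unfolding t_def epowr_d_seminorm[OF q q'] unfolding t_def[symmetric] wt_def[symmetric]
        by (intro nn_integral_mono)
      also have "\<dots> = ?c * ((\<integral>\<^sup>+h. ?G f h \<partial>lborel) + (\<integral>\<^sup>+h. ?G g h \<partial>lborel))"
        by (simp add: nn_integral_add nn_integral_cmult)
      also have "\<dots> < \<infinity>"
        using G[OF f fin'(1)] G[OF g fin'(2)] by (simp add: ennreal_mult_less_top)
      finally show ?thesis by (simp only: epowr_less_top_iff)
    qed
  qed
  show ?thesis
    unfolding D_norm_def e_def[symmetric] using L semi
    by (simp add: finite_homs_below less_top[symmetric])
qed

text \<open>The coefficients are absorbed in the vectors \<open>f (y z)\<close>, so all c are 1.
  Local finiteness holds on scaled balls of radius \<delta>: a cell that is active somewhere in such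
  a ball is near its centre.\<close>

lemma approximant_in_E_space:
  assumes p: "1 \<le> p" and q: "1 \<le> q" and \<delta>: "0 < \<delta>" and N: "\<And>\<alpha>. \<alpha> \<in> homs S \<Longrightarrow> \<gamma> - \<alpha> \<le> real N"
    and f: "f \<in> D_space s S \<Gamma> \<gamma> p q"
    and fin: "D_norm s S \<Gamma> \<gamma> p q (\<lambda>x. f x - approximant \<gamma> N \<delta> y f x) < \<infinity>"
  shows "approximant \<gamma> N \<delta> y f \<in> E_space s S X star \<Gamma> \<gamma> p q"
proof -
  let ?g = "approximant \<gamma> N \<delta> y f"
  have f': "T_measurable S \<gamma> f" "\<And>x. f x \<in> T_below S \<gamma>" "D_norm s S \<Gamma> \<gamma> p q f < \<infinity>"
    using f by (auto simp: D_space_def)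
  have "D_norm s S \<Gamma> \<gamma> p q (\<lambda>x. f x - (f x - ?g x)) < \<infinity>"
    by (rule D_norm_diff_finite[OF p q f'(1,2) T_measurable_error[OF f'(1) \<delta>] error_T_below[of f \<gamma>, OF f'(2)] f'(3) fin])
  then have D: "?g \<in> D_space s S \<Gamma> \<gamma> p q"
    using T_measurable_approximant[OF \<delta>] approximant_T_below by (simp add: D_space_def)
  obtain e :: "nat \<Rightarrow> int^'d" where e: "bij e" using exists_enumeration_cells .
  define F where "F j = loc_const s S X star \<Gamma> \<gamma> (y (e j)) (cell_bump s \<delta> (e j) (\<lambda>_. 0)) (f (y (e j)))" for j
  have F0: "\<bar>cell_coord s \<delta> (e j) x $ i\<bar> < 1" if "F j x \<noteq> 0" for j x i
    using that loc_const_cell_bump_nonzero[OF N] unfolding F_def by blast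
  have fin: "finite {j. e j \<in> near_cells s \<delta> x}" for x
    using finite_vimageI[OF finite_near_cells bij_is_inj[OF e]] by (simp add: vimage_def)
  show ?thesis
    unfolding E_space_def
  proof (intro CollectI conjI D exI[of _ "\<lambda>_. 1"] exI[of _ F] allI)
    show "\<exists>z \<phi> \<tau>. test_fun \<phi> \<and> F j = loc_const s S X star \<Gamma> \<gamma> z \<phi> \<tau>" for j
      unfolding F_def using test_fun_cell_bump[OF \<delta>] by blast
    show "\<exists>U. open U \<and> x \<in> U \<and> finite {j. \<exists>u\<in>U. F j u \<noteq> 0}" for x
    proof (intro exI[of _ "{u. sn (x - u) < \<delta>}"] conjI)
      have "continuous_on UNIV (\<lambda>u. sn (x - u))"
        by (rule continuous_on_compose2[OF continuous_on_sc_norm[OF scaling, of UNIV]]) (auto intro!: continuous_intros)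
      then show "open {u. sn (x - u) < \<delta>}" by (intro open_Collect_less continuous_intros)
      show "x \<in> {u. sn (x - u) < \<delta>}" using \<delta> by simp
      have "e j \<in> near_cells s \<delta> x" if "sn (x - u) < \<delta>" "F j u \<noteq> 0" for j u
        using near_cells_shift[OF \<delta>, of "x - u" "e j" u] F0[OF that(2)] that(1) by simp
      then show "finite {j. \<exists>u\<in>{u. sn (x - u) < \<delta>}. F j u \<noteq> 0}"
        by (intro finite_subset[OF _ fin[of x]]) auto
    qed
    show "?g x = (\<Sum>j | F j x \<noteq> 0. 1 *\<^sub>R F j x)" for x
    proof -
      let ?J = "{j. e j \<in> near_cells s \<delta> x}"
      have bij: "bij_betw e ?J (near_cells s \<delta> x)"
        using e by (auto simp: bij_betw_def inj_on_def inj_def surj_def)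
      have "?g x = (\<Sum>z\<in>near_cells s \<delta> x. loc_const s S X star \<Gamma> \<gamma> (y z) (cell_bump s \<delta> z (\<lambda>_. 0)) (f (y z)) x)"
        by (rule approximant_eq_sum_loc_const[OF N])
      also have "\<dots> = (\<Sum>j\<in>?J. F j x)"
        unfolding F_def by (rule sum.reindex_bij_betw[OF bij, symmetric])
      also have "\<dots> = (\<Sum>j | F j x \<noteq> 0. F j x)"
      proof (rule sum.mono_neutral_right[OF fin])
        show "{j. F j x \<noteq> 0} \<subseteq> ?J"
          using F0 near_cells_if by blast
      qed auto
      finally show ?thesis by simp
    qed
  qed
qed

end

section \<open>Density\<close>

text \<open>The inserted 1 covers the case of empty A.\<close>

lemma exists_margin:
  fixes w :: "'a \<Rightarrow> real"
  assumes "finite A" "\<And>a. a \<in> A \<Longrightarrow> 0 < w a"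
  shows "\<exists>m>0. \<forall>a\<in>A. m \<le> w a"
  using assms by (intro exI[of _ "Min (insert 1 (w ` A))"]) auto

text \<open>The sizes are chosen so that the radius of the tail in
  \<open>error_D_norm_integral\<close> becomes \<open>1 / Suc n\<close>; the smallness condition on
  \<delta> is then met as well.\<close>

lemma mesh_sizes:
  fixes d :: nat
  assumes "0 < d"
  shows "(\<lambda>n. 1 / (8 * real d * real (Suc n))) \<longlonglongrightarrow> 0" "0 < 1 / (8 * real d * real (Suc n))"
    "8 * real d * (1 / (8 * real d * real (Suc n))) = 1 / real (Suc n)"
    "8 * real d * (1 / (8 * real d * real (Suc n))) \<le> 1"
proof -
  have "(\<lambda>n. 1 / (8 * real d) * inverse (real (Suc n))) \<longlonglongrightarrow> 1 / (8 * real d) * 0"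
    by (intro tendsto_intros LIMSEQ_inverse_real_of_nat)
  then show "(\<lambda>n. 1 / (8 * real d * real (Suc n))) \<longlonglongrightarrow> 0"
    by (simp add: inverse_eq_divide)
  show "0 < 1 / (8 * real d * real (Suc n))"
    using assms by (simp del: of_nat_Suc)
  show eq: "8 * real d * (1 / (8 * real d * real (Suc n))) = 1 / real (Suc n)"
    using assms by (simp del: of_nat_Suc)
  show "8 * real d * (1 / (8 * real d * real (Suc n))) \<le> 1"
    unfolding eq by simp
qed

context modelled_setting
begin

lemma dense_sup:
  assumes p: "1 \<le> p" and f: "f \<in> D_space s S \<Gamma> \<gamma> p \<infinity>"
    and \<theta>: "\<And>\<alpha>. \<alpha> \<in> homs S \<Longrightarrow> \<alpha> < \<gamma> \<Longrightarrow> \<theta> \<le> \<gamma> - \<alpha>" and \<epsilon>: "0 < \<epsilon>" "\<epsilon> \<le> \<theta>" and \<eta>: "0 < \<eta>"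
  shows "\<exists>g\<in>E_space s S X star \<Gamma> \<gamma> p \<infinity>. D_norm s S \<Gamma> (\<gamma> - \<epsilon>) p \<infinity> (\<lambda>x. f x - g x) < \<eta>"
proof -
  have f': "T_measurable S \<gamma> f" "\<And>x. f x \<in> T_below S \<gamma>" "D_norm s S \<Gamma> \<gamma> p \<infinity> f < \<infinity>"
    using f by (auto simp: D_space_def)
  obtain a where a: "\<And>\<alpha>. \<alpha> \<in> homs S \<Longrightarrow> a \<le> \<alpha>"
    using reg by (auto simp: regularity_structure_def bdd_below_def)
  \<comment> \<open>a bounds all homogeneities from below, so the ceiling serves every \<alpha> at
    once; \<open>Suc\<close> gives \<open>0 < N\<close>.\<close>
  define N where "N = Suc (nat \<lceil>\<gamma> - a\<rceil>)"
  have N: "0 < N" "\<gamma> - \<alpha> \<le> real N" if "\<alpha> \<in> homs S" for \<alpha>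
    using a[OF that] unfolding N_def by linarith+
  have N0: "0 < N" by (simp add: N_def)
  obtain M where M: "M \<ge> 0" "\<And>\<delta>. 0 < \<delta> \<Longrightarrow> 8 * real CARD('d) * \<delta> \<le> 1 \<Longrightarrow> \<exists>y. \<forall>\<epsilon>. 0 \<le> \<epsilon> \<longrightarrow> \<epsilon> \<le> \<theta> \<longrightarrow>
    D_norm s S \<Gamma> (\<gamma> - \<epsilon>) p \<infinity> (\<lambda>x. f x - approximant \<gamma> N \<delta> y f x) \<le>
      ennreal (\<delta> powr \<epsilon>) * (ennreal M * D_norm s S \<Gamma> \<gamma> p \<infinity> f)"
    using error_D_norm_sup[OF p N0 N(2) \<theta> f'(1,2)] by blast
  have MD: "ennreal M * D_norm s S \<Gamma> \<gamma> p \<infinity> f < \<infinity>"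
    using f'(3) by (simp add: ennreal_mult_less_top)
  define \<delta> where "\<delta> n = 1 / (8 * real CARD('d) * real (Suc n))" for n
  note \<delta> = mesh_sizes[of "CARD('d)", folded \<delta>_def, OF zero_less_card_finite]
  have "(\<lambda>n. \<delta> n powr \<epsilon>) \<longlonglongrightarrow> 0"
    using tendsto_powr'[OF \<delta>(1) tendsto_const[of \<epsilon>]] \<epsilon>(1) \<delta>(2) by (auto simp: less_imp_le)
  then have "(\<lambda>n. (ennreal M * D_norm s S \<Gamma> \<gamma> p \<infinity> f) * ennreal (\<delta> n powr \<epsilon>)) \<longlonglongrightarrow> (ennreal M * D_norm s S \<Gamma> \<gamma> p \<infinity> f) * ennreal 0"
    using MD by (intro ennreal_tendsto_cmult tendsto_ennrealI) auto
  then have "eventually (\<lambda>n. ennreal (\<delta> n powr \<epsilon>) * (ennreal M * D_norm s S \<Gamma> \<gamma> p \<infinity> f) < \<eta>) sequentially"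
    using \<eta> by (intro order_tendstoD(2)) (simp_all add: mult.commute)
  from eventually_happens'[OF sequentially_bot this] obtain n where n: "ennreal (\<delta> n powr \<epsilon>) * (ennreal M * D_norm s S \<Gamma> \<gamma> p \<infinity> f) < \<eta>"
    by blast
  obtain y where y: "\<And>\<epsilon>. 0 \<le> \<epsilon> \<Longrightarrow> \<epsilon> \<le> \<theta> \<Longrightarrow>
    D_norm s S \<Gamma> (\<gamma> - \<epsilon>) p \<infinity> (\<lambda>x. f x - approximant \<gamma> N (\<delta> n) y f x) \<le>
      ennreal (\<delta> n powr \<epsilon>) * (ennreal M * D_norm s S \<Gamma> \<gamma> p \<infinity> f)"
    using M(2)[OF \<delta>(2,4)] by blast
  \<comment> \<open>Order \<gamma> itself, that is \<epsilon> = 0: only finiteness is wanted here,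
    for membership in the space.\<close>
  have "D_norm s S \<Gamma> \<gamma> p \<infinity> (\<lambda>x. f x - approximant \<gamma> N (\<delta> n) y f x) \<le>
      ennreal (\<delta> n powr 0) * (ennreal M * D_norm s S \<Gamma> \<gamma> p \<infinity> f)"
    using y[of 0] \<epsilon> by simp
  also have "\<dots> < \<infinity>" using MD by (simp add: ennreal_mult_less_top)
  finally have "approximant \<gamma> N (\<delta> n) y f \<in> E_space s S X star \<Gamma> \<gamma> p \<infinity>"
    by (intro approximant_in_E_space p \<delta> N f) auto
  then show ?thesis
    using y[of \<epsilon>] \<epsilon> n by (intro bexI[of _ "approximant \<gamma> N (\<delta> n) y f"]) auto
qed

text \<open>Smallness already holds at order \<gamma> and passes to lower orders by
  \<open>D_norm_lower_order\<close>.\<close>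

lemma dense_integral:
  assumes p: "1 \<le> p" and q: "1 \<le> q" "q < \<infinity>" and f: "f \<in> D_space s S \<Gamma> \<gamma> p q"
    and \<gamma>: "\<gamma> \<notin> homs S" and \<epsilon>: "0 \<le> \<epsilon>" and \<eta>: "0 < \<eta>"
  shows "\<exists>g\<in>E_space s S X star \<Gamma> \<gamma> p q. D_norm s S \<Gamma> (\<gamma> - \<epsilon>) p q (\<lambda>x. f x - g x) < \<eta>"
proof -
  have f': "T_measurable S \<gamma> f" "\<And>x. f x \<in> T_below S \<gamma>" "D_norm s S \<Gamma> \<gamma> p q f < \<infinity>"
    using f by (auto simp: D_space_def)
  define t where "t = enn2real q"
  have t: "0 < t" using enn2real_pos[OF q] by (simp add: t_def)
  obtain \<theta> where \<theta>: "0 < \<theta>" "\<And>\<alpha>. \<alpha> \<in> homs S \<Longrightarrow> \<alpha> < \<gamma> \<Longrightarrow> \<theta> \<le> \<gamma> - \<alpha>"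
    using exists_margin[of "homs S \<inter> {..<\<gamma>}" "\<lambda>\<alpha>. \<gamma> - \<alpha>"] finite_homs_below[of \<gamma>] by auto
  \<comment> \<open>A margin is taken over the window up to \<gamma> + 1, which contains finitely
    many homogeneities; beyond it the minimum with 1 suffices.\<close>
  obtain \<kappa>' where \<kappa>': "0 < \<kappa>'" "\<And>\<alpha>. \<alpha> \<in> homs S \<Longrightarrow> \<gamma> < \<alpha> \<Longrightarrow> \<alpha> < \<gamma> + 1 \<Longrightarrow> \<kappa>' \<le> \<alpha> - \<gamma>"
    using exists_margin[of "homs S \<inter> {..<\<gamma> + 1} \<inter> {\<gamma><..}" "\<lambda>\<alpha>. \<alpha> - \<gamma>"] finite_homs_below[of "\<gamma> + 1"] by auto
  define \<kappa> where "\<kappa> = min 1 \<kappa>'"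
  have \<kappa>: "0 < \<kappa>" "\<And>\<alpha>. \<alpha> \<in> homs S \<Longrightarrow> \<gamma> \<le> \<alpha> \<Longrightarrow> \<gamma> + \<kappa> \<le> \<alpha>"
  proof -
    show "0 < \<kappa>" using \<kappa>'(1) by (simp add: \<kappa>_def)
    fix \<alpha> assume \<alpha>: "\<alpha> \<in> homs S" "\<gamma> \<le> \<alpha>"
    then have "\<gamma> < \<alpha>" using \<gamma> by (cases "\<alpha> = \<gamma>") auto
    then show "\<gamma> + \<kappa> \<le> \<alpha>"
      using \<kappa>'(2)[OF \<alpha>(1)] by (cases "\<alpha> < \<gamma> + 1") (auto simp: \<kappa>_def)
  qed
  obtain a where a: "\<And>\<alpha>. \<alpha> \<in> homs S \<Longrightarrow> a \<le> \<alpha>"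
    using reg by (auto simp: regularity_structure_def bdd_below_def)
  define N where "N = Suc (nat \<lceil>\<gamma> - a + \<kappa>\<rceil>)"
  have N: "\<gamma> - \<alpha> + \<kappa> \<le> real N" if "\<alpha> \<in> homs S" for \<alpha>
    using a[OF that] unfolding N_def by linarith
  have N': "\<gamma> - \<alpha> \<le> real N" if "\<alpha> \<in> homs S" for \<alpha>
    using N[OF that] \<kappa>(1) by linarith
  have N0: "0 < N" by (simp add: N_def)
  obtain M where M: "M \<ge> 0" "\<And>\<delta>. 0 < \<delta> \<Longrightarrow> 8 * real CARD('d) * \<delta> \<le> 1 \<Longrightarrow> \<exists>y.
    D_norm s S \<Gamma> \<gamma> p q (\<lambda>x. f x - approximant \<gamma> N \<delta> y f x) \<le>
      ennreal M * epowr (tail f \<gamma> p q (8 * real CARD('d) * \<delta>)) (1 / enn2real q)"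
    using error_D_norm_integral[OF p q N0 N \<kappa> \<theta> f'(1,2)] by blast
  \<comment> \<open>\<eta> may be infinite, so a positive real number below it is fixed.\<close>
  obtain \<eta>' :: real where \<eta>': "0 < \<eta>'" "ennreal \<eta>' < \<eta>"
  proof (cases \<eta>)
    case (real x)
    with \<eta> have "0 < x" by simp
    then show ?thesis using real that[of "x / 2"] by (simp add: ennreal_less_iff)
  qed (use that[of 1] in simp)
  \<comment> \<open>\<open>M + 1\<close> instead of M, which may be 0.\<close>
  define Y where "Y = \<eta>' / (M + 1)"
  have Y: "0 < Y" "M * Y \<le> \<eta>'"
    using \<eta>'(1) M(1) by (simp_all add: Y_def field_simps)
  define \<delta> where "\<delta> n = 1 / (8 * real CARD('d) * real (Suc n))" for n
  note \<delta> = mesh_sizes[of "CARD('d)", folded \<delta>_def, OF zero_less_card_finite]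
  have "(\<lambda>n. tail f \<gamma> p q (1 / real (Suc n))) \<longlonglongrightarrow> 0"
    using LIMSEQ_inverse_real_of_nat
    by (intro tail_tendsto_0[OF f'(1,2)] tail_finite[OF f'(1,2) q f'(3)]) (simp_all add: inverse_eq_divide)
  moreover have "0 < ennreal (Y powr t)"
    using powr_gt_zero[of Y t] Y(1) by (simp only: ennreal_less_zero_iff)
  ultimately have "eventually (\<lambda>n. tail f \<gamma> p q (1 / real (Suc n)) < ennreal (Y powr t)) sequentially"
    by (rule order_tendstoD(2))
  from eventually_happens'[OF sequentially_bot this] obtain n where n: "tail f \<gamma> p q (1 / real (Suc n)) < ennreal (Y powr t)"
    by blast
  obtain y where y: "D_norm s S \<Gamma> \<gamma> p q (\<lambda>x. f x - approximant \<gamma> N (\<delta> n) y f x) \<le>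
      ennreal M * epowr (tail f \<gamma> p q (1 / real (Suc n))) (1 / t)"
    using M(2)[OF \<delta>(2,4), of n] unfolding \<delta>(3) t_def by blast
  have "epowr (tail f \<gamma> p q (1 / real (Suc n))) (1 / t) \<le> ennreal Y"
    using n t Y(1) by (simp add: epowr_le_iff epowr_ennreal less_imp_le)
  then have "ennreal M * epowr (tail f \<gamma> p q (1 / real (Suc n))) (1 / t) \<le> ennreal M * ennreal Y"
    by (intro mult_left_mono) auto
  also have "\<dots> \<le> ennreal \<eta>'"
    using M(1) Y by (simp add: ennreal_mult'[symmetric] ennreal_leI)
  finally have small: "D_norm s S \<Gamma> \<gamma> p q (\<lambda>x. f x - approximant \<gamma> N (\<delta> n) y f x) < \<eta>"
    using y \<eta>'(2) by (meson le_less_trans order_trans)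
  then have "D_norm s S \<Gamma> \<gamma> p q (\<lambda>x. f x - approximant \<gamma> N (\<delta> n) y f x) < \<infinity>"
    using less_le_trans[OF _ top_greatest] by simp
  then have "approximant \<gamma> N (\<delta> n) y f \<in> E_space s S X star \<Gamma> \<gamma> p q"
    by (intro approximant_in_E_space p q \<delta> N' f)
  moreover have "D_norm s S \<Gamma> (\<gamma> - \<epsilon>) p q (\<lambda>x. f x - approximant \<gamma> N (\<delta> n) y f x) < \<eta>"
  proof (rule le_less_trans[OF _ small])
    show "D_norm s S \<Gamma> (\<gamma> - \<epsilon>) p q (\<lambda>x. f x - approximant \<gamma> N (\<delta> n) y f x) \<le>
        D_norm s S \<Gamma> \<gamma> p q (\<lambda>x. f x - approximant \<gamma> N (\<delta> n) y f x)"
      by (rule D_norm_lower_order[OF p T_measurable_error[OF f'(1) \<delta>(2)] error_T_below[of f \<gamma>, OF f'(2)]])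
        (use \<epsilon> in simp)
  qed
  ultimately show ?thesis by blast
qed

end

theorem lemma3p3:
  fixes s :: "'d::finite \<Rightarrow> nat"
    and S :: "('v::real_vector) reg_struct"
    and X :: "('d \<Rightarrow> nat) \<Rightarrow> 'v"
    and star :: "'v \<Rightarrow> 'v \<Rightarrow> 'v"
    and \<Pi>\<^sub>Z :: "real^'d \<Rightarrow> 'v \<Rightarrow> (real^'d \<Rightarrow> real) \<Rightarrow> real"
    and \<Gamma> :: "real^'d \<Rightarrow> real^'d \<Rightarrow> 'v \<Rightarrow> 'v"
    and r :: nat and \<gamma> :: real and p q :: ennreal
  assumes scaling: "\<forall>i. 1 \<le> s i"
    and reg: "regularity_structure S"
    and r: "\<bar>Inf (homs S)\<bar> < real r"
    and polynomials: "contains_polynomials s S X"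
    and prod: "poly_product s S X star"
    and model: "is_model s r S \<Pi>\<^sub>Z \<Gamma>"
    and canonical: "canonical_on_polynomials X \<Pi>\<^sub>Z \<Gamma>"
    and cond1: "\<forall>k \<tau>. \<forall>g\<in>sgroup S. g (star (X k) \<tau>) = star (g (X k)) (g \<tau>)"
    and cond2: "\<forall>k \<tau> x \<phi>. test_fun \<phi> \<longrightarrow>
        \<Pi>\<^sub>Z x (star (X k) \<tau>) \<phi> = fun_times_distr (\<lambda>y. mpow (y - x) k) (\<Pi>\<^sub>Z x \<tau>) \<phi>"
    and p: "1 \<le> p" and q: "1 \<le> q"
    and gamma: "q < \<infinity> \<Longrightarrow> \<gamma> \<notin> homs S"
  shows "\<exists>\<epsilon>\<^sub>0>0. \<forall>\<epsilon>. (if p < \<infinity> \<and> q < \<infinity> then \<epsilon> = 0 else 0 < \<epsilon> \<and> \<epsilon> < \<epsilon>\<^sub>0) \<longrightarrow>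
      dense_in_D_topology s S \<Gamma> (\<gamma> - \<epsilon>) p q (E_space s S X star \<Gamma> \<gamma> p q) (D_space s S \<Gamma> \<gamma> p q)"
proof -
  interpret modelled_setting s S X star \<Pi>\<^sub>Z \<Gamma> r
    using reg scaling polynomials prod model canonical cond1 by unfold_locales
  \<comment> \<open>\<theta> serves as the bound on \<epsilon>: it is the exponent with which the
    error decays at long shifts, and the gain from a larger \<epsilon> would not be matched by
    it.\<close>
  obtain \<theta> where \<theta>: "0 < \<theta>" "\<And>\<alpha>. \<alpha> \<in> homs S \<Longrightarrow> \<alpha> < \<gamma> \<Longrightarrow> \<theta> \<le> \<gamma> - \<alpha>"
    using exists_margin[of "homs S \<inter> {..<\<gamma>}" "\<lambda>\<alpha>. \<gamma> - \<alpha>"] finite_homs_below[of \<gamma>] by auto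
  show ?thesis
  proof (intro exI[of _ \<theta>] conjI allI impI \<theta>(1))
    fix \<epsilon> :: real
    assume \<epsilon>: "if p < \<infinity> \<and> q < \<infinity> then \<epsilon> = 0 else 0 < \<epsilon> \<and> \<epsilon> < \<theta>"
    have "\<exists>g\<in>E_space s S X star \<Gamma> \<gamma> p q. D_norm s S \<Gamma> (\<gamma> - \<epsilon>) p q (\<lambda>x. f x - g x) < \<eta>"
      if f: "f \<in> D_space s S \<Gamma> \<gamma> p q" and \<eta>: "0 < \<eta>" for f \<eta>
    \<comment> \<open>Only q decides: for finite q the integral argument covers p = \<infinity> too,
      with any nonnegative \<epsilon>.\<close>
    proof (cases "q = \<infinity>")
      case True
      then have "0 < \<epsilon>" "\<epsilon> \<le> \<theta>" using \<epsilon> by auto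
      with f \<theta>(2) \<eta> show ?thesis unfolding True by (intro dense_sup p)
    next
      case False
      then have "q < \<infinity>" by (simp add: less_top)
      moreover have "0 \<le> \<epsilon>" using \<epsilon> by (auto split: if_splits)
      ultimately show ?thesis
        using f \<eta> by (intro dense_integral p q gamma)
    qed
    then show "dense_in_D_topology s S \<Gamma> (\<gamma> - \<epsilon>) p q (E_space s S X star \<Gamma> \<gamma> p q) (D_space s S \<Gamma> \<gamma> p q)"
      by (auto simp: dense_in_D_topology_def E_space_def)
  qed
qed

end
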